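(* Let $G$ be a connected compact semisimple Lie group and let $(\cdot,\cdot)$ be the standard metric on $G$. Then the following assertions hold, where $S$ is the scalar curvature functional on the set $\mathcal{M}_1$ of left-invariant Riemannian metrics on $G$ with the same volume as $(\cdot,\cdot)$. 1) If $G$ is locally isomorphic to the group $SU(2)$, then $(\cdot,\cdot)$ is a local maximum point of $S$. 2) For any semisimple group $G$, the metric $(\cdot,\cdot)$ is not a local minimum point of $S$. 3) If the group $G$ is not simple, then $(\cdot,\cdot)$ is a saddle point of $S$. 4) If the group $G$ is locally isomorphic to the group $Sp(n)$ with $n\ge 2$ or to the group $SU(n)$ with $n\ge 3$, then $(\cdot,\cdot)$ is a saddle point of $S$.
   Context: $\mathfrak{g}$ is the (nonzero) Lie algebra of $G$ and $B$ its Killing form (so $-B$ is positive definite). Left-invariant Riemannian metrics on $G$ are identified with inner products on $\mathfrak{g}$. The standard (Killing) metric on $G$ is the one given by the inner product $-B(\cdot,\cdot)$ on $\mathfrak{g}$; it is well known to be Einstein. $\mathcal{M}_1$ is the set of inner products on $\mathfrak{g}$ with determinant $1$ relative to $-B$, with its natural topology. $S$ assigns to each such metric its (constant) scalar curvature; it is known that the critical points of $S$ on $\mathcal{M}_1$ are exactly the Einstein left-invariant metrics in $\mathcal{M}_1$, so the standard metric is a critical point. A saddle point is a critical point that is neither a local maximum point nor a local minimum point of $S$ on $\mathcal{M}_1$. $G$ is called simple if its Lie algebra is simple. $Sp(n)$ denotes the compact symplectic group of rank $n$. *)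

theory Defs
  imports "HOL-Analysis.Analysis" "HOL-Algebra.Group"
begin

section \<open>Smooth maps between Euclidean spaces\<close>

text \<open>Only meaningful for open \<open>S\<close>; then \<open>Ck_on k f S\<close> says that all iterated directional
  derivatives of \<open>f\<close> up to order \<open>k\<close> exist (as derivatives of totally differentiable
  functions) and are continuous on \<open>S\<close>.\<close>

fun Ck_on :: "nat \<Rightarrow> ('a::euclidean_space \<Rightarrow> 'b::euclidean_space) \<Rightarrow> 'a set \<Rightarrow> bool" where
  "Ck_on 0 f S \<longleftrightarrow> continuous_on S f"
| "Ck_on (Suc k) f S \<longleftrightarrow>
     f differentiable_on S \<and> (\<forall>v. Ck_on k (\<lambda>x. frechet_derivative f (at x) v) S)"

definition smooth_on :: "('a::euclidean_space \<Rightarrow> 'b::euclidean_space) \<Rightarrow> 'a set \<Rightarrow> bool" where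
  "smooth_on f S \<longleftrightarrow> open S \<and> (\<forall>k. Ck_on k f S)"

text \<open>Smoothness on an arbitrary subset: local extendability to a smooth map.\<close>

definition smooth_on_subset :: "('a::euclidean_space \<Rightarrow> 'b::euclidean_space) \<Rightarrow> 'a set \<Rightarrow> bool" where
  "smooth_on_subset f S \<longleftrightarrow>
     (\<forall>x\<in>S. \<exists>W F. x \<in> W \<and> smooth_on F W \<and> (\<forall>y\<in>S \<inter> W. F y = f y))"


section \<open>Smooth manifolds\<close>

type_synonym ('a, 'v) chart = "'a set \<times> ('a \<Rightarrow> 'v)"

abbreviation chart_dom :: "('a, 'v) chart \<Rightarrow> 'a set" where "chart_dom \<equiv> fst"
abbreviation chart_map :: "('a, 'v) chart \<Rightarrow> 'a \<Rightarrow> 'v" where "chart_map \<equiv> snd"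
abbreviation chart_inv :: "('a, 'v) chart \<Rightarrow> 'v \<Rightarrow> 'a" where
  "chart_inv c \<equiv> inv_into (chart_dom c) (chart_map c)"

definition is_chart :: "'a topology \<Rightarrow> ('a, 'v::euclidean_space) chart \<Rightarrow> bool" where
  "is_chart T c \<longleftrightarrow>
     openin T (chart_dom c) \<and> open (chart_map c ` chart_dom c) \<and>
     homeomorphic_map (subtopology T (chart_dom c))
       (top_of_set (chart_map c ` chart_dom c)) (chart_map c)"

text \<open>The smooth structure is the one generated by the atlas \<open>A\<close>, which need not be maximal.\<close>

definition smooth_manifold :: "'a topology \<Rightarrow> ('a, 'v::euclidean_space) chart set \<Rightarrow> bool" where
  "smooth_manifold T A \<longleftrightarrow>
     Hausdorff_space T \<and>
     (\<exists>\<B>. countable \<B> \<and> (\<forall>V\<in>\<B>. openin T V) \<and>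
        (\<forall>U x. openin T U \<and> x \<in> U \<longrightarrow> (\<exists>V\<in>\<B>. x \<in> V \<and> V \<subseteq> U))) \<and>
     (\<forall>c\<in>A. is_chart T c) \<and>
     (\<Union>c\<in>A. chart_dom c) = topspace T \<and>
     (\<forall>c\<in>A. \<forall>d\<in>A. smooth_on (chart_map d \<circ> chart_inv c) (chart_map c ` (chart_dom c \<inter> chart_dom d)))"

text \<open>Smoothness of a map defined on the open subset \<open>U\<close> of a manifold: near every point of \<open>U\<close>
  some coordinate expression of the map is smooth.\<close>

definition smooth_map_on ::
  "'a topology \<Rightarrow> ('a, 'v::euclidean_space) chart set \<Rightarrow> ('b, 'w::euclidean_space) chart set \<Rightarrow>
   'a set \<Rightarrow> ('a \<Rightarrow> 'b) \<Rightarrow> bool" where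
  "smooth_map_on T A A' U f \<longleftrightarrow>
     (\<forall>x\<in>U. \<exists>c\<in>A. \<exists>d\<in>A'. \<exists>N.
        openin T N \<and> x \<in> N \<and> N \<subseteq> U \<inter> chart_dom c \<and> f ` N \<subseteq> chart_dom d \<and>
        smooth_on (chart_map d \<circ> f \<circ> chart_inv c) (chart_map c ` N))"

definition prod_atlas ::
  "('a, 'v) chart set \<Rightarrow> ('b, 'w) chart set \<Rightarrow> ('a \<times> 'b, 'v \<times> 'w) chart set" where
  "prod_atlas A A' =
     {(chart_dom c \<times> chart_dom d, map_prod (chart_map c) (chart_map d)) | c d. c \<in> A \<and> d \<in> A'}"

text \<open>The smooth structure of an embedded submanifold \<open>M\<close> of a Euclidean space, with
  model space \<open>'v\<close>: all diffeomorphisms from relatively open subsets of \<open>M\<close> onto open subsets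
  of \<open>'v\<close>. There are no charts if \<open>M\<close> is nowhere a submanifold of dimension \<open>DIM('v)\<close>.\<close>

definition submanifold_atlas :: "'a::euclidean_space set \<Rightarrow> ('a, 'v::euclidean_space) chart set" where
  "submanifold_atlas M =
     {c. openin (top_of_set M) (chart_dom c) \<and> inj_on (chart_map c) (chart_dom c) \<and>
         smooth_on_subset (chart_map c) (chart_dom c) \<and>
         smooth_on (chart_inv c) (chart_map c ` chart_dom c)}"


section \<open>Lie groups and their Lie algebras\<close>

definition lie_group ::
  "('a, 'r) monoid_scheme \<Rightarrow> 'a topology \<Rightarrow> ('a, 'v::euclidean_space) chart set \<Rightarrow> bool" where
  "lie_group G T A \<longleftrightarrow>
     group G \<and> topspace T = carrier G \<and> smooth_manifold T A \<and>
     smooth_map_on (prod_topology T T) (prod_atlas A A) A (carrier G \<times> carrier G)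
       (\<lambda>(x, y). x \<otimes>\<^bsub>G\<^esub> y) \<and>
     smooth_map_on T A A (carrier G) (\<lambda>x. inv\<^bsub>G\<^esub> x)"

definition locally_isomorphic ::
  "('a, 'r) monoid_scheme \<Rightarrow> 'a topology \<Rightarrow> ('a, 'v::euclidean_space) chart set \<Rightarrow>
   ('b, 's) monoid_scheme \<Rightarrow> 'b topology \<Rightarrow> ('b, 'w::euclidean_space) chart set \<Rightarrow> bool" where
  "locally_isomorphic G T A G' T' A' \<longleftrightarrow>
     (\<exists>U V f h. openin T U \<and> \<one>\<^bsub>G\<^esub> \<in> U \<and> openin T' V \<and> \<one>\<^bsub>G'\<^esub> \<in> V \<and>
        f ` U = V \<and> h ` V = U \<and> (\<forall>x\<in>U. h (f x) = x) \<and> (\<forall>y\<in>V. f (h y) = y) \<and>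
        smooth_map_on T A A' U f \<and> smooth_map_on T' A' A V h \<and>
        (\<forall>x\<in>U. \<forall>y\<in>U. x \<otimes>\<^bsub>G\<^esub> y \<in> U \<longrightarrow> f (x \<otimes>\<^bsub>G\<^esub> y) = f x \<otimes>\<^bsub>G'\<^esub> f y) \<and>
        (\<forall>x\<in>V. \<forall>y\<in>V. x \<otimes>\<^bsub>G'\<^esub> y \<in> V \<longrightarrow> h (x \<otimes>\<^bsub>G'\<^esub> y) = h x \<otimes>\<^bsub>G\<^esub> h y))"

text \<open>Let \<open>c\<close> be a chart around the identity. Its differential identifies the tangent space at
  the identity with the model space. \<open>left_invariant_field G c X\<close> is the coordinate expression
  of the left-invariant vector field with value \<open>X\<close> at the identity, and \<open>lie_bracket G c X Y\<close>
  is the value at the identity of the commutator \<open>DY(X) - DX(Y)\<close> of two such fields.\<close>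

definition left_invariant_field ::
  "('a, 'r) monoid_scheme \<Rightarrow> ('a, 'v::euclidean_space) chart \<Rightarrow> 'v \<Rightarrow> 'v \<Rightarrow> 'v" where
  "left_invariant_field G c X x =
     frechet_derivative (\<lambda>y. chart_map c (chart_inv c x \<otimes>\<^bsub>G\<^esub> chart_inv c y))
       (at (chart_map c \<one>\<^bsub>G\<^esub>)) X"

definition lie_bracket ::
  "('a, 'r) monoid_scheme \<Rightarrow> ('a, 'v::euclidean_space) chart \<Rightarrow> 'v \<Rightarrow> 'v \<Rightarrow> 'v" where
  "lie_bracket G c X Y =
     frechet_derivative (left_invariant_field G c Y) (at (chart_map c \<one>\<^bsub>G\<^esub>)) X -
     frechet_derivative (left_invariant_field G c X) (at (chart_map c \<one>\<^bsub>G\<^esub>)) Y"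


section \<open>Notions for a Lie algebra with underlying space \<open>'v\<close> and bracket \<open>br\<close>\<close>

definition lie_ideal :: "('v::real_vector \<Rightarrow> 'v \<Rightarrow> 'v) \<Rightarrow> 'v set \<Rightarrow> bool" where
  "lie_ideal br I \<longleftrightarrow> subspace I \<and> (\<forall>x. \<forall>y\<in>I. br x y \<in> I)"

definition simple_lie_algebra :: "('v::real_vector \<Rightarrow> 'v \<Rightarrow> 'v) \<Rightarrow> bool" where
  "simple_lie_algebra br \<longleftrightarrow>
     (\<exists>x y. br x y \<noteq> 0) \<and> (\<forall>I. lie_ideal br I \<longrightarrow> I = {0} \<or> I = UNIV)"

fun derived_series :: "('v::real_vector \<Rightarrow> 'v \<Rightarrow> 'v) \<Rightarrow> 'v set \<Rightarrow> nat \<Rightarrow> 'v set" where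
  "derived_series br I 0 = I"
| "derived_series br I (Suc k) =
     span {br x y | x y. x \<in> derived_series br I k \<and> y \<in> derived_series br I k}"

definition semisimple_lie_algebra :: "('v::real_vector \<Rightarrow> 'v \<Rightarrow> 'v) \<Rightarrow> bool" where
  "semisimple_lie_algebra br \<longleftrightarrow>
     (\<forall>I. lie_ideal br I \<and> (\<exists>k. derived_series br I k = {0}) \<longrightarrow> I = {0})"

definition killing_form :: "(real^'n \<Rightarrow> real^'n \<Rightarrow> real^'n) \<Rightarrow> real^'n \<Rightarrow> real^'n \<Rightarrow> real" where
  "killing_form br X Y = trace (matrix (\<lambda>Z. br X (br Y Z)))"


section \<open>Left-invariant metrics\<close>

text \<open>A left-invariant metric is an inner product on the Lie algebra, represented by its Gram
  matrix \<open>g\<close> in the standard basis of \<open>real^'n\<close>. The space of inner products thereby gets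
  its natural topology from \<open>real^'n^'n\<close>.\<close>

definition metric_form :: "real^'n^'n \<Rightarrow> real^'n \<Rightarrow> real^'n \<Rightarrow> real" where
  "metric_form g x y = x \<bullet> (g *v y)"

definition is_metric :: "real^'n^'n \<Rightarrow> bool" where
  "is_metric g \<longleftrightarrow> transpose g = g \<and> (\<forall>x. x \<noteq> 0 \<longrightarrow> metric_form g x x > 0)"

definition standard_metric :: "(real^'n \<Rightarrow> real^'n \<Rightarrow> real^'n) \<Rightarrow> real^'n^'n" where
  "standard_metric br = (\<chi> i j. - killing_form br (axis i 1) (axis j 1))"

text \<open>The quotient of Gram determinants is the determinant of \<open>g\<close> relative to the standard
  metric: it does not depend on the basis.\<close>

definition metrics_1 :: "(real^'n \<Rightarrow> real^'n \<Rightarrow> real^'n) \<Rightarrow> (real^'n^'n) set" where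
  "metrics_1 br = {g. is_metric g \<and> det g / det (standard_metric br) = 1}"

text \<open>The Levi-Civita connection on left-invariant fields, given by Koszul's formula, in which the
  terms differentiating the (constant) functions \<open>g(X,Y)\<close> vanish.\<close>

definition levi_civita ::
  "(real^'n \<Rightarrow> real^'n \<Rightarrow> real^'n) \<Rightarrow> real^'n^'n \<Rightarrow> real^'n \<Rightarrow> real^'n \<Rightarrow> real^'n" where
  "levi_civita br g X Y =
     (THE W. \<forall>Z. 2 * metric_form g W Z =
        metric_form g (br X Y) Z - metric_form g (br Y Z) X + metric_form g (br Z X) Y)"

definition riemann_curvature ::
  "(real^'n \<Rightarrow> real^'n \<Rightarrow> real^'n) \<Rightarrow> real^'n^'n \<Rightarrow> real^'n \<Rightarrow> real^'n \<Rightarrow> real^'n \<Rightarrow> real^'n" where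
  "riemann_curvature br g X Y Z =
     levi_civita br g X (levi_civita br g Y Z) - levi_civita br g Y (levi_civita br g X Z)
     - levi_civita br g (br X Y) Z"

definition ricci_curvature ::
  "(real^'n \<Rightarrow> real^'n \<Rightarrow> real^'n) \<Rightarrow> real^'n^'n \<Rightarrow> real^'n \<Rightarrow> real^'n \<Rightarrow> real" where
  "ricci_curvature br g Y Z = trace (matrix (\<lambda>X. riemann_curvature br g X Y Z))"

definition scalar_curvature ::
  "(real^'n \<Rightarrow> real^'n \<Rightarrow> real^'n) \<Rightarrow> real^'n^'n \<Rightarrow> real" where
  "scalar_curvature br g =
     (\<Sum>i\<in>UNIV. \<Sum>j\<in>UNIV. matrix_inv g $ i $ j * ricci_curvature br g (axis i 1) (axis j 1))"


section \<open>Critical points of a function on a set\<close>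

definition local_max_point :: "('x::topological_space \<Rightarrow> real) \<Rightarrow> 'x set \<Rightarrow> 'x \<Rightarrow> bool" where
  "local_max_point S M p \<longleftrightarrow> p \<in> M \<and> (\<forall>\<^sub>F q in at p within M. S q \<le> S p)"

definition local_min_point :: "('x::topological_space \<Rightarrow> real) \<Rightarrow> 'x set \<Rightarrow> 'x \<Rightarrow> bool" where
  "local_min_point S M p \<longleftrightarrow> p \<in> M \<and> (\<forall>\<^sub>F q in at p within M. S q \<ge> S p)"

text \<open>For a submanifold \<open>M\<close>: the differential of \<open>S\<close> along \<open>M\<close> vanishes at \<open>p\<close>.\<close>

definition critical_point :: "('x::real_normed_vector \<Rightarrow> real) \<Rightarrow> 'x set \<Rightarrow> 'x \<Rightarrow> bool" where
  "critical_point S M p \<longleftrightarrow> p \<in> M \<and>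
     (\<forall>\<gamma> :: real \<Rightarrow> 'x. range \<gamma> \<subseteq> M \<and> \<gamma> 0 = p \<and> \<gamma> differentiable (at 0) \<longrightarrow>
        ((\<lambda>t. S (\<gamma> t)) has_real_derivative 0) (at 0))"

definition saddle_point :: "('x::real_normed_vector \<Rightarrow> real) \<Rightarrow> 'x set \<Rightarrow> 'x \<Rightarrow> bool" where
  "saddle_point S M p \<longleftrightarrow>
     critical_point S M p \<and> \<not> local_max_point S M p \<and> \<not> local_min_point S M p"


section \<open>The classical groups\<close>

definition conj_transpose :: "complex^'m^'m \<Rightarrow> complex^'m^'m" where
  "conj_transpose A = (\<chi> i j. cnj (A $ j $ i))"

definition SU :: "(complex^'m^'m) set" where
  "SU = {A. A ** conj_transpose A = mat 1 \<and> det A = 1}"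

definition symplectic_matrix :: "complex^('m::finite + 'm)^('m + 'm)" where
  "symplectic_matrix = (\<chi> i j. case (i, j) of
      (Inl a, Inr b) \<Rightarrow> if a = b then 1 else 0
    | (Inr a, Inl b) \<Rightarrow> if a = b then - 1 else 0
    | _ \<Rightarrow> 0)"

text \<open>The compact group \<open>Sp(n) = U(2n) \<inter> Sp(2n, \<complex>)\<close> with \<open>n = CARD('m)\<close>.\<close>

definition Sp :: "(complex^('m::finite + 'm)^('m + 'm)) set" where
  "Sp = {A. A ** conj_transpose A = mat 1 \<and>
            transpose A ** symplectic_matrix ** A = symplectic_matrix}"

definition matrix_group :: "(complex^'m^'m) set \<Rightarrow> (complex^'m^'m) monoid" where
  "matrix_group H = \<lparr>carrier = H, mult = (**), one = mat 1\<rparr>"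

definition locally_isomorphic_to_matrix_group ::
  "('a, 'r) monoid_scheme \<Rightarrow> 'a topology \<Rightarrow> ('a, 'v::euclidean_space) chart set \<Rightarrow>
   (complex^'m^'m) set \<Rightarrow> bool" where
  "locally_isomorphic_to_matrix_group G T A H \<longleftrightarrow>
     locally_isomorphic G T A (matrix_group H) (top_of_set H)
       (submanifold_atlas H :: (complex^'m^'m, 'v) chart set)"

end

theory Submission imports Defs begin

text \<open>
  Every left-invariant metric of the given volume is diagonal in some frame \<open>f\<close> that is orthonormal for
  the standard metric (\<open>metrics_1_diagonal\<close>). With eigenvalues \<open>x i\<close> and structure constants
  \<open>c i j k\<close>, which are totally antisymmetric, the scalar curvature is
  \<open>(\<Sum>i. 1 / x i) / 2 - (\<Sum>i j k. (c i j k)^2 * x k / (x i * x j)) / 4\<close>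
  (\<open>scalar_curvature_diagonal\<close>), and \<open>\<Sum>j k. (c i j k)^2 = 1\<close>. Putting \<open>x i = exp (s * t i)\<close> with
  \<open>\<Sum>i. t i = 0\<close> makes all variations explicit. The first variation is a multiple of the sum of the
  \<open>t i\<close>, so the standard metric is critical (\<open>standard_critical\<close>). The second variation is
  \<open>- (\<Sum>i. (t i)^2) / 4 + (\<Sum>i j k. (c i j k)^2 * t i * t j) / 2\<close>.

  It is negative if \<open>t\<close> is the difference of two unit vectors, so the standard metric is never a local
  minimum point (\<open>standard_not_local_min\<close>). To exclude a local maximum, stretch a subalgebra uniformly
  (\<open>not_local_max_of_block\<close>): this raises the curvature for a proper ideal, and also for the subalgebra
  \<open>sp(n - 1)\<close> of \<open>sp(n)\<close>. For \<open>su(m)\<close> the subalgebra \<open>su(m - 1)\<close> has to be combined with its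
  one-dimensional centraliser, which yields a direction with vanishing second and positive third
  derivative (\<open>not_local_max_of_special_unitary_block\<close>). The required sums of squares of structure
  constants follow from the ratio of the Killing forms of the algebra and the subalgebra, which are
  multiples of the trace form. In dimension three there is only one structure constant, and Schur's
  inequality shows that the standard metric is a maximum point (\<open>local_max_of_dim_3\<close>).

  Two facts connect this with Lie groups. The Killing form of a compact semisimple group is negative
  definite (\<open>compact_lie_algebra_of_compact_group\<close>), because the bounded adjoint representation leaves an
  inner product invariant. And a local isomorphism with a matrix group identifies the Lie algebra with
  the tangent space of the matrix group at the identity, with the commutator as bracket
  (\<open>local_isomorphism_differential\<close>).
\<close>

section \<open>Smooth maps\<close>

lemma Ck_on_cong:
  assumes "open S" "\<And>x. x \<in> S \<Longrightarrow> f x = g x" "Ck_on k f S"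
  shows "Ck_on k g S"
  using assms(2,3)
proof (induction k arbitrary: f g)
  case 0
  then show ?case by (simp cong: continuous_on_cong)
next
  case (Suc k)
  have iff: "(f has_derivative D) (at x) \<longleftrightarrow> (g has_derivative D) (at x)" if "x \<in> S" for x D
    using has_derivative_transform_within_open[OF _ assms(1) that, of f D UNIV g]
      has_derivative_transform_within_open[OF _ assms(1) that, of g D UNIV f] Suc.prems(1) by auto
  have d: "frechet_derivative f (at x) = frechet_derivative g (at x)" if "x \<in> S" for x
    unfolding frechet_derivative_def using iff[OF that] by simp
  have "g differentiable_on S"
    using Suc.prems(2) iff by (auto simp: differentiable_on_eq_differentiable_at[OF assms(1)] differentiable_def)
  moreover have "Ck_on k (\<lambda>x. frechet_derivative g (at x) v) S" for v
    using Suc.IH[of "\<lambda>x. frechet_derivative f (at x) v"] Suc.prems(2) d by simp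
  ultimately show ?case by simp
qed

lemma Ck_on_subset: "Ck_on k f S \<Longrightarrow> T \<subseteq> S \<Longrightarrow> Ck_on k f T"
proof (induction k arbitrary: f)
  case 0
  then show ?case using continuous_on_subset by auto
next
  case (Suc k)
  then show ?case using differentiable_on_subset by (metis Ck_on.simps(2))
qed

lemma Ck_on_Suc_imp: "Ck_on (Suc k) f S \<Longrightarrow> Ck_on k f S"
proof (induction k arbitrary: f)
  case 0
  then show ?case using differentiable_imp_continuous_on by auto
next
  case (Suc k)
  then show ?case by (metis Ck_on.simps(2))
qed

lemma Ck_on_has_derivative:
  assumes "Ck_on (Suc k) f S" "open S" "x \<in> S"
  shows "(f has_derivative frechet_derivative f (at x)) (at x)"
  using assms by (metis Ck_on.simps(2) differentiable_on_eq_differentiable_at frechet_derivative_works)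

lemma Ck_on_SucI:
  assumes "open S" "\<And>x. x \<in> S \<Longrightarrow> (f has_derivative f' x) (at x)" "\<And>v. Ck_on k (\<lambda>x. f' x v) S"
  shows "Ck_on (Suc k) f S"
proof -
  have "f differentiable_on S"
    by (meson assms(2) differentiable_at_withinI differentiable_def differentiable_on_def)
  moreover have "Ck_on k (\<lambda>x. frechet_derivative f (at x) v) S" for v
    by (rule Ck_on_cong[OF assms(1) _ assms(3)[of v]]) (metis assms(2) frechet_derivative_at)
  ultimately show ?thesis by simp
qed

lemma Ck_on_const: "open S \<Longrightarrow> Ck_on k (\<lambda>x. c) S"
proof (induction k arbitrary: c)
  case (Suc k)
  show ?case by (rule Ck_on_SucI[OF Suc.prems, where f' = "\<lambda>_ _. 0"]) (simp_all add: Suc)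
qed simp

lemma Ck_on_linear:
  assumes "bounded_linear f" "open S" shows "Ck_on k f S"
proof (cases k)
  case (Suc j)
  show ?thesis unfolding Suc
    by (rule Ck_on_SucI[OF assms(2), where f' = "\<lambda>_. f"])
       (auto intro: Ck_on_const assms bounded_linear_imp_has_derivative)
qed (use assms in \<open>auto simp: linear_continuous_on\<close>)

lemma Ck_on_add:
  assumes "open S" "Ck_on k f S" "Ck_on k g S" shows "Ck_on k (\<lambda>x. f x + g x) S"
  using assms(2,3)
proof (induction k arbitrary: f g)
  case (Suc k)
  show ?case
  proof (rule Ck_on_SucI[OF assms(1)])
    show "((\<lambda>x. f x + g x) has_derivative
        (\<lambda>v. frechet_derivative f (at x) v + frechet_derivative g (at x) v)) (at x)" if "x \<in> S" for x
      by (rule has_derivative_add[OF Ck_on_has_derivative[OF Suc.prems(1) assms(1) that] Ck_on_has_derivative[OF Suc.prems(2) assms(1) that]])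
    show "Ck_on k (\<lambda>x. frechet_derivative f (at x) v + frechet_derivative g (at x) v) S" for v
      using Suc by simp
  qed
qed (auto intro: continuous_intros)

lemma Ck_on_sum:
  assumes "open S" "\<And>i. i \<in> I \<Longrightarrow> Ck_on k (f i) S" shows "Ck_on k (\<lambda>x. \<Sum>i\<in>I. f i x) S"
proof (cases "finite I")
  case True
  then show ?thesis using assms(2)
    by (induction I) (auto intro: Ck_on_const Ck_on_add assms(1))
qed (auto intro: Ck_on_const assms)

lemma Ck_on_bilinear:
  fixes prod :: "'b::euclidean_space \<Rightarrow> 'c::euclidean_space \<Rightarrow> 'd::euclidean_space"
  assumes "bounded_bilinear prod" "open S" "Ck_on k f S" "Ck_on k g S"
  shows "Ck_on k (\<lambda>x. prod (f x) (g x)) S"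
  using assms(3,4)
proof (induction k arbitrary: f g)
  case 0
  then show ?case by (simp add: bounded_bilinear.continuous_on[OF assms(1)])
next
  case (Suc k)
  show ?case
  proof (rule Ck_on_SucI[OF assms(2)])
    show "((\<lambda>x. prod (f x) (g x)) has_derivative
       (\<lambda>v. prod (f x) (frechet_derivative g (at x) v) + prod (frechet_derivative f (at x) v) (g x))) (at x)"
      if "x \<in> S" for x
      by (rule bounded_bilinear.FDERIV[OF assms(1) Ck_on_has_derivative[OF Suc.prems(1) assms(2) that] Ck_on_has_derivative[OF Suc.prems(2) assms(2) that]])
    show "Ck_on k (\<lambda>x. prod (f x) (frechet_derivative g (at x) v) + prod (frechet_derivative f (at x) v) (g x)) S" for v
      using Suc.prems Suc.prems[THEN Ck_on_Suc_imp] by (intro Ck_on_add assms(2) Suc.IH) auto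
  qed
qed

text \<open>Expanding the derivative of \<open>g\<close> in a basis turns the chain rule into a sum of products, to which
the induction on \<open>k\<close> applies.\<close>

lemma Ck_on_comp:
  fixes f :: "'a::euclidean_space \<Rightarrow> 'b::euclidean_space" and g :: "'b \<Rightarrow> 'c::euclidean_space"
  assumes "open S" "open U" "Ck_on k f S" "Ck_on k g U" "f ` S \<subseteq> U"
  shows "Ck_on k (\<lambda>x. g (f x)) S"
  using assms(3,4)
proof (induction k arbitrary: g)
  case 0
  then show ?case using assms(5) by (auto intro: continuous_on_compose2)
next
  case (Suc k)
  have fd: "(f has_derivative frechet_derivative f (at x)) (at x)" if "x \<in> S" for x
    using Ck_on_has_derivative[OF Suc.prems(1) assms(1) that] .
  have gd: "(g has_derivative frechet_derivative g (at (f x))) (at (f x))" if "x \<in> S" for x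
    using Ck_on_has_derivative[OF Suc.prems(2) assms(2)] that assms(5) by auto
  show ?case
  proof (rule Ck_on_SucI[OF assms(1)])
    show "((\<lambda>x. g (f x)) has_derivative
       (\<lambda>v. \<Sum>b\<in>Basis. (frechet_derivative f (at x) v \<bullet> b) *\<^sub>R frechet_derivative g (at (f x)) b)) (at x)"
      if "x \<in> S" for x
    proof -
      have comp: "((\<lambda>x. g (f x)) has_derivative (\<lambda>v. frechet_derivative g (at (f x)) (frechet_derivative f (at x) v))) (at x)"
        using has_derivative_compose[OF fd[OF that] gd[OF that]] .
      have rep: "frechet_derivative g (at (f x)) w = (\<Sum>b\<in>Basis. (w \<bullet> b) *\<^sub>R frechet_derivative g (at (f x)) b)" for w
      proof -
        interpret linear "frechet_derivative g (at (f x))" using gd[OF that] has_derivative_linear by blast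
        show ?thesis by (subst euclidean_representation[of w, symmetric]) (simp add: sum scale)
      qed
      show ?thesis by (rule has_derivative_eq_rhs[OF comp ext[OF rep]])
    qed
    show "Ck_on k (\<lambda>x. \<Sum>b\<in>Basis. (frechet_derivative f (at x) v \<bullet> b) *\<^sub>R frechet_derivative g (at (f x)) b) S" for v
    proof (intro Ck_on_sum assms(1) Ck_on_bilinear[OF bounded_bilinear_scaleR])
      fix b
      show "Ck_on k (\<lambda>x. frechet_derivative f (at x) v \<bullet> b) S"
        by (rule Ck_on_bilinear[OF bounded_bilinear_inner]) (use Suc.prems assms in \<open>auto intro: Ck_on_const\<close>)
      show "Ck_on k (\<lambda>x. frechet_derivative g (at (f x)) b) S"
        by (rule Suc.IH) (use Suc.prems Ck_on_Suc_imp[OF Suc.prems(1)] in auto)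
    qed
  qed
qed

lemma Ck_on_Pair:
  fixes f :: "'a::euclidean_space \<Rightarrow> 'b::euclidean_space" and g :: "'a \<Rightarrow> 'c::euclidean_space"
  assumes "open S" "Ck_on k f S" "Ck_on k g S"
  shows "Ck_on k (\<lambda>x. (f x, g x)) S"
proof -
  have 1: "Ck_on k (\<lambda>x. (f x, 0::'c)) S"
    by (rule Ck_on_comp[OF assms(1) open_UNIV assms(2) Ck_on_linear]) (auto intro: bounded_linear_intros bounded_linear_Pair)
  have 2: "Ck_on k (\<lambda>x. (0::'b, g x)) S"
    by (rule Ck_on_comp[OF assms(1) open_UNIV assms(3) Ck_on_linear]) (auto intro: bounded_linear_intros bounded_linear_Pair)
  show ?thesis using Ck_on_add[OF assms(1) 1 2] by simp
qed

text \<open>The second difference quotient is symmetric in the increments \<open>v\<close> and \<open>w\<close>, while its limit is one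
of the two mixed derivatives; this is what makes mixed derivatives equal.\<close>

lemma second_difference_quotient:
  fixes f :: "'a::euclidean_space \<Rightarrow> real"
  assumes "open S" "x \<in> S" and fd: "\<And>y. y \<in> S \<Longrightarrow> (f has_derivative f' y) (at y)"
    and vd: "((\<lambda>y. f' y v) has_derivative A) (at x)"
  shows "((\<lambda>h. (f (x + h *\<^sub>R v + h *\<^sub>R w) - f (x + h *\<^sub>R v) - f (x + h *\<^sub>R w) + f x) / h^2) \<longlongrightarrow> A w) (at_right 0)"
proof (rule tendstoI)
  fix \<epsilon> :: real assume "\<epsilon> > 0"
  define K where "K = 1 + 2 * norm v + norm w"
  have K: "K > 0" unfolding K_def by (smt (verit) norm_ge_zero)
  define \<eta> where "\<eta> = \<epsilon> / (2 * K)"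
  have \<eta>: "\<eta> > 0" using \<open>\<epsilon> > 0\<close> K by (simp add: \<eta>_def)
  interpret A: linear A using vd has_derivative_linear by blast
  obtain d where d: "d > 0" "\<And>y. norm (y - x) < d \<Longrightarrow> norm (f' y v - f' x v - A (y - x)) \<le> \<eta> * norm (y - x)"
    using vd \<eta> unfolding has_derivative_at_alt by blast
  obtain r where r: "r > 0" "ball x r \<subseteq> S" using assms(1,2) open_contains_ball by blast
  define \<delta> where "\<delta> = min d r / K"
  have \<delta>: "\<delta> > 0" using d r K by (simp add: \<delta>_def)
  have "dist ((f (x + h *\<^sub>R v + h *\<^sub>R w) - f (x + h *\<^sub>R v) - f (x + h *\<^sub>R w) + f x) / h^2) (A w) < \<epsilon>"
    if h: "0 < h" "h < \<delta>" for h
  proof -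
    have hK: "h * K < min d r" using h K unfolding \<delta>_def by (simp add: field_simps)
    have nb: "norm (s *\<^sub>R v + t *\<^sub>R w) \<le> h * (K - 1 - norm v)" if "0 \<le> s" "s \<le> h" "0 \<le> t" "t \<le> h" for s t
    proof -
      have "norm (s *\<^sub>R v + t *\<^sub>R w) \<le> s * norm v + t * norm w"
        using norm_triangle_ineq[of "s *\<^sub>R v" "t *\<^sub>R w"] that by simp
      also have "\<dots> \<le> h * norm v + h * norm w" using that by (intro add_mono mult_right_mono) auto
      finally show ?thesis by (simp add: K_def algebra_simps)
    qed
    have nb1: "norm (s *\<^sub>R v + t *\<^sub>R w) < min d r" if "0 \<le> s" "s \<le> h" "0 \<le> t" "t \<le> h" for s t
    proof -
      have "h * (K - 1 - norm v) \<le> h * K" using h norm_ge_zero[of v] by (intro mult_left_mono) linarith+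
      then show ?thesis using nb[OF that] hK by linarith
    qed
    have inS: "x + s *\<^sub>R v + t *\<^sub>R w \<in> S" if "0 \<le> s" "s \<le> h" "0 \<le> t" "t \<le> h" for s t
      using nb1[OF that] r(2) by (auto simp: dist_norm add.assoc norm_minus_commute subset_iff)
    define G where "G = (\<lambda>s. f (x + s *\<^sub>R v + h *\<^sub>R w) - f (x + s *\<^sub>R v))"
    have Gd: "(G has_real_derivative (f' (x + s *\<^sub>R v + h *\<^sub>R w) v - f' (x + s *\<^sub>R v) v)) (at s)"
      if "0 \<le> s" "s \<le> h" for s
    proof -
      have a: "x + s *\<^sub>R v + h *\<^sub>R w \<in> S" using inS[of s h] that h by auto
      have b: "x + s *\<^sub>R v \<in> S" using inS[of s 0] that h by auto
      interpret l1: linear "f' (x + s *\<^sub>R v + h *\<^sub>R w)" using fd[OF a] has_derivative_linear by blast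
      interpret l2: linear "f' (x + s *\<^sub>R v)" using fd[OF b] has_derivative_linear by blast
      have e1: "((\<lambda>s. x + s *\<^sub>R v + h *\<^sub>R w) has_derivative (\<lambda>t. t *\<^sub>R v)) (at s)"
        and e2: "((\<lambda>s. x + s *\<^sub>R v) has_derivative (\<lambda>t. t *\<^sub>R v)) (at s)"
        by (auto intro!: derivative_eq_intros)
      have g1: "(G has_derivative (\<lambda>t. f' (x + s *\<^sub>R v + h *\<^sub>R w) (t *\<^sub>R v) - f' (x + s *\<^sub>R v) (t *\<^sub>R v))) (at s)"
        unfolding G_def
        by (rule has_derivative_diff[OF has_derivative_compose[OF e1 fd[OF a]] has_derivative_compose[OF e2 fd[OF b]]])
      have g2: "f' (x + s *\<^sub>R v + h *\<^sub>R w) (t *\<^sub>R v) - f' (x + s *\<^sub>R v) (t *\<^sub>R v) = (f' (x + s *\<^sub>R v + h *\<^sub>R w) v - f' (x + s *\<^sub>R v) v) * t" for t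
        unfolding l1.scale l2.scale real_scaleR_def by (simp only: right_diff_distrib mult.commute)
      show ?thesis using g1 unfolding has_field_derivative_def by (simp only: g2)
    qed
    obtain \<xi> where \<xi>: "0 < \<xi>" "\<xi> < h" "G h - G 0 = (h - 0) * (f' (x + \<xi> *\<^sub>R v + h *\<^sub>R w) v - f' (x + \<xi> *\<^sub>R v) v)"
      using MVT2[OF h(1) Gd] by blast
    define y1 where "y1 = x + \<xi> *\<^sub>R v + h *\<^sub>R w"
    define y2 where "y2 = x + \<xi> *\<^sub>R v"
    have n1: "norm (y1 - x) \<le> h * (K - 1 - norm v)" "norm (y1 - x) < d"
      using nb[of \<xi> h] nb1[of \<xi> h] \<xi> h by (auto simp: y1_def add.assoc)
    have n2: "norm (y2 - x) \<le> h * norm v" "norm (y2 - x) < d"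
      using nb1[of \<xi> 0] \<xi> h by (auto simp: y2_def intro: mult_right_mono)
    have "A w * h = A (y1 - x) - A (y2 - x)" by (simp add: y1_def y2_def A.scale A.add mult.commute)
    then have "\<bar>(f' y1 v - f' y2 v) - A w * h\<bar> \<le> \<bar>f' y1 v - f' x v - A (y1 - x)\<bar> + \<bar>f' y2 v - f' x v - A (y2 - x)\<bar>"
      by linarith
    also have "\<dots> \<le> \<eta> * norm (y1 - x) + \<eta> * norm (y2 - x)"
      using d(2)[OF n1(2)] d(2)[OF n2(2)] by simp
    also have "\<dots> \<le> \<eta> * (h * (K - 1 - norm v)) + \<eta> * (h * norm v)"
      using n1 n2 \<eta> by (intro add_mono mult_left_mono) auto
    also have "\<dots> \<le> \<eta> * (h * K)" using \<eta> h by (simp add: algebra_simps)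
    finally have e: "\<bar>(f' y1 v - f' y2 v) - A w * h\<bar> \<le> \<eta> * (h * K)" .
    have num: "f (x + h *\<^sub>R v + h *\<^sub>R w) - f (x + h *\<^sub>R v) - f (x + h *\<^sub>R w) + f x = h * (f' y1 v - f' y2 v)"
      using \<xi>(3) by (simp add: G_def y1_def y2_def)
    have "(f (x + h *\<^sub>R v + h *\<^sub>R w) - f (x + h *\<^sub>R v) - f (x + h *\<^sub>R w) + f x) / h^2 - A w = ((f' y1 v - f' y2 v) - A w * h) / h"
      unfolding num using h by (simp add: field_simps power2_eq_square)
    also have "\<bar>\<dots>\<bar> \<le> \<eta> * K" using e h by (simp add: field_simps abs_divide)
    also have "\<dots> < \<epsilon>" using K \<open>\<epsilon> > 0\<close> by (simp add: \<eta>_def)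
    finally show ?thesis by (simp add: dist_norm)
  qed
  then show "\<forall>\<^sub>F h in at_right 0. dist ((f (x + h *\<^sub>R v + h *\<^sub>R w) - f (x + h *\<^sub>R v) - f (x + h *\<^sub>R w) + f x) / h^2) (A w) < \<epsilon>"
    unfolding eventually_at_right_field using \<delta> by (intro exI[of _ \<delta>]) auto
qed

lemma second_derivative_symmetric_real:
  fixes f :: "'a::euclidean_space \<Rightarrow> real"
  assumes "open S" "x \<in> S" "\<And>y. y \<in> S \<Longrightarrow> (f has_derivative f' y) (at y)"
    and "((\<lambda>y. f' y v) has_derivative A) (at x)" "((\<lambda>y. f' y w) has_derivative B) (at x)"
  shows "A w = B v"
proof -
  have 1: "((\<lambda>h. (f (x + h *\<^sub>R v + h *\<^sub>R w) - f (x + h *\<^sub>R v) - f (x + h *\<^sub>R w) + f x) / h^2) \<longlongrightarrow> A w) (at_right 0)"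
    by (rule second_difference_quotient[OF assms(1-4)])
  have 2: "((\<lambda>h. (f (x + h *\<^sub>R w + h *\<^sub>R v) - f (x + h *\<^sub>R w) - f (x + h *\<^sub>R v) + f x) / h^2) \<longlongrightarrow> B v) (at_right 0)"
    by (rule second_difference_quotient[OF assms(1-3,5)])
  have "(\<lambda>h. (f (x + h *\<^sub>R w + h *\<^sub>R v) - f (x + h *\<^sub>R w) - f (x + h *\<^sub>R v) + f x) / h^2) =
     (\<lambda>h. (f (x + h *\<^sub>R v + h *\<^sub>R w) - f (x + h *\<^sub>R v) - f (x + h *\<^sub>R w) + f x) / h^2)"
    by (rule ext) (simp add: add_ac)
  then show ?thesis using tendsto_unique[OF _ 1] 2 by simp
qed

lemma second_derivative_symmetric:
  fixes f :: "'a::euclidean_space \<Rightarrow> 'b::euclidean_space"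
  assumes "open S" "x \<in> S" "\<And>y. y \<in> S \<Longrightarrow> (f has_derivative f' y) (at y)"
    and "((\<lambda>y. f' y v) has_derivative A) (at x)" "((\<lambda>y. f' y w) has_derivative B) (at x)"
  shows "A w = B v"
proof (rule euclidean_eqI)
  fix b :: 'b assume "b \<in> Basis"
  show "A w \<bullet> b = B v \<bullet> b"
    by (rule second_derivative_symmetric_real[where f = "\<lambda>y. f y \<bullet> b" and f' = "\<lambda>y z. f' y z \<bullet> b", OF assms(1,2)])
      (use assms(3-5) in \<open>auto intro!: derivative_intros\<close>)
qed

section \<open>Inner products and frames\<close>

lemma trace_dual_basis:
  fixes f :: "real^'n \<Rightarrow> real^'n" and v :: "'n \<Rightarrow> real^'n"
  assumes f: "linear f" and l: "\<And>i. linear (l i :: real^'n \<Rightarrow> real)"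
    and dual: "\<And>i j. l i (v j) = (if i = j then 1 else 0)"
  shows "trace (matrix f) = (\<Sum>i\<in>UNIV. l i (f (v i)))"
proof -
  define V :: "real^'n^'n" where "V = (\<chi> a i. v i $ a)"
  define L :: "real^'n^'n" where "L = (\<chi> i a. l i (axis a 1))"
  have rep: "(\<Sum>a\<in>UNIV. l i (axis a 1) * w $ a) = l i w" for i w
  proof -
    interpret linear "l i" by (rule l)
    have "l i w = l i (\<Sum>a\<in>UNIV. (w $ a) *\<^sub>R axis a 1)"
      using basis_expansion[of w] by (simp add: scalar_mult_eq_scaleR)
    then show ?thesis by (simp add: sum scale mult.commute)
  qed
  have "L ** V = mat 1"
    by (simp add: vec_eq_iff matrix_matrix_mult_def L_def V_def rep dual mat_def)
  then have "V ** L = mat 1" by (simp add: matrix_left_right_inverse)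
  then have "trace (matrix f) = trace (L ** (matrix f ** V))"
    by (metis matrix_mul_assoc matrix_mul_rid trace_mul_sym)
  also have "\<dots> = (\<Sum>i\<in>UNIV. l i (f (v i)))"
  proof -
    have "(L ** (matrix f ** V)) $ i $ i = l i (f (v i))" for i
    proof -
      have "(matrix f ** V) $ a $ i = f (v i) $ a" for a
      proof -
        have "(matrix f ** V) $ a $ i = (matrix f *v v i) $ a"
          by (simp add: matrix_matrix_mult_def matrix_vector_mult_def V_def)
        then show ?thesis using f by (simp add: matrix_works linear_matrix_vector_mul_eq[symmetric] matrix_vector_mul(2)[symmetric])
      qed
      moreover have "(L ** M) $ i $ i = (\<Sum>a\<in>UNIV. l i (axis a 1) * M $ a $ i)" for M :: "real^'n^'n"
        by (simp add: matrix_matrix_mult_def L_def)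
      ultimately show ?thesis by (simp add: rep)
    qed
    then show ?thesis by (simp add: trace_def)
  qed
  finally show ?thesis .
qed

lemma bilinear_metric_form: "bilinear (metric_form g)"
  unfolding bilinear_def metric_form_def
  by (auto intro!: linearI simp: inner_left_distrib inner_right_distrib matrix_vector_right_distrib
      matrix_vector_mult_scaleR)

lemma metric_form_commute: "transpose g = g \<Longrightarrow> metric_form g x y = metric_form g y x"
  unfolding metric_form_def by (metis dot_lmul_matrix inner_commute transpose_matrix_vector)

lemmas metric_form_simps =
  bilinear_ladd[OF bilinear_metric_form] bilinear_radd[OF bilinear_metric_form]
  bilinear_lmul[OF bilinear_metric_form] bilinear_rmul[OF bilinear_metric_form]
  bilinear_lsub[OF bilinear_metric_form] bilinear_rsub[OF bilinear_metric_form]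
  bilinear_lneg[OF bilinear_metric_form] bilinear_rneg[OF bilinear_metric_form]
  bilinear_lzero[OF bilinear_metric_form] bilinear_rzero[OF bilinear_metric_form]

lemma linear_metric_form_left: "linear (\<lambda>x. metric_form g x y)"
  using bilinear_metric_form unfolding bilinear_def by blast

lemma linear_metric_form_right: "linear (metric_form g x)"
  using bilinear_metric_form unfolding bilinear_def by (metis (full_types) eta_contract_eq)

lemma metric_form_sum_left: "metric_form g (sum F I) y = (\<Sum>i\<in>I. metric_form g (F i) y)"
  using linear_sum[OF linear_metric_form_left] by simp

lemma metric_form_sum_right: "metric_form g x (sum F I) = (\<Sum>i\<in>I. metric_form g x (F i))"
  using linear_sum[OF linear_metric_form_right] by simp

lemma metric_form_axis: "metric_form g (axis i 1) (axis j 1) = g $ i $ j"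
  by (simp add: metric_form_def inner_axis' matrix_vector_mult_basis column_def)

definition orthonormal_set :: "real^'n^'n \<Rightarrow> (real^'n) set \<Rightarrow> bool" where
  "orthonormal_set g B \<longleftrightarrow> finite B \<and> (\<forall>b\<in>B. \<forall>b'\<in>B. metric_form g b b' = (if b = b' then 1 else 0))"

definition frame :: "real^'n^'n \<Rightarrow> ('n \<Rightarrow> real^'n) \<Rightarrow> bool" where
  "frame g e \<longleftrightarrow> (\<forall>i j. metric_form g (e i) (e j) = (if i = j then 1 else 0))"

lemma orthonormal_set_independent:
  assumes "orthonormal_set g B" shows "independent B"
proof -
  have "finite B" using assms by (simp add: orthonormal_set_def)
  then show ?thesis
  proof (rule independent_if_scalars_zero)
    fix f x assume f: "(\<Sum>x\<in>B. f x *\<^sub>R x) = 0" and x: "x \<in> B"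
    have "0 = metric_form g (\<Sum>x\<in>B. f x *\<^sub>R x) x" by (simp add: f metric_form_simps)
    also have "\<dots> = (\<Sum>y\<in>B. f y * metric_form g y x)" by (simp add: metric_form_sum_left metric_form_simps)
    also have "\<dots> = (\<Sum>y\<in>B. if y = x then f y else 0)"
      using assms x by (intro sum.cong) (auto simp: orthonormal_set_def)
    also have "\<dots> = f x" using x \<open>finite B\<close> by simp
    finally show "f x = 0" by simp
  qed
qed

lemma metric_lower_bound:
  fixes Q :: "real^'n^'n"
  assumes "is_metric Q"
  obtains m where "m > 0" "\<And>x. m * (norm x)^2 \<le> metric_form Q x x"
proof -
  have contQ: "continuous_on UNIV (\<lambda>x. metric_form Q x x)"
    unfolding metric_form_def by (intro continuous_intros linear_continuous_on)
  have "compact (sphere (0::real^'n) 1)" by simp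
  moreover have "sphere (0::real^'n) 1 \<noteq> {}" by simp
  ultimately obtain z :: "real^'n" where "z \<in> sphere 0 1" "\<forall>y\<in>sphere 0 1. metric_form Q z z \<le> metric_form Q y y"
    using continuous_attains_inf[OF _ _ continuous_on_subset[OF contQ subset_UNIV]] by blast
  then have z: "norm z = 1" "\<And>y. norm y = 1 \<Longrightarrow> metric_form Q z z \<le> metric_form Q y y" by auto
  have "metric_form Q z z * (norm x)^2 \<le> metric_form Q x x" for x
  proof (cases "x = 0")
    case False
    then have "metric_form Q z z \<le> metric_form Q (x /\<^sub>R norm x) (x /\<^sub>R norm x)" by (intro z(2)) simp
    then show ?thesis using False by (simp add: metric_form_simps field_simps power2_eq_square)
  qed (simp add: metric_form_simps)
  moreover have "metric_form Q z z > 0"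
    using assms z(1) unfolding is_metric_def by (metis norm_zero zero_neq_one)
  ultimately show ?thesis using that by blast
qed

text \<open>A maximiser of \<open>g\<close> on the \<open>Q\<close>-unit sphere of \<open>V\<close> is \<open>g\<close>-orthogonal to its \<open>Q\<close>-orthogonal
complement in \<open>V\<close>, which has smaller dimension.\<close>

lemma simultaneous_diagonalization:
  fixes Q g :: "real^'n^'n"
  assumes Q: "is_metric Q" and g: "transpose g = g" and V: "subspace V"
  obtains B where "orthonormal_set Q B" "span B = V" "\<And>b b'. b \<in> B \<Longrightarrow> b' \<in> B \<Longrightarrow> b \<noteq> b' \<Longrightarrow> metric_form g b b' = 0"
proof -
  have Qsym: "metric_form Q x y = metric_form Q y x" for x y
    using Q metric_form_commute is_metric_def by blast
  have Qpos: "metric_form Q x x > 0" if "x \<noteq> 0" for x using Q that is_metric_def by blast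
  have gsym: "metric_form g x y = metric_form g y x" for x y
    using g metric_form_commute by blast
  have "\<exists>B. orthonormal_set Q B \<and> span B = V \<and> (\<forall>b\<in>B. \<forall>b'\<in>B. b \<noteq> b' \<longrightarrow> metric_form g b b' = 0)"
    using V
  proof (induction "dim V" arbitrary: V rule: less_induct)
    case less
    show ?case
    proof (cases "V = {0}")
      case True
      show ?thesis by (rule exI[of _ "{}"]) (simp add: orthonormal_set_def True)
    next
      case False
      define C where "C = {x \<in> V. metric_form Q x x = 1}"
      have contQ: "continuous_on UNIV (\<lambda>x. metric_form g' x x)" for g' :: "real^'n^'n"
        unfolding metric_form_def by (intro continuous_intros linear_continuous_on)
      obtain m where m: "m > 0" "\<And>x. m * (norm x)^2 \<le> metric_form Q x x"
        using metric_lower_bound[OF Q] by blast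
      have "closed C"
      proof -
        have "closed {x. metric_form Q x x = 1}"
          by (intro closed_Collect_eq contQ continuous_on_const)
        moreover have "C = V \<inter> {x. metric_form Q x x = 1}" by (auto simp: C_def)
        ultimately show ?thesis using closed_subspace[OF less.prems] by auto
      qed
      moreover have "bounded C"
      proof (rule boundedI)
        fix x assume "x \<in> C"
        then have "(norm x)^2 \<le> 1 / m" using m(2)[of x] m(1) by (simp add: C_def field_simps)
        then show "norm x \<le> sqrt (1 / m)" by (simp add: real_le_rsqrt)
      qed
      ultimately have "compact C" by (simp add: compact_eq_bounded_closed)
      have nrm: "\<exists>c>0. metric_form Q (c *\<^sub>R x) (c *\<^sub>R x) = 1" if "x \<noteq> 0" for x
        using Qpos[OF that] by (intro exI[of _ "1 / sqrt (metric_form Q x x)"]) (simp add: metric_form_simps field_simps)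
      obtain x1 where "x1 \<in> V" "x1 \<noteq> 0" using False subspace_0[OF less.prems] by auto
      then have "C \<noteq> {}" using nrm[of x1] subspace_scale[OF less.prems] by (auto simp: C_def)
      obtain x0 where x0: "x0 \<in> C" "\<And>y. y \<in> C \<Longrightarrow> metric_form g y y \<le> metric_form g x0 x0"
        using continuous_attains_sup[OF \<open>compact C\<close> \<open>C \<noteq> {}\<close> continuous_on_subset[OF contQ subset_UNIV]] by blast
      then have x0V: "x0 \<in> V" and x01: "metric_form Q x0 x0 = 1" by (auto simp: C_def)
      define \<mu> where "\<mu> = metric_form g x0 x0"
      have bound: "metric_form g z z \<le> \<mu> * metric_form Q z z" if "z \<in> V" for z
      proof (cases "z = 0")
        case False
        then obtain c where c: "c > 0" "metric_form Q (c *\<^sub>R z) (c *\<^sub>R z) = 1" using nrm by blast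
        then have "metric_form g (c *\<^sub>R z) (c *\<^sub>R z) \<le> \<mu> * metric_form Q (c *\<^sub>R z) (c *\<^sub>R z)"
          using x0(2)[of "c *\<^sub>R z"] subspace_scale[OF less.prems that] by (simp add: C_def \<mu>_def)
        then have "c * c * metric_form g z z \<le> c * c * (\<mu> * metric_form Q z z)"
          by (simp only: metric_form_simps) (simp add: algebra_simps)
        then show ?thesis using c(1) by simp
      qed (simp add: metric_form_simps)
      have orth: "metric_form g x0 y = 0" if y: "y \<in> V" "metric_form Q x0 y = 0" for y
      proof -
        define a where "a = metric_form g x0 y"
        define b where "b = \<mu> * metric_form Q y y - metric_form g y y"
        have "2 * t * a \<le> t^2 * b" for t
        proof -
          have "metric_form g (x0 + t *\<^sub>R y) (x0 + t *\<^sub>R y) \<le> \<mu> * metric_form Q (x0 + t *\<^sub>R y) (x0 + t *\<^sub>R y)"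
            by (rule bound) (simp add: subspace_add less.prems subspace_scale x0V y)
          then show ?thesis
            using y(2) Qsym[of x0 y] gsym[of x0 y] x01
            by (simp add: metric_form_simps a_def b_def \<mu>_def power2_eq_square algebra_simps)
        qed note * = this
        have "b \<ge> 0" using *[of 1] *[of "-1"] by simp
        show "a = 0"
        proof (rule ccontr)
          assume "a \<noteq> 0"
          define t where "t = a / (b + 1)"
          have "a = t * (b + 1)" "t \<noteq> 0" using \<open>b \<ge> 0\<close> \<open>a \<noteq> 0\<close> by (simp_all add: t_def)
          then have "t^2 * (b + 2) \<le> 0" using *[of t] by (simp add: power2_eq_square algebra_simps)
          then show False using \<open>t \<noteq> 0\<close> \<open>b \<ge> 0\<close> by (smt (verit) mult_pos_pos zero_less_power2)
        qed
      qed
      define V' where "V' = {y \<in> V. metric_form Q x0 y = 0}"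
      have sV': "subspace V'"
        using less.prems unfolding V'_def subspace_def by (auto simp: metric_form_simps)
      have "x0 \<notin> V'" "V' \<subseteq> V" using x01 by (auto simp: V'_def)
      then have "V' \<subset> V" using x0V by blast
      then have "dim V' < dim V"
        using less.prems sV' by (metis dim_psubset span_eq_iff)
      from less.hyps[OF this sV'] obtain B where B: "orthonormal_set Q B" "span B = V'"
        "\<forall>b\<in>B. \<forall>b'\<in>B. b \<noteq> b' \<longrightarrow> metric_form g b b' = 0" by blast
      have BV': "b \<in> V \<and> metric_form Q x0 b = 0" if "b \<in> B" for b
        using B(2) that span_superset unfolding V'_def by blast
      show ?thesis
      proof (intro exI[of _ "insert x0 B"] conjI)
        show "orthonormal_set Q (insert x0 B)"
          using B(1) BV' x01 Qsym unfolding orthonormal_set_def by (auto split: if_splits)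
        show "\<forall>b\<in>insert x0 B. \<forall>b'\<in>insert x0 B. b \<noteq> b' \<longrightarrow> metric_form g b b' = 0"
          using B(3) BV' orth gsym by auto
        show "span (insert x0 B) = V"
        proof
          show "span (insert x0 B) \<subseteq> V" using x0V BV' less.prems by (intro span_minimal) auto
          show "V \<subseteq> span (insert x0 B)"
          proof
            fix y assume y: "y \<in> V"
            have "y - metric_form Q x0 y *\<^sub>R x0 \<in> V'"
              using y x0V x01 by (simp add: V'_def subspace_diff subspace_scale less.prems metric_form_simps)
            then show "y \<in> span (insert x0 B)" using B(2) span_breakdown_eq by blast
          qed
        qed
      qed
    qed
  qed
  then show ?thesis using that by blast
qed

lemma frame_of_spanning_orthonormal_set:
  assumes "orthonormal_set (Q :: real^'n^'n) B" "span B = UNIV"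
  obtains f where "frame Q f" "range f = B"
proof -
  have "dim B = dim (UNIV :: (real^'n) set)" using assms(2) by (metis dim_span)
  then have "card B = CARD('n)"
    using dim_eq_card_independent[OF orthonormal_set_independent[OF assms(1)]] by simp
  then obtain f :: "'n \<Rightarrow> real^'n" where f: "bij_betw f UNIV B"
    by (metis assms(1) finite_same_card_bij finite_class.finite_UNIV orthonormal_set_def)
  have "frame Q f" "range f = B"
    using f assms(1) unfolding frame_def orthonormal_set_def bij_betw_def inj_def by (auto split: if_splits)
  then show ?thesis by (rule that)
qed

lemma simultaneous_frame:
  assumes "is_metric Q" "transpose g = g"
  obtains f where "frame Q f" "\<And>i j. i \<noteq> j \<Longrightarrow> metric_form g (f i) (f j) = 0"
proof -
  obtain B where B: "orthonormal_set Q B" "span B = UNIV"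
    "\<And>b b'. b \<in> B \<Longrightarrow> b' \<in> B \<Longrightarrow> b \<noteq> b' \<Longrightarrow> metric_form g b b' = 0"
    using simultaneous_diagonalization[OF assms subspace_UNIV] by blast
  obtain f where f: "frame Q f" "range f = B" using frame_of_spanning_orthonormal_set[OF B(1,2)] by blast
  have "f i \<noteq> f j" if "i \<noteq> j" for i j using f(1) that unfolding frame_def by (metis zero_neq_one)
  then show ?thesis using that[OF f(1)] B(3) f(2) by blast
qed

lemma orthonormal_set_extend:
  assumes Q: "is_metric Q" and B: "orthonormal_set Q B"
  obtains f where "frame Q f" "B \<subseteq> range f"
proof -
  have Qsym: "metric_form Q x y = metric_form Q y x" for x y
    using Q metric_form_commute is_metric_def by blast
  define W where "W = {x. \<forall>b\<in>B. metric_form Q b x = 0}"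
  have "subspace W" unfolding W_def subspace_def by (auto simp: metric_form_simps)
  then obtain B' where B': "orthonormal_set Q B'" "span B' = W"
    using simultaneous_diagonalization[OF Q _ \<open>subspace W\<close>, of Q] Q unfolding is_metric_def by metis
  have o: "metric_form Q b b' = 0" if "b \<in> B" "b' \<in> B'" for b b'
    using B'(2) that span_superset unfolding W_def by blast
  have "orthonormal_set Q (B \<union> B')"
    using B B'(1) o Qsym unfolding orthonormal_set_def by (auto split: if_splits) (metis+)
  moreover have "span (B \<union> B') = UNIV"
  proof -
    have "x \<in> span (B \<union> B')" for x
    proof -
      define p where "p = (\<Sum>b\<in>B. metric_form Q b x *\<^sub>R b)"
      have "p \<in> span B" unfolding p_def by (intro span_sum span_scale span_base)
      moreover have "x - p \<in> W"
      proof -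
        have "metric_form Q b (x - p) = 0" if "b \<in> B" for b
        proof -
          have "metric_form Q b p = (\<Sum>c\<in>B. metric_form Q c x * metric_form Q b c)"
            unfolding p_def by (simp add: metric_form_sum_right metric_form_simps)
          also have "\<dots> = (\<Sum>c\<in>B. if c = b then metric_form Q c x else 0)"
            using B that by (intro sum.cong refl) (auto simp: orthonormal_set_def)
          also have "\<dots> = metric_form Q b x" using B that by (simp add: orthonormal_set_def)
          finally show ?thesis by (simp add: metric_form_simps)
        qed
        then show ?thesis by (simp add: W_def)
      qed
      ultimately have "p \<in> span (B \<union> B')" "x - p \<in> span (B \<union> B')"
        using B'(2) span_mono[of B "B \<union> B'"] span_mono[of B' "B \<union> B'"] by auto
      then show ?thesis using span_add by fastforce
    qed
    then show ?thesis by blast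
  qed
  ultimately show ?thesis using frame_of_spanning_orthonormal_set that by (metis sup_ge1)
qed

lemma frame_expand:
  assumes g: "is_metric g" and e: "frame g e"
  shows "(\<Sum>i\<in>UNIV. metric_form g v (e i) *\<^sub>R e i) = v"
proof -
  have gsym: "metric_form g x y = metric_form g y x" for x y
    using g metric_form_commute is_metric_def by blast
  have inj: "inj e" using e unfolding frame_def inj_def by (metis zero_neq_one)
  have on: "orthonormal_set g (range e)"
    using e unfolding frame_def orthonormal_set_def by (auto simp: inj_eq[OF inj])
  have "card (range e) = CARD('a)" using inj by (simp add: card_image)
  then have "dim (range e) = DIM(real^'a)"
    using dim_eq_card_independent[OF orthonormal_set_independent[OF on]] by simp
  then have "span (range e) = UNIV" using dim_eq_full by blast
  then have "v \<in> span (range e)" by simp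
  then obtain u where u: "v = (\<Sum>i\<in>UNIV. u i *\<^sub>R e i)"
    unfolding span_finite[OF finite_imageI[OF finite_class.finite_UNIV]]
    by (auto simp: sum.reindex[OF inj] o_def)
  have "metric_form g v (e i) = u i" for i
  proof -
    have "metric_form g v (e i) = (\<Sum>j\<in>UNIV. u j * metric_form g (e j) (e i))"
      unfolding u by (simp add: metric_form_sum_left metric_form_simps)
    also have "\<dots> = (\<Sum>j\<in>UNIV. if j = i then u j else 0)"
      using e by (intro sum.cong) (auto simp: frame_def)
    finally show ?thesis by simp
  qed
  then show ?thesis using u by simp
qed

lemma frame_parseval:
  assumes g: "is_metric g" and e: "frame g e"
  shows "metric_form g v w = (\<Sum>i\<in>UNIV. metric_form g v (e i) * metric_form g w (e i))"
  by (subst (1) frame_expand[OF assms, of w, symmetric]) (simp add: metric_form_sum_right metric_form_simps mult.commute)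

lemma trace_frame:
  assumes g: "is_metric g" and e: "frame g e" and f: "linear f"
  shows "trace (matrix f) = (\<Sum>i\<in>UNIV. metric_form g (f (e i)) (e i))"
  by (rule trace_dual_basis[where l = "\<lambda>i x. metric_form g x (e i)", OF f linear_metric_form_left])
     (use e in \<open>auto simp: frame_def\<close>)

lemma frame_eqI:
  assumes g: "is_metric g" and "\<And>z. metric_form g v z = metric_form g w z"
  shows "v = w"
proof -
  have "metric_form g (v - w) (v - w) = 0" by (simp add: metric_form_simps assms(2))
  then show ?thesis using g unfolding is_metric_def by (metis less_irrefl right_minus_eq)
qed

lemma matrix_inv_frame:
  assumes g: "is_metric g" and e: "frame g e"
  shows "matrix_inv g $ i $ j = (\<Sum>a\<in>UNIV. e a $ i * e a $ j)"
proof -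
  define N :: "real^'a^'a" where "N = (\<chi> i j. \<Sum>a\<in>UNIV. e a $ i * e a $ j)"
  have "N *v (g *v v) = v" for v
  proof -
    have "N *v w = (\<Sum>a\<in>UNIV. (e a \<bullet> w) *\<^sub>R e a)" for w
      by (simp add: vec_eq_iff matrix_vector_mult_def N_def inner_vec_def sum_distrib_right sum_distrib_left)
         (subst sum.swap, simp add: mult_ac)
    then have "N *v (g *v v) = (\<Sum>a\<in>UNIV. metric_form g (e a) v *\<^sub>R e a)" by (simp add: metric_form_def)
    also have "\<dots> = (\<Sum>a\<in>UNIV. metric_form g v (e a) *\<^sub>R e a)"
      using g by (simp add: is_metric_def metric_form_commute[of g v])
    also have "\<dots> = v" by (rule frame_expand[OF assms])
    finally show ?thesis .
  qed
  then have "N ** g = mat 1" by (simp add: matrix_eq matrix_vector_mul_assoc[symmetric])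
  then have "N ** g = mat 1" "invertible g"
    unfolding invertible_def by (auto simp: matrix_left_right_inverse)
  then have "matrix_inv g = (N ** g) ** matrix_inv g" "g ** matrix_inv g = mat 1"
    using someI_ex[of "\<lambda>h. g ** h = mat 1 \<and> h ** g = mat 1"] by (simp_all add: matrix_inv_def invertible_def)
  then have "matrix_inv g = N" by (simp add: matrix_mul_assoc[symmetric])
  then show ?thesis by (simp add: N_def)
qed

section \<open>Scalar curvature of a left-invariant metric\<close>

definition koszul :: "(real^'n \<Rightarrow> real^'n \<Rightarrow> real^'n) \<Rightarrow> real^'n^'n \<Rightarrow> real^'n \<Rightarrow> real^'n \<Rightarrow> real^'n \<Rightarrow> real" where
  "koszul br g X Y Z = (metric_form g (br X Y) Z - metric_form g (br Y Z) X + metric_form g (br Z X) Y) / 2"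

lemma levi_civita_frame:
  assumes br: "bilinear br" and g: "is_metric g" and e: "frame g e"
  shows "levi_civita br g X Y = (\<Sum>k\<in>UNIV. koszul br g X Y (e k) *\<^sub>R e k)" (is "_ = ?W")
    and "metric_form g (levi_civita br g X Y) Z = koszul br g X Y Z"
proof -
  have lin: "linear (koszul br g X Y)"
    unfolding koszul_def
    by (intro linearI) (simp_all add: bilinear_ladd[OF br] bilinear_radd[OF br] bilinear_lmul[OF br] bilinear_rmul[OF br] metric_form_simps field_simps)
  have W: "metric_form g ?W Z = koszul br g X Y Z" for Z
  proof -
    have "metric_form g ?W Z = (\<Sum>k\<in>UNIV. koszul br g X Y (e k) * metric_form g (e k) Z)"
      by (simp add: metric_form_sum_left metric_form_simps)
    also have "\<dots> = (\<Sum>k\<in>UNIV. koszul br g X Y (metric_form g Z (e k) *\<^sub>R e k))"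
      using g by (simp add: linear_scale[OF lin] is_metric_def metric_form_commute[of g Z] mult.commute)
    also have "\<dots> = koszul br g X Y Z"
      unfolding linear_sum[OF lin, symmetric] frame_expand[OF g e] ..
    finally show ?thesis .
  qed
  show "levi_civita br g X Y = ?W"
    unfolding levi_civita_def
  proof (rule the_equality)
    show "\<forall>Z. 2 * metric_form g ?W Z =
        metric_form g (br X Y) Z - metric_form g (br Y Z) X + metric_form g (br Z X) Y"
      unfolding W by (simp add: koszul_def)
    show "V = ?W" if "\<forall>Z. 2 * metric_form g V Z =
        metric_form g (br X Y) Z - metric_form g (br Y Z) X + metric_form g (br Z X) Y" for V
      
    proof (rule frame_eqI[OF g])
      fix Z
      have "2 * metric_form g V Z =
        metric_form g (br X Y) Z - metric_form g (br Y Z) X + metric_form g (br Z X) Y" using that by blast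
      then show "metric_form g V Z = metric_form g ?W Z" unfolding W unfolding koszul_def by (metis nonzero_mult_div_cancel_left zero_neq_numeral)
    qed
  qed
  then show "metric_form g (levi_civita br g X Y) Z = koszul br g X Y Z" by (simp add: W)
qed

lemma bilinear_levi_civita:
  assumes br: "bilinear br" and g: "is_metric g" and e: "frame g e"
  shows "bilinear (levi_civita br g)"
  unfolding bilinear_def
  by (auto intro!: linearI frame_eqI[OF g]
      simp: metric_form_simps levi_civita_frame(2)[OF assms] koszul_def bilinear_ladd[OF br]
        bilinear_radd[OF br] bilinear_lmul[OF br] bilinear_rmul[OF br] algebra_simps add_divide_distrib diff_divide_distrib)

lemma sum3_rotate:
  fixes F :: "'n::finite \<Rightarrow> 'n \<Rightarrow> 'n \<Rightarrow> real"
  shows "(\<Sum>i\<in>UNIV. \<Sum>j\<in>UNIV. \<Sum>k\<in>UNIV. F j k i) = (\<Sum>i\<in>UNIV. \<Sum>j\<in>UNIV. \<Sum>k\<in>UNIV. F i j k)"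
  by (subst (2) sum.swap, subst sum.swap) (rule refl)

text \<open>Koszul's formula expresses the curvature through the structure constants of the frame. The terms
containing the mean curvature vector \<open>\<Sum>i. \<nabla>\<^bsub>e i\<^esub> (e i)\<close> are traces of adjoint maps and vanish by
unimodularity; the rest collects to a Killing form term and the squared length of the bracket.\<close>

lemma scalar_curvature_frame:
  assumes br: "bilinear br" and skew: "\<And>x y. br y x = - br x y"
    and unimodular: "\<And>x. trace (matrix (br x)) = 0"
    and g: "is_metric g" and e: "frame g e"
  shows "scalar_curvature br g =
    - (\<Sum>i\<in>UNIV. killing_form br (e i) (e i)) / 2
    - (\<Sum>i\<in>UNIV. \<Sum>j\<in>UNIV. metric_form g (br (e i) (e j)) (br (e i) (e j))) / 4"
proof -
  let ?g = "metric_form g" and ?N = "levi_civita br g"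
  have gsym: "?g x y = ?g y x" for x y
    using g metric_form_commute is_metric_def by blast
  note N = levi_civita_frame(2)[OF br g e]
  note bN = bilinear_levi_civita[OF br g e]
  note bs = bilinear_ladd[OF br] bilinear_radd[OF br] bilinear_lmul[OF br] bilinear_rmul[OF br]
  note Ns = bilinear_ladd[OF bN] bilinear_radd[OF bN] bilinear_lmul[OF bN] bilinear_rmul[OF bN]
  have lbr: "linear (br x)" for x using br unfolding bilinear_def by (metis (full_types) eta_contract_eq)
  define c where "c i j k = ?g (br (e i) (e j)) (e k)" for i j k
  define \<Gamma> where "\<Gamma> i j k = ?g (?N (e i) (e j)) (e k)" for i j k
  have csk: "c j i k = - c i j k" for i j k
    unfolding c_def by (subst skew) (simp only: metric_form_simps)
  have \<Gamma>c: "\<Gamma> i j k = (c i j k - c j k i + c k i j) / 2" for i j k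
    by (simp add: \<Gamma>_def N koszul_def c_def)
  have compat: "?g (?N X Y) Z = - ?g Y (?N X Z)" for X Y Z
    unfolding gsym[of Y] N koszul_def
    by (simp add: skew[of X Z] skew[of Y Z] skew[of X Y] metric_form_simps field_simps)
  have uni: "(\<Sum>j\<in>UNIV. c k j j) = 0" for k
    using unimodular[of "e k"] trace_frame[OF g e lbr] by (simp add: c_def)
  have Ric: "ricci_curvature br g Y Z = (\<Sum>i\<in>UNIV. ?g (riemann_curvature br g (e i) Y Z) (e i))" for Y Z
    unfolding ricci_curvature_def
    by (rule trace_frame[OF g e], rule linearI) (simp_all add: riemann_curvature_def bs Ns algebra_simps)
  have "bilinear (ricci_curvature br g)"
    unfolding bilinear_def
    by (auto intro!: linearI simp: Ric riemann_curvature_def bs Ns metric_form_simps sum.distrib sum_subtractf sum_distrib_left algebra_simps)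
  then have lr: "linear (\<lambda>X. ricci_curvature br g X Y)" "linear (ricci_curvature br g X)" for X Y
    unfolding bilinear_def by (auto simp: eta_contract_eq)
  have ax: "(\<Sum>i\<in>UNIV. v $ i *\<^sub>R axis i 1) = v" for v :: "real^'n"
    using basis_expansion[of v] by (simp add: scalar_mult_eq_scaleR)
  have "scalar_curvature br g = (\<Sum>i\<in>UNIV. \<Sum>j\<in>UNIV. \<Sum>a\<in>UNIV. e a $ i * e a $ j * ricci_curvature br g (axis i 1) (axis j 1))"
    unfolding scalar_curvature_def matrix_inv_frame[OF g e] by (simp add: sum_distrib_right)
  also have "\<dots> = (\<Sum>i\<in>UNIV. \<Sum>a\<in>UNIV. \<Sum>j\<in>UNIV. e a $ i * e a $ j * ricci_curvature br g (axis i 1) (axis j 1))"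
    by (rule sum.cong[OF refl], rule sum.swap)
  also have "\<dots> = (\<Sum>a\<in>UNIV. \<Sum>i\<in>UNIV. \<Sum>j\<in>UNIV. e a $ i * e a $ j * ricci_curvature br g (axis i 1) (axis j 1))"
    by (rule sum.swap)
  also have "\<dots> = (\<Sum>a\<in>UNIV. ricci_curvature br g (e a) (e a))"
  proof (rule sum.cong[OF refl])
    fix a
    have "ricci_curvature br g (e a) (e a) = (\<Sum>i\<in>UNIV. e a $ i * ricci_curvature br g (axis i 1) (e a))"
      by (subst (1) ax[of "e a", symmetric]) (simp add: linear_sum[OF lr(1)] linear_scale[OF lr(1)])
    also have "\<dots> = (\<Sum>i\<in>UNIV. e a $ i * (\<Sum>j\<in>UNIV. e a $ j * ricci_curvature br g (axis i 1) (axis j 1)))"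
    proof (rule sum.cong[OF refl])
      fix i
      have "ricci_curvature br g (axis i 1) (e a) = (\<Sum>j\<in>UNIV. e a $ j * ricci_curvature br g (axis i 1) (axis j 1))"
        by (subst (1) ax[of "e a", symmetric]) (simp add: linear_sum[OF lr(2)] linear_scale[OF lr(2)])
      then show "e a $ i * ricci_curvature br g (axis i 1) (e a) = e a $ i * (\<Sum>j\<in>UNIV. e a $ j * ricci_curvature br g (axis i 1) (axis j 1))"
        by simp
    qed
    finally show "(\<Sum>i\<in>UNIV. \<Sum>j\<in>UNIV. e a $ i * e a $ j * ricci_curvature br g (axis i 1) (axis j 1)) = ricci_curvature br g (e a) (e a)"
      by (simp add: sum_distrib_left mult.assoc)
  qed
  also have "\<dots> = (\<Sum>j\<in>UNIV. \<Sum>i\<in>UNIV. ?g (riemann_curvature br g (e i) (e j) (e j)) (e i))"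
    by (simp add: Ric)
  also have "\<dots> = (\<Sum>i\<in>UNIV. \<Sum>j\<in>UNIV. ?g (riemann_curvature br g (e i) (e j) (e j)) (e i))"
    by (rule sum.swap)
  also have "\<dots> = (\<Sum>i\<in>UNIV. \<Sum>j\<in>UNIV. (\<Sum>k\<in>UNIV. \<Gamma> i j k * \<Gamma> j i k - c i j k * \<Gamma> k j i) - (\<Sum>k\<in>UNIV. \<Gamma> j j k * \<Gamma> i i k))"
  proof (rule sum.cong[OF refl], rule sum.cong[OF refl])
    fix i j
    have 1: "?g (?N (e i) (?N (e j) (e j))) (e i) = - (\<Sum>k\<in>UNIV. \<Gamma> j j k * \<Gamma> i i k)"
      using frame_parseval[OF g e, of "?N (e j) (e j)" "?N (e i) (e i)"] compat[of "e i" "?N (e j) (e j)" "e i"]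
      by (simp only: \<Gamma>_def)
    have 2: "?g (?N (e j) (?N (e i) (e j))) (e i) = - (\<Sum>k\<in>UNIV. \<Gamma> i j k * \<Gamma> j i k)"
      using frame_parseval[OF g e, of "?N (e i) (e j)" "?N (e j) (e i)"] compat[of "e j" "?N (e i) (e j)" "e i"]
      by (simp only: \<Gamma>_def)
    have lN: "linear (\<lambda>X. ?N X Y)" for Y using bN unfolding bilinear_def by blast
    have 3: "?g (?N (br (e i) (e j)) (e j)) (e i) = (\<Sum>k\<in>UNIV. c i j k * \<Gamma> k j i)"
      by (subst (1) frame_expand[OF g e, of "br (e i) (e j)", symmetric])
        (simp add: linear_sum[OF lN] linear_scale[OF lN] metric_form_sum_left metric_form_simps c_def \<Gamma>_def)
    show "?g (riemann_curvature br g (e i) (e j) (e j)) (e i) =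
       (\<Sum>k\<in>UNIV. \<Gamma> i j k * \<Gamma> j i k - c i j k * \<Gamma> k j i) - (\<Sum>k\<in>UNIV. \<Gamma> j j k * \<Gamma> i i k)"
      unfolding riemann_curvature_def by (simp add: metric_form_simps 1 2 3 sum_subtractf)
  qed
  also have "\<dots> = (\<Sum>i\<in>UNIV. \<Sum>j\<in>UNIV. \<Sum>k\<in>UNIV. \<Gamma> i j k * \<Gamma> j i k - c i j k * \<Gamma> k j i)
      - (\<Sum>i\<in>UNIV. \<Sum>j\<in>UNIV. \<Sum>k\<in>UNIV. \<Gamma> j j k * \<Gamma> i i k)"
    by (simp add: sum_subtractf)
  also have "(\<Sum>i\<in>UNIV. \<Sum>j\<in>UNIV. \<Sum>k\<in>UNIV. \<Gamma> j j k * \<Gamma> i i k) = 0"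
  proof -
    have z: "(\<Sum>j\<in>UNIV. \<Gamma> j j k) = 0" for k
    proof -
      have "c j j k = 0" for j using csk[of j j k] by simp
      then have "\<Gamma> j j k = c k j j" for j using csk[of j k j] by (simp add: \<Gamma>c)
      then show ?thesis using uni by simp
    qed
    have "(\<Sum>i\<in>UNIV. \<Sum>j\<in>UNIV. \<Sum>k\<in>UNIV. \<Gamma> j j k * \<Gamma> i i k) = (\<Sum>i\<in>UNIV. \<Sum>k\<in>UNIV. (\<Sum>j\<in>UNIV. \<Gamma> j j k) * \<Gamma> i i k)"
      unfolding sum_distrib_right by (rule sum.cong[OF refl], rule sum.swap)
    then show ?thesis by (simp add: z)
  qed
  also have "(\<Sum>i\<in>UNIV. \<Sum>j\<in>UNIV. \<Sum>k\<in>UNIV. \<Gamma> i j k * \<Gamma> j i k - c i j k * \<Gamma> k j i) - 0 =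
    (\<Sum>i\<in>UNIV. \<Sum>j\<in>UNIV. \<Sum>k\<in>UNIV. (c k i j)^2 / 4 + (c j k i)^2 / 4 - 3/4 * (c i j k)^2
        - c k i j * c j k i / 2 + c i j k * c j k i / 2 + c i j k * c k i j / 2)"
  proof -
    have "\<Gamma> i j k * \<Gamma> j i k - c i j k * \<Gamma> k j i = (c k i j)^2 / 4 + (c j k i)^2 / 4 - 3/4 * (c i j k)^2
        - c k i j * c j k i / 2 + c i j k * c j k i / 2 + c i j k * c k i j / 2" for i j k
      unfolding \<Gamma>c csk[of i j k] csk[of k i j] csk[of j k i]
      by (simp add: power2_eq_square field_simps)
    then show ?thesis by simp
  qed
  also have "\<dots> = (\<Sum>i\<in>UNIV. \<Sum>j\<in>UNIV. \<Sum>k\<in>UNIV. c i j k * c k i j) / 2 - (\<Sum>i\<in>UNIV. \<Sum>j\<in>UNIV. \<Sum>k\<in>UNIV. (c i j k)^2) / 4"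
  proof -
    have a: "(\<Sum>i\<in>UNIV. \<Sum>j\<in>UNIV. \<Sum>k\<in>UNIV. (c j k i)^2) = (\<Sum>i\<in>UNIV. \<Sum>j\<in>UNIV. \<Sum>k\<in>UNIV. (c i j k)^2)"
      by (rule sum3_rotate)
    have b: "(\<Sum>i\<in>UNIV. \<Sum>j\<in>UNIV. \<Sum>k\<in>UNIV. (c k i j)^2) = (\<Sum>i\<in>UNIV. \<Sum>j\<in>UNIV. \<Sum>k\<in>UNIV. (c i j k)^2)"
      by (rule sum3_rotate[of "\<lambda>i j k. (c k i j)^2", symmetric])
    have d: "(\<Sum>i\<in>UNIV. \<Sum>j\<in>UNIV. \<Sum>k\<in>UNIV. c i j k * c j k i) = (\<Sum>i\<in>UNIV. \<Sum>j\<in>UNIV. \<Sum>k\<in>UNIV. c i j k * c k i j)"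
      by (subst sum3_rotate[of "\<lambda>i j k. c i j k * c k i j", symmetric]) (simp add: mult.commute)
    have f: "(\<Sum>i\<in>UNIV. \<Sum>j\<in>UNIV. \<Sum>k\<in>UNIV. c k i j * c j k i) = (\<Sum>i\<in>UNIV. \<Sum>j\<in>UNIV. \<Sum>k\<in>UNIV. c i j k * c k i j)"
      by (subst sum3_rotate[of "\<lambda>i j k. c k i j * c j k i", symmetric]) (simp add: mult.commute)
    show ?thesis
      by (simp only: sum.distrib sum_subtractf sum_divide_distrib[symmetric] sum_distrib_left[symmetric] a b d f)
  qed
  also have "(\<Sum>i\<in>UNIV. \<Sum>j\<in>UNIV. \<Sum>k\<in>UNIV. (c i j k)^2) = (\<Sum>i\<in>UNIV. \<Sum>j\<in>UNIV. ?g (br (e i) (e j)) (br (e i) (e j)))"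
    by (intro sum.cong refl) (simp add: frame_parseval[OF g e, of "br _ _" "br _ _"] c_def power2_eq_square)
  also have "(\<Sum>i\<in>UNIV. \<Sum>j\<in>UNIV. \<Sum>k\<in>UNIV. c i j k * c k i j) = - (\<Sum>i\<in>UNIV. killing_form br (e i) (e i))"
  proof -
    have "killing_form br (e i) (e i) = (\<Sum>j\<in>UNIV. \<Sum>k\<in>UNIV. c i j k * c i k j)" for i
    proof -
      have "linear (\<lambda>z. br (e i) (br (e i) z))" using linear_compose[OF lbr lbr] by (simp add: o_def)
      then have K: "killing_form br (e i) (e i) = (\<Sum>j\<in>UNIV. ?g (br (e i) (br (e i) (e j))) (e j))"
        unfolding killing_form_def by (rule trace_frame[OF g e])
      have "?g (br (e i) (br (e i) (e j))) (e j) = (\<Sum>k\<in>UNIV. c i j k * c i k j)" for j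
        by (subst (1) frame_expand[OF g e, of "br (e i) (e j)", symmetric])
          (simp add: linear_sum[OF lbr] linear_scale[OF lbr] metric_form_sum_left metric_form_simps c_def)
      with K show ?thesis by simp
    qed
    moreover have "c i j k * c k i j = - (c i j k * c i k j)" for i j k using csk[of i k j] by simp
    ultimately show ?thesis by (simp add: sum_negf)
  qed
  finally show ?thesis by simp
qed

section \<open>Derivative tests\<close>

lemma greater_near_zero_of_deriv_pos:
  fixes h :: "real \<Rightarrow> real"
  assumes "\<And>s. (h has_real_derivative h1 s) (at s)" "\<delta> > 0" "\<And>s. 0 < s \<Longrightarrow> s < \<delta> \<Longrightarrow> h1 s > 0"
    and "0 < s" "s < \<delta>"
  shows "h s > h 0"
proof -
  obtain z where "0 < z" "z < s" "h s - h 0 = (s - 0) * h1 z"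
    using MVT2[OF \<open>0 < s\<close>, of h h1] assms(1) by blast
  moreover have "h1 z > 0" using calculation assms by auto
  ultimately show ?thesis using assms(4) by (smt (verit) mult_pos_pos)
qed

lemma second_derivative_test:
  fixes h :: "real \<Rightarrow> real"
  assumes "\<And>s. (h has_real_derivative h1 s) (at s)" "h1 0 = 0" "(h1 has_real_derivative D) (at 0)" "D > 0"
  shows "\<exists>\<delta>>0. \<forall>s. 0 < s \<longrightarrow> s < \<delta> \<longrightarrow> h s > h 0"
proof -
  obtain \<delta> where "\<delta> > 0" "\<And>s. 0 < s \<Longrightarrow> s < \<delta> \<Longrightarrow> h1 s > 0"
    using DERIV_pos_inc_right[OF assms(3,4)] assms(2) by auto
  then show ?thesis using greater_near_zero_of_deriv_pos[OF assms(1)] by blast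
qed

text \<open>The second variation degenerates for the special unitary groups, so that the decision falls at
third order.\<close>

lemma third_derivative_test:
  fixes h :: "real \<Rightarrow> real"
  assumes "\<And>s. (h has_real_derivative h1 s) (at s)" "\<And>s. (h1 has_real_derivative h2 s) (at s)"
    "h1 0 = 0" "h2 0 = 0" "(h2 has_real_derivative D) (at 0)" "D > 0"
  shows "\<exists>\<delta>>0. \<forall>s. 0 < s \<longrightarrow> s < \<delta> \<longrightarrow> h s > h 0"
proof -
  obtain \<delta> where "\<delta> > 0" "\<And>s. 0 < s \<Longrightarrow> s < \<delta> \<Longrightarrow> h1 s > 0"
    using second_derivative_test[OF assms(2,4,5,6)] assms(3) by auto
  then show ?thesis using greater_near_zero_of_deriv_pos[OF assms(1)] by blast
qed

section \<open>Diagonal metrics\<close>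

lemma matrix_add_rdistrib: "(A + B) ** C = A ** C + B ** (C :: 'a::semiring_1^_^_)"
  by (simp add: vec_eq_iff matrix_matrix_mult_def distrib_right sum.distrib)

lemma matrix_diff_ldistrib: "A ** (B - C) = A ** B - A ** (C :: 'a::ring_1^_^_)"
  by (simp add: vec_eq_iff matrix_matrix_mult_def right_diff_distrib sum_subtractf)

lemma matrix_diff_rdistrib: "(A - B) ** C = A ** C - B ** (C :: 'a::ring_1^_^_)"
  by (simp add: vec_eq_iff matrix_matrix_mult_def left_diff_distrib sum_subtractf)

lemma matrix_scaleR_left: "(r *\<^sub>R A) ** B = r *\<^sub>R (A ** (B :: 'a::real_algebra_1^_^_))"
  by (simp add: vec_eq_iff matrix_matrix_mult_def scaleR_sum_right)

lemma matrix_scaleR_right: "A ** (r *\<^sub>R B) = r *\<^sub>R (A ** (B :: 'a::real_algebra_1^_^_))"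
  by (simp add: vec_eq_iff matrix_matrix_mult_def scaleR_sum_right)

lemma det_gram: "det (\<chi> i j. metric_form g (f i) (f j)) = det g * (det (\<chi> i. f i))^2"
proof -
  have "(\<chi> i j. metric_form g (f i) (f j)) = (\<chi> i. f i) ** g ** transpose (\<chi> i. f i)"
    by (simp add: vec_eq_iff metric_form_def matrix_matrix_mult_def matrix_vector_mult_def transpose_def
        inner_vec_def sum_distrib_left sum_distrib_right mult.assoc)
       (intro allI, rule sum.swap)
  then show ?thesis by (simp add: det_mul det_transpose power2_eq_square)
qed

lemma det_ratio_diagonal:
  assumes "frame Q f" "\<And>i j. i \<noteq> j \<Longrightarrow> metric_form g (f i) (f j) = 0"
  shows "det g / det Q = (\<Prod>i\<in>UNIV. metric_form g (f i) (f i))"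
proof -
  have "(\<chi> i j. metric_form Q (f i) (f j)) = mat 1"
    using assms(1) by (simp add: vec_eq_iff mat_def frame_def)
  then have 1: "det Q * (det (\<chi> i. f i))^2 = 1" using det_gram[of Q f] by simp
  have "det g * (det (\<chi> i. f i))^2 = (\<Prod>i\<in>UNIV. metric_form g (f i) (f i))"
    unfolding det_gram[symmetric] using assms(2) by (subst det_diagonal) simp_all
  moreover have "det Q \<noteq> 0" "(det (\<chi> i. f i))^2 \<noteq> 0" using 1 by auto
  then have "det g / det Q = (det g * (det (\<chi> i. f i))^2) / (det Q * (det (\<chi> i. f i))^2)" by simp
  ultimately show ?thesis using 1 by simp
qed

definition diagonal_metric :: "real^'n^'n \<Rightarrow> ('n \<Rightarrow> real^'n) \<Rightarrow> ('n \<Rightarrow> real) \<Rightarrow> real^'n^'n" where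
  "diagonal_metric Q f x = (\<chi> a b. \<Sum>i\<in>UNIV. x i * ((Q *v f i) $ a * (Q *v f i) $ b))"

lemma diagonal_metric_form:
  "metric_form (diagonal_metric Q f x) v w = (\<Sum>i\<in>UNIV. x i * (metric_form Q v (f i) * metric_form Q w (f i)))"
proof -
  have "(\<chi> a b. \<Sum>i\<in>UNIV. x i * (y i $ a * y i $ b)) *v w = (\<Sum>i\<in>UNIV. (x i * (w \<bullet> y i)) *\<^sub>R y i)"
    for y :: "'a \<Rightarrow> real^'a"
    by (simp add: vec_eq_iff matrix_vector_mult_def inner_vec_def sum_distrib_left sum_distrib_right mult_ac)
       (intro allI, rule sum.swap)
  then have "diagonal_metric Q f x *v w = (\<Sum>i\<in>UNIV. (x i * metric_form Q w (f i)) *\<^sub>R (Q *v f i))"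
    by (simp add: diagonal_metric_def metric_form_def)
  then show ?thesis
    unfolding metric_form_def[of "diagonal_metric Q f x"]
    by (simp add: inner_sum_right metric_form_def[of Q] mult_ac)
qed

lemma diagonal_metric_frame:
  assumes "frame Q f"
  shows "metric_form (diagonal_metric Q f x) (f i) (f j) = (if i = j then x i else 0)"
proof -
  have "metric_form (diagonal_metric Q f x) (f i) (f j) = (\<Sum>k\<in>UNIV. if k = i then (if i = j then x i else 0) else 0)"
    unfolding diagonal_metric_form using assms by (intro sum.cong refl) (auto simp: frame_def)
  then show ?thesis by simp
qed

lemma is_metric_diagonal_metric:
  assumes Q: "is_metric Q" and f: "frame Q f" and x: "\<And>i. x i > 0"
  shows "is_metric (diagonal_metric Q f x)"
  unfolding is_metric_def
proof (intro conjI allI impI)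
  show "transpose (diagonal_metric Q f x) = diagonal_metric Q f x"
    by (simp add: transpose_def diagonal_metric_def mult.commute)
  fix v :: "real^'a" assume v: "v \<noteq> 0"
  have "\<exists>i. metric_form Q v (f i) \<noteq> 0"
  proof (rule ccontr)
    assume "\<not> ?thesis"
    then have "(\<Sum>i\<in>UNIV. metric_form Q v (f i) *\<^sub>R f i) = 0" by simp
    then show False using frame_expand[OF Q f] v by simp
  qed
  then obtain i where "metric_form Q v (f i) \<noteq> 0" by blast
  then have "x i * (metric_form Q v (f i) * metric_form Q v (f i)) > 0"
    using x[of i] by (metis mult_pos_pos not_real_square_gt_zero)
  moreover have "x i * (metric_form Q v (f i) * metric_form Q v (f i)) \<ge> 0" for i
    using x[of i] by (simp add: less_imp_le)
  ultimately show "0 < metric_form (diagonal_metric Q f x) v v"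
    unfolding diagonal_metric_form by (intro sum_pos2[of UNIV i]) auto
qed

section \<open>Compact semisimple Lie algebras\<close>

text \<open>The Lie algebras of compact semisimple groups: by their Killing forms being negative definite, the
standard metric is an inner product for which all adjoint maps are skew.\<close>

locale compact_lie_algebra =
  fixes br :: "real^'n \<Rightarrow> real^'n \<Rightarrow> real^'n"
  assumes bilin: "bilinear br"
    and skew: "br y x = - br x y"
    and jacobi: "br x (br y z) = br (br x y) z + br y (br x z)"
    and killing_negative: "x \<noteq> 0 \<Longrightarrow> killing_form br x x < 0"
begin

abbreviation Q :: "real^'n^'n" where "Q \<equiv> standard_metric br"
abbreviation q :: "real^'n \<Rightarrow> real^'n \<Rightarrow> real" where "q \<equiv> metric_form Q"

lemma linear_br: "linear (br x)"
  using bilin unfolding bilinear_def by (metis (full_types) eta_contract_eq)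

lemmas br_simps = bilinear_ladd[OF bilin] bilinear_radd[OF bilin] bilinear_lmul[OF bilin] bilinear_rmul[OF bilin]
  bilinear_lsub[OF bilin] bilinear_rsub[OF bilin]

lemma killing_form_trace: "killing_form br x y = trace (matrix (br x) ** matrix (br y))"
  unfolding killing_form_def using matrix_compose[OF linear_br linear_br] by (simp add: o_def)

lemma matrix_br_add: "matrix (br (x + y)) = matrix (br x) + matrix (br y)"
  by (simp add: matrix_def vec_eq_iff br_simps)

lemma matrix_br_scale: "matrix (br (r *\<^sub>R x)) = r *\<^sub>R matrix (br x)"
  by (simp add: matrix_def vec_eq_iff br_simps)

lemma matrix_br_br: "matrix (br (br x y)) = matrix (br x) ** matrix (br y) - matrix (br y) ** matrix (br x)"
proof -
  have "br (br x y) = (\<lambda>z. (br x \<circ> br y) z - (br y \<circ> br x) z)"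
    using jacobi[of x y] by (auto simp: algebra_simps)
  then have "matrix (br (br x y)) = matrix (br x \<circ> br y) - matrix (br y \<circ> br x)"
    by (simp add: matrix_def vec_eq_iff)
  then show ?thesis by (simp add: matrix_compose linear_br)
qed

lemma trace_scaleR: "trace (r *\<^sub>R A) = r * trace (A :: real^'n^'n)"
  by (simp add: trace_def sum_distrib_left)

lemma bilinear_killing_form: "bilinear (killing_form br)"
  unfolding bilinear_def
  by (auto intro!: linearI simp: killing_form_trace matrix_br_add matrix_br_scale trace_add
      matrix_add_ldistrib matrix_add_rdistrib matrix_scaleR_left matrix_scaleR_right trace_scaleR)

lemma standard_form: "q x y = - killing_form br x y"
proof -
  have "bilinear (\<lambda>x y. - killing_form br x y)"
    using bilinear_killing_form by (simp add: bilinear_def linear_compose_neg)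
  moreover have "q i j = - killing_form br i j" if ij: "i \<in> Basis" "j \<in> Basis" for i j
  proof -
    obtain a b where "i = axis a 1" "j = axis b 1" using ij by (auto simp: Basis_vec_def)
    then show ?thesis by (simp only: metric_form_axis) (simp add: standard_metric_def)
  qed
  ultimately have "q = (\<lambda>x y. - killing_form br x y)"
    by (intro bilinear_eq_stdbasis bilinear_metric_form)
  then show ?thesis by (rule arg_cong[where f = "\<lambda>h. h x y"])
qed

lemma is_metric_standard: "is_metric Q"
proof -
  have "killing_form br x y = killing_form br y x" for x y
    unfolding killing_form_trace by (rule trace_mul_sym)
  then have "transpose Q = Q" by (simp add: transpose_def standard_metric_def)
  moreover have "q x x > 0" if "x \<noteq> 0" for x using killing_negative[OF that] by (simp add: standard_form)
  ultimately show ?thesis by (simp add: is_metric_def)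
qed

lemma q_commute: "q x y = q y x"
  using is_metric_standard metric_form_commute is_metric_def by blast

lemma q_invariant: "q (br x y) z = q x (br y z)"
proof -
  define X where "X = matrix (br x)" define Y where "Y = matrix (br y)" define Z where "Z = matrix (br z)"
  have "trace ((X ** Y - Y ** X) ** Z) = trace (X ** (Y ** Z - Z ** Y))"
  proof -
    have "trace (Y ** X ** Z) = trace (X ** (Z ** Y))"
      by (metis matrix_mul_assoc trace_mul_sym)
    then show ?thesis
      by (simp add: matrix_diff_ldistrib matrix_diff_rdistrib trace_sub matrix_mul_assoc)
  qed
  then show ?thesis by (simp add: standard_form killing_form_trace matrix_br_br X_def Y_def Z_def)
qed

lemma q_ad_skew: "q (br x y) z = - q y (br x z)"
  using q_invariant[of y x z] by (subst skew) (simp add: metric_form_simps)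

lemma unimodular: "trace (matrix (br x)) = 0"
proof -
  obtain f where f: "frame Q f"
    using simultaneous_frame[OF is_metric_standard, of Q] is_metric_standard is_metric_def by metis
  have "q (br x y) y = 0" for y using q_ad_skew[of x y y] q_commute[of "br x y" y] by linarith
  then show ?thesis by (simp add: trace_frame[OF is_metric_standard f linear_br])
qed

definition struct_const :: "('n \<Rightarrow> real^'n) \<Rightarrow> 'n \<Rightarrow> 'n \<Rightarrow> 'n \<Rightarrow> real" where
  "struct_const f i j k = q (br (f i) (f j)) (f k)"

lemma struct_const_skew: "struct_const f j i k = - struct_const f i j k"
  unfolding struct_const_def by (subst skew) (simp only: metric_form_simps)

lemma struct_const_cyclic: "struct_const f j k i = struct_const f i j k"
  unfolding struct_const_def by (metis q_invariant q_commute)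

lemma struct_const_refl: "struct_const f i i k = 0"
  using struct_const_skew[of f i i k] by simp

text \<open>The sum is minus the Killing form at \<open>f i\<close>, which is the squared length of \<open>f i\<close>.\<close>

lemma sum_struct_const:
  assumes f: "frame Q f"
  shows "(\<Sum>j\<in>UNIV. \<Sum>k\<in>UNIV. (struct_const f i j k)^2) = 1"
proof -
  note tr = trace_frame[OF is_metric_standard f]
  have "linear (\<lambda>z. br (f i) (br (f i) z))" using linear_compose[OF linear_br linear_br] by (simp add: o_def)
  then have "q (f i) (f i) = - (\<Sum>j\<in>UNIV. q (br (f i) (br (f i) (f j))) (f j))"
    by (simp add: standard_form[of "f i"] killing_form_def tr)
  also have "\<dots> = (\<Sum>j\<in>UNIV. q (br (f i) (f j)) (br (f i) (f j)))"
    by (simp add: q_ad_skew[of "f i" "br _ _"] sum_negf)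
  also have "\<dots> = (\<Sum>j\<in>UNIV. \<Sum>k\<in>UNIV. (struct_const f i j k)^2)"
    by (intro sum.cong refl)
      (simp add: frame_parseval[OF is_metric_standard f, of "br _ _" "br _ _"] struct_const_def power2_eq_square)
  finally show ?thesis using f by (simp add: frame_def)
qed

text \<open>The scalar curvature of the metric with eigenvalues \<open>x i\<close> relative to the standard metric, in the
frame \<open>f\<close> of eigenvectors.\<close>

definition diag_curvature :: "('n \<Rightarrow> real^'n) \<Rightarrow> ('n \<Rightarrow> real) \<Rightarrow> real" where
  "diag_curvature f x = (\<Sum>i\<in>UNIV. 1 / x i) / 2
     - (\<Sum>i\<in>UNIV. \<Sum>j\<in>UNIV. \<Sum>k\<in>UNIV. (struct_const f i j k)^2 * (x k / (x i * x j))) / 4"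

lemma scalar_curvature_diagonal:
  assumes g: "is_metric g" and f: "frame Q f"
    and diag: "\<And>i j. metric_form g (f i) (f j) = (if i = j then x i else 0)"
  shows "scalar_curvature br g = diag_curvature f x"
proof -
  have x: "x i > 0" for i
  proof -
    have "q (f i) (f i) = 1" using f by (simp add: frame_def)
    then have "f i \<noteq> 0" by (auto simp: metric_form_simps)
    then have "metric_form g (f i) (f i) > 0" using g by (simp add: is_metric_def)
    then show ?thesis using diag[of i i] by simp
  qed
  define e where "e i = (1 / sqrt (x i)) *\<^sub>R f i" for i
  have e: "frame g e"
    unfolding frame_def e_def using diag x less_imp_neq[OF x] by (auto simp: metric_form_simps real_sqrt_mult_self abs_of_pos)
  have gv: "metric_form g v v = (\<Sum>k\<in>UNIV. x k * (q v (f k))^2)" for v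
  proof -
    have vk: "metric_form g v (f k) = x k * q v (f k)" for k
    proof -
      have "metric_form g v (f k) = metric_form g (\<Sum>l\<in>UNIV. q v (f l) *\<^sub>R f l) (f k)"
        by (simp add: frame_expand[OF is_metric_standard f])
      also have "\<dots> = (\<Sum>l\<in>UNIV. q v (f l) * metric_form g (f l) (f k))"
        by (simp add: metric_form_sum_left metric_form_simps)
      also have "\<dots> = (\<Sum>l\<in>UNIV. if l = k then q v (f k) * x k else 0)"
        by (intro sum.cong refl) (simp add: diag)
      finally show ?thesis by simp
    qed
    have "metric_form g v v = metric_form g v (\<Sum>k\<in>UNIV. q v (f k) *\<^sub>R f k)"
      by (simp add: frame_expand[OF is_metric_standard f])
    also have "\<dots> = (\<Sum>k\<in>UNIV. q v (f k) * (x k * q v (f k)))"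
      by (simp add: metric_form_sum_right metric_form_simps vk)
    finally show ?thesis by (simp add: power2_eq_square mult_ac)
  qed
  have "scalar_curvature br g = - (\<Sum>i\<in>UNIV. killing_form br (e i) (e i)) / 2
    - (\<Sum>i\<in>UNIV. \<Sum>j\<in>UNIV. metric_form g (br (e i) (e j)) (br (e i) (e j))) / 4"
    by (rule scalar_curvature_frame[OF bilin _ unimodular g e]) (rule skew)
  also have "- (\<Sum>i\<in>UNIV. killing_form br (e i) (e i)) = (\<Sum>i\<in>UNIV. 1 / x i)"
  proof -
    have "killing_form br (e i) (e i) = - (1 / x i)" for i
    proof -
      have "killing_form br (e i) (e i) = - q (e i) (e i)" by (simp add: standard_form)
      also have "q (e i) (e i) = 1 / x i"
        using f x[of i] by (simp add: e_def metric_form_simps frame_def)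
      finally show ?thesis .
    qed
    then show ?thesis by (simp add: sum_negf)
  qed
  also have "(\<Sum>i\<in>UNIV. \<Sum>j\<in>UNIV. metric_form g (br (e i) (e j)) (br (e i) (e j)))
     = (\<Sum>i\<in>UNIV. \<Sum>j\<in>UNIV. \<Sum>k\<in>UNIV. (struct_const f i j k)^2 * (x k / (x i * x j)))"
  proof (intro sum.cong refl)
    fix i j
    have "metric_form g (br (e i) (e j)) (br (e i) (e j)) =
      (1 / (x i * x j)) * metric_form g (br (f i) (f j)) (br (f i) (f j))"
      using x[of i] x[of j] by (simp add: e_def br_simps metric_form_simps field_simps)
    also have "\<dots> = (\<Sum>k\<in>UNIV. (struct_const f i j k)^2 * (x k / (x i * x j)))"
      unfolding gv sum_distrib_left by (simp add: struct_const_def mult_ac)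
    finally show "metric_form g (br (e i) (e j)) (br (e i) (e j)) = (\<Sum>k\<in>UNIV. (struct_const f i j k)^2 * (x k / (x i * x j)))" .
  qed
  finally show ?thesis by (simp add: diag_curvature_def)
qed

lemma standard_in_metrics_1: "Q \<in> metrics_1 br"
proof -
  obtain f where f: "frame Q f"
    using simultaneous_frame[OF is_metric_standard, of Q] is_metric_standard is_metric_def by metis
  have "det Q / det Q = (\<Prod>i\<in>UNIV. q (f i) (f i))"
    by (rule det_ratio_diagonal[OF f]) (use f in \<open>simp add: frame_def\<close>)
  then have "det Q / det Q = 1" using f by (simp add: frame_def)
  then show ?thesis using is_metric_standard unfolding metrics_1_def by blast
qed

lemma scalar_curvature_standard: "scalar_curvature br Q = CARD('n) / 4"
proof -
  obtain f where f: "frame Q f"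
    using simultaneous_frame[OF is_metric_standard, of Q] is_metric_standard is_metric_def by metis
  have "scalar_curvature br Q = diag_curvature f (\<lambda>_. 1)"
    by (rule scalar_curvature_diagonal[OF is_metric_standard f]) (use f in \<open>simp add: frame_def\<close>)
  then show ?thesis by (simp add: diag_curvature_def sum_struct_const[OF f])
qed

end

lemma metric_form_le_norm: "\<bar>metric_form M v v\<bar> \<le> (CARD('n))^2 * norm M * (norm v)^2"
  for M :: "real^'n^'n"
proof -
  have "\<bar>metric_form M v v\<bar> = \<bar>\<Sum>a\<in>UNIV. \<Sum>b\<in>UNIV. v $ a * (M $ a $ b * v $ b)\<bar>"
    by (simp add: metric_form_def inner_vec_def matrix_vector_mult_def sum_distrib_left)
  also have "\<dots> \<le> (\<Sum>a\<in>UNIV. \<Sum>b\<in>UNIV. \<bar>v $ a * (M $ a $ b * v $ b)\<bar>)"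
    by (rule order_trans[OF sum_abs]) (intro sum_mono sum_abs)
  also have "\<dots> \<le> (\<Sum>a\<in>(UNIV::'n set). \<Sum>b\<in>(UNIV::'n set). norm M * (norm v)^2)"
  proof (intro sum_mono)
    fix a b
    have "\<bar>M $ a $ b\<bar> \<le> norm M"
      by (metis component_le_norm_cart Finite_Cartesian_Product.norm_nth_le order_trans)
    then have "\<bar>v $ a\<bar> * (\<bar>M $ a $ b\<bar> * \<bar>v $ b\<bar>) \<le> norm v * (norm M * norm v)"
      by (intro mult_mono component_le_norm_cart) auto
    then show "\<bar>v $ a * (M $ a $ b * v $ b)\<bar> \<le> norm M * (norm v)^2"
      by (simp add: abs_mult power2_eq_square mult_ac)
  qed
  also have "\<dots> = (CARD('n))^2 * norm M * (norm v)^2" by (simp add: power2_eq_square)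
  finally show ?thesis .
qed

lemma exp_linear_error:
  fixes u :: real assumes "u \<le> 1/2" shows "\<bar>exp u - 1 - u\<bar> \<le> 2 * u^2"
proof -
  have "exp u * (1 - u) \<le> exp u * exp (- u)" using exp_ge_add_one_self[of "- u"] by (intro mult_left_mono) auto
  then have "exp u * (1 - u) \<le> 1" by (simp add: exp_minus)
  moreover have "1 \<le> (1 + u + 2 * u^2) * (1 - u)"
  proof -
    have "(1 + u + 2 * u^2) * (1 - u) - 1 = u^2 * (1 - 2 * u)" by (simp add: algebra_simps power2_eq_square)
    moreover have "u^2 * (1 - 2 * u) \<ge> 0" using assms by simp
    ultimately show ?thesis by linarith
  qed
  ultimately have "exp u * (1 - u) \<le> (1 + u + 2 * u^2) * (1 - u)" by linarith
  then have "exp u \<le> 1 + u + 2 * u^2" using assms by simp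
  moreover have "exp u \<ge> 1 + u" using exp_ge_add_one_self[of u] by simp
  ultimately show ?thesis by (smt (verit) zero_le_power2)
qed

lemma sum_indicator_eq: "(\<Sum>i\<in>UNIV. if i \<in> I then u else 0) = real (card I) * u"
  for I :: "'n::finite set"
  by (simp add: sum.If_cases)

context compact_lie_algebra begin

definition triple_sum :: "('n \<Rightarrow> real^'n) \<Rightarrow> ('n \<Rightarrow> 'n \<Rightarrow> 'n \<Rightarrow> real) \<Rightarrow> real" where
  "triple_sum f F = (\<Sum>i\<in>UNIV. \<Sum>j\<in>UNIV. \<Sum>k\<in>UNIV. (struct_const f i j k)^2 * F i j k)"

lemma triple_sum_add: "triple_sum f (\<lambda>i j k. F i j k + G i j k) = triple_sum f F + triple_sum f G"
  by (simp add: triple_sum_def sum.distrib algebra_simps)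
lemma triple_sum_diff: "triple_sum f (\<lambda>i j k. F i j k - G i j k) = triple_sum f F - triple_sum f G"
  by (simp add: triple_sum_def sum_subtractf algebra_simps)
lemma triple_sum_cmult: "triple_sum f (\<lambda>i j k. a * F i j k) = a * triple_sum f F"
  by (simp add: triple_sum_def sum_distrib_left mult_ac)

lemma triple_sum_rotate: "triple_sum f (\<lambda>i j k. F j k i) = triple_sum f F"
  unfolding triple_sum_def
  using sum3_rotate[of "\<lambda>i j k. (struct_const f i j k)^2 * F i j k"] by (simp add: struct_const_cyclic)

lemma triple_sum_swap: "triple_sum f (\<lambda>i j k. F j i k) = triple_sum f F"
proof -
  have "(struct_const f i j k)^2 = (struct_const f j i k)^2" for i j k
    using struct_const_skew[of f i j k] by simp
  then have "triple_sum f (\<lambda>i j k. F j i k) = (\<Sum>i\<in>UNIV. \<Sum>j\<in>UNIV. \<Sum>k\<in>UNIV. (struct_const f j i k)^2 * F j i k)"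
    by (simp add: triple_sum_def)
  also have "\<dots> = triple_sum f F" unfolding triple_sum_def by (rule sum.swap)
  finally show ?thesis .
qed

lemma triple_sum_single:
  assumes "frame Q f"
  shows "triple_sum f (\<lambda>i j k. u i) = sum u UNIV" "triple_sum f (\<lambda>i j k. u j) = sum u UNIV"
    "triple_sum f (\<lambda>i j k. u k) = sum u UNIV"
proof -
  show a: "triple_sum f (\<lambda>i j k. u i) = sum u UNIV"
    using sum_struct_const[OF assms] by (simp add: triple_sum_def sum_distrib_right[symmetric])
  show "triple_sum f (\<lambda>i j k. u j) = sum u UNIV"
    using triple_sum_rotate[of f "\<lambda>i j k. u i"] a by simp
  show "triple_sum f (\<lambda>i j k. u k) = sum u UNIV"
    using triple_sum_rotate[of f "\<lambda>i j k. u k"] triple_sum_rotate[of f "\<lambda>i j k. u j"] a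
      triple_sum_rotate[of f "\<lambda>i j k. u i"] by simp
qed

lemma triple_sum_pair:
  "triple_sum f (\<lambda>i j k. G j k) = triple_sum f (\<lambda>i j k. G i j)"
  "triple_sum f (\<lambda>i j k. G k i) = triple_sum f (\<lambda>i j k. G i j)"
  "triple_sum f (\<lambda>i j k. G j i) = triple_sum f (\<lambda>i j k. G i j)"
  "triple_sum f (\<lambda>i j k. G k j) = triple_sum f (\<lambda>i j k. G i j)"
  "triple_sum f (\<lambda>i j k. G i k) = triple_sum f (\<lambda>i j k. G i j)"
proof -
  show 1: "triple_sum f (\<lambda>i j k. G j k) = triple_sum f (\<lambda>i j k. G i j)" for G
    by (rule triple_sum_rotate[of f "\<lambda>i j k. G i j"])
  show 2: "triple_sum f (\<lambda>i j k. G k i) = triple_sum f (\<lambda>i j k. G i j)" for G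
    using triple_sum_rotate[of f "\<lambda>i j k. G j k"] 1 by simp
  show 3: "triple_sum f (\<lambda>i j k. G j i) = triple_sum f (\<lambda>i j k. G i j)" for G
    by (rule triple_sum_swap[of f "\<lambda>i j k. G i j"])
  show "triple_sum f (\<lambda>i j k. G k j) = triple_sum f (\<lambda>i j k. G i j)"
    using 1[of "\<lambda>i j. G j i"] 3 by simp
  show "triple_sum f (\<lambda>i j k. G i k) = triple_sum f (\<lambda>i j k. G i j)"
    using 2[of "\<lambda>i j. G j i"] 3 by simp
qed

section \<open>Scalar curvature along one-parameter families of metrics\<close>

text \<open>The \<open>m\<close>-th derivative, at parameter \<open>s\<close>, of the curvature of the metrics with eigenvalues
\<open>exp (s * t i)\<close>. In these coordinates every term of \<open>diag_curvature\<close> is an exponential, so that all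
derivatives are explicit, and the volume condition is the linear condition \<open>sum t UNIV = 0\<close>.\<close>

definition curvature_deriv :: "('n \<Rightarrow> real^'n) \<Rightarrow> ('n \<Rightarrow> real) \<Rightarrow> nat \<Rightarrow> real \<Rightarrow> real" where
  "curvature_deriv f t m s = (\<Sum>i\<in>UNIV. (- t i)^m * exp (s * - t i)) / 2
     - triple_sum f (\<lambda>i j k. (t k - t i - t j)^m * exp (s * (t k - t i - t j))) / 4"

lemma curvature_deriv_has_derivative:
  "(curvature_deriv f t m has_real_derivative curvature_deriv f t (Suc m) s) (at s)"
  unfolding curvature_deriv_def triple_sum_def
  by (auto intro!: derivative_eq_intros simp: sum_divide_distrib[symmetric] mult_ac)

lemma curvature_deriv_0: "curvature_deriv f t 0 s = diag_curvature f (\<lambda>i. exp (s * t i))"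
proof -
  have "exp (s * (t k - t i - t j)) = exp (s * t k) / (exp (s * t i) * exp (s * t j))" for i j k
    by (simp add: exp_diff right_diff_distrib)
  then show ?thesis
    by (simp add: curvature_deriv_def diag_curvature_def triple_sum_def exp_minus inverse_eq_divide)
qed

lemma curvature_deriv_1:
  assumes "frame Q f"
  shows "curvature_deriv f t 1 0 = - sum t UNIV / 4"
  by (simp add: curvature_deriv_def triple_sum_diff triple_sum_single[OF assms] sum_negf)

text \<open>Total antisymmetry of the structure constants makes the weights \<open>(struct_const f i j k)^2\<close> symmetric,
so the square expands into a diagonal part, summed by \<open>sum_struct_const\<close>, and one mixed part.\<close>

lemma curvature_deriv_2:
  assumes "frame Q f"
  shows "curvature_deriv f t 2 0 = - (\<Sum>i\<in>UNIV. (t i)^2) / 4 + triple_sum f (\<lambda>i j k. t i * t j) / 2"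
proof -
  have "(\<lambda>i j k. (t k - t i - t j)^2) =
      (\<lambda>i j k. ((t k)^2 + (t i)^2 + (t j)^2) + (2 * (t i * t j) - 2 * (t k * t i) - 2 * (t j * t k)))"
    by (intro ext) (simp add: power2_eq_square algebra_simps)
  then have "triple_sum f (\<lambda>i j k. (t k - t i - t j)^2) =
     3 * (\<Sum>i\<in>UNIV. (t i)^2) - 2 * triple_sum f (\<lambda>i j k. t i * t j)"
    by (simp only: triple_sum_add triple_sum_diff triple_sum_cmult triple_sum_single[OF assms, of "\<lambda>i. (t i)^2"]
      triple_sum_pair[of f "\<lambda>i j. t i * t j"])
  then show ?thesis by (simp add: curvature_deriv_def diff_divide_distrib)
qed

lemma curvature_deriv_3:
  assumes "frame Q f"
  shows "curvature_deriv f t 3 0 = - (\<Sum>i\<in>UNIV. (t i)^3) / 4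
    + 3/2 * triple_sum f (\<lambda>i j k. (t i)^2 * t j) - 3/2 * triple_sum f (\<lambda>i j k. t i * t j * t k)"
proof -
  have "(\<lambda>i j k. (t k - t i - t j)^3) =
      (\<lambda>i j k. ((t k)^3 - (t i)^3 - (t j)^3) +
        (3 * ((t i)^2 * t k) - 3 * ((t k)^2 * t i)) + (3 * ((t j)^2 * t k) - 3 * ((t k)^2 * t j)) -
        3 * ((t i)^2 * t j) - 3 * ((t j)^2 * t i) + 6 * (t i * t j * t k))"
    by (intro ext) (simp add: power2_eq_square power3_eq_cube algebra_simps)
  then have "triple_sum f (\<lambda>i j k. (t k - t i - t j)^3) =
     - (\<Sum>i\<in>UNIV. (t i)^3) - 6 * triple_sum f (\<lambda>i j k. (t i)^2 * t j) + 6 * triple_sum f (\<lambda>i j k. t i * t j * t k)"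
    by (simp only: triple_sum_add triple_sum_diff triple_sum_cmult triple_sum_single[OF assms, of "\<lambda>i. (t i)^3"]
      triple_sum_pair[of f "\<lambda>i j. (t i)^2 * t j"])
  then show ?thesis by (simp add: curvature_deriv_def sum_negf diff_divide_distrib add_divide_distrib)
qed

definition exp_metric :: "('n \<Rightarrow> real^'n) \<Rightarrow> ('n \<Rightarrow> real) \<Rightarrow> real \<Rightarrow> real^'n^'n" where
  "exp_metric f t s = diagonal_metric Q f (\<lambda>i. exp (s * t i))"

lemma scalar_curvature_exp_metric:
  assumes "frame Q f"
  shows "scalar_curvature br (exp_metric f t s) = curvature_deriv f t 0 s"
  unfolding exp_metric_def curvature_deriv_0
  by (rule scalar_curvature_diagonal[OF is_metric_diagonal_metric[OF is_metric_standard assms] assms])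
    (simp_all add: diagonal_metric_frame[OF assms])

lemma exp_metric_in_metrics_1:
  assumes "frame Q f" "sum t UNIV = 0"
  shows "exp_metric f t s \<in> metrics_1 br"
proof -
  have "is_metric (exp_metric f t s)"
    unfolding exp_metric_def by (rule is_metric_diagonal_metric[OF is_metric_standard assms(1)]) simp
  moreover have "det (exp_metric f t s) / det Q = 1"
  proof -
    have "det (exp_metric f t s) / det Q = (\<Prod>i\<in>UNIV. metric_form (exp_metric f t s) (f i) (f i))"
      by (rule det_ratio_diagonal[OF assms(1)]) (simp add: exp_metric_def diagonal_metric_frame[OF assms(1)])
    also have "\<dots> = exp (\<Sum>i\<in>UNIV. s * t i)"
      by (simp add: exp_metric_def diagonal_metric_frame[OF assms(1)] exp_sum)
    finally show ?thesis using assms(2) by (simp add: sum_distrib_left[symmetric])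
  qed
  ultimately show ?thesis unfolding metrics_1_def by blast
qed

lemma exp_metric_zero: "frame Q f \<Longrightarrow> exp_metric f t 0 = Q"
proof -
  assume f: "frame Q f"
  have "metric_form (exp_metric f t 0) v w = q v w" for v w
    unfolding exp_metric_def diagonal_metric_form by (simp add: frame_parseval[OF is_metric_standard f, of v w])
  then show ?thesis by (metis metric_form_axis vec_eq_iff)
qed

lemma continuous_exp_metric: "continuous (at s) (exp_metric f t)"
  unfolding exp_metric_def diagonal_metric_def isCont_def by (intro tendsto_vec_lambda tendsto_intros)

lemma exp_metric_near:
  assumes "frame Q f" "\<delta> > 0" "eventually P (at Q within metrics_1 br)" "sum t UNIV = 0"
  shows "\<exists>s. 0 < s \<and> s < \<delta> \<and> (exp_metric f t s = Q \<or> P (exp_metric f t s))"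
proof -
  obtain d where d: "d > 0" "\<And>g. g \<in> metrics_1 br \<Longrightarrow> g \<noteq> Q \<Longrightarrow> dist g Q < d \<Longrightarrow> P g"
    using assms(3) unfolding eventually_at by auto
  obtain r where r: "r > 0" "\<And>s. dist s 0 < r \<Longrightarrow> dist (exp_metric f t s) (exp_metric f t 0) < d"
    using continuous_exp_metric[of 0 f t] d(1) unfolding continuous_at_eps_delta by metis
  have "dist (exp_metric f t (min \<delta> r / 2)) Q < d"
    using r(2)[of "min \<delta> r / 2"] r(1) assms(2) exp_metric_zero[OF assms(1)] by (simp add: dist_norm)
  then show ?thesis
    using d(2)[OF exp_metric_in_metrics_1[OF assms(1,4)]] r(1) assms(2)
    by (intro exI[of _ "min \<delta> r / 2"]) auto
qed

lemma not_local_max_along: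
  assumes f: "frame Q f" and t: "sum t UNIV = 0"
    and "\<exists>\<delta>>0. \<forall>s. 0 < s \<longrightarrow> s < \<delta> \<longrightarrow> curvature_deriv f t 0 s > curvature_deriv f t 0 0"
  shows "\<not> local_max_point (scalar_curvature br) (metrics_1 br) Q"
proof
  assume "local_max_point (scalar_curvature br) (metrics_1 br) Q"
  then have ev: "\<forall>\<^sub>F g in at Q within metrics_1 br. scalar_curvature br g \<le> scalar_curvature br Q"
    unfolding local_max_point_def by blast
  obtain \<delta> where \<delta>: "\<delta> > 0" "\<And>s. 0 < s \<Longrightarrow> s < \<delta> \<Longrightarrow> scalar_curvature br (exp_metric f t s) > scalar_curvature br (exp_metric f t 0)"
    using assms(3) unfolding scalar_curvature_exp_metric[OF f] by blast
  then show False using exp_metric_near[OF f \<delta>(1) ev t] exp_metric_zero[OF f] by (metis linorder_not_less order_refl)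
qed

lemma not_local_min_along:
  assumes f: "frame Q f" and t: "sum t UNIV = 0" and neg: "curvature_deriv f t 2 0 < 0"
  shows "\<not> local_min_point (scalar_curvature br) (metrics_1 br) Q"
proof
  assume "local_min_point (scalar_curvature br) (metrics_1 br) Q"
  then have ev: "\<forall>\<^sub>F g in at Q within metrics_1 br. scalar_curvature br g \<ge> scalar_curvature br Q"
    unfolding local_min_point_def by blast
  have "\<exists>\<delta>>0. \<forall>s. 0 < s \<longrightarrow> s < \<delta> \<longrightarrow> - curvature_deriv f t 0 s > - curvature_deriv f t 0 0"
  proof (rule second_derivative_test)
    show "((\<lambda>s. - curvature_deriv f t 0 s) has_real_derivative - curvature_deriv f t 1 s) (at s)" for s
      using curvature_deriv_has_derivative[of f t 0 s] by (simp add: DERIV_minus)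
    show "((\<lambda>s. - curvature_deriv f t 1 s) has_real_derivative - curvature_deriv f t 2 0) (at 0)"
      using curvature_deriv_has_derivative[of f t 1 0] by (simp add: DERIV_minus numeral_2_eq_2)
    show "- curvature_deriv f t 1 0 = 0" unfolding curvature_deriv_1[OF f] using t by simp
  qed (use neg in simp)
  then obtain \<delta> where \<delta>: "\<delta> > 0" "\<And>s. 0 < s \<Longrightarrow> s < \<delta> \<Longrightarrow> scalar_curvature br (exp_metric f t s) < scalar_curvature br (exp_metric f t 0)"
    unfolding scalar_curvature_exp_metric[OF f] by auto
  then show False using exp_metric_near[OF f \<delta>(1) ev t] exp_metric_zero[OF f] by (metis linorder_not_less order_refl)
qed

lemma not_local_max_second_order:
  assumes f: "frame Q f" and t: "sum t UNIV = 0" and pos: "curvature_deriv f t 2 0 > 0"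
  shows "\<not> local_max_point (scalar_curvature br) (metrics_1 br) Q"
proof (rule not_local_max_along[OF f t], rule second_derivative_test)
  show "(curvature_deriv f t 0 has_real_derivative curvature_deriv f t 1 s) (at s)" for s
    using curvature_deriv_has_derivative[of f t 0 s] by simp
  show "(curvature_deriv f t 1 has_real_derivative curvature_deriv f t 2 0) (at 0)"
    using curvature_deriv_has_derivative[of f t 1 0] by (simp add: numeral_2_eq_2)
  show "curvature_deriv f t 1 0 = 0" unfolding curvature_deriv_1[OF f] using t by simp
qed (rule pos)

lemma not_local_max_third_order:
  assumes f: "frame Q f" and t: "sum t UNIV = 0"
    and "curvature_deriv f t 2 0 = 0" "curvature_deriv f t 3 0 > 0"
  shows "\<not> local_max_point (scalar_curvature br) (metrics_1 br) Q"
proof (rule not_local_max_along[OF f t], rule third_derivative_test)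
  show "(curvature_deriv f t 0 has_real_derivative curvature_deriv f t 1 s) (at s)" for s
    using curvature_deriv_has_derivative[of f t 0 s] by simp
  show "(curvature_deriv f t 1 has_real_derivative curvature_deriv f t 2 s) (at s)" for s
    using curvature_deriv_has_derivative[of f t 1 s] by (simp add: numeral_2_eq_2)
  show "(curvature_deriv f t 2 has_real_derivative curvature_deriv f t 3 0) (at 0)"
    using curvature_deriv_has_derivative[of f t 2 0] by (simp add: numeral_2_eq_2 numeral_3_eq_3)
  show "curvature_deriv f t 1 0 = 0" unfolding curvature_deriv_1[OF f] using t by simp
qed (use assms in auto)

lemma standard_frame_exists: obtains f where "frame Q f"
  using simultaneous_frame[OF is_metric_standard, of Q] is_metric_standard is_metric_def by metis

section \<open>Variations that raise or lower the curvature\<close>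

text \<open>Stretch one vector of a frame and shrink another one. The mixed part of the second derivative has
only the nonpositive products \<open>t a * t b\<close>, because \<open>struct_const f a a k = 0\<close>.\<close>

theorem standard_not_local_min: "\<not> local_min_point (scalar_curvature br) (metrics_1 br) Q"
proof -
  obtain f where f: "frame Q f" by (rule standard_frame_exists)
  fix a0 :: 'n
  have "\<exists>a b::'n. a \<noteq> b"
  proof (rule ccontr)
    assume "\<not> ?thesis"
    then have "struct_const f i j k = 0" for i j k using struct_const_refl by metis
    then show False using sum_struct_const[OF f, of a0] by simp
  qed
  then obtain a b :: 'n where ab: "a \<noteq> b" by blast
  define u where "u c i = (if i = c then 1 else 0 :: real)" for c i :: 'n
  define t where "t i = u a i - u b i" for i
  have "sum t UNIV = 0" by (simp add: t_def u_def sum_subtractf)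
  moreover have "curvature_deriv f t 2 0 < 0"
  proof -
    have "(t i)^2 = u a i + u b i" for i using ab by (simp add: t_def u_def)
    then have 1: "(\<Sum>i\<in>UNIV. (t i)^2) = 2" by (simp add: u_def sum.distrib)
    have "triple_sum f (\<lambda>i j k. t i * t j) \<le> triple_sum f (\<lambda>i j k. 0)"
      unfolding triple_sum_def
    proof (intro sum_mono)
      fix i j k
      show "(struct_const f i j k)^2 * (t i * t j) \<le> (struct_const f i j k)^2 * 0"
        using struct_const_refl[of f i k] by (auto simp: t_def u_def mult_le_0_iff)
    qed
    then have "triple_sum f (\<lambda>i j k. t i * t j) \<le> 0" by (simp add: triple_sum_def)
    then show ?thesis unfolding curvature_deriv_2[OF f] 1 by simp
  qed
  ultimately show ?thesis by (rule not_local_min_along[OF f])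
qed

text \<open>Stretch the span of a part of a frame uniformly and shrink the rest to keep the volume. The second
derivative in this direction is a positive multiple of the difference of the two sides of the
inequality. Here \<open>K\<close> is the part of the trace of \<open>- B\<close> over the block that is contributed by brackets
within the block.\<close>

theorem not_local_max_of_block:
  fixes I :: "'n set" and K :: real
  assumes f: "frame Q f"
    and K: "K = (\<Sum>i\<in>I. \<Sum>j\<in>I. \<Sum>k\<in>UNIV. (struct_const f i j k)^2)"
    and large: "CARD('n) * K > (card I)^2 + card I * (real (CARD('n)) - card I) / 2"
  shows "\<not> local_max_point (scalar_curvature br) (metrics_1 br) Q"
proof -
  define n d where "n = real (CARD('n))" and "d = real (card I)"
  define u where "u i = (if i \<in> I then n else 0)" for i
  define t where "t i = u i - d" for i
  have su: "sum u UNIV = d * n" by (simp add: u_def sum_indicator_eq d_def)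
  have t0: "sum t UNIV = 0" by (simp add: t_def sum_subtractf su n_def)
  have "curvature_deriv f t 2 0 = - (d * n^2 - 2 * d * (d * n) + d^2 * n) / 4 + (n^2 * K - 2 * d * (d * n) + d^2 * n) / 2"
  proof -
    have "(\<Sum>i\<in>UNIV. (t i)^2) = (\<Sum>i\<in>UNIV. (if i \<in> I then n^2 else 0) - 2 * d * u i + d^2)"
      by (intro sum.cong refl) (simp add: t_def u_def power2_eq_square algebra_simps)
    also have "\<dots> = d * n^2 - 2 * d * (d * n) + d^2 * n"
      by (simp add: sum.distrib sum_subtractf sum_distrib_left[symmetric] su sum_indicator_eq d_def n_def)
    finally have 1: "(\<Sum>i\<in>UNIV. (t i)^2) = d * n^2 - 2 * d * (d * n) + d^2 * n" .
    have uu: "triple_sum f (\<lambda>i j k. u i * u j) = n^2 * K"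
    proof -
      have "triple_sum f (\<lambda>i j k. u i * u j) =
        (\<Sum>i\<in>UNIV. if i \<in> I then (\<Sum>j\<in>UNIV. if j \<in> I then n^2 * (\<Sum>k\<in>UNIV. (struct_const f i j k)^2) else 0) else 0)"
        unfolding triple_sum_def
        by (intro sum.cong refl) (auto simp: u_def sum_distrib_left power2_eq_square mult_ac intro!: sum.cong)
      also have "\<dots> = n^2 * K" by (simp add: sum.If_cases K sum_distrib_left)
      finally show ?thesis .
    qed
    have "(\<lambda>i j k. t i * t j) = (\<lambda>i j k::'n. (u i * u j - d * u i - d * u j) + d^2)"
      by (intro ext) (simp add: t_def power2_eq_square algebra_simps)
    then have 2: "triple_sum f (\<lambda>i j k. t i * t j) = n^2 * K - 2 * d * (d * n) + d^2 * n"
      by (simp only: triple_sum_add triple_sum_diff triple_sum_cmult triple_sum_single[OF f] uu su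
          triple_sum_single(1)[OF f, of "\<lambda>_. d^2"]) (simp add: n_def algebra_simps)
    show ?thesis unfolding curvature_deriv_2[OF f] 1 2 ..
  qed
  also have "\<dots> = n / 2 * (n * K - d^2 - d * (n - d) / 2)" by (simp add: field_simps power2_eq_square)
  also have "\<dots> > 0" using large by (simp add: n_def d_def)
  finally show ?thesis by (rule not_local_max_second_order[OF f t0])
qed

text \<open>The situation of \<open>su(p)\<close> inside \<open>su(p + 1)\<close>, with \<open>z\<close> spanning the centraliser of \<open>su(p)\<close>. For \<open>p = 2\<close>
stretching the block alone has a negative second derivative. Moving \<open>z\<close> as well gives a direction
in which the second derivative vanishes, and the third one is positive.\<close>

theorem not_local_max_of_special_unitary_block:
  fixes I :: "'n set" and p :: nat
  assumes f: "frame Q f" and p: "p \<ge> 2"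
    and cI: "card I = p^2 - 1" and n: "CARD('n) = p^2 + 2 * p"
    and K: "(\<Sum>i\<in>I. \<Sum>j\<in>I. \<Sum>k\<in>UNIV. (struct_const f i j k)^2) = p * (real p - 1)"
    and sub: "\<And>i j k. i \<in> I \<Longrightarrow> j \<in> I \<Longrightarrow> k \<notin> I \<Longrightarrow> struct_const f i j k = 0"
    and z: "z \<notin> I" "\<And>i k. i \<in> I \<Longrightarrow> struct_const f i z k = 0"
  shows "\<not> local_max_point (scalar_curvature br) (metrics_1 br) Q"
proof -
  define P where "P = real p"
  \<comment> \<open>The direction is \<open>\<tau> + u1\<close> on the block, \<open>\<tau> + u2\<close> at \<open>z\<close> and \<open>\<tau>\<close> elsewhere. The values make the
    trace and the second derivative vanish.\<close>
  define \<tau> u1 u2 where "\<tau> = (P - 1) / 2" and "u1 = - (P + 1) / 2" and "u2 = (P - 1) / 2"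
  define u where "u i = (if i \<in> I then u1 else 0) + (if i = z then u2 else 0)" for i
  define t where "t i = \<tau> + u i" for i
  have d: "real (card I) = P^2 - 1" using p by (simp add: cI P_def of_nat_diff)
  have N: "real (CARD('n)) = P^2 + 2 * P" by (simp add: n P_def)
  have powers: "(\<Sum>i\<in>UNIV. (u i)^m) = (P^2 - 1) * u1^m + u2^m" if "m > 0" for m
  proof -
    have "(u i)^m = (if i \<in> I then u1^m else 0) + (if i = z then u2^m else 0)" for i
      using z(1) that by (auto simp: u_def)
    then show ?thesis by (simp add: sum.distrib sum_indicator_eq d)
  qed
  have su: "sum u UNIV = (P^2 - 1) * u1 + u2" using powers[of 1] by simp
  have t0: "sum t UNIV = 0"
  proof -
    have "sum t UNIV = \<tau> * (P^2 + 2 * P) + sum u UNIV" by (simp add: t_def sum.distrib N)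
    then show ?thesis by (simp add: su \<tau>_def u1_def u2_def power2_eq_square field_simps)
  qed
  have zero: "struct_const f i z k = 0" "struct_const f z i k = 0" if "i \<in> I \<or> i = z" for i k
    using that z(2) struct_const_skew[of f i z k] struct_const_refl by auto
  have block: "triple_sum f (\<lambda>i j k. (if i \<in> I then 1 else 0) * (if j \<in> I then 1 else 0)) = P * (P - 1)"
  proof -
    have "triple_sum f (\<lambda>i j k. (if i \<in> I then 1 else 0) * (if j \<in> I then 1 else 0)) =
      (\<Sum>i\<in>UNIV. if i \<in> I then (\<Sum>j\<in>UNIV. if j \<in> I then (\<Sum>k\<in>UNIV. (struct_const f i j k)^2) else 0) else 0)"
      unfolding triple_sum_def by (intro sum.cong refl) (auto intro!: sum.cong)
    also have "\<dots> = P * (P - 1)" using K by (simp add: sum.If_cases P_def)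
    finally show ?thesis .
  qed
  have reduce: "triple_sum f F = a * (P * (P - 1))"
    if "\<And>i j k. (struct_const f i j k)^2 * F i j k = (struct_const f i j k)^2 * (a * ((if i \<in> I then 1 else 0) * (if j \<in> I then 1 else 0)))"
    for F a
    unfolding block[symmetric] triple_sum_cmult[symmetric] unfolding triple_sum_def that ..
  have uu: "triple_sum f (\<lambda>i j k. u i * u j) = u1^2 * (P * (P - 1))"
  proof (rule reduce)
    fix i j k
    show "(struct_const f i j k)^2 * (u i * u j) = (struct_const f i j k)^2 * (u1^2 * ((if i \<in> I then 1 else 0) * (if j \<in> I then 1 else 0)))"
      using zero[of i k] zero[of j k] z(1) by (auto simp: u_def power2_eq_square)
  qed
  have uuu: "triple_sum f (\<lambda>i j k. (u i)^2 * u j) = u1^3 * (P * (P - 1))"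
  proof (rule reduce)
    fix i j k
    show "(struct_const f i j k)^2 * ((u i)^2 * u j) = (struct_const f i j k)^2 * (u1^3 * ((if i \<in> I then 1 else 0) * (if j \<in> I then 1 else 0)))"
      using zero[of i k] zero[of j k] z(1) by (auto simp: u_def power2_eq_square power3_eq_cube)
  qed
  have uuu': "triple_sum f (\<lambda>i j k. u i * u j * u k) = u1^3 * (P * (P - 1))"
  proof (rule reduce)
    fix i j k
    show "(struct_const f i j k)^2 * (u i * u j * u k) = (struct_const f i j k)^2 * (u1^3 * ((if i \<in> I then 1 else 0) * (if j \<in> I then 1 else 0)))"
      using zero[of i k] zero[of j k] z(1) sub[of i j k] by (auto simp: u_def power3_eq_cube)
  qed
  have tt: "triple_sum f (\<lambda>i j k. t i * t j) = \<tau>^2 * (P^2 + 2 * P) + 2 * \<tau> * sum u UNIV + u1^2 * (P * (P - 1))"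
  proof -
    have "(\<lambda>i j k. t i * t j) = (\<lambda>i j k::'n. \<tau>^2 + \<tau> * u i + \<tau> * u j + u i * u j)"
      by (intro ext) (simp add: t_def power2_eq_square algebra_simps)
    then show ?thesis
      by (simp only: triple_sum_add triple_sum_cmult triple_sum_single[OF f] uu
          triple_sum_single(1)[OF f, of "\<lambda>_. \<tau>^2"]) (simp add: N)
  qed
  have cubes: "triple_sum f (\<lambda>i j k. (t i)^2 * t j) - triple_sum f (\<lambda>i j k. t i * t j * t k)
      = \<tau> * ((P^2 - 1) * u1^2 + u2^2) - \<tau> * (u1^2 * (P * (P - 1)))"
  proof -
    have 1: "(\<lambda>i j k. (t i)^2 * t j) = (\<lambda>i j k::'n. (\<tau>^3 + \<tau>^2 * u j + 2 * \<tau>^2 * u i) + 2 * \<tau> * (u i * u j) + \<tau> * (u i)^2 + (u i)^2 * u j)"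
      by (intro ext) (simp add: t_def power2_eq_square power3_eq_cube algebra_simps)
    have 2: "(\<lambda>i j k. t i * t j * t k) = (\<lambda>i j k::'n. (\<tau>^3 + \<tau>^2 * u j + \<tau>^2 * u i + \<tau>^2 * u k)
        + \<tau> * (u i * u j) + \<tau> * (u j * u k) + \<tau> * (u k * u i) + u i * u j * u k)"
      by (intro ext) (simp add: t_def power2_eq_square power3_eq_cube algebra_simps)
    show ?thesis unfolding 1 2
      by (simp only: triple_sum_add triple_sum_cmult triple_sum_single[OF f] uu uuu uuu'
          triple_sum_pair[of f "\<lambda>i j. u i * u j"] triple_sum_single(1)[OF f, of "\<lambda>i. (u i)^2"] powers[OF zero_less_numeral])
  qed
  have s2: "(\<Sum>i\<in>UNIV. (t i)^2) = \<tau>^2 * (P^2 + 2 * P) + 2 * \<tau> * sum u UNIV + ((P^2 - 1) * u1^2 + u2^2)"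
    by (simp add: t_def power2_sum sum.distrib sum_distrib_left[symmetric] powers N mult.assoc)
  have s3: "(\<Sum>i\<in>UNIV. (t i)^3) = \<tau>^3 * (P^2 + 2 * P) + 3 * \<tau>^2 * sum u UNIV + 3 * \<tau> * ((P^2 - 1) * u1^2 + u2^2) + ((P^2 - 1) * u1^3 + u2^3)"
  proof -
    have "(t i)^3 = \<tau>^3 + 3 * \<tau>^2 * u i + 3 * \<tau> * (u i)^2 + (u i)^3" for i
      by (simp add: t_def power2_eq_square power3_eq_cube algebra_simps)
    then show ?thesis
      by (simp add: sum.distrib sum_distrib_left[symmetric] powers N)
  qed
  have "curvature_deriv f t 2 0 = 0"
    unfolding curvature_deriv_2[OF f] tt s2 su \<tau>_def u1_def u2_def
    by (simp add: power2_eq_square field_simps)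
  moreover have "curvature_deriv f t 3 0 > 0"
  proof -
    have "curvature_deriv f t 3 0 = - (\<tau>^3 * (P^2 + 2 * P) + 3 * \<tau>^2 * sum u UNIV + 3 * \<tau> * ((P^2 - 1) * u1^2 + u2^2) + ((P^2 - 1) * u1^3 + u2^3)) / 4
       + 3/2 * (\<tau> * ((P^2 - 1) * u1^2 + u2^2) - \<tau> * (u1^2 * (P * (P - 1))))"
      unfolding curvature_deriv_3[OF f] s3 cubes[symmetric] by (simp add: algebra_simps)
    also have "\<dots> = P * (P - 1) * (P + 1)^2 / 8"
      unfolding su \<tau>_def u1_def u2_def by (simp add: power2_eq_square power3_eq_cube field_simps)
    also have "\<dots> > 0" using p by (simp add: P_def)
    finally show ?thesis .
  qed
  ultimately show ?thesis by (rule not_local_max_third_order[OF f t0])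
qed

text \<open>The set \<open>E\<close> allows prescribing vectors of the frame orthogonal to \<open>V\<close>, such as the centraliser of a
subalgebra.\<close>

lemma subspace_frame:
  assumes V: "subspace V" and E: "orthonormal_set Q E" and VE: "\<And>v e. v \<in> V \<Longrightarrow> e \<in> E \<Longrightarrow> q v e = 0"
  obtains f I where "frame Q f" "f ` I \<subseteq> V" "span (f ` I) = V" "card I = dim V"
    "\<And>i v. i \<notin> I \<Longrightarrow> v \<in> V \<Longrightarrow> q v (f i) = 0" "E \<subseteq> f ` (- I)"
proof -
  obtain B where B: "orthonormal_set Q B" "span B = V"
    using simultaneous_diagonalization[OF is_metric_standard _ V, of Q] is_metric_standard is_metric_def by metis
  have BE: "q b e = 0" "q e b = 0" if "b \<in> B" "e \<in> E" for b e
    using VE[of b e] B(2) that span_base q_commute by auto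
  have "orthonormal_set Q (B \<union> E)"
    using B(1) E BE unfolding orthonormal_set_def by (auto split: if_splits)
  then obtain f where f: "frame Q f" "B \<union> E \<subseteq> range f"
    using orthonormal_set_extend[OF is_metric_standard] by blast
  define I where "I = f -` B"
  have inj: "inj f" using f(1) unfolding frame_def inj_def by (metis zero_neq_one)
  have im: "f ` I = B" using f(2) by (auto simp: I_def)
  have "card I = card B" using im inj by (metis card_image inj_on_subset subset_UNIV)
  also have "\<dots> = dim V" using orthonormal_set_independent[OF B(1)] B(2) by (metis dim_span dim_eq_card_independent)
  finally have cI: "card I = dim V" .
  have orthV: "q v (f i) = 0" if i: "i \<notin> I" and v: "v \<in> V" for i v
  proof -
    have "subspace {v. q v (f i) = 0}" by (simp add: subspace_def metric_form_simps)
    moreover have "B \<subseteq> {v. q v (f i) = 0}"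
      unfolding im[symmetric] using f(1) i by (auto simp: frame_def)
    ultimately show ?thesis using span_minimal B(2) v by blast
  qed
  have EI: "E \<subseteq> f ` (- I)"
  proof
    fix e assume e: "e \<in> E"
    then obtain i where i: "e = f i" using f(2) by blast
    have "e \<notin> B" using BE(1)[of e e] e E by (auto simp: orthonormal_set_def)
    then show "e \<in> f ` (- I)" using i by (auto simp: I_def)
  qed
  have "f ` I \<subseteq> V" "span (f ` I) = V" using im B(2) span_superset[of B] by simp_all
  then show ?thesis using f(1) cI orthV EI by (intro that[of f I])
qed

text \<open>For a frame adapted to a proper ideal, \<open>struct_const f i j k\<close> with \<open>i\<close> in the ideal vanishes unless
\<open>j\<close> is in it too. So the block sum equals the dimension of the ideal, and the block test applies.\<close>

theorem not_local_max_of_not_simple: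
  assumes "\<not> simple_lie_algebra br"
  shows "\<not> local_max_point (scalar_curvature br) (metrics_1 br) Q"
proof -
  have "\<exists>x y. br x y \<noteq> 0"
  proof (rule ccontr)
    assume z: "\<not> ?thesis"
    obtain f where f: "frame Q f" by (rule standard_frame_exists)
    have "struct_const f i j k = 0" for i j k using z by (simp add: struct_const_def metric_form_simps)
    then show False using sum_struct_const[OF f] by simp
  qed
  then obtain V where V: "lie_ideal br V" "V \<noteq> {0}" "V \<noteq> UNIV"
    using assms unfolding simple_lie_algebra_def by blast
  then have sV: "subspace V" and brV: "\<And>x y. y \<in> V \<Longrightarrow> br x y \<in> V" by (auto simp: lie_ideal_def)
  have "orthonormal_set Q {}" by (simp add: orthonormal_set_def)
  then obtain f I where "frame Q f" "f ` I \<subseteq> V" "span (f ` I) = V" "card I = dim V"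
    and orth: "\<And>i v. i \<notin> I \<Longrightarrow> v \<in> V \<Longrightarrow> q v (f i) = 0" and "{} \<subseteq> f ` (- I)"
    by (rule subspace_frame[OF sV]) (simp, rule that)
  then have f: "frame Q f" "f ` I \<subseteq> V" "card I = dim V" by auto
  have fI: "f i \<in> V" if "i \<in> I" for i using that f(2) by blast
  have "dim V > 0" using V(2) sV by (metis dim_eq_0 gr0I subset_singletonD subspace_0 singletonD empty_iff)
  moreover have "dim V < CARD('n)"
    using V(3) sV dim_psubset[of V UNIV] by (simp add: psubset_eq span_eq_iff[THEN iffD2])
  ultimately have d: "0 < card I" "card I < CARD('n)" using f(3) by auto
  have "(\<Sum>j\<in>I. \<Sum>k\<in>UNIV. (struct_const f i j k)^2) = 1" if i: "i \<in> I" for i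
  proof -
    have "struct_const f i j k = 0" if "j \<notin> I" for j k
      using orth[OF that brV[OF fI[OF i], of "f k"]] struct_const_cyclic[of f i j k]
      unfolding struct_const_def by simp
    then have "(\<Sum>j\<in>UNIV. \<Sum>k\<in>UNIV. (struct_const f i j k)^2) = (\<Sum>j\<in>I. \<Sum>k\<in>UNIV. (struct_const f i j k)^2)"
      by (intro sum.mono_neutral_right) auto
    then show ?thesis using sum_struct_const[OF f(1)] by simp
  qed
  then have K: "real (card I) = (\<Sum>i\<in>I. \<Sum>j\<in>I. \<Sum>k\<in>UNIV. (struct_const f i j k)^2)" by simp
  have "real (card I) * (real (CARD('n)) - card I) > 0" using d by simp
  then have "CARD('n) * real (card I) > (card I)^2 + card I * (real (CARD('n)) - card I) / 2"
    by (simp add: power2_eq_square field_simps)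
  then show ?thesis using not_local_max_of_block[OF f(1) K] by simp
qed

section \<open>Dimension three\<close>

text \<open>Schur's inequality bounds the left-hand side by \<open>9 / (4 * p)\<close> for \<open>p = x + y + z\<close>, and \<open>p \<ge> 3\<close> by the
inequality of the means.\<close>

lemma schur_bound:
  fixes x y z :: real
  assumes pos: "x > 0" "y > 0" "z > 0" and xyz: "x * y * z = 1"
  shows "(x * y + y * z + z * x) / 2 - (x^2 + y^2 + z^2) / 4 \<le> 3 / 4"
proof -
  define p where "p = x + y + z"
  have p0: "p > 0" using pos by (simp add: p_def)
  have schur: "x * (x - y) * (x - z) + y * (y - x) * (y - z) + z * (z - x) * (z - y) \<ge> 0"
  proof -
    have main: "a * (a - b) * (a - c) + b * (b - a) * (b - c) + c * (c - a) * (c - b) \<ge> 0"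
      if "a \<ge> b" "b \<ge> c" "c > 0" for a b c :: real
    proof -
      have "a * (a - b) * (a - c) + b * (b - a) * (b - c) + c * (c - a) * (c - b)
         = (a - b) * ((a - b) * (a + b - c)) + c * ((a - c) * (b - c))" by (simp add: algebra_simps)
      moreover have "(a - b) * ((a - b) * (a + b - c)) \<ge> 0" using that by (intro mult_nonneg_nonneg) auto
      moreover have "c * ((a - c) * (b - c)) \<ge> 0" using that by (intro mult_nonneg_nonneg) auto
      ultimately show ?thesis by linarith
    qed
    consider "x \<ge> y" "y \<ge> z" | "x \<ge> z" "z \<ge> y" | "y \<ge> x" "x \<ge> z" | "y \<ge> z" "z \<ge> x"
      | "z \<ge> x" "x \<ge> y" | "z \<ge> y" "y \<ge> x" by linarith
    then show ?thesis
    proof cases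
      case 1 show ?thesis using main[OF 1 pos(3)] by (simp add: algebra_simps)
    next case 2 show ?thesis using main[OF 2 pos(2)] by (simp add: algebra_simps)
    next case 3 show ?thesis using main[OF 3 pos(3)] by (simp add: algebra_simps)
    next case 4 show ?thesis using main[OF 4 pos(1)] by (simp add: algebra_simps)
    next case 5 show ?thesis using main[OF 5 pos(2)] by (simp add: algebra_simps)
    next case 6 show ?thesis using main[OF 6 pos(1)] by (simp add: algebra_simps)
    qed
  qed
  have amgm: "p^3 \<ge> 27"
  proof -
    have "p^3 - 27 * (x * y * z) \<ge> 0"
    proof -
      have "2 * (p^3 - 27 * (x * y * z)) = (x + y + z) * ((x - y)^2 + (y - z)^2 + (z - x)^2)
          + 6 * (x * (y - z)^2 + y * (z - x)^2 + z * (x - y)^2)"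
        by (simp add: p_def power2_eq_square power3_eq_cube algebra_simps)
      also have "\<dots> \<ge> 0" using pos by (intro add_nonneg_nonneg mult_nonneg_nonneg) auto
      finally show ?thesis by simp
    qed
    then show ?thesis using xyz by simp
  qed
  have "p \<ge> 3"
  proof (rule ccontr)
    assume "\<not> p \<ge> 3"
    then have "p^3 < 3^3" using p0 by (intro power_strict_mono) auto
    then show False using amgm by simp
  qed
  have "4 * p * ((x * y + y * z + z * x) - p^2 / 4) \<le> 9 * (x * y * z)"
    using schur by (simp add: p_def power2_eq_square algebra_simps)
  then have "4 * p * ((x * y + y * z + z * x) - p^2 / 4) \<le> 9" using xyz by simp
  also have "9 \<le> 4 * p * (3 / 4)" using \<open>p \<ge> 3\<close> by simp
  finally have "(x * y + y * z + z * x) - p^2 / 4 \<le> 3 / 4"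
    using p0 by (simp add: mult_le_cancel_left_pos)
  then show ?thesis by (simp add: p_def power2_eq_square field_simps)
qed

text \<open>Every metric is diagonal in a frame of the standard metric, and its volume is the product of the
eigenvalues; so statements about all metrics reduce to \<open>diag_curvature\<close>.\<close>

lemma metrics_1_diagonal:
  assumes "g \<in> metrics_1 br"
  obtains f x where "frame Q f" "\<And>i j. metric_form g (f i) (f j) = (if i = j then x i else 0)"
    "\<And>i. x i > 0" "prod x UNIV = 1" "scalar_curvature br g = diag_curvature f x"
proof -
  have g: "is_metric g" and det: "det g / det Q = 1" using assms unfolding metrics_1_def by blast+
  then have "transpose g = g" by (simp add: is_metric_def)
  then obtain f where f: "frame Q f" "\<And>i j. i \<noteq> j \<Longrightarrow> metric_form g (f i) (f j) = 0"
    using simultaneous_frame[OF is_metric_standard] by metis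
  define x where "x i = metric_form g (f i) (f i)" for i
  have diag: "metric_form g (f i) (f j) = (if i = j then x i else 0)" for i j
    using f(2) by (simp add: x_def)
  have "x i > 0" for i
  proof -
    have "q (f i) (f i) = 1" using f(1) by (simp add: frame_def)
    then have "f i \<noteq> 0" by (auto simp: metric_form_simps)
    then show ?thesis using g by (simp add: is_metric_def x_def)
  qed
  moreover have "prod x UNIV = 1" using det_ratio_diagonal[OF f] det by (simp add: x_def)
  ultimately show ?thesis using that[OF f(1) diag] scalar_curvature_diagonal[OF g f(1) diag] by blast
qed

lemma exists_distinct_triple: "\<exists>a b c::'n. a \<noteq> b \<and> b \<noteq> c \<and> a \<noteq> c"
proof (rule ccontr)
  assume no: "\<not> ?thesis"
  obtain f where f: "frame Q f" by (rule standard_frame_exists)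
  have "struct_const f i j k = 0" for i j k
    using no struct_const_refl[of f] struct_const_cyclic[of f] by metis
  then show False using sum_struct_const[OF f] by simp
qed

text \<open>Up to sign there is a single structure constant, with square \<open>1 / 2\<close>. The curvature becomes the
left-hand side of \<open>schur_bound\<close>, so the standard metric is even a global maximum point.\<close>

theorem local_max_of_dim_3:
  assumes "CARD('n) = 3"
  shows "local_max_point (scalar_curvature br) (metrics_1 br) Q"
proof -
  have "scalar_curvature br g \<le> scalar_curvature br Q" if g: "g \<in> metrics_1 br" for g
  proof -
    obtain f x where f: "frame Q f" and x: "\<And>i. x i > 0" "prod x UNIV = 1" and S: "scalar_curvature br g = diag_curvature f x"
      using metrics_1_diagonal[OF g] by metis
    obtain a b c :: 'n where abc: "a \<noteq> b" "b \<noteq> c" "a \<noteq> c" using exists_distinct_triple by blast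
    have U: "UNIV = {a, b, c}"
      using abc assms by (intro sym[OF card_subset_eq]) auto
    define C where "C = (struct_const f a b c)^2"
    have cyc: "(struct_const f a b c)^2 = C" "(struct_const f b c a)^2 = C" "(struct_const f c a b)^2 = C"
      "(struct_const f b a c)^2 = C" "(struct_const f a c b)^2 = C" "(struct_const f c b a)^2 = C"
      using struct_const_cyclic[of f a b c] struct_const_cyclic[of f b c a] struct_const_skew[of f a b c]
        struct_const_skew[of f c a b] struct_const_skew[of f b c a] by (auto simp: C_def)
    have zero: "struct_const f i i k = 0" "struct_const f i k i = 0" "struct_const f k i i = 0" for i k
      using struct_const_refl[of f i k] struct_const_cyclic[of f i i k] struct_const_cyclic[of f i k i] by auto
    have "2 * C = 1"
      using sum_struct_const[OF f, of a] abc unfolding U by (simp add: zero cyc)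
    then have C: "C = 1 / 2" by simp
    have xyz: "x a * x b * x c = 1" using x(2) abc unfolding U by (simp add: mult.assoc)
    have inv: "1 / x a = x b * x c" "1 / x b = x c * x a" "1 / x c = x a * x b"
      using xyz x(1)[of a] x(1)[of b] x(1)[of c] by (simp_all add: field_simps)
    have ratio: "x a / (x b * x c) = (x a)^2" "x b / (x c * x a) = (x b)^2" "x c / (x a * x b) = (x c)^2"
      unfolding inv[symmetric] by (simp_all add: power2_eq_square)
    have ratio': "x a / (x c * x b) = (x a)^2" "x b / (x a * x c) = (x b)^2" "x c / (x b * x a) = (x c)^2"
      using ratio by (simp_all add: mult.commute)
    have "diag_curvature f x = (x a * x b + x b * x c + x c * x a) / 2 - ((x a)^2 + (x b)^2 + (x c)^2) / 4"
      unfolding diag_curvature_def U using abc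
      by (simp add: zero cyc C inv ratio ratio' field_simps)
    also have "\<dots> \<le> 3 / 4" by (rule schur_bound) (use x xyz in auto)
    finally show ?thesis using S scalar_curvature_standard assms by simp
  qed
  then show ?thesis
    using standard_in_metrics_1 by (simp add: local_max_point_def eventually_at_filter)
qed

section \<open>The standard metric is critical\<close>

text \<open>The frame that diagonalises \<open>g\<close> varies with \<open>g\<close>, so the curvature is compared directly rather than
differentiated along a family: in logarithmic eigenvalues \<open>t\<close> the first-order term is
\<open>- sum t UNIV / 4\<close>, which is zero by the volume condition, and the remainder is quadratic uniformly in
the frame.\<close>

lemma curvature_quadratic_bound:
  "\<exists>C \<epsilon>. \<epsilon> > 0 \<and> C \<ge> 0 \<and> (\<forall>g\<in>metrics_1 br. norm (g - Q) < \<epsilon> \<longrightarrow>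
      \<bar>scalar_curvature br g - scalar_curvature br Q\<bar> \<le> C * (norm (g - Q))^2)"
proof -
  obtain m where m: "m > 0" "\<And>x. m * (norm x)^2 \<le> q x x"
    using metric_lower_bound[OF is_metric_standard] by blast
  define n where "n = real (CARD('n))"
  have n: "n > 0" by (simp add: n_def)
  define L where "L = n^2 / m"
  have L: "L > 0" using n m by (simp add: L_def)
  \<comment> \<open>The eigenvalues of \<open>g\<close> differ from \<open>1\<close> by at most \<open>\<eta> = L * norm (g - Q)\<close>. Within this radius all
    exponents below are bounded by \<open>6 * \<eta> \<le> 1 / 2\<close>.\<close>
  define \<epsilon> where "\<epsilon> = 1 / (12 * L)"
  have "\<bar>scalar_curvature br g - scalar_curvature br Q\<bar> \<le> (22 * n * L^2) * (norm (g - Q))^2"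
    if g: "g \<in> metrics_1 br" and near: "norm (g - Q) < \<epsilon>" for g
  proof -
    obtain f x where f: "frame Q f" and diag: "\<And>i j. metric_form g (f i) (f j) = (if i = j then x i else 0)"
      and x: "\<And>i. x i > 0" "prod x UNIV = 1" and S: "scalar_curvature br g = diag_curvature f x"
      using metrics_1_diagonal[OF g] by metis
    define \<eta> where "\<eta> = L * norm (g - Q)"
    have \<eta>: "0 \<le> \<eta>" "\<eta> < 1/12" using near L by (auto simp: \<eta>_def \<epsilon>_def field_simps)
    have dx: "\<bar>x i - 1\<bar> \<le> \<eta>" for i
    proof -
      have q1: "q (f i) (f i) = 1" using f by (simp add: frame_def)
      then have "m * (norm (f i))^2 \<le> 1" using m(2)[of "f i"] by simp
      then have nf: "(norm (f i))^2 \<le> 1 / m" using m(1) by (simp add: field_simps)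
      have "x i - 1 = metric_form (g - Q) (f i) (f i)"
        using diag[of i i] q1 by (simp add: metric_form_def matrix_vector_mult_diff_rdistrib inner_diff_right)
      also have "\<bar>\<dots>\<bar> \<le> n^2 * norm (g - Q) * (norm (f i))^2"
        using metric_form_le_norm[of "g - Q" "f i"] by (simp add: n_def)
      also have "\<dots> \<le> n^2 * norm (g - Q) * (1 / m)" by (intro mult_left_mono nf) auto
      finally show ?thesis by (simp add: \<eta>_def L_def)
    qed
    define t where "t i = ln (x i)" for i
    have tb: "\<bar>t i\<bar> \<le> 2 * \<eta>" for i
    proof -
      have a: "\<bar>x i - 1\<bar> \<le> 1 / 2" using dx[of i] \<eta> by linarith
      have "\<bar>ln (1 + (x i - 1)) - (x i - 1)\<bar> \<le> 2 * (x i - 1)^2"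
        using a by (rule abs_ln_one_plus_x_minus_x_bound)
      moreover have "2 * (x i - 1)^2 \<le> \<bar>x i - 1\<bar>"
      proof -
        have "\<bar>x i - 1\<bar> * \<bar>x i - 1\<bar> \<le> \<bar>x i - 1\<bar> * (1 / 2)" using a by (intro mult_left_mono) auto
        then show ?thesis by (simp add: power2_eq_square abs_mult[symmetric])
      qed
      ultimately show ?thesis using dx[of i] unfolding t_def by simp
    qed
    have "ln (prod x UNIV) = sum t UNIV" unfolding t_def by (intro ln_prod finite_class.finite_UNIV) (metis x(1) less_irrefl)
    then have sum_t: "sum t UNIV = 0" using x(2) by simp
    have S1: "scalar_curvature br g = curvature_deriv f t 0 1"
      unfolding S curvature_deriv_0 using x(1) by (simp add: t_def)
    have S0: "scalar_curvature br Q = curvature_deriv f t 0 0"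
      using scalar_curvature_exp_metric[OF f, of t 0] exp_metric_zero[OF f] by simp
    have D1: "curvature_deriv f t 1 0 = 0" unfolding curvature_deriv_1[OF f] sum_t by simp
    define R where "R u = exp u - 1 - u" for u :: real
    have "scalar_curvature br g - scalar_curvature br Q = curvature_deriv f t 0 1 - curvature_deriv f t 0 0 - curvature_deriv f t 1 0"
      unfolding S1 S0 D1 by simp
    also have "\<dots> = (\<Sum>i\<in>UNIV. R (- t i)) / 2 - triple_sum f (\<lambda>i j k. R (t k - t i - t j)) / 4"
      unfolding R_def
      by (simp add: curvature_deriv_def triple_sum_diff sum_subtractf sum.distrib sum_negf diff_divide_distrib)
    also have "\<bar>\<dots>\<bar> \<le> \<bar>(\<Sum>i\<in>UNIV. R (- t i))\<bar> / 2 + \<bar>triple_sum f (\<lambda>i j k. R (t k - t i - t j))\<bar> / 4"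
      by linarith
    also have "\<dots> \<le> (n * (8 * \<eta>^2)) / 2 + (n * (72 * \<eta>^2)) / 4"
    proof -
      have Rb: "\<bar>R u\<bar> \<le> 2 * b^2" if "\<bar>u\<bar> \<le> b" "b \<le> 1/2" for u b
      proof -
        have "u^2 \<le> b^2" using that by (simp add: abs_le_square_iff[symmetric])
        moreover have "u \<le> 1/2" using that by linarith
        ultimately show ?thesis using exp_linear_error[of u] unfolding R_def by linarith
      qed
      have "\<bar>\<Sum>i\<in>UNIV. R (- t i)\<bar> \<le> (\<Sum>i\<in>(UNIV::'n set). 8 * \<eta>^2)"
      proof (rule order_trans[OF sum_abs], intro sum_mono)
        fix i show "\<bar>R (- t i)\<bar> \<le> 8 * \<eta>^2"
          using Rb[of "- t i" "2 * \<eta>"] tb[of i] \<eta> by (simp add: power_mult_distrib)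
      qed
      moreover have "\<bar>triple_sum f (\<lambda>i j k. R (t k - t i - t j))\<bar> \<le> triple_sum f (\<lambda>i j k. 72 * \<eta>^2)"
        unfolding triple_sum_def
      proof (rule order_trans[OF sum_abs], intro sum_mono, rule order_trans[OF sum_abs], intro sum_mono,
          rule order_trans[OF sum_abs], intro sum_mono)
        fix i j k
        have "\<bar>t k - t i - t j\<bar> \<le> 6 * \<eta>" using tb[of i] tb[of j] tb[of k] by linarith
        then have "\<bar>R (t k - t i - t j)\<bar> \<le> 72 * \<eta>^2"
          using Rb[of "t k - t i - t j" "6 * \<eta>"] \<eta> by (simp add: power_mult_distrib)
        then show "\<bar>(struct_const f i j k)^2 * R (t k - t i - t j)\<bar> \<le> (struct_const f i j k)^2 * (72 * \<eta>^2)"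
          by (simp add: abs_mult mult_left_mono)
      qed
      moreover have "triple_sum f (\<lambda>i j k. 72 * \<eta>^2) = n * (72 * \<eta>^2)"
        using triple_sum_single(1)[OF f, of "\<lambda>_. 72 * \<eta>^2"] by (simp add: n_def)
      ultimately show ?thesis by (simp add: n_def)
    qed
    also have "\<dots> = (22 * n * L^2) * (norm (g - Q))^2" by (simp add: \<eta>_def power_mult_distrib)
    finally show ?thesis .
  qed
  moreover have "\<epsilon> > 0" "22 * n * L^2 \<ge> 0" using L n by (simp_all add: \<epsilon>_def)
  ultimately show ?thesis by blast
qed

theorem standard_critical: "critical_point (scalar_curvature br) (metrics_1 br) Q"
  unfolding critical_point_def
proof (intro conjI allI impI)
  show "Q \<in> metrics_1 br" by (rule standard_in_metrics_1)
  fix \<gamma> :: "real \<Rightarrow> real^'n^'n"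
  assume \<gamma>: "range \<gamma> \<subseteq> metrics_1 br \<and> \<gamma> 0 = Q \<and> \<gamma> differentiable at 0"
  obtain C \<epsilon> where C: "\<epsilon> > 0" "C \<ge> 0" "\<And>g. g \<in> metrics_1 br \<Longrightarrow> norm (g - Q) < \<epsilon> \<Longrightarrow>
      \<bar>scalar_curvature br g - scalar_curvature br Q\<bar> \<le> C * (norm (g - Q))^2"
    using curvature_quadratic_bound by blast
  obtain D where D: "(\<gamma> has_derivative D) (at 0)" using \<gamma> unfolding differentiable_def by blast
  obtain K where K: "K > 0" "\<And>s. norm (D s) \<le> norm s * K"
    using bounded_linear.pos_bounded[OF has_derivative_bounded_linear[OF D]] by blast
  obtain \<delta> where \<delta>: "\<delta> > 0" "\<And>s. norm (s - 0) < \<delta> \<Longrightarrow> norm (\<gamma> s - \<gamma> 0 - D (s - 0)) \<le> 1 * norm (s - 0)"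
    using D unfolding has_derivative_at_alt by (metis zero_less_one)
  define r where "r = min \<delta> (\<epsilon> / (K + 1))"
  have r: "r > 0" using \<delta>(1) C(1) K(1) by (simp add: r_def)
  have lip: "norm (\<gamma> s - Q) \<le> (K + 1) * \<bar>s\<bar>" if "\<bar>s\<bar> < r" for s
  proof -
    have "norm (\<gamma> s - Q) \<le> norm (\<gamma> s - \<gamma> 0 - D s) + norm (D s)"
      using norm_triangle_ineq[of "\<gamma> s - \<gamma> 0 - D s" "D s"] \<gamma> by simp
    also have "\<dots> \<le> \<bar>s\<bar> + \<bar>s\<bar> * K" using \<delta>(2)[of s] K(2)[of s] that by (simp add: r_def)
    finally show ?thesis by (simp add: algebra_simps)
  qed
  have "((\<lambda>s. (scalar_curvature br (\<gamma> s) - scalar_curvature br (\<gamma> 0)) / s) \<longlongrightarrow> 0) (at 0)"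
  proof -
    have "\<bar>(scalar_curvature br (\<gamma> s) - scalar_curvature br (\<gamma> 0)) / s\<bar> \<le> (C * (K + 1)^2) * \<bar>s\<bar>"
      if s: "s \<noteq> 0" "\<bar>s\<bar> < r" for s
    proof -
      have "(K + 1) * \<bar>s\<bar> < \<epsilon>" using s(2) K(1) by (simp add: r_def field_simps)
      then have "norm (\<gamma> s - Q) < \<epsilon>" using lip[OF s(2)] by linarith
      then have "\<bar>scalar_curvature br (\<gamma> s) - scalar_curvature br Q\<bar> \<le> C * (norm (\<gamma> s - Q))^2"
        using C(3)[of "\<gamma> s"] \<gamma> by blast
      also have "\<dots> \<le> C * ((K + 1) * \<bar>s\<bar>)^2"
        using lip[OF s(2)] C(2) by (intro mult_left_mono power_mono) auto
      also have "\<dots> = (C * (K + 1)^2 * \<bar>s\<bar>) * \<bar>s\<bar>" by (simp add: power_mult_distrib power2_eq_square)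
      finally show ?thesis using s(1) \<gamma> by (simp add: abs_divide divide_le_eq)
    qed
    then have ub: "\<forall>\<^sub>F s in at 0. \<bar>(scalar_curvature br (\<gamma> s) - scalar_curvature br (\<gamma> 0)) / s\<bar> \<le> (C * (K + 1)^2) * \<bar>s\<bar>"
      unfolding eventually_at using r by (intro exI[of _ r]) (auto simp: dist_norm)
    have "((\<lambda>s. (C * (K + 1)^2) * \<bar>s\<bar>) \<longlongrightarrow> (C * (K + 1)^2) * \<bar>0\<bar>) (at (0::real))"
      by (intro tendsto_intros)
    then have lim: "((\<lambda>s. (C * (K + 1)^2) * \<bar>s\<bar>) \<longlongrightarrow> 0) (at (0::real))" by simp
    show ?thesis
      by (rule tendsto_rabs_zero_cancel, rule tendsto_sandwich[OF _ ub tendsto_const lim]) simp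
  qed
  then show "((\<lambda>s. scalar_curvature br (\<gamma> s)) has_real_derivative 0) (at 0)"
    by (simp add: has_field_derivative_iff)
qed

end

section \<open>Germs of smooth maps\<close>

text \<open>Only the germ of a coordinate expression matters for derivatives at the identity, and working with
germs avoids tracking domains.\<close>

definition smooth_near :: "('a::euclidean_space \<Rightarrow> 'b::euclidean_space) \<Rightarrow> 'a \<Rightarrow> bool" where
  "smooth_near f p \<longleftrightarrow> (\<exists>S. p \<in> S \<and> smooth_on f S)"

lemma smooth_near_eventually: "smooth_near f p \<Longrightarrow> \<forall>\<^sub>F x in nhds p. smooth_near f x"
  unfolding smooth_near_def eventually_nhds by (auto simp: smooth_on_def)

lemma smooth_near_cong:
  assumes "smooth_near f p" "\<forall>\<^sub>F x in nhds p. f x = g x" shows "smooth_near g p"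
proof -
  obtain S where S: "p \<in> S" "open S" "\<And>k. Ck_on k f S" using assms(1) by (auto simp: smooth_near_def smooth_on_def)
  obtain U where U: "open U" "p \<in> U" "\<And>x. x \<in> U \<Longrightarrow> f x = g x" using assms(2) unfolding eventually_nhds by blast
  have "Ck_on k g (S \<inter> U)" for k
    by (rule Ck_on_cong[OF _ _ Ck_on_subset[OF S(3)]]) (use S U in auto)
  then show ?thesis using S U unfolding smooth_near_def smooth_on_def by (intro exI[of _ "S \<inter> U"]) auto
qed

lemma smooth_near_comp:
  assumes "smooth_near f p" "smooth_near g (f p)" shows "smooth_near (\<lambda>x. g (f x)) p"
proof -
  obtain S where S: "p \<in> S" "open S" "\<And>k. Ck_on k f S" using assms(1) by (auto simp: smooth_near_def smooth_on_def)
  obtain U where U: "f p \<in> U" "open U" "\<And>k. Ck_on k g U" using assms(2) by (auto simp: smooth_near_def smooth_on_def)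
  have "continuous_on S f" using S(3)[of 0] by simp
  then have o: "open (S \<inter> f -` U)" using S(2) U(2) by (simp add: continuous_on_open_vimage Int_commute)
  have "Ck_on k (\<lambda>x. g (f x)) (S \<inter> f -` U)" for k
    by (rule Ck_on_comp[OF o U(2) Ck_on_subset[OF S(3)] U(3)]) auto
  then show ?thesis using o S U unfolding smooth_near_def smooth_on_def by (intro exI[of _ "S \<inter> f -` U"]) auto
qed

lemma smooth_near_linear: "bounded_linear f \<Longrightarrow> smooth_near f p"
  unfolding smooth_near_def smooth_on_def using Ck_on_linear[of f UNIV] by blast

lemma smooth_near_const: "smooth_near (\<lambda>x. c) p"
  unfolding smooth_near_def smooth_on_def using Ck_on_const[of UNIV] by blast

lemma smooth_near_Pair:
  assumes "smooth_near f p" "smooth_near g p" shows "smooth_near (\<lambda>x. (f x, g x)) p"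
proof -
  obtain S where S: "p \<in> S" "open S" "\<And>k. Ck_on k f S" using assms(1) by (auto simp: smooth_near_def smooth_on_def)
  obtain U where U: "p \<in> U" "open U" "\<And>k. Ck_on k g U" using assms(2) by (auto simp: smooth_near_def smooth_on_def)
  have "Ck_on k (\<lambda>x. (f x, g x)) (S \<inter> U)" for k
    by (rule Ck_on_Pair[OF _ Ck_on_subset[OF S(3)] Ck_on_subset[OF U(3)]]) (use S U in auto)
  then show ?thesis using S U unfolding smooth_near_def smooth_on_def by (intro exI[of _ "S \<inter> U"]) auto
qed

lemma smooth_near_bilinear:
  fixes prod :: "'b::euclidean_space \<Rightarrow> 'c::euclidean_space \<Rightarrow> 'd::euclidean_space"
  assumes "bounded_bilinear prod" "smooth_near f p" "smooth_near g p"
  shows "smooth_near (\<lambda>x. prod (f x) (g x)) p"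
proof -
  obtain S where S: "p \<in> S" "open S" "\<And>k. Ck_on k f S" using assms(2) by (auto simp: smooth_near_def smooth_on_def)
  obtain U where U: "p \<in> U" "open U" "\<And>k. Ck_on k g U" using assms(3) by (auto simp: smooth_near_def smooth_on_def)
  have "Ck_on k (\<lambda>x. prod (f x) (g x)) (S \<inter> U)" for k
    by (rule Ck_on_bilinear[OF assms(1) _ Ck_on_subset[OF S(3)] Ck_on_subset[OF U(3)]]) (use S U in auto)
  then show ?thesis using S U unfolding smooth_near_def smooth_on_def by (intro exI[of _ "S \<inter> U"]) auto
qed

lemma smooth_near_has_derivative:
  assumes "smooth_near f p" shows "(f has_derivative frechet_derivative f (at p)) (at p)"
  using assms Ck_on_has_derivative[of 0 f _ p] unfolding smooth_near_def smooth_on_def by blast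

lemma smooth_near_linear_derivative: "smooth_near f p \<Longrightarrow> linear (frechet_derivative f (at p))"
  using smooth_near_has_derivative has_derivative_linear by blast

lemma smooth_near_derivative:
  assumes "smooth_near f p" shows "smooth_near (\<lambda>x. frechet_derivative f (at x) v) p"
proof -
  obtain S where S: "p \<in> S" "open S" "\<And>k. Ck_on k f S" using assms by (auto simp: smooth_near_def smooth_on_def)
  have "Ck_on k (\<lambda>x. frechet_derivative f (at x) v) S" for k using S(3)[of "Suc k"] by simp
  then show ?thesis using S unfolding smooth_near_def smooth_on_def by blast
qed

lemma smooth_near_isCont: "smooth_near f p \<Longrightarrow> isCont f p"
  using smooth_near_has_derivative has_derivative_continuous by blast

lemma isCont_eventually_nhds:
  assumes "isCont f p" "\<forall>\<^sub>F y in nhds (f p). P y" shows "\<forall>\<^sub>F x in nhds p. P (f x)"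
proof -
  have "filterlim f (nhds (f p)) (nhds p)"
    using assms(1) tendsto_at_iff_tendsto_nhds[of f p] unfolding isCont_def by blast
  then show ?thesis using assms(2) unfolding filterlim_iff by blast
qed

lemma has_derivative_cong_nhds:
  assumes "\<forall>\<^sub>F x in nhds p. f x = g x" "(f has_derivative D) (at p)" shows "(g has_derivative D) (at p)"
proof -
  obtain U where "open U" "p \<in> U" "\<And>x. x \<in> U \<Longrightarrow> f x = g x" using assms(1) unfolding eventually_nhds by blast
  then show ?thesis using has_derivative_transform_within_open[OF assms(2)] by blast
qed

lemma frechet_derivative_cong:
  assumes "\<forall>\<^sub>F x in nhds p. f x = g x" shows "frechet_derivative f (at p) = frechet_derivative g (at p)"
proof -
  have "\<forall>\<^sub>F x in nhds p. g x = f x" using assms by (rule eventually_mono) simp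
  then have "(f has_derivative D) (at p) \<longleftrightarrow> (g has_derivative D) (at p)" for D
    using has_derivative_cong_nhds assms by blast
  then show ?thesis unfolding frechet_derivative_def by simp
qed

lemma frechet_derivative_chain:
  assumes "smooth_near f p" "smooth_near g (f p)"
  shows "frechet_derivative (\<lambda>x. g (f x)) (at p) v = frechet_derivative g (at (f p)) (frechet_derivative f (at p) v)"
  using frechet_derivative_at[OF has_derivative_compose[OF smooth_near_has_derivative[OF assms(1)] smooth_near_has_derivative[OF assms(2)]]]
  by metis

lemma eventually_nhds_prod_iterated:
  assumes "\<forall>\<^sub>F p in nhds (a, b). P p"
  shows "\<forall>\<^sub>F x in nhds a. \<forall>\<^sub>F y in nhds b. P (x, y)"
proof -
  obtain S where S: "open S" "(a, b) \<in> S" "\<And>p. p \<in> S \<Longrightarrow> P p" using assms unfolding eventually_nhds by blast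
  obtain A B where AB: "open A" "open B" "a \<in> A" "b \<in> B" "A \<times> B \<subseteq> S" using open_prod_elim[OF S(1,2)] by (metis mem_Sigma_iff)
  show ?thesis unfolding eventually_nhds
    using AB S(3) by (intro exI[of _ A]) (auto simp: subset_iff intro!: exI[of _ B])
qed

lemma smooth_near_second_derivative_symmetric:
  assumes "smooth_near f p"
  shows "frechet_derivative (\<lambda>x. frechet_derivative f (at x) v) (at p) w =
    frechet_derivative (\<lambda>x. frechet_derivative f (at x) w) (at p) v"
proof -
  obtain S where S: "p \<in> S" "open S" "\<And>k. Ck_on k f S" using assms by (auto simp: smooth_near_def smooth_on_def)
  show ?thesis
    by (rule second_derivative_symmetric[OF S(2,1) Ck_on_has_derivative[OF S(3) S(2)]])
      (use smooth_near_has_derivative[OF smooth_near_derivative[OF assms]] in auto)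
qed

section \<open>The infinitesimal structure of a local multiplication\<close>

text \<open>Throughout, \<open>m\<close> is a multiplication defined near \<open>(e, e)\<close>. \<open>deriv_right m e x Y\<close> is the value at
\<open>x\<close> of the left-invariant field through \<open>Y\<close>, and \<open>deriv_left\<close> belongs to right-invariant fields.\<close>

definition deriv_right :: "('a::euclidean_space \<times> 'a \<Rightarrow> 'a) \<Rightarrow> 'a \<Rightarrow> 'a \<Rightarrow> 'a \<Rightarrow> 'a" where
  "deriv_right m e x Y = frechet_derivative (\<lambda>y. m (x, y)) (at e) Y"

definition deriv_left :: "('a::euclidean_space \<times> 'a \<Rightarrow> 'a) \<Rightarrow> 'a \<Rightarrow> 'a \<Rightarrow> 'a \<Rightarrow> 'a" where
  "deriv_left m e y X = frechet_derivative (\<lambda>x. m (x, y)) (at e) X"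

definition local_bracket :: "('a::euclidean_space \<times> 'a \<Rightarrow> 'a) \<Rightarrow> 'a \<Rightarrow> 'a \<Rightarrow> 'a \<Rightarrow> 'a" where
  "local_bracket m e X Y = frechet_derivative (\<lambda>x. deriv_right m e x Y) (at e) X
     - frechet_derivative (\<lambda>x. deriv_right m e x X) (at e) Y"

lemma smooth_near_slice:
  assumes "smooth_near m (x, y)"
  shows "smooth_near (\<lambda>v. m (x, v)) y" "smooth_near (\<lambda>u. m (u, y)) x"
    "frechet_derivative (\<lambda>v. m (x, v)) (at y) Y = frechet_derivative m (at (x, y)) (0, Y)"
    "frechet_derivative (\<lambda>u. m (u, y)) (at x) Y = frechet_derivative m (at (x, y)) (Y, 0)"
proof -
  have 1: "smooth_near (\<lambda>v. (x, v)) y" "smooth_near (\<lambda>u. (u, y)) x"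
    by (intro smooth_near_Pair smooth_near_const smooth_near_linear bounded_linear_ident)+
  show "smooth_near (\<lambda>v. m (x, v)) y" by (rule smooth_near_comp[OF 1(1)]) (rule assms)
  show "smooth_near (\<lambda>u. m (u, y)) x" by (rule smooth_near_comp[OF 1(2)]) (rule assms)
  have d: "frechet_derivative (\<lambda>v. (x, v)) (at y) = (\<lambda>Y. (0, Y))" "frechet_derivative (\<lambda>u. (u, y)) (at x) = (\<lambda>Y. (Y, 0))"
    by (rule frechet_derivative_at[symmetric]; auto intro!: derivative_eq_intros)+
  show "frechet_derivative (\<lambda>v. m (x, v)) (at y) Y = frechet_derivative m (at (x, y)) (0, Y)"
    using frechet_derivative_chain[OF 1(1) assms, of Y] d(1) by simp
  show "frechet_derivative (\<lambda>u. m (u, y)) (at x) Y = frechet_derivative m (at (x, y)) (Y, 0)"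
    using frechet_derivative_chain[OF 1(2) assms, of Y] d(2) by simp
qed

lemma deriv_right_eq:
  assumes "smooth_near m (e, e)"
  shows "\<forall>\<^sub>F x in nhds e. deriv_right m e x Y = frechet_derivative m (at (x, e)) (0, Y)"
    "\<forall>\<^sub>F x in nhds e. smooth_near (\<lambda>y. m (x, y)) e" "smooth_near (\<lambda>x. deriv_right m e x Y) e"
proof -
  have ev: "\<forall>\<^sub>F x in nhds e. smooth_near m (x, e)"
    using eventually_nhds_prod_iterated[OF smooth_near_eventually[OF assms]]
    by (rule eventually_mono) (auto dest: eventually_nhds_x_imp_x)
  show 1: "\<forall>\<^sub>F x in nhds e. deriv_right m e x Y = frechet_derivative m (at (x, e)) (0, Y)"
    using ev by (rule eventually_mono) (simp add: deriv_right_def smooth_near_slice(3))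
  show "\<forall>\<^sub>F x in nhds e. smooth_near (\<lambda>y. m (x, y)) e"
    using ev by (rule eventually_mono) (rule smooth_near_slice(1))
  have "smooth_near (\<lambda>x. frechet_derivative m (at (x, e)) (0, Y)) e"
    by (rule smooth_near_slice(2)[OF smooth_near_derivative[OF assms]])
  then show "smooth_near (\<lambda>x. deriv_right m e x Y) e"
    by (rule smooth_near_cong) (use 1 in \<open>auto elim: eventually_mono\<close>)
qed

lemma deriv_left_eq:
  assumes "smooth_near m (e, e)"
  shows "\<forall>\<^sub>F y in nhds e. deriv_left m e y Y = frechet_derivative m (at (e, y)) (Y, 0)"
    "\<forall>\<^sub>F y in nhds e. smooth_near (\<lambda>x. m (x, y)) e" "smooth_near (\<lambda>y. deriv_left m e y Y) e"
proof -
  have ev: "\<forall>\<^sub>F y in nhds e. smooth_near m (e, y)"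
    using eventually_nhds_x_imp_x[OF eventually_nhds_prod_iterated[OF smooth_near_eventually[OF assms]]] .
  show 1: "\<forall>\<^sub>F y in nhds e. deriv_left m e y Y = frechet_derivative m (at (e, y)) (Y, 0)"
    using ev by (rule eventually_mono) (simp add: deriv_left_def smooth_near_slice(4))
  show "\<forall>\<^sub>F y in nhds e. smooth_near (\<lambda>x. m (x, y)) e"
    using ev by (rule eventually_mono) (rule smooth_near_slice(2))
  have "smooth_near (\<lambda>y. frechet_derivative m (at (e, y)) (Y, 0)) e"
    by (rule smooth_near_slice(1)[OF smooth_near_derivative[OF assms]])
  then show "smooth_near (\<lambda>y. deriv_left m e y Y) e"
    by (rule smooth_near_cong) (use 1 in \<open>auto elim: eventually_mono\<close>)
qed

lemma linear_in_parameter_derivative: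
  assumes "\<And>Y. smooth_near (\<lambda>x. F x Y) e" "\<forall>\<^sub>F x in nhds e. linear (F x)"
  shows "linear (\<lambda>Y. frechet_derivative (\<lambda>x. F x Y) (at e) X)"
proof (rule linearI)
  fix Y Z and r :: real
  note d = smooth_near_has_derivative[OF assms(1)]
  have "frechet_derivative (\<lambda>x. F x (Y + Z)) (at e) = frechet_derivative (\<lambda>x. F x Y + F x Z) (at e)"
    by (rule frechet_derivative_cong) (use assms(2) in \<open>auto elim: eventually_mono simp: linear_add\<close>)
  also have "\<dots> = (\<lambda>X. frechet_derivative (\<lambda>x. F x Y) (at e) X + frechet_derivative (\<lambda>x. F x Z) (at e) X)"
    by (rule frechet_derivative_at[symmetric], rule has_derivative_add[OF d d])
  finally show "frechet_derivative (\<lambda>x. F x (Y + Z)) (at e) X = frechet_derivative (\<lambda>x. F x Y) (at e) X + frechet_derivative (\<lambda>x. F x Z) (at e) X"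
    by simp
  have "frechet_derivative (\<lambda>x. F x (r *\<^sub>R Y)) (at e) = frechet_derivative (\<lambda>x. r *\<^sub>R F x Y) (at e)"
    by (rule frechet_derivative_cong) (use assms(2) in \<open>auto elim: eventually_mono simp: linear_scale\<close>)
  also have "\<dots> = (\<lambda>X. r *\<^sub>R frechet_derivative (\<lambda>x. F x Y) (at e) X)"
    by (rule frechet_derivative_at[symmetric], rule has_derivative_scaleR_right[OF d])
  finally show "frechet_derivative (\<lambda>x. F x (r *\<^sub>R Y)) (at e) X = r *\<^sub>R frechet_derivative (\<lambda>x. F x Y) (at e) X"
    by simp
qed

lemma bilinear_local_bracket:
  assumes m: "smooth_near m (e, e)"
  shows "bilinear (local_bracket m e)" "local_bracket m e Y X = - local_bracket m e X Y"
proof -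
  have "\<forall>\<^sub>F x in nhds e. linear (deriv_right m e x)"
    using deriv_right_eq(2)[OF m] unfolding deriv_right_def
    by (rule eventually_mono) (auto intro: smooth_near_linear_derivative)
  then have 1: "linear (\<lambda>Y. frechet_derivative (\<lambda>x. deriv_right m e x Y) (at e) X)" for X
    by (intro linear_in_parameter_derivative deriv_right_eq(3)[OF m])
  have 2: "linear (frechet_derivative (\<lambda>x. deriv_right m e x Y) (at e))" for Y
    by (rule smooth_near_linear_derivative[OF deriv_right_eq(3)[OF m]])
  show "bilinear (local_bracket m e)"
    unfolding bilinear_def local_bracket_def
    by (auto intro!: linearI simp: linear_add[OF 1] linear_add[OF 2] linear_scale[OF 1] linear_scale[OF 2] algebra_simps)
  show "local_bracket m e Y X = - local_bracket m e X Y" by (simp add: local_bracket_def)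
qed

lemma deriv_right_unit:
  assumes "\<forall>\<^sub>F y in nhds e. m (e, y) = y" shows "deriv_right m e e Y = Y"
proof -
  have "frechet_derivative (\<lambda>y. m (e, y)) (at e) = frechet_derivative (\<lambda>y. y) (at e)"
    by (rule frechet_derivative_cong) (rule assms)
  then show ?thesis by (simp add: deriv_right_def)
qed

text \<open>The product rule for a varying linear map applied to a varying vector.\<close>

lemma has_derivative_apply:
  fixes \<phi> :: "'a::euclidean_space \<Rightarrow> 'b::euclidean_space" and w :: "'a \<Rightarrow> 'a"
  assumes \<phi>: "smooth_near \<phi> e" and w: "smooth_near w e"
  shows "((\<lambda>x. frechet_derivative \<phi> (at x) (w x)) has_derivative
    (\<lambda>X. frechet_derivative \<phi> (at e) (frechet_derivative w (at e) X)
      + frechet_derivative (\<lambda>x. frechet_derivative \<phi> (at x) (w e)) (at e) X)) (at e)"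
proof -
  let ?D = "\<lambda>x. frechet_derivative \<phi> (at x)"
  have lin: "\<forall>\<^sub>F x in nhds e. linear (?D x)"
    using smooth_near_eventually[OF \<phi>] by (rule eventually_mono) (rule smooth_near_linear_derivative)
  have rep: "D v = (\<Sum>b\<in>Basis. (v \<bullet> b) *\<^sub>R D b)" if "linear D" for D :: "'a \<Rightarrow> 'b" and v
  proof -
    have "D v = D (\<Sum>b\<in>Basis. (v \<bullet> b) *\<^sub>R b)" by (simp add: euclidean_representation)
    then show ?thesis by (simp add: linear_sum[OF that] linear_scale[OF that])
  qed
  note wd = smooth_near_has_derivative[OF w] and Dd = smooth_near_has_derivative[OF smooth_near_derivative[OF \<phi>]]
  have "((\<lambda>x. \<Sum>b\<in>Basis. (w x \<bullet> b) *\<^sub>R ?D x b) has_derivative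
     (\<lambda>X. \<Sum>b\<in>Basis. (w e \<bullet> b) *\<^sub>R frechet_derivative (\<lambda>x. ?D x b) (at e) X + (frechet_derivative w (at e) X \<bullet> b) *\<^sub>R ?D e b)) (at e)"
    by (intro has_derivative_sum has_derivative_scaleR has_derivative_inner_left wd Dd)
  moreover have "(\<Sum>b\<in>Basis. (w e \<bullet> b) *\<^sub>R frechet_derivative (\<lambda>x. ?D x b) (at e) X + (frechet_derivative w (at e) X \<bullet> b) *\<^sub>R ?D e b)
     = ?D e (frechet_derivative w (at e) X) + frechet_derivative (\<lambda>x. ?D x (w e)) (at e) X" for X
  proof -
    have "linear (\<lambda>Y. frechet_derivative (\<lambda>x. ?D x Y) (at e) X)"
      by (rule linear_in_parameter_derivative[OF smooth_near_derivative[OF \<phi>] lin])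
    then show ?thesis
      using rep[of "\<lambda>Y. frechet_derivative (\<lambda>x. ?D x Y) (at e) X" "w e"]
        rep[OF smooth_near_linear_derivative[OF \<phi>], of "frechet_derivative w (at e) X"]
      by (simp add: sum.distrib)
  qed
  ultimately have d: "((\<lambda>x. \<Sum>b\<in>Basis. (w x \<bullet> b) *\<^sub>R ?D x b) has_derivative
    (\<lambda>X. ?D e (frechet_derivative w (at e) X) + frechet_derivative (\<lambda>x. ?D x (w e)) (at e) X)) (at e)" by simp
  have ev: "\<forall>\<^sub>F x in nhds e. (\<Sum>b\<in>Basis. (w x \<bullet> b) *\<^sub>R ?D x b) = ?D x (w x)"
    using lin by (rule eventually_mono) (rule rep[symmetric])
  show ?thesis
    by (rule has_derivative_cong_nhds[OF ev d])
qed

text \<open>Left-invariant fields are related by \<open>\<phi>\<close>. Differentiating this relation produces a second derivative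
of \<open>\<phi>\<close>, which is symmetric and drops out of the commutator.\<close>

lemma local_homomorphism_bracket:
  assumes m: "smooth_near m (e, e)" and m': "smooth_near m' (\<phi> e, \<phi> e)" and \<phi>: "smooth_near \<phi> e"
    and hom: "\<forall>\<^sub>F p in nhds (e, e). \<phi> (m p) = m' (\<phi> (fst p), \<phi> (snd p))"
    and right_unit: "\<forall>\<^sub>F x in nhds e. m (x, e) = x" and left_unit: "\<forall>\<^sub>F y in nhds e. m (e, y) = y"
  shows "frechet_derivative \<phi> (at e) (local_bracket m e X Y) =
    local_bracket m' (\<phi> e) (frechet_derivative \<phi> (at e) X) (frechet_derivative \<phi> (at e) Y)"
proof -
  let ?D = "frechet_derivative \<phi> (at e)"
  have key: "?D (frechet_derivative (\<lambda>x. deriv_right m e x Y) (at e) X) + frechet_derivative (\<lambda>x. frechet_derivative \<phi> (at x) Y) (at e) X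
     = frechet_derivative (\<lambda>x. deriv_right m' (\<phi> e) x (?D Y)) (at (\<phi> e)) (?D X)" for X Y
  proof -
    have "isCont \<phi> e" using smooth_near_isCont[OF \<phi>] .
    then have ev': "\<forall>\<^sub>F x in nhds e. smooth_near (\<lambda>y. m' (\<phi> x, y)) (\<phi> e)"
      using isCont_eventually_nhds deriv_right_eq(2)[OF m'] by blast
    have ev: "\<forall>\<^sub>F x in nhds e. frechet_derivative \<phi> (at x) (deriv_right m e x Y) = deriv_right m' (\<phi> e) (\<phi> x) (?D Y)"
      using eventually_nhds_prod_iterated[OF hom] right_unit deriv_right_eq(2)[OF m] ev' smooth_near_eventually[OF \<phi>]
    proof eventually_elim
      case (elim x)
      have "frechet_derivative (\<lambda>y. \<phi> (m (x, y))) (at e) Y = frechet_derivative (\<lambda>y. m' (\<phi> x, \<phi> y)) (at e) Y"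
        using frechet_derivative_cong[where p = e and f = "\<lambda>y. \<phi> (m (x, y))" and g = "\<lambda>y. m' (\<phi> x, \<phi> y)"] elim(1) by simp
      moreover have "frechet_derivative (\<lambda>y. \<phi> (m (x, y))) (at e) Y = frechet_derivative \<phi> (at x) (deriv_right m e x Y)"
        using frechet_derivative_chain[OF elim(3), of \<phi> Y] elim(2,5) by (simp add: deriv_right_def)
      moreover have "frechet_derivative (\<lambda>y. m' (\<phi> x, \<phi> y)) (at e) Y = deriv_right m' (\<phi> e) (\<phi> x) (?D Y)"
        using frechet_derivative_chain[OF \<phi> elim(4), of Y] by (simp add: deriv_right_def)
      ultimately show ?case by simp
    qed
    have "frechet_derivative (\<lambda>x. frechet_derivative \<phi> (at x) (deriv_right m e x Y)) (at e) X
        = frechet_derivative (\<lambda>x. deriv_right m' (\<phi> e) (\<phi> x) (?D Y)) (at e) X"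
      using frechet_derivative_cong[OF ev] by simp
    moreover have "frechet_derivative (\<lambda>x. deriv_right m' (\<phi> e) (\<phi> x) (?D Y)) (at e) X
        = frechet_derivative (\<lambda>x. deriv_right m' (\<phi> e) x (?D Y)) (at (\<phi> e)) (?D X)"
      by (rule frechet_derivative_chain[OF \<phi> deriv_right_eq(3)[OF m']])
    ultimately show ?thesis
      using frechet_derivative_at[OF has_derivative_apply[OF \<phi> deriv_right_eq(3)[OF m, of Y]], symmetric]
      by (simp only: deriv_right_unit[OF left_unit])
  qed
  define W H R where "W X Y = frechet_derivative (\<lambda>x. deriv_right m e x Y) (at e) X"
    and "H X Y = frechet_derivative (\<lambda>x. frechet_derivative \<phi> (at x) Y) (at e) X"
    and "R X Y = frechet_derivative (\<lambda>x. deriv_right m' (\<phi> e) x (?D Y)) (at (\<phi> e)) (?D X)" for X Y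
  have "?D (W X Y) + H X Y = R X Y" "?D (W Y X) + H Y X = R Y X" "H X Y = H Y X"
    unfolding W_def H_def R_def by (rule key, rule key, rule smooth_near_second_derivative_symmetric[OF \<phi>])
  then have "?D (W X Y) - ?D (W Y X) = R X Y - R Y X" by (metis add_diff_cancel_right)
  then show ?thesis
    unfolding local_bracket_def linear_diff[OF smooth_near_linear_derivative[OF \<phi>]] W_def R_def .
qed

text \<open>Here \<open>a u\<close> is the adjoint action of \<open>u\<close>: left translation by \<open>u\<close> is right translation by \<open>u\<close> after
conjugation. Differentiating this relation at \<open>e\<close> gives the derivative of left translation minus
that of right translation; as mixed derivatives of \<open>m\<close> are symmetric, this is the bracket. The bound
is uniform since right translation is close to the identity map.\<close>

lemma local_adjoint:
  fixes m :: "'a::euclidean_space \<times> 'a \<Rightarrow> 'a" and a :: "'a \<Rightarrow> 'a \<Rightarrow> 'a"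
  assumes m: "smooth_near m (e, e)"
    and right_unit: "\<forall>\<^sub>F x in nhds e. m (x, e) = x" and left_unit: "\<forall>\<^sub>F y in nhds e. m (e, y) = y"
    and a: "\<forall>\<^sub>F u in nhds e. \<forall>Y. deriv_right m e u Y = deriv_left m e u (a u Y)"
  shows "\<exists>C. \<forall>\<^sub>F u in nhds e. \<forall>Y. norm (a u Y) \<le> C * norm Y"
    and "((\<lambda>u. a u Y) has_derivative (\<lambda>X. local_bracket m e X Y)) (at e)"
proof -
  let ?L = "deriv_right m e" and ?R = "deriv_left m e"
  have linR: "\<forall>\<^sub>F u in nhds e. linear (?R u)"
    using deriv_left_eq(2)[OF m] unfolding deriv_left_def
    by (rule eventually_mono) (auto intro: smooth_near_linear_derivative)
  have linL: "\<forall>\<^sub>F u in nhds e. linear (?L u)"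
    using deriv_right_eq(2)[OF m] unfolding deriv_right_def
    by (rule eventually_mono) (auto intro: smooth_near_linear_derivative)
  have Re: "?R e Y = Y" for Y
  proof -
    have "frechet_derivative (\<lambda>x. m (x, e)) (at e) = frechet_derivative (\<lambda>x. x) (at e)"
      by (rule frechet_derivative_cong) (rule right_unit)
    then show ?thesis by (simp add: deriv_left_def)
  qed
  have Le: "?L e Y = Y" for Y by (rule deriv_right_unit[OF left_unit])
  have ae: "a e Y = Y" for Y using eventually_nhds_x_imp_x[OF a] Re Le by metis
  have op_bound: "norm (A v) \<le> real (DIM('a)) * c * norm v"
    if A: "linear A" and c: "\<And>b. b \<in> Basis \<Longrightarrow> norm (A b) \<le> c" for A :: "'a \<Rightarrow> 'a" and c v
  proof -
    have "A v = A (\<Sum>b\<in>Basis. (v \<bullet> b) *\<^sub>R b)" by (simp add: euclidean_representation)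
    also have "\<dots> = (\<Sum>b\<in>Basis. (v \<bullet> b) *\<^sub>R A b)" by (simp add: linear_sum[OF A] linear_scale[OF A])
    also have "norm \<dots> \<le> (\<Sum>b\<in>(Basis::'a set). norm v * c)"
      by (rule order_trans[OF norm_sum], rule sum_mono) (auto intro!: mult_mono Basis_le_norm c)
    finally show ?thesis by (simp add: mult_ac)
  qed
  have id_close: "\<forall>\<^sub>F u in nhds e. \<forall>v. norm (?R u v - v) \<le> \<epsilon> * norm v" if "\<epsilon> > 0" for \<epsilon>
  proof -
    have "\<forall>\<^sub>F u in nhds e. norm (?R u b - b) \<le> \<epsilon> / DIM('a)" if b: "b \<in> Basis" for b
    proof -
      have "isCont (\<lambda>u. ?R u b) e" by (rule smooth_near_isCont[OF deriv_left_eq(3)[OF m]])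
      moreover have "\<forall>\<^sub>F y in nhds (?R e b). norm (y - b) < \<epsilon> / DIM('a)"
        unfolding Re eventually_nhds_metric dist_norm using \<open>\<epsilon> > 0\<close>
        by (intro exI[of _ "\<epsilon> / DIM('a)"]) auto
      ultimately have "\<forall>\<^sub>F u in nhds e. norm (?R u b - b) < \<epsilon> / DIM('a)"
        by (rule isCont_eventually_nhds)
      then show ?thesis by (rule eventually_mono) simp
    qed
    then have "\<forall>\<^sub>F u in nhds e. \<forall>b\<in>Basis. norm (?R u b - b) \<le> \<epsilon> / DIM('a)"
      by (intro eventually_ball_finite) auto
    then show ?thesis using linR
    proof eventually_elim
      case (elim u)
      have "linear (\<lambda>v. ?R u v - v)" by (intro linear_compose_sub elim(2) linear_ident)
      then have "norm (?R u v - v) \<le> real (DIM('a)) * (\<epsilon> / DIM('a)) * norm v" for v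
        by (rule op_bound) (use elim(1) in blast)
      then show ?case by simp
    qed
  qed
  have half: "\<forall>\<^sub>F u in nhds e. \<forall>v. norm v \<le> 2 * norm (?R u v)"
    using id_close[of "1/2"]
  proof (rule eventually_mono)
    fix u assume *: "\<forall>v. norm (?R u v - v) \<le> 1 / 2 * norm v"
    show "\<forall>v. norm v \<le> 2 * norm (?R u v)"
    proof
      fix v
      have "norm v \<le> norm (?R u v) + norm (?R u v - v)" using norm_triangle_ineq4[of "?R u v" "?R u v - v"] by simp
      then show "norm v \<le> 2 * norm (?R u v)" using spec[OF *, of v] by linarith
    qed
  qed simp
  have "\<forall>\<^sub>F u in nhds e. norm (?L u b) \<le> norm b + 1" for b
  proof -
    have "isCont (\<lambda>u. ?L u b) e" by (rule smooth_near_isCont[OF deriv_right_eq(3)[OF m]])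
    moreover have "\<forall>\<^sub>F y in nhds (?L e b). norm (y - b) < 1"
      unfolding Le eventually_nhds_metric dist_norm by (intro exI[of _ 1]) auto
    ultimately have "\<forall>\<^sub>F u in nhds e. norm (?L u b - b) < 1" by (rule isCont_eventually_nhds)
    then show ?thesis by (rule eventually_mono) (smt (verit) norm_triangle_sub)
  qed
  then have "\<forall>\<^sub>F u in nhds e. \<forall>b\<in>Basis. norm (?L u b) \<le> norm b + 1"
    by (intro eventually_ball_finite[OF finite_Basis] ballI)
  then have "\<forall>\<^sub>F u in nhds e. \<forall>Y. norm (a u Y) \<le> (4 * DIM('a)) * norm Y"
    using linL half a
  proof eventually_elim
    case (elim u)
    have "norm (?L u Y) \<le> real (DIM('a)) * 2 * norm Y" for Y
      by (rule op_bound[OF elim(2)]) (use elim(1) in fastforce)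
    moreover have "norm (a u Y) \<le> 2 * norm (?L u Y)" for Y using elim(3,4) by metis
    ultimately have "norm (a u Y) \<le> 2 * (real (DIM('a)) * 2 * norm Y)" for Y
      by (meson mult_left_mono order_trans zero_le_numeral)
    then show ?case by (simp add: mult_ac)
  qed
  then show "\<exists>C. \<forall>\<^sub>F u in nhds e. \<forall>Y. norm (a u Y) \<le> C * norm Y" by blast
  define g where "g u = ?L u Y - ?R u Y" for u
  have "frechet_derivative (\<lambda>u. ?R u Y) (at e) X = frechet_derivative (\<lambda>u. ?L u X) (at e) Y" for X
  proof -
    have "frechet_derivative (\<lambda>u. ?R u Y) (at e) X = frechet_derivative (\<lambda>u. frechet_derivative m (at (e, u)) (Y, 0)) (at e) X"
      using frechet_derivative_cong[OF deriv_left_eq(1)[OF m]] by metis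
    also have "\<dots> = frechet_derivative (\<lambda>p. frechet_derivative m (at p) (Y, 0)) (at (e, e)) (0, X)"
      by (rule smooth_near_slice(3)[OF smooth_near_derivative[OF m]])
    also have "\<dots> = frechet_derivative (\<lambda>p. frechet_derivative m (at p) (0, X)) (at (e, e)) (Y, 0)"
      by (rule smooth_near_second_derivative_symmetric[OF m])
    also have "\<dots> = frechet_derivative (\<lambda>u. frechet_derivative m (at (u, e)) (0, X)) (at e) Y"
      by (rule smooth_near_slice(4)[OF smooth_near_derivative[OF m], symmetric])
    also have "\<dots> = frechet_derivative (\<lambda>u. ?L u X) (at e) Y"
      using frechet_derivative_cong[OF deriv_right_eq(1)[OF m]] by metis
    finally show ?thesis .
  qed
  then have gd: "(g has_derivative (\<lambda>X. local_bracket m e X Y)) (at e)"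
    using has_derivative_diff[OF smooth_near_has_derivative[OF deriv_right_eq(3)[OF m, of Y]] smooth_near_has_derivative[OF deriv_left_eq(3)[OF m, of Y]]]
    unfolding g_def local_bracket_def by simp
  have ge: "g e = 0" by (simp add: g_def Le Re)
  define B where "B X = local_bracket m e X Y" for X
  have B: "bounded_linear B" using has_derivative_bounded_linear[OF gd] by (simp add: B_def[abs_def])
  obtain K where K: "K > 0" "\<And>X. norm (B X) \<le> norm X * K" using bounded_linear.pos_bounded[OF B] by blast
  show "((\<lambda>u. a u Y) has_derivative (\<lambda>X. local_bracket m e X Y)) (at e)"
    unfolding has_derivative_at_alt B_def[symmetric]
  proof (intro conjI allI impI B)
    fix \<epsilon> :: real assume \<epsilon>: "\<epsilon> > 0"
    define \<delta> where "\<delta> = \<epsilon> / (4 * (K + \<epsilon>))"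
    have \<delta>: "\<delta> > 0" using \<epsilon> K(1) by (simp add: \<delta>_def)
    have "\<forall>\<^sub>F u in nhds e. norm (g u - g e - B (u - e)) \<le> (\<epsilon> / 2) * norm (u - e)"
    proof -
      obtain d where "d > 0" "\<And>u. norm (u - e) < d \<Longrightarrow> norm (g u - g e - B (u - e)) \<le> (\<epsilon> / 2) * norm (u - e)"
        using gd \<epsilon> unfolding has_derivative_at_alt B_def[symmetric] by (meson half_gt_zero)
      then show ?thesis unfolding eventually_nhds_metric dist_norm by blast
    qed
    then have "\<forall>\<^sub>F u in nhds e. norm (a u Y - a e Y - B (u - e)) \<le> \<epsilon> * norm (u - e)"
      using id_close[OF \<delta>] half a linR
    proof eventually_elim
      case (elim u)
      define k where "k = a u Y - Y"
      have Rk: "?R u k = g u" unfolding k_def g_def linear_diff[OF elim(5)] using elim(4) by simp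
      have nb: "norm (g u) \<le> (K + \<epsilon>) * norm (u - e)"
      proof -
        have "norm (g u) \<le> norm (g u - B (u - e)) + norm (B (u - e))" using norm_triangle_sub[of "g u" "B (u - e)"] by linarith
        also have "\<dots> \<le> (\<epsilon> / 2) * norm (u - e) + norm (u - e) * K" using elim(1) K(2)[of "u - e"] ge by simp
        also have "\<dots> \<le> (K + \<epsilon>) * norm (u - e)" using \<epsilon> by (simp add: algebra_simps)
        finally show ?thesis .
      qed
      have "norm (k - g u) \<le> \<delta> * norm k"
        using spec[OF elim(2), of k] by (simp add: Rk norm_minus_commute)
      also have "\<dots> \<le> \<delta> * (2 * norm (g u))" using spec[OF elim(3), of k] \<delta> by (intro mult_left_mono) (auto simp: Rk)
      also have "\<dots> \<le> \<delta> * (2 * ((K + \<epsilon>) * norm (u - e)))" using nb \<delta> by (intro mult_left_mono) auto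
      also have "\<dots> = (\<epsilon> / 2) * norm (u - e)" using K(1) \<epsilon> by (simp add: \<delta>_def field_simps)
      finally have "norm (k - g u) \<le> (\<epsilon> / 2) * norm (u - e)" .
      then have "norm ((k - g u) + (g u - B (u - e))) \<le> (\<epsilon> / 2) * norm (u - e) + (\<epsilon> / 2) * norm (u - e)"
        using elim(1) ge by (intro norm_triangle_mono) auto
      then show ?case by (simp add: k_def ae)
    qed
    then show "\<exists>d>0. \<forall>u. norm (u - e) < d \<longrightarrow> norm (a u Y - a e Y - B (u - e)) \<le> \<epsilon> * norm (u - e)"
      unfolding eventually_nhds_metric dist_norm by blast
  qed
qed

section \<open>Charts\<close>

text \<open>Charts in a form that passes easily to products: images and preimages of open sets replace the
homeomorphism of subspaces.\<close>

definition chart_like :: "'a topology \<Rightarrow> ('a, 'v::euclidean_space) chart \<Rightarrow> bool" where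
  "chart_like T c \<longleftrightarrow> openin T (chart_dom c) \<and> inj_on (chart_map c) (chart_dom c) \<and>
     (\<forall>N. openin T N \<and> N \<subseteq> chart_dom c \<longrightarrow> open (chart_map c ` N)) \<and>
     (\<forall>U. open U \<longrightarrow> openin T {x \<in> chart_dom c. chart_map c x \<in> U})"

lemma chart_like_of_chart:
  assumes "is_chart T c" shows "chart_like T c"
proof -
  have o: "openin T (chart_dom c)" "open (chart_map c ` chart_dom c)"
    and h: "homeomorphic_map (subtopology T (chart_dom c)) (top_of_set (chart_map c ` chart_dom c)) (chart_map c)"
    using assms by (auto simp: is_chart_def)
  have ts: "topspace (subtopology T (chart_dom c)) = chart_dom c"
    using openin_subset[OF o(1)] by auto
  have "inj_on (chart_map c) (chart_dom c)" using homeomorphic_imp_injective_map[OF h] ts by simp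
  moreover have "open (chart_map c ` N)" if "openin T N" "N \<subseteq> chart_dom c" for N
  proof -
    have "openin (subtopology T (chart_dom c)) N" using that o(1) by (simp add: openin_open_subtopology)
    then have "openin (top_of_set (chart_map c ` chart_dom c)) (chart_map c ` N)"
      using homeomorphic_imp_open_map[OF h] unfolding open_map_def by blast
    then show ?thesis using o(2) openin_open_eq by blast
  qed
  moreover have "openin T {x \<in> chart_dom c. chart_map c x \<in> U}" if "open U" for U
  proof -
    have "continuous_map (subtopology T (chart_dom c)) (top_of_set (chart_map c ` chart_dom c)) (chart_map c)"
      using h homeomorphic_imp_continuous_map by blast
    then have "openin (subtopology T (chart_dom c)) {x \<in> topspace (subtopology T (chart_dom c)). chart_map c x \<in> chart_map c ` chart_dom c \<inter> U}"
      by (rule openin_continuous_map_preimage) (rule openin_open_Int[OF that])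
    then have "openin (subtopology T (chart_dom c)) {x \<in> chart_dom c. chart_map c x \<in> chart_map c ` chart_dom c \<inter> U}"
      unfolding ts .
    moreover have "{x \<in> chart_dom c. chart_map c x \<in> chart_map c ` chart_dom c \<inter> U} = {x \<in> chart_dom c. chart_map c x \<in> U}" by auto
    ultimately show ?thesis using o(1) by (simp add: openin_open_subtopology)
  qed
  ultimately show ?thesis using o(1) unfolding chart_like_def by blast
qed

lemma chart_inv_map: "chart_like T c \<Longrightarrow> x \<in> chart_dom c \<Longrightarrow> chart_inv c (chart_map c x) = x"
  by (simp add: chart_like_def inv_into_f_f)

lemma eventually_chart:
  assumes c: "chart_like T c" and N: "openin T N" "x \<in> N" "x \<in> chart_dom c"
  shows "\<forall>\<^sub>F u in nhds (chart_map c x). chart_inv c u \<in> N \<and> chart_inv c u \<in> chart_dom c \<and> chart_map c (chart_inv c u) = u"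
proof -
  have "openin T (N \<inter> chart_dom c)" using c N by (simp add: chart_like_def openin_Int)
  then have "open (chart_map c ` (N \<inter> chart_dom c))" using c by (simp add: chart_like_def)
  moreover have "chart_map c x \<in> chart_map c ` (N \<inter> chart_dom c)" using N by blast
  moreover have "chart_inv c u \<in> N \<and> chart_inv c u \<in> chart_dom c \<and> chart_map c (chart_inv c u) = u"
    if "u \<in> chart_map c ` (N \<inter> chart_dom c)" for u
    using that chart_inv_map[OF c] by auto
  ultimately show ?thesis unfolding eventually_nhds by blast
qed

text \<open>Two coordinate expressions of \<open>f\<close> differ by transition maps.\<close>

lemma change_charts:
  assumes c: "chart_like T c" and c': "chart_like T c'" and d': "chart_like T' d'"
    and x: "x \<in> chart_dom c" "x \<in> chart_dom c'"
    and N: "openin T N" "x \<in> N" "f ` N \<subseteq> chart_dom d'"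
    and cc': "smooth_near (\<lambda>u. chart_map c' (chart_inv c u)) (chart_map c x)"
    and f: "smooth_near (\<lambda>u. chart_map d' (f (chart_inv c' u))) (chart_map c' x)"
    and dd': "smooth_near (\<lambda>w. chart_map d (chart_inv d' w)) (chart_map d' (f x))"
  shows "smooth_near (\<lambda>u. chart_map d (f (chart_inv c u))) (chart_map c x)"
proof -
  have "smooth_near (\<lambda>u. chart_map d' (f (chart_inv c' (chart_map c' (chart_inv c u))))) (chart_map c x)"
    by (rule smooth_near_comp[OF cc']) (simp add: chart_inv_map[OF c x(1)] f)
  then have "smooth_near (\<lambda>u. chart_map d (chart_inv d' (chart_map d' (f (chart_inv c' (chart_map c' (chart_inv c u))))))) (chart_map c x)"
    by (rule smooth_near_comp) (simp add: chart_inv_map[OF c x(1)] chart_inv_map[OF c' x(2)] dd')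
  moreover have "openin T (N \<inter> chart_dom c')" using N c' by (simp add: chart_like_def openin_Int)
  then have "\<forall>\<^sub>F u in nhds (chart_map c x). chart_map d (chart_inv d' (chart_map d' (f (chart_inv c' (chart_map c' (chart_inv c u))))))
      = chart_map d (f (chart_inv c u))"
    using eventually_chart[OF c, of "N \<inter> chart_dom c'" x] x N(2)
    by (auto elim!: eventually_mono simp: chart_inv_map[OF c'] chart_inv_map[OF d'] subsetD[OF N(3)])
  ultimately show ?thesis by (rule smooth_near_cong)
qed

lemma smooth_map_onE:
  assumes "smooth_map_on T A A' U f" "x \<in> U"
  obtains c d N where "c \<in> A" "d \<in> A'" "openin T N" "x \<in> N" "N \<subseteq> U" "N \<subseteq> chart_dom c" "f ` N \<subseteq> chart_dom d"
    "smooth_near (\<lambda>u. chart_map d (f (chart_inv c u))) (chart_map c x)"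
    "smooth_on (\<lambda>u. chart_map d (f (chart_inv c u))) (chart_map c ` N)"
proof -
  obtain c d N where *: "c \<in> A" "d \<in> A'" "openin T N" "x \<in> N" "N \<subseteq> U \<inter> chart_dom c" "f ` N \<subseteq> chart_dom d"
    "smooth_on (chart_map d \<circ> f \<circ> chart_inv c) (chart_map c ` N)"
    using assms unfolding smooth_map_on_def by blast
  then have s: "smooth_on (\<lambda>u. chart_map d (f (chart_inv c u))) (chart_map c ` N)" by (simp add: o_def)
  then have "smooth_near (\<lambda>u. chart_map d (f (chart_inv c u))) (chart_map c x)"
    using *(4) unfolding smooth_near_def by blast
  then show ?thesis using that[OF *(1-4) _ _ *(6) _ s] *(5) by blast
qed

lemma smooth_map_on_continuous:
  assumes f: "smooth_map_on T A A' U f" and A: "\<And>c. c \<in> A \<Longrightarrow> chart_like T c" and A': "\<And>d. d \<in> A' \<Longrightarrow> chart_like T' d"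
    and x: "x \<in> U" "openin T' V" "f x \<in> V"
  shows "\<exists>N. openin T N \<and> x \<in> N \<and> N \<subseteq> U \<and> f ` N \<subseteq> V"
proof -
  obtain c d N where *: "c \<in> A" "d \<in> A'" "openin T N" "x \<in> N" "N \<subseteq> U" "N \<subseteq> chart_dom c" "f ` N \<subseteq> chart_dom d"
    and s: "smooth_on (\<lambda>u. chart_map d (f (chart_inv c u))) (chart_map c ` N)"
    using smooth_map_onE[OF f x(1)] by metis
  let ?F = "\<lambda>u. chart_map d (f (chart_inv c u))"
  have c: "chart_like T c" and d: "chart_like T' d" using A A' * by auto
  have "openin T' (V \<inter> chart_dom d)" using x(2) d by (simp add: chart_like_def openin_Int)
  then have oV: "open (chart_map d ` (V \<inter> chart_dom d))" using d by (simp add: chart_like_def)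
  have "open (chart_map c ` N)" "continuous_on (chart_map c ` N) ?F"
    using s Ck_on.simps(1)[of ?F] unfolding smooth_on_def by blast+
  then have oW: "open (chart_map c ` N \<inter> ?F -` (chart_map d ` (V \<inter> chart_dom d)))"
    using oV by (simp add: continuous_on_open_vimage Int_commute)
  let ?N = "N \<inter> {y \<in> chart_dom c. chart_map c y \<in> chart_map c ` N \<inter> ?F -` (chart_map d ` (V \<inter> chart_dom d))}"
  have inv: "chart_inv c (chart_map c y) = y" if "y \<in> N" for y using chart_inv_map[OF c] that *(6) by blast
  have "openin T ?N" using c oW *(3) unfolding chart_like_def by (intro openin_Int) blast+
  moreover have "x \<in> ?N" using * x(3) inv[OF *(4)] by auto
  moreover have "f y \<in> V" if "y \<in> ?N" for y
  proof -
    have yN: "y \<in> N" and "?F (chart_map c y) \<in> chart_map d ` (V \<inter> chart_dom d)" using that by blast+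
    then have "chart_map d (f y) \<in> chart_map d ` (V \<inter> chart_dom d)" by (simp add: inv)
    then obtain z where "z \<in> V" "z \<in> chart_dom d" "chart_map d (f y) = chart_map d z" by auto
    moreover have "f y \<in> chart_dom d" using that *(7) by auto
    ultimately show ?thesis using d unfolding chart_like_def by (metis inj_onD)
  qed
  then have "f ` ?N \<subseteq> V" by blast
  moreover have "?N \<subseteq> U" using *(5) by blast
  ultimately show ?thesis by (intro exI[of _ ?N] conjI)
qed

definition prod_chart :: "('a, 'v) chart \<Rightarrow> ('b, 'w) chart \<Rightarrow> ('a \<times> 'b, 'v \<times> 'w) chart" where
  "prod_chart c d = (chart_dom c \<times> chart_dom d, map_prod (chart_map c) (chart_map d))"

lemma prod_atlas_eq: "prod_atlas A A' = {prod_chart c d | c d. c \<in> A \<and> d \<in> A'}"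
  by (simp add: prod_atlas_def prod_chart_def)

lemma chart_like_prod:
  assumes c: "chart_like T c" and d: "chart_like T' d"
  shows "chart_like (prod_topology T T') (prod_chart c d)"
proof -
  have "openin (prod_topology T T') (chart_dom c \<times> chart_dom d)"
    using c d by (simp add: chart_like_def openin_prod_Times_iff)
  moreover have "inj_on (map_prod (chart_map c) (chart_map d)) (chart_dom c \<times> chart_dom d)"
    using c d by (simp add: chart_like_def map_prod_inj_on)
  moreover have "open (map_prod (chart_map c) (chart_map d) ` N)"
    if N: "openin (prod_topology T T') N" "N \<subseteq> chart_dom c \<times> chart_dom d" for N
  proof (subst open_subopen, intro ballI)
    fix p assume "p \<in> map_prod (chart_map c) (chart_map d) ` N"
    then obtain x y where xy: "(x, y) \<in> N" "p = (chart_map c x, chart_map d y)" by auto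
    obtain U V where UV: "openin T U" "openin T' V" "x \<in> U" "y \<in> V" "U \<times> V \<subseteq> N"
      using iffD1[OF openin_prod_topology_alt N(1), rule_format, OF xy(1)] by blast
    have "U \<subseteq> chart_dom c" "V \<subseteq> chart_dom d" using UV N(2) by auto
    then have "open (chart_map c ` U)" "open (chart_map d ` V)" using UV c d by (auto simp: chart_like_def)
    then have "open (chart_map c ` U \<times> chart_map d ` V)" by (rule open_Times)
    moreover have "p \<in> chart_map c ` U \<times> chart_map d ` V" using xy UV by auto
    moreover have "chart_map c ` U \<times> chart_map d ` V \<subseteq> map_prod (chart_map c) (chart_map d) ` N"
    proof
      fix r assume "r \<in> chart_map c ` U \<times> chart_map d ` V"
      then obtain a b where "a \<in> U" "b \<in> V" "r = map_prod (chart_map c) (chart_map d) (a, b)" by auto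
      then show "r \<in> map_prod (chart_map c) (chart_map d) ` N" using UV(5) by blast
    qed
    ultimately show "\<exists>W. open W \<and> p \<in> W \<and> W \<subseteq> map_prod (chart_map c) (chart_map d) ` N"
      by (intro exI[of _ "chart_map c ` U \<times> chart_map d ` V"] conjI)
  qed
  moreover have "openin (prod_topology T T') {p \<in> chart_dom c \<times> chart_dom d. map_prod (chart_map c) (chart_map d) p \<in> U}"
    if U: "open U" for U
    unfolding openin_prod_topology_alt
  proof (intro allI impI)
    fix x y assume "(x, y) \<in> {p \<in> chart_dom c \<times> chart_dom d. map_prod (chart_map c) (chart_map d) p \<in> U}"
    then have xy: "x \<in> chart_dom c" "y \<in> chart_dom d" "(chart_map c x, chart_map d y) \<in> U" by auto
    obtain P R where PR: "open P" "open R" "chart_map c x \<in> P" "chart_map d y \<in> R" "P \<times> R \<subseteq> U"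
      using open_prod_elim[OF U xy(3)] by (metis mem_Sigma_iff)
    show "\<exists>Ua V. openin T Ua \<and> openin T' V \<and> x \<in> Ua \<and> y \<in> V \<and>
       Ua \<times> V \<subseteq> {p \<in> chart_dom c \<times> chart_dom d. map_prod (chart_map c) (chart_map d) p \<in> U}"
    proof (intro exI conjI)
      show "openin T {x \<in> chart_dom c. chart_map c x \<in> P}" "openin T' {y \<in> chart_dom d. chart_map d y \<in> R}"
        using c d PR(1,2) unfolding chart_like_def by blast+
    qed (use PR xy in auto)
  qed
  ultimately show ?thesis unfolding chart_like_def prod_chart_def fst_conv snd_conv by blast
qed

lemma eventually_nhds_fst:
  assumes "\<forall>\<^sub>F x in nhds a. P x" shows "\<forall>\<^sub>F p in nhds (a, b). P (fst p)"
proof -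
  obtain S where "open S" "a \<in> S" "\<And>x. x \<in> S \<Longrightarrow> P x" using assms unfolding eventually_nhds by blast
  then show ?thesis unfolding eventually_nhds by (intro exI[of _ "S \<times> UNIV"]) (auto intro: open_Times)
qed

lemma eventually_nhds_snd:
  assumes "\<forall>\<^sub>F y in nhds b. P y" shows "\<forall>\<^sub>F p in nhds (a, b). P (snd p)"
proof -
  obtain S where "open S" "b \<in> S" "\<And>x. x \<in> S \<Longrightarrow> P x" using assms unfolding eventually_nhds by blast
  then show ?thesis unfolding eventually_nhds by (intro exI[of _ "UNIV \<times> S"]) (auto intro: open_Times)
qed

lemma chart_inv_prod:
  assumes c: "chart_like T c" and d: "chart_like T' d" and x: "x \<in> chart_dom c" "y \<in> chart_dom d"
  shows "\<forall>\<^sub>F p in nhds (chart_map c x, chart_map d y).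
    chart_inv (prod_chart c d) p = (chart_inv c (fst p), chart_inv d (snd p))"
proof -
  have o: "openin T (chart_dom c)" "openin T' (chart_dom d)" using c d by (auto simp: chart_like_def)
  have "\<forall>\<^sub>F p in nhds (chart_map c x, chart_map d y). chart_inv c (fst p) \<in> chart_dom c \<and> chart_map c (chart_inv c (fst p)) = fst p"
    by (rule eventually_nhds_fst, rule eventually_mono[OF eventually_chart[OF c o(1) x(1) x(1)]]) blast
  moreover have "\<forall>\<^sub>F p in nhds (chart_map c x, chart_map d y). chart_inv d (snd p) \<in> chart_dom d \<and> chart_map d (chart_inv d (snd p)) = snd p"
    by (rule eventually_nhds_snd, rule eventually_mono[OF eventually_chart[OF d o(2) x(2) x(2)]]) blast
  ultimately show ?thesis
  proof eventually_elim
    case (elim p)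
    have "chart_inv (prod_chart c d) (chart_map (prod_chart c d) (chart_inv c (fst p), chart_inv d (snd p))) = (chart_inv c (fst p), chart_inv d (snd p))"
      by (rule chart_inv_map[OF chart_like_prod[OF c d]]) (use elim in \<open>simp add: prod_chart_def\<close>)
    moreover have "chart_map (prod_chart c d) (chart_inv c (fst p), chart_inv d (snd p)) = p"
      using elim by (simp add: prod_chart_def)
    ultimately show ?case by simp
  qed
qed

lemma smooth_near_map_prod:
  assumes "smooth_near f (fst p)" "smooth_near g (snd p)"
  shows "smooth_near (\<lambda>p. (f (fst p), g (snd p))) p"
  by (intro smooth_near_Pair smooth_near_comp[OF smooth_near_linear[OF bounded_linear_fst] assms(1)]
      smooth_near_comp[OF smooth_near_linear[OF bounded_linear_snd] assms(2)])

section \<open>The adjoint representation of a Lie group\<close>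

locale lie_group_chart =
  fixes G :: "('a, 'r) monoid_scheme" and T :: "'a topology" and A :: "('a, 'v::euclidean_space) chart set"
    and c :: "('a, 'v) chart"
  assumes lie: "lie_group G T A" and cA: "c \<in> A" and one_in: "\<one>\<^bsub>G\<^esub> \<in> chart_dom c"
begin

sublocale group G using lie by (simp add: lie_group_def)

lemma chart_like_A: "d \<in> A \<Longrightarrow> chart_like T d"
  using lie chart_like_of_chart unfolding lie_group_def smooth_manifold_def by blast

lemma topspace_eq: "topspace T = carrier G" using lie by (simp add: lie_group_def)

lemma chart_dom_subset: "d \<in> A \<Longrightarrow> chart_dom d \<subseteq> carrier G"
  using chart_like_A openin_subset topspace_eq unfolding chart_like_def by metis

lemma chart_exists: "x \<in> carrier G \<Longrightarrow> \<exists>d\<in>A. x \<in> chart_dom d"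
  using lie topspace_eq unfolding lie_group_def smooth_manifold_def by blast

lemma transition_smooth:
  assumes "d \<in> A" "d' \<in> A" "x \<in> chart_dom d" "x \<in> chart_dom d'"
  shows "smooth_near (\<lambda>u. chart_map d' (chart_inv d u)) (chart_map d x)"
proof -
  have "smooth_on (chart_map d' \<circ> chart_inv d) (chart_map d ` (chart_dom d \<inter> chart_dom d'))"
    using lie assms unfolding lie_group_def smooth_manifold_def by blast
  moreover have "chart_map d x \<in> chart_map d ` (chart_dom d \<inter> chart_dom d')" using assms(3,4) by blast
  ultimately show ?thesis unfolding smooth_near_def o_def by (intro exI conjI)
qed

lemma mult_smooth:
  assumes "c1 \<in> A" "c2 \<in> A" "d \<in> A" "x \<in> chart_dom c1" "y \<in> chart_dom c2" "x \<otimes>\<^bsub>G\<^esub> y \<in> chart_dom d"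
  shows "smooth_near (\<lambda>p. chart_map d (chart_inv c1 (fst p) \<otimes>\<^bsub>G\<^esub> chart_inv c2 (snd p))) (chart_map c1 x, chart_map c2 y)"
proof -
  let ?f = "\<lambda>(x, y). x \<otimes>\<^bsub>G\<^esub> y"
  have sm: "smooth_map_on (prod_topology T T) (prod_atlas A A) A (carrier G \<times> carrier G) ?f"
    using lie by (simp add: lie_group_def)
  have xy: "(x, y) \<in> carrier G \<times> carrier G"
    using subsetD[OF chart_dom_subset[OF assms(1)] assms(4)] subsetD[OF chart_dom_subset[OF assms(2)] assms(5)] by simp
  obtain C d' N where *: "C \<in> prod_atlas A A" "d' \<in> A" "openin (prod_topology T T) N" "(x, y) \<in> N" "N \<subseteq> chart_dom C"
      "?f ` N \<subseteq> chart_dom d'" "smooth_near (\<lambda>u. chart_map d' (?f (chart_inv C u))) (chart_map C (x, y))"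
    using smooth_map_onE[OF sm xy] by metis
  then obtain k1 k2 where k: "C = prod_chart k1 k2" "k1 \<in> A" "k2 \<in> A" unfolding prod_atlas_eq by blast
  have dom: "x \<in> chart_dom k1" "y \<in> chart_dom k2" using * k by (auto simp: prod_chart_def)
  have cl: "chart_like (prod_topology T T) (prod_chart c1 c2)" "chart_like (prod_topology T T) C"
    unfolding k(1) by (intro chart_like_prod chart_like_A assms k)+
  note inv = chart_inv_prod[OF chart_like_A[OF assms(1)] chart_like_A[OF assms(2)] assms(4,5)]
  have base: "chart_map (prod_chart c1 c2) (x, y) = (chart_map c1 x, chart_map c2 y)" by (simp add: prod_chart_def)
  have "smooth_near (\<lambda>u. chart_map d (?f (chart_inv (prod_chart c1 c2) u))) (chart_map (prod_chart c1 c2) (x, y))"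
  proof (rule change_charts[OF cl chart_like_A[OF *(2)] _ _ *(3,4,6) _ *(7)])
    show "(x, y) \<in> chart_dom (prod_chart c1 c2)" using assms by (simp add: prod_chart_def)
    show "(x, y) \<in> chart_dom C" using * by blast
    have "smooth_near (\<lambda>p. (chart_map k1 (chart_inv c1 (fst p)), chart_map k2 (chart_inv c2 (snd p)))) (chart_map c1 x, chart_map c2 y)"
      by (rule smooth_near_map_prod) (use transition_smooth assms dom k in auto)
    then show "smooth_near (\<lambda>u. chart_map C (chart_inv (prod_chart c1 c2) u)) (chart_map (prod_chart c1 c2) (x, y))"
      unfolding base by (rule smooth_near_cong) (use inv in \<open>auto elim!: eventually_mono simp: k(1) prod_chart_def[of k1 k2]\<close>)
    have "?f (x, y) \<in> chart_dom d'" using * by blast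
    then show "smooth_near (\<lambda>w. chart_map d (chart_inv d' w)) (chart_map d' (?f (x, y)))"
      using transition_smooth[OF *(2) assms(3)] assms(6) by simp
  qed
  then show ?thesis
    unfolding base by (rule smooth_near_cong) (use inv in \<open>auto elim!: eventually_mono\<close>)
qed

lemma mult_continuous:
  assumes x: "x \<in> carrier G" "y \<in> carrier G" and V: "openin T V" "x \<otimes>\<^bsub>G\<^esub> y \<in> V"
  shows "\<exists>M N. openin T M \<and> openin T N \<and> x \<in> M \<and> y \<in> N \<and> (\<forall>a\<in>M. \<forall>b\<in>N. a \<otimes>\<^bsub>G\<^esub> b \<in> V)"
proof -
  have sm: "smooth_map_on (prod_topology T T) (prod_atlas A A) A (carrier G \<times> carrier G) (\<lambda>(x, y). x \<otimes>\<^bsub>G\<^esub> y)"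
    using lie by (simp add: lie_group_def)
  have pl: "chart_like (prod_topology T T) C" if "C \<in> prod_atlas A A" for C
    using that chart_like_prod chart_like_A unfolding prod_atlas_eq by blast
  have "\<exists>N. openin (prod_topology T T) N \<and> (x, y) \<in> N \<and> N \<subseteq> carrier G \<times> carrier G \<and> (\<lambda>(x, y). x \<otimes>\<^bsub>G\<^esub> y) ` N \<subseteq> V"
    by (rule smooth_map_on_continuous[OF sm pl chart_like_A]) (use x V in auto)
  then obtain N where N: "openin (prod_topology T T) N" "(x, y) \<in> N" "(\<lambda>(x, y). x \<otimes>\<^bsub>G\<^esub> y) ` N \<subseteq> V" by blast
  obtain M M' where "openin T M" "openin T M'" "x \<in> M" "y \<in> M'" "M \<times> M' \<subseteq> N"
    using iffD1[OF openin_prod_topology_alt N(1), rule_format, OF N(2)] by blast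
  moreover have "\<forall>a\<in>M. \<forall>b\<in>M'. a \<otimes>\<^bsub>G\<^esub> b \<in> V" using calculation(5) N(3) by fastforce
  ultimately show ?thesis by blast
qed

abbreviation "e0 \<equiv> chart_map c \<one>\<^bsub>G\<^esub>"

definition loc_mult :: "'v \<times> 'v \<Rightarrow> 'v" where
  "loc_mult p = chart_map c (chart_inv c (fst p) \<otimes>\<^bsub>G\<^esub> chart_inv c (snd p))"

lemma lie_bracket_eq: "lie_bracket G c = local_bracket loc_mult e0"
  by (intro ext) (simp add: lie_bracket_def local_bracket_def deriv_right_def left_invariant_field_def[abs_def] loc_mult_def)

lemmas inv_map = chart_inv_map[OF chart_like_A[OF cA]]

lemma eventually_near_one:
  assumes "openin T N" "\<one>\<^bsub>G\<^esub> \<in> N"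
  shows "\<forall>\<^sub>F u in nhds e0. chart_inv c u \<in> N \<and> chart_inv c u \<in> chart_dom c \<and> chart_inv c u \<in> carrier G \<and> chart_map c (chart_inv c u) = u"
  using eventually_chart[OF chart_like_A[OF cA] assms one_in] chart_dom_subset[OF cA]
  by (auto elim!: eventually_mono)

lemma open_dom: "openin T (chart_dom c)" using chart_like_A[OF cA] by (simp add: chart_like_def)

lemma loc_mult_smooth: "smooth_near loc_mult (e0, e0)"
  using mult_smooth[OF cA cA cA one_in one_in] one_in by (simp add: loc_mult_def[abs_def])

lemma loc_mult_units: "\<forall>\<^sub>F u in nhds e0. loc_mult (u, e0) = u" "\<forall>\<^sub>F u in nhds e0. loc_mult (e0, u) = u"
  using eventually_near_one[OF open_dom one_in]
  by (auto elim!: eventually_mono simp: loc_mult_def inv_map one_in)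

definition conj_by :: "'a \<Rightarrow> 'a \<Rightarrow> 'a" where "conj_by x y = x \<otimes>\<^bsub>G\<^esub> y \<otimes>\<^bsub>G\<^esub> inv\<^bsub>G\<^esub> x"

definition loc_conj :: "'a \<Rightarrow> 'v \<Rightarrow> 'v" where "loc_conj x u = chart_map c (conj_by x (chart_inv c u))"

definition Ad :: "'a \<Rightarrow> 'v \<Rightarrow> 'v" where "Ad x = frechet_derivative (loc_conj x) (at e0)"

lemma conj_one: "x \<in> carrier G \<Longrightarrow> conj_by x \<one>\<^bsub>G\<^esub> = \<one>\<^bsub>G\<^esub>" by (simp add: conj_by_def)

lemma loc_conj_e0: "x \<in> carrier G \<Longrightarrow> loc_conj x e0 = e0" by (simp add: loc_conj_def inv_map one_in conj_one)

lemma conj_continuous: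
  assumes "x \<in> carrier G" "openin T V" "\<one>\<^bsub>G\<^esub> \<in> V"
  shows "\<exists>N. openin T N \<and> \<one>\<^bsub>G\<^esub> \<in> N \<and> (\<forall>y\<in>N. conj_by x y \<in> V)"
proof -
  have "x \<otimes>\<^bsub>G\<^esub> inv\<^bsub>G\<^esub> x \<in> V" using assms by simp
  then obtain M where M: "openin T M" "x \<in> M" "\<And>a. a \<in> M \<Longrightarrow> a \<otimes>\<^bsub>G\<^esub> inv\<^bsub>G\<^esub> x \<in> V"
    using mult_continuous[OF assms(1) inv_closed[OF assms(1)] assms(2)] by metis
  have "x \<otimes>\<^bsub>G\<^esub> \<one>\<^bsub>G\<^esub> \<in> M" using assms M(2) by simp
  then obtain N where "openin T N" "\<one>\<^bsub>G\<^esub> \<in> N" "\<And>b. b \<in> N \<Longrightarrow> x \<otimes>\<^bsub>G\<^esub> b \<in> M"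
    using mult_continuous[OF assms(1) one_closed M(1)] by metis
  then show ?thesis using M(3) unfolding conj_by_def by blast
qed

lemma eventually_conj:
  assumes "x \<in> carrier G"
  shows "\<forall>\<^sub>F u in nhds e0. chart_inv c u \<in> carrier G \<and> chart_map c (chart_inv c u) = u \<and> conj_by x (chart_inv c u) \<in> chart_dom c
     \<and> chart_inv c (loc_conj x u) = conj_by x (chart_inv c u)"
proof -
  obtain N where N: "openin T N" "\<one>\<^bsub>G\<^esub> \<in> N" "\<forall>y\<in>N. conj_by x y \<in> chart_dom c"
    using conj_continuous[OF assms open_dom one_in] by blast
  show ?thesis using eventually_near_one[OF N(1,2)]
    by (rule eventually_mono) (use N(3) in \<open>auto simp: loc_conj_def inv_map\<close>)
qed

lemma loc_conj_smooth:
  assumes x: "x \<in> carrier G" shows "smooth_near (loc_conj x) e0"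
proof -
  obtain d d2 where d: "d \<in> A" "x \<in> chart_dom d" "d2 \<in> A" "inv\<^bsub>G\<^esub> x \<in> chart_dom d2"
    using chart_exists x inv_closed by metis
  have "smooth_near (\<lambda>p. chart_map d (chart_inv d (fst p) \<otimes>\<^bsub>G\<^esub> chart_inv c (snd p))) (chart_map d x, e0)"
    by (rule mult_smooth) (use d cA one_in x in auto)
  from smooth_near_slice(1)[OF this]
  have 1: "smooth_near (\<lambda>u. chart_map d (x \<otimes>\<^bsub>G\<^esub> chart_inv c u)) e0"
    by (simp add: chart_inv_map[OF chart_like_A[OF d(1)] d(2)])
  have "smooth_near (\<lambda>p. chart_map c (chart_inv d (fst p) \<otimes>\<^bsub>G\<^esub> chart_inv d2 (snd p))) (chart_map d x, chart_map d2 (inv\<^bsub>G\<^esub> x))"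
    by (rule mult_smooth) (use d cA one_in x in auto)
  from smooth_near_slice(2)[OF this]
  have 2: "smooth_near (\<lambda>w. chart_map c (chart_inv d w \<otimes>\<^bsub>G\<^esub> inv\<^bsub>G\<^esub> x)) (chart_map d x)"
    by (simp add: chart_inv_map[OF chart_like_A[OF d(3)] d(4)])
  have "smooth_near (\<lambda>u. chart_map c (chart_inv d (chart_map d (x \<otimes>\<^bsub>G\<^esub> chart_inv c u)) \<otimes>\<^bsub>G\<^esub> inv\<^bsub>G\<^esub> x)) e0"
    by (rule smooth_near_comp[OF 1]) (simp add: inv_map one_in x 2)
  moreover
  have "openin T (chart_dom d)" using chart_like_A[OF d(1)] by (simp add: chart_like_def)
  then obtain N where N: "openin T N" "\<one>\<^bsub>G\<^esub> \<in> N" "\<And>b. b \<in> N \<Longrightarrow> x \<otimes>\<^bsub>G\<^esub> b \<in> chart_dom d"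
    using mult_continuous[OF x one_closed, of "chart_dom d"] d(2) x by (metis r_one)
  have "\<forall>\<^sub>F u in nhds e0. chart_map c (chart_inv d (chart_map d (x \<otimes>\<^bsub>G\<^esub> chart_inv c u)) \<otimes>\<^bsub>G\<^esub> inv\<^bsub>G\<^esub> x) = loc_conj x u"
    using eventually_near_one[OF N(1,2)]
    by (rule eventually_mono) (simp add: loc_conj_def conj_by_def chart_inv_map[OF chart_like_A[OF d(1)]] N(3))
  ultimately show ?thesis by (rule smooth_near_cong)
qed

lemma linear_Ad: "x \<in> carrier G \<Longrightarrow> linear (Ad x)"
  unfolding Ad_def by (intro smooth_near_linear_derivative loc_conj_smooth)

lemma conj_by_mult: "x \<in> carrier G \<Longrightarrow> y \<in> carrier G \<Longrightarrow> z \<in> carrier G \<Longrightarrow>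
    conj_by x (y \<otimes>\<^bsub>G\<^esub> z) = conj_by x y \<otimes>\<^bsub>G\<^esub> conj_by x z"
  by (simp add: conj_by_def m_assoc) (simp add: m_assoc[symmetric])

lemma Ad_mult:
  assumes x: "x \<in> carrier G" and y: "y \<in> carrier G"
  shows "Ad (x \<otimes>\<^bsub>G\<^esub> y) Y = Ad x (Ad y Y)"
proof -
  have "\<forall>\<^sub>F u in nhds e0. loc_conj (x \<otimes>\<^bsub>G\<^esub> y) u = loc_conj x (loc_conj y u)"
    using eventually_conj[OF y]
    by (rule eventually_mono) (auto simp: loc_conj_def conj_by_def inv_map x y m_assoc inv_mult_group)
  then have "Ad (x \<otimes>\<^bsub>G\<^esub> y) = frechet_derivative (\<lambda>u. loc_conj x (loc_conj y u)) (at e0)"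
    unfolding Ad_def by (rule frechet_derivative_cong)
  then show ?thesis
    using frechet_derivative_chain[OF loc_conj_smooth[OF y], of "loc_conj x" Y] loc_conj_smooth[OF x] loc_conj_e0[OF y]
    by (simp add: Ad_def)
qed

lemma Ad_one: "Ad \<one>\<^bsub>G\<^esub> Y = Y"
proof -
  have "\<forall>\<^sub>F u in nhds e0. loc_conj \<one>\<^bsub>G\<^esub> u = u"
    using eventually_near_one[OF open_dom one_in]
    by (rule eventually_mono) (simp add: loc_conj_def conj_by_def)
  then have "Ad \<one>\<^bsub>G\<^esub> = frechet_derivative (\<lambda>u. u) (at e0)" unfolding Ad_def by (rule frechet_derivative_cong)
  then show ?thesis by simp
qed

lemma eventually_near_one_pair:
  assumes "\<forall>\<^sub>F u in nhds e0. P u" "\<forall>\<^sub>F u in nhds e0. R u"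
  shows "\<forall>\<^sub>F p in nhds (e0, e0). P (fst p) \<and> R (snd p)"
proof -
  have "\<forall>\<^sub>F p in nhds (e0, e0). P (fst p)" by (rule eventually_nhds_fst[OF assms(1)])
  moreover have "\<forall>\<^sub>F p in nhds (e0, e0). R (snd p)" by (rule eventually_nhds_snd[OF assms(2)])
  ultimately show ?thesis by eventually_elim simp
qed

lemma eventually_mult:
  assumes "openin T V" "\<one>\<^bsub>G\<^esub> \<in> V"
  shows "\<forall>\<^sub>F p in nhds (e0, e0). chart_inv c (fst p) \<otimes>\<^bsub>G\<^esub> chart_inv c (snd p) \<in> V"
proof -
  have "\<one>\<^bsub>G\<^esub> \<otimes>\<^bsub>G\<^esub> \<one>\<^bsub>G\<^esub> \<in> V" using assms by simp
  then obtain M N where MN: "openin T M" "openin T N" "\<one>\<^bsub>G\<^esub> \<in> M" "\<one>\<^bsub>G\<^esub> \<in> N" "\<forall>a\<in>M. \<forall>b\<in>N. a \<otimes>\<^bsub>G\<^esub> b \<in> V"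
    using mult_continuous[OF one_closed one_closed assms(1)] by metis
  show ?thesis
    using eventually_near_one_pair[OF eventually_near_one[OF MN(1,3)] eventually_near_one[OF MN(2,4)]]
    by (rule eventually_mono) (use MN(5) in blast)
qed

lemma Ad_bracket:
  assumes x: "x \<in> carrier G"
  shows "Ad x (lie_bracket G c X Y) = lie_bracket G c (Ad x X) (Ad x Y)"
proof -
  have "\<forall>\<^sub>F p in nhds (e0, e0). loc_conj x (loc_mult p) = loc_mult (loc_conj x (fst p), loc_conj x (snd p))"
    using eventually_near_one_pair[OF eventually_conj[OF x] eventually_conj[OF x]] eventually_mult[OF open_dom one_in]
    by eventually_elim (simp add: loc_mult_def loc_conj_def inv_map x conj_by_mult)
  then show ?thesis
    unfolding lie_bracket_eq Ad_def
    using local_homomorphism_bracket[OF loc_mult_smooth _ loc_conj_smooth[OF x] _ loc_mult_units, of loc_mult X Y]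
      loc_conj_e0[OF x] loc_mult_smooth by simp
qed

lemma Ad_near_one:
  "\<forall>\<^sub>F u in nhds e0. \<forall>Y. deriv_right loc_mult e0 u Y = deriv_left loc_mult e0 u (Ad (chart_inv c u) Y)"
  using eventually_near_one[OF open_dom one_in] deriv_left_eq(2)[OF loc_mult_smooth]
proof eventually_elim
  case (elim u)
  define x where "x = chart_inv c u"
  have x: "x \<in> carrier G" "chart_map c x = u" "x \<in> chart_dom c" using elim by (auto simp: x_def)
  have "\<forall>\<^sub>F v in nhds e0. loc_mult (u, v) = loc_mult (loc_conj x v, u)"
    using eventually_conj[OF x(1)]
    by (rule eventually_mono) (simp add: loc_mult_def x(1) x_def[symmetric], simp add: conj_by_def m_assoc x(1))
  then have "deriv_right loc_mult e0 u Y = frechet_derivative (\<lambda>v. loc_mult (loc_conj x v, u)) (at e0) Y" for Y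
    unfolding deriv_right_def using frechet_derivative_cong by metis
  also have "frechet_derivative (\<lambda>v. loc_mult (loc_conj x v, u)) (at e0) Y = deriv_left loc_mult e0 u (Ad x Y)" for Y
    using frechet_derivative_chain[OF loc_conj_smooth[OF x(1)], of "\<lambda>w. loc_mult (w, u)" Y] elim(2) loc_conj_e0[OF x(1)]
    by (simp add: deriv_left_def Ad_def)
  finally show ?case by (simp add: x_def)
qed

lemmas Ad_local = local_adjoint[OF loc_mult_smooth loc_mult_units Ad_near_one, folded lie_bracket_eq]

text \<open>Near the identity the bound is local; \<open>Ad y = Ad x \<circ> Ad (inv x * y)\<close> carries it to a neighbourhood of any \<open>x\<close>,
and finitely many such neighbourhoods cover the group.\<close>

lemma Ad_bounded:
  assumes "compact_space T"
  shows "\<exists>C. \<forall>x\<in>carrier G. \<forall>Y. norm (Ad x Y) \<le> C * norm Y"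
proof -
  obtain C0 where "\<forall>\<^sub>F u in nhds e0. \<forall>Y. norm (Ad (chart_inv c u) Y) \<le> C0 * norm Y" using Ad_local(1) by blast
  then obtain U0 where U0: "open U0" "e0 \<in> U0" "\<And>u Y. u \<in> U0 \<Longrightarrow> norm (Ad (chart_inv c u) Y) \<le> C0 * norm Y"
    unfolding eventually_nhds by blast
  define N where "N = {x \<in> chart_dom c. chart_map c x \<in> U0}"
  have N: "openin T N" "\<one>\<^bsub>G\<^esub> \<in> N" using chart_like_A[OF cA] U0 one_in by (auto simp: chart_like_def N_def)
  have NC: "norm (Ad x Y) \<le> C0 * norm Y" if "x \<in> N" for x Y
    using U0(3)[of "chart_map c x" Y] that inv_map[of x] by (simp add: N_def)
  have "\<exists>M K. openin T M \<and> x \<in> M \<and> (\<forall>y\<in>M. \<forall>Y. norm (Ad y Y) \<le> K * norm Y)" if x: "x \<in> carrier G" for x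
  proof -
    have "inv\<^bsub>G\<^esub> x \<otimes>\<^bsub>G\<^esub> x \<in> N" using N x by simp
    then obtain M where M: "openin T M" "x \<in> M" "\<And>y. y \<in> M \<Longrightarrow> inv\<^bsub>G\<^esub> x \<otimes>\<^bsub>G\<^esub> y \<in> N"
      using mult_continuous[OF inv_closed[OF x] x N(1)] by metis
    obtain K where K: "K > 0" "\<And>Y. norm (Ad x Y) \<le> K * norm Y"
      using linear_bounded_pos[OF linear_Ad[OF x]] by blast
    have "norm (Ad y Y) \<le> (K * C0) * norm Y" if y: "y \<in> M" for y Y
    proof -
      have yG: "y \<in> carrier G" using y openin_subset[OF M(1)] topspace_eq by blast
      have "Ad y Y = Ad x (Ad (inv\<^bsub>G\<^esub> x \<otimes>\<^bsub>G\<^esub> y) Y)"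
        using Ad_mult[of x "inv\<^bsub>G\<^esub> x \<otimes>\<^bsub>G\<^esub> y" Y] x yG by (simp add: m_assoc[symmetric])
      then have "norm (Ad y Y) \<le> K * norm (Ad (inv\<^bsub>G\<^esub> x \<otimes>\<^bsub>G\<^esub> y) Y)" using K(2) by simp
      also have "\<dots> \<le> K * (C0 * norm Y)" using NC[OF M(3)[OF y]] K(1) by (intro mult_left_mono) auto
      finally show ?thesis by (simp add: mult.assoc)
    qed
    then show ?thesis using M by blast
  qed
  then obtain M K where MK: "\<And>x. x \<in> carrier G \<Longrightarrow> openin T (M x) \<and> x \<in> M x \<and> (\<forall>y\<in>M x. \<forall>Y. norm (Ad y Y) \<le> K x * norm Y)"
    by metis
  have "compactin T (topspace T)" using assms by (simp add: compact_space_def)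
  moreover have "\<forall>U\<in>M ` carrier G. openin T U" using MK by blast
  moreover have "topspace T \<subseteq> \<Union>(M ` carrier G)" using MK topspace_eq by blast
  ultimately obtain \<F> where \<F>: "finite \<F>" "\<F> \<subseteq> M ` carrier G" "topspace T \<subseteq> \<Union>\<F>"
    unfolding compactin_def by meson
  obtain F where F: "finite F" "F \<subseteq> carrier G" "\<F> = M ` F" using finite_subset_image[OF \<F>(1,2)] by blast
  have "norm (Ad x Y) \<le> (\<Sum>z\<in>F. \<bar>K z\<bar>) * norm Y" if x: "x \<in> carrier G" for x Y
  proof -
    obtain z where z: "z \<in> F" "x \<in> M z" using x \<F>(3) F(3) topspace_eq by auto
    then have "norm (Ad x Y) \<le> K z * norm Y" using MK F(2) by blast
    also have "\<dots> \<le> (\<Sum>z\<in>F. \<bar>K z\<bar>) * norm Y"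
    proof (rule mult_right_mono)
      have "K z \<le> \<bar>K z\<bar>" by simp
      also have "\<dots> \<le> (\<Sum>z\<in>F. \<bar>K z\<bar>)" using F(1) z(1) by (intro member_le_sum) auto
      finally show "K z \<le> (\<Sum>z\<in>F. \<bar>K z\<bar>)" .
    qed simp
    finally show ?thesis .
  qed
  then show ?thesis by blast
qed

end

section \<open>Invariant inner products of bounded linear groups\<close>

definition pullback_form :: "real^'n^'n \<Rightarrow> real^'n^'n \<Rightarrow> real^'n^'n" where
  "pullback_form A g = transpose A ** g ** A"

lemma metric_form_pullback: "metric_form (pullback_form A g) v w = metric_form g (A *v v) (A *v w)"
proof -
  have "v \<bullet> (transpose A *v z) = (A *v v) \<bullet> z" for z
    using dot_lmul_matrix[of v "transpose A" z] by (simp add: vector_transpose_matrix)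
  then show ?thesis
    by (simp add: metric_form_def pullback_form_def matrix_vector_mul_assoc[symmetric])
qed

lemma pullback_form_mult: "pullback_form A (pullback_form B g) = pullback_form (B ** A) g"
  by (simp add: pullback_form_def matrix_transpose_mul matrix_mul_assoc)

lemma linear_pullback_form: "linear (pullback_form A)"
  unfolding pullback_form_def
  by (rule linearI) (simp_all add: matrix_add_ldistrib matrix_add_rdistrib matrix_scaleR_left matrix_scaleR_right)

lemma norm_matrix_le_entries:
  fixes M :: "real^'n^'n" and b :: real
  assumes "\<And>i j. \<bar>M $ i $ j\<bar> \<le> b" shows "norm M \<le> (CARD('n))^2 * b"
proof -
  have "norm (M $ i) \<le> CARD('n) * b" for i
    using norm_le_l1_cart[of "M $ i"] sum_bounded_above[of UNIV "\<lambda>j. \<bar>M $ i $ j\<bar>" b] assms by fastforce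
  then have "(\<Sum>i\<in>UNIV. norm (M $ i)) \<le> (\<Sum>i\<in>(UNIV::'n set). CARD('n) * b)" by (intro sum_mono)
  moreover have "norm M \<le> (\<Sum>i\<in>UNIV. norm (M $ i))" by (simp add: norm_vec_def L2_set_le_sum)
  ultimately show ?thesis by (simp add: power2_eq_square mult.assoc)
qed

lemma norm_pullback_form_le:
  fixes A g :: "real^'n^'n" and C :: real
  assumes A: "\<And>v. norm (A *v v) \<le> C * norm v" and C: "C \<ge> 0"
  shows "norm (pullback_form A g) \<le> ((CARD('n))^2 * ((CARD('n))^2 * C^2)) * norm g"
proof -
  have a: "\<bar>A $ i $ j\<bar> \<le> C" for i j
  proof -
    have "\<bar>A $ i $ j\<bar> = \<bar>(A *v axis j 1) $ i\<bar>" by (simp add: matrix_vector_mult_basis column_def)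
    also have "\<dots> \<le> norm (A *v axis j 1)" by (rule component_le_norm_cart)
    also have "\<dots> \<le> C" using A[of "axis j 1"] by (simp add: norm_axis_1)
    finally show ?thesis .
  qed
  have g: "\<bar>g $ i $ j\<bar> \<le> norm g" for i j
    by (metis component_le_norm_cart Finite_Cartesian_Product.norm_nth_le order_trans)
  have "\<bar>pullback_form A g $ i $ j\<bar> \<le> (CARD('n))^2 * (C^2 * norm g)" for i j
  proof -
    have "\<bar>pullback_form A g $ i $ j\<bar> = \<bar>\<Sum>l\<in>UNIV. \<Sum>k\<in>UNIV. A $ k $ i * g $ k $ l * A $ l $ j\<bar>"
      by (simp add: pullback_form_def matrix_matrix_mult_def transpose_def sum_distrib_right)
    also have "\<dots> \<le> (\<Sum>l\<in>UNIV. \<Sum>k\<in>UNIV. \<bar>A $ k $ i * g $ k $ l * A $ l $ j\<bar>)"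
      by (rule order_trans[OF sum_abs]) (intro sum_mono sum_abs)
    also have "\<dots> \<le> (\<Sum>l\<in>(UNIV::'n set). \<Sum>k\<in>(UNIV::'n set). C * norm g * C)"
      using a g C by (intro sum_mono) (auto simp: abs_mult intro!: mult_mono)
    finally show ?thesis by (simp add: power2_eq_square mult_ac)
  qed
  from norm_matrix_le_entries[OF this] show ?thesis by (simp add: power2_eq_square mult_ac)
qed

text \<open>Averaging without an integral: the supremum of the norms of the translates of a form is an invariant
norm, whose minimiser on an invariant closed convex set of forms is unique by the parallelogram law
and hence invariant itself. The convex set consists of forms with translates bounded below, so that
the minimiser is positive definite.\<close>

theorem invariant_inner_product_exists:
  fixes H :: "(real^'n^'n) set"
  assumes bounded: "\<And>A v. A \<in> H \<Longrightarrow> norm (A *v v) \<le> C * norm v"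
    and one: "mat 1 \<in> H" and mult: "\<And>A B. A \<in> H \<Longrightarrow> B \<in> H \<Longrightarrow> A ** B \<in> H"
    and inverse: "\<And>A. A \<in> H \<Longrightarrow> \<exists>B\<in>H. A ** B = mat 1"
  obtains g where "is_metric g" "\<And>A. A \<in> H \<Longrightarrow> pullback_form A g = g"
proof -
  have Cpos: "C > 0"
  proof -
    have "norm (mat 1 *v (axis undefined 1 :: real^'n)) \<le> C * norm (axis undefined 1 :: real^'n)" by (rule bounded[OF one])
    then show ?thesis by (simp add: norm_axis_1)
  qed
  define D where "D = real ((CARD('n))^2) * (real ((CARD('n))^2) * C^2)"
  have D: "D > 0" using Cpos by (simp add: D_def)
  have pb: "norm (pullback_form A g) \<le> D * norm g" if "A \<in> H" for A g
    using norm_pullback_form_le[of A C g] bounded[OF that] Cpos by (simp add: D_def)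
  have inv: "\<exists>B\<in>H. B ** A = mat 1 \<and> A ** B = mat 1" if "A \<in> H" for A
    using inverse[OF that] matrix_left_right_inverse by blast
  define p where "p g = (SUP A\<in>H. norm (pullback_form A g))" for g
  have bdd: "bdd_above ((\<lambda>A. norm (pullback_form A g)) ` H)" for g
    using pb by (intro bdd_aboveI2[of _ _ "D * norm g"]) auto
  have p_upper: "norm (pullback_form A g) \<le> p g" if "A \<in> H" for A g
    unfolding p_def by (rule cSUP_upper[OF that bdd])
  have p_least: "p g \<le> b" if "\<And>A. A \<in> H \<Longrightarrow> norm (pullback_form A g) \<le> b" for g b
    unfolding p_def by (rule cSUP_least) (use one that in auto)
  have p_bound: "p g \<le> D * norm g" for g by (rule p_least) (rule pb)
  have p_norm: "norm g \<le> p g" for g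
    using p_upper[OF one, of g] by (simp add: pullback_form_def transpose_mat)
  have p_pos: "p g \<ge> 0" for g using p_norm[of g] norm_ge_zero[of g] by linarith
  have p_triangle: "p (g + h) \<le> p g + p h" for g h
  proof (rule p_least)
    fix A assume A: "A \<in> H"
    have "norm (pullback_form A (g + h)) \<le> norm (pullback_form A g) + norm (pullback_form A h)"
      by (simp add: linear_add[OF linear_pullback_form] norm_triangle_ineq)
    then show "norm (pullback_form A (g + h)) \<le> p g + p h" using p_upper[OF A, of g] p_upper[OF A, of h] by linarith
  qed
  have p_inv: "p (pullback_form B g) = p g" if B: "B \<in> H" for B g
  proof (rule antisym)
    have le: "p (pullback_form B g) \<le> p g" if "B \<in> H" for B g
      by (rule p_least) (use that mult p_upper in \<open>auto simp: pullback_form_mult\<close>)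
    show "p (pullback_form B g) \<le> p g" by (rule le[OF B])
    obtain B' where B': "B' \<in> H" "B ** B' = mat 1" using inv[OF B] by blast
    have "g = pullback_form B' (pullback_form B g)" by (simp add: pullback_form_mult B') (simp add: pullback_form_def transpose_mat)
    then show "p g \<le> p (pullback_form B g)" using le[OF B'(1), of "pullback_form B g"] by simp
  qed
  have p_cont: "continuous_on UNIV p"
  proof (rule continuous_onI)
    fix g :: "real^'n^'n" and \<epsilon> :: real assume \<epsilon>: "\<epsilon> > 0"
    have "dist (p h) (p g) \<le> \<epsilon>" if "dist h g < \<epsilon> / D" for h
    proof -
      have "p h \<le> p g + p (h - g)" "p g \<le> p h + p (g - h)" using p_triangle[of g "h - g"] p_triangle[of h "g - h"] by auto
      moreover have "p (h - g) \<le> D * dist h g" "p (g - h) \<le> D * dist h g"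
        using p_bound[of "h - g"] p_bound[of "g - h"] by (auto simp: dist_norm norm_minus_commute)
      moreover have "D * dist h g \<le> \<epsilon>" using that D by (simp add: field_simps)
      ultimately show ?thesis unfolding dist_real_def by linarith
    qed
    then show "\<exists>d>0. \<forall>x'\<in>UNIV. dist x' g < d \<longrightarrow> dist (p x') (p g) \<le> \<epsilon>"
      using \<epsilon> D by (intro exI[of _ "\<epsilon> / D"]) auto
  qed
  define K where "K = {g. transpose g = g \<and> (\<forall>A\<in>H. \<forall>v. metric_form g (A *v v) (A *v v) \<ge> (norm v)^2 / C^2)}"
  have K_inv: "pullback_form B g \<in> K" if "B \<in> H" "g \<in> K" for B g
  proof -
    have "transpose (pullback_form B g) = pullback_form B g"
      using that(2) by (simp add: pullback_form_def K_def matrix_transpose_mul matrix_mul_assoc)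
    moreover have "metric_form (pullback_form B g) (A *v v) (A *v v) \<ge> (norm v)^2 / C^2" if "A \<in> H" for A v
      using \<open>g \<in> K\<close> mult[OF \<open>B \<in> H\<close> that] by (auto simp: metric_form_pullback matrix_vector_mul_assoc K_def)
    ultimately show ?thesis by (simp add: K_def)
  qed
  have "mat 1 \<in> K"
  proof -
    have "metric_form (mat 1) (A *v v) (A *v v) \<ge> (norm v)^2 / C^2" if A: "A \<in> H" for A v
    proof -
      obtain B where B: "B \<in> H" "B ** A = mat 1" using inv[OF A] by blast
      have "norm v = norm (B *v (A *v v))" by (simp add: matrix_vector_mul_assoc B)
      also have "\<dots> \<le> C * norm (A *v v)" by (rule bounded[OF B(1)])
      finally have "(norm v)^2 \<le> (C * norm (A *v v))^2" by (intro power_mono) auto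
      then show ?thesis using Cpos by (simp add: metric_form_def power2_norm_eq_inner[symmetric] power_mult_distrib field_simps)
    qed
    then show ?thesis by (simp add: K_def transpose_mat)
  qed
  have cont_form: "continuous_on UNIV (\<lambda>g. metric_form g v v)" for v :: "real^'n"
    unfolding metric_form_def matrix_vector_mult_def inner_vec_def by (intro continuous_intros)
  have "closed K"
  proof -
    have "closed {g. transpose g = (g :: real^'n^'n)}"
      unfolding transpose_def by (intro closed_Collect_eq continuous_intros)
    moreover have "closed {g. metric_form g (A *v v) (A *v v) \<ge> (norm v)^2 / C^2}" for A :: "real^'n^'n" and v
      by (intro closed_Collect_le continuous_on_const cont_form)
    moreover have "K = {g. transpose g = g} \<inter> (\<Inter>A\<in>H. \<Inter>v. {g. metric_form g (A *v v) (A *v v) \<ge> (norm v)^2 / C^2})"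
      by (auto simp: K_def)
    ultimately show ?thesis by (simp only:) (intro closed_Int closed_INT ballI; assumption)
  qed
  then have "compact (K \<inter> cball 0 (p (mat 1)))" by (intro closed_Int_compact compact_cball)
  moreover have "mat 1 \<in> K \<inter> cball 0 (p (mat 1))" using \<open>mat 1 \<in> K\<close> p_norm[of "mat 1"] by simp
  ultimately obtain g0 where g0: "g0 \<in> K \<inter> cball 0 (p (mat 1))" "\<And>h. h \<in> K \<inter> cball 0 (p (mat 1)) \<Longrightarrow> p g0 \<le> p h"
    using continuous_attains_inf[OF _ _ continuous_on_subset[OF p_cont subset_UNIV]] by (metis empty_iff)
  have min: "p g0 \<le> p h" if "h \<in> K" for h
  proof (cases "norm h \<le> p (mat 1)")
    case True then show ?thesis using g0(2) that by simp
  next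
    case False
    then show ?thesis using p_norm[of h] g0(2)[of "mat 1"] \<open>mat 1 \<in> K\<close> p_norm[of "mat 1"] by simp
  qed
  have unique: "h = g0" if h: "h \<in> K" "p h = p g0" for h
  proof (rule ccontr)
    assume "h \<noteq> g0"
    define d where "d = (1/2) *\<^sub>R (h - g0)"
    define mid where "mid = (1/2) *\<^sub>R (h + g0)"
    have dpos: "norm d > 0" using \<open>h \<noteq> g0\<close> by (simp add: d_def)
    have "mid \<in> K"
    proof -
      have "transpose mid = mid" using h g0(1) by (simp add: mid_def K_def transpose_def vec_eq_iff)
      moreover have "metric_form mid (A *v v) (A *v v) \<ge> (norm v)^2 / C^2" if "A \<in> H" for A v
      proof -
        have "metric_form mid w w = (metric_form h w w + metric_form g0 w w) / 2" for w
          by (simp add: mid_def metric_form_def scaleR_matrix_vector_assoc[symmetric] matrix_vector_mult_add_rdistrib inner_add_right)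
        from this[of "A *v v"] have "2 * metric_form mid (A *v v) (A *v v) = metric_form h (A *v v) (A *v v) + metric_form g0 (A *v v) (A *v v)" by simp
        moreover have "metric_form h (A *v v) (A *v v) \<ge> (norm v)^2 / C^2" "metric_form g0 (A *v v) (A *v v) \<ge> (norm v)^2 / C^2"
          using h(1) g0(1) that by (auto simp: K_def)
        ultimately show ?thesis by linarith
      qed
      ultimately show ?thesis by (simp add: K_def)
    qed
    then have "p g0 \<le> p mid" by (rule min)
    have each: "(norm (pullback_form A mid))^2 \<le> (p g0)^2 - (norm d / D)^2" if A: "A \<in> H" for A
    proof -
      let ?x = "pullback_form A h" and ?y = "pullback_form A g0"
      have m: "pullback_form A mid = (1/2) *\<^sub>R (?x + ?y)" "pullback_form A d = (1/2) *\<^sub>R (?x - ?y)"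
        by (simp_all add: mid_def d_def linear_scale[OF linear_pullback_form] linear_add[OF linear_pullback_form] linear_diff[OF linear_pullback_form])
      have par: "(norm (pullback_form A mid))^2 + (norm (pullback_form A d))^2 = ((norm ?x)^2 + (norm ?y)^2) / 2"
        unfolding m by (simp add: power2_norm_eq_inner inner_add_left inner_add_right inner_diff_left inner_diff_right inner_commute field_simps)
      have arith: "a \<le> P - \<delta>" if "x \<le> P" "y \<le> P" "\<delta> \<le> b" "a + b = (x + y) / 2" for a b x y P \<delta> :: real
      proof -
        have "2 * (a + b) = x + y" using that(4) by simp
        then show ?thesis using that(1-3) by argo
      qed
      have xy: "(norm ?x)^2 \<le> (p g0)^2" "(norm ?y)^2 \<le> (p g0)^2"
        using p_upper[OF A, of h] p_upper[OF A, of g0] h(2) by (auto intro: power_mono)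
      have "norm d / D \<le> norm (pullback_form A d)"
      proof -
        obtain B where B: "B \<in> H" "A ** B = mat 1" using inv[OF A] by blast
        have "d = pullback_form B (pullback_form A d)" by (simp add: pullback_form_mult B) (simp add: pullback_form_def transpose_mat)
        then have "norm d \<le> D * norm (pullback_form A d)" using pb[OF B(1), of "pullback_form A d"] by simp
        then show ?thesis using D by (simp add: field_simps)
      qed
      then have "(norm d / D)^2 \<le> (norm (pullback_form A d))^2" using D by (intro power_mono) auto
      then show ?thesis by (rule arith[OF xy _ par])
    qed
    have lt: "(p g0)^2 - (norm d / D)^2 < (p g0)^2" using dpos D by simp
    have nonneg: "(p g0)^2 - (norm d / D)^2 \<ge> 0" using each[OF one] by (smt (verit) zero_le_power2)
    have "p mid \<le> sqrt ((p g0)^2 - (norm d / D)^2)"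
      by (rule p_least) (rule real_le_rsqrt, rule each)
    also have "\<dots> < sqrt ((p g0)^2)" using lt by (rule real_sqrt_less_mono)
    finally show False using \<open>p g0 \<le> p mid\<close> p_pos[of g0] by simp
  qed
  have "pullback_form A g0 = g0" if "A \<in> H" for A
    by (rule unique) (use K_inv[OF that] g0(1) p_inv[OF that] in auto)
  moreover have "is_metric g0"
    unfolding is_metric_def
  proof (intro conjI allI impI)
    show "transpose g0 = g0" using g0(1) by (simp add: K_def)
    fix v :: "real^'n" assume "v \<noteq> 0"
    then have "0 < (norm v)^2 / C^2" using Cpos by simp
    also have "\<dots> \<le> metric_form g0 (mat 1 *v v) (mat 1 *v v)" using g0(1) one by (auto simp only: K_def)
    finally show "0 < metric_form g0 v v" by simp
  qed
  ultimately show ?thesis using that by blast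
qed

section \<open>The Lie algebra of a compact semisimple Lie group\<close>

text \<open>The adjoint representation is bounded by compactness and so leaves an inner product invariant.
Differentiating at the identity, adjoint maps preserve brackets infinitesimally, which is the
Jacobi identity, and are skew. Therefore the Killing form at \<open>X\<close> is minus the squared length of
\<open>ad X\<close>, and vanishes only for central \<open>X\<close>; the centre is a solvable ideal.\<close>

theorem compact_lie_algebra_of_compact_group:
  fixes G :: "('a, 'r) monoid_scheme" and A :: "('a, real^'n) chart set"
  assumes lie: "lie_group G T A" and compact: "compact_space T" and c: "c \<in> A" "\<one>\<^bsub>G\<^esub> \<in> chart_dom c"
    and ss: "semisimple_lie_algebra (lie_bracket G c)"
  shows "compact_lie_algebra (lie_bracket G c)"
proof -
  interpret lie_group_chart G T A c using lie c by unfold_locales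
  let ?br = "lie_bracket G c"
  have bil: "bilinear ?br" unfolding lie_bracket_eq by (rule bilinear_local_bracket(1)[OF loc_mult_smooth])
  have skew: "?br y x = - ?br x y" for x y
    unfolding lie_bracket_eq by (rule bilinear_local_bracket(2)[OF loc_mult_smooth])
  note bb = bil[unfolded bilinear_conv_bounded_bilinear]
  have lbr: "linear (?br x)" for x using bil unfolding bilinear_def by (metis (full_types) eta_contract_eq)
  have near: "\<forall>\<^sub>F u in nhds e0. chart_inv c u \<in> carrier G"
    using eventually_near_one[OF open_dom one_in] by (rule eventually_mono) blast
  have ad1: "Ad (chart_inv c e0) Y = Y" for Y by (simp add: inv_map one_in Ad_one)
  note dAd = Ad_local(2)
  have jacobi: "?br X (?br Y Z) = ?br (?br X Y) Z + ?br Y (?br X Z)" for X Y Z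
  proof -
    have d: "((\<lambda>u. ?br (Ad (chart_inv c u) Y) (Ad (chart_inv c u) Z)) has_derivative
        (\<lambda>X. ?br (Ad (chart_inv c e0) Y) (?br X Z) + ?br (?br X Y) (Ad (chart_inv c e0) Z))) (at e0)"
      by (rule bounded_bilinear.FDERIV[OF bb dAd dAd])
    have ev: "\<forall>\<^sub>F u in nhds e0. ?br (Ad (chart_inv c u) Y) (Ad (chart_inv c u) Z) = Ad (chart_inv c u) (?br Y Z)"
      using near by (rule eventually_mono) (simp add: Ad_bracket)
    have "((\<lambda>u. Ad (chart_inv c u) (?br Y Z)) has_derivative (\<lambda>X. ?br Y (?br X Z) + ?br (?br X Y) Z)) (at e0)"
      using has_derivative_cong_nhds[OF ev d] unfolding ad1 .
    then have "(\<lambda>X. ?br X (?br Y Z)) = (\<lambda>X. ?br Y (?br X Z) + ?br (?br X Y) Z)"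
      using has_derivative_unique[OF dAd] by blast
    then show ?thesis by (metis add.commute)
  qed
  obtain C where C: "\<And>x Y. x \<in> carrier G \<Longrightarrow> norm (Ad x Y) \<le> C * norm Y" using Ad_bounded[OF compact] by blast
  define H where "H = (\<lambda>x. matrix (Ad x)) ` carrier G"
  have mAd: "matrix (Ad x) *v v = Ad x v" if "x \<in> carrier G" for x v
    using linear_Ad[OF that] by (simp add: matrix_works linear_matrix_vector_mul_eq[symmetric] matrix_vector_mul(2)[symmetric])
  have mm: "matrix (Ad x) ** matrix (Ad y) = matrix (Ad (x \<otimes>\<^bsub>G\<^esub> y))" if "x \<in> carrier G" "y \<in> carrier G" for x y
    using that by (simp add: matrix_eq matrix_vector_mul_assoc[symmetric] mAd Ad_mult)
  have m1: "matrix (Ad \<one>\<^bsub>G\<^esub>) = mat 1" by (simp add: matrix_eq mAd Ad_one)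
  obtain g where g: "is_metric g" "\<And>B. B \<in> H \<Longrightarrow> pullback_form B g = g"
  proof (rule invariant_inner_product_exists[of H C])
    show "norm (B *v v) \<le> C * norm v" if "B \<in> H" for B v using that C by (auto simp: H_def mAd)
    show "mat 1 \<in> H" unfolding H_def m1[symmetric] by blast
    show "B ** B' \<in> H" if "B \<in> H" "B' \<in> H" for B B' using that by (auto simp: H_def mm)
    show "\<exists>B'\<in>H. B ** B' = mat 1" if BH: "B \<in> H" for B
    proof -
      obtain x where x: "x \<in> carrier G" "B = matrix (Ad x)" using BH by (auto simp: H_def)
      then have "B ** matrix (Ad (inv\<^bsub>G\<^esub> x)) = mat 1" by (simp add: mm m1)
      then show ?thesis using x(1) unfolding H_def by blast
    qed
  qed blast
  have inv: "metric_form g (Ad x Y) (Ad x Z) = metric_form g Y Z" if "x \<in> carrier G" for x Y Z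
    using g(2)[of "matrix (Ad x)"] that metric_form_pullback[of "matrix (Ad x)" g Y Z] by (simp add: H_def mAd)
  have ad_skew: "metric_form g (?br X Y) Z = - metric_form g Y (?br X Z)" for X Y Z
  proof -
    have bf: "bounded_bilinear (metric_form g)" using bilinear_metric_form by (simp add: bilinear_conv_bounded_bilinear)
    have d: "((\<lambda>u. metric_form g (Ad (chart_inv c u) Y) (Ad (chart_inv c u) Z)) has_derivative
        (\<lambda>X. metric_form g (Ad (chart_inv c e0) Y) (?br X Z) + metric_form g (?br X Y) (Ad (chart_inv c e0) Z))) (at e0)"
      by (rule bounded_bilinear.FDERIV[OF bf dAd dAd])
    have ev: "\<forall>\<^sub>F u in nhds e0. metric_form g (Ad (chart_inv c u) Y) (Ad (chart_inv c u) Z) = metric_form g Y Z"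
      using near by (rule eventually_mono) (rule inv)
    have "((\<lambda>u. metric_form g Y Z) has_derivative (\<lambda>X. metric_form g Y (?br X Z) + metric_form g (?br X Y) Z)) (at e0)"
      using has_derivative_cong_nhds[OF ev d] unfolding ad1 .
    then have "(\<lambda>X. metric_form g Y (?br X Z) + metric_form g (?br X Y) Z) = (\<lambda>X. 0)"
      using has_derivative_unique has_derivative_const by blast
    then have "metric_form g Y (?br X Z) + metric_form g (?br X Y) Z = 0" by (rule fun_cong)
    then show ?thesis by linarith
  qed
  have center: "X = 0" if X: "\<And>Y. ?br X Y = 0" for X
  proof -
    define Z where "Z = {x. \<forall>y. ?br x y = 0}"
    have "subspace Z"
      by (auto simp: subspace_def Z_def bilinear_ladd[OF bil] bilinear_lmul[OF bil] bilinear_lzero[OF bil])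
    moreover have zero: "?br x y = 0" if "y \<in> Z" for x y using that skew[of y x] by (simp add: Z_def)
    ultimately have "lie_ideal ?br Z" using subspace_0[of Z] by (auto simp: lie_ideal_def)
    moreover have "derived_series ?br Z 1 = {0}"
    proof -
      have "{?br x y | x y. x \<in> Z \<and> y \<in> Z} \<subseteq> {0}" using zero by auto
      then have "span {?br x y | x y. x \<in> Z \<and> y \<in> Z} \<subseteq> {0}" by (intro span_minimal) auto
      then show ?thesis using span_zero by auto
    qed
    ultimately have "Z = {0}" using ss unfolding semisimple_lie_algebra_def by blast
    then show ?thesis using X by (auto simp: Z_def)
  qed
  have "killing_form ?br X X < 0" if "X \<noteq> 0" for X
  proof -
    obtain e where e: "frame g e" using simultaneous_frame[OF g(1), of g] g(1) is_metric_def by metis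
    have "linear (\<lambda>z. ?br X (?br X z))" using linear_compose[OF lbr lbr] by (simp add: o_def)
    then have "killing_form ?br X X = (\<Sum>i\<in>UNIV. metric_form g (?br X (?br X (e i))) (e i))"
      unfolding killing_form_def by (rule trace_frame[OF g(1) e])
    also have "\<dots> = - (\<Sum>i\<in>UNIV. metric_form g (?br X (e i)) (?br X (e i)))"
      by (simp add: ad_skew[of X "?br X _"] sum_negf)
    finally have kf: "killing_form ?br X X = - (\<Sum>i\<in>UNIV. metric_form g (?br X (e i)) (?br X (e i)))" .
    have nn: "metric_form g v v \<ge> 0" for v
      using g(1) by (cases "v = 0") (auto simp: is_metric_def metric_form_simps less_imp_le)
    have "\<exists>i. ?br X (e i) \<noteq> 0"
    proof (rule ccontr)
      assume no: "\<not> ?thesis"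
      have "?br X Y = 0" for Y
      proof -
        have "?br X Y = ?br X (\<Sum>i\<in>UNIV. metric_form g Y (e i) *\<^sub>R e i)" by (simp add: frame_expand[OF g(1) e])
        then show ?thesis using no by (simp add: linear_sum[OF lbr] linear_scale[OF lbr])
      qed
      then show False using center that by blast
    qed
    then obtain i where "?br X (e i) \<noteq> 0" by blast
    then have "metric_form g (?br X (e i)) (?br X (e i)) > 0" using g(1) by (simp add: is_metric_def)
    then have "(\<Sum>i\<in>UNIV. metric_form g (?br X (e i)) (?br X (e i))) > 0"
      by (intro sum_pos2[of UNIV i]) (auto simp: nn)
    then show ?thesis using kf by simp
  qed
  then show ?thesis using bil skew jacobi by unfold_locales
qed

section \<open>Traces on complex matrices\<close>

text \<open>Both sides are the trace of \<open>f\<close> restricted to \<open>W\<close>.\<close>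

lemma sum_orthonormal_basis_projection:
  fixes f \<pi> :: "'a::euclidean_space \<Rightarrow> 'a"
  assumes \<beta>: "finite \<beta>" "\<And>b c. b \<in> \<beta> \<Longrightarrow> c \<in> \<beta> \<Longrightarrow> b \<bullet> c = (if b = c then 1 else 0)" "span \<beta> = W"
    and \<pi>: "\<And>x. \<pi> x \<in> W" "\<And>x. x \<in> W \<Longrightarrow> \<pi> x = x" "\<And>x y. \<pi> x \<bullet> y = x \<bullet> \<pi> y"
    and f: "linear f"
  shows "(\<Sum>b\<in>\<beta>. f b \<bullet> b) = (\<Sum>e\<in>Basis. f (\<pi> e) \<bullet> e)"
proof -
  have expand: "w = (\<Sum>b\<in>\<beta>. (w \<bullet> b) *\<^sub>R b)" if w: "w \<in> W" for w
  proof -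
    obtain u where u: "w = (\<Sum>b\<in>\<beta>. u b *\<^sub>R b)"
      using w \<beta>(3) span_finite[OF \<beta>(1)] by auto
    have "w \<bullet> c = u c" if c: "c \<in> \<beta>" for c
    proof -
      have "w \<bullet> c = (\<Sum>b\<in>\<beta>. u b * (b \<bullet> c))" unfolding u by (simp add: inner_sum_left)
      also have "\<dots> = (\<Sum>b\<in>\<beta>. if b = c then u c else 0)" using \<beta>(2) c by (intro sum.cong refl) auto
      finally show ?thesis using \<beta>(1) c by simp
    qed
    then show ?thesis using u by simp
  qed
  have "f (\<pi> e) \<bullet> e = (\<Sum>b\<in>\<beta>. (b \<bullet> e) * (f b \<bullet> e))" for e
  proof -
    have "\<pi> e = (\<Sum>b\<in>\<beta>. (b \<bullet> e) *\<^sub>R b)"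
      using expand[OF \<pi>(1)[of e]] \<pi>(2,3) \<beta>(3) by (metis (no_types, lifting) inner_commute span_base sum.cong)
    then show ?thesis by (simp add: linear_sum[OF f] linear_scale[OF f] inner_sum_left)
  qed
  then have "(\<Sum>e\<in>Basis. f (\<pi> e) \<bullet> e) = (\<Sum>b\<in>\<beta>. \<Sum>e\<in>Basis. (b \<bullet> e) * (f b \<bullet> e))"
    by (simp only:) (rule sum.swap)
  also have "\<dots> = (\<Sum>b\<in>\<beta>. f b \<bullet> b)"
  proof (rule sum.cong[OF refl])
    fix b show "(\<Sum>e\<in>Basis. (b \<bullet> e) * (f b \<bullet> e)) = f b \<bullet> b"
      by (subst euclidean_inner[of "f b" b]) (simp add: mult.commute)
  qed
  finally show ?thesis ..
qed

text \<open>Multiplication by complex scalars; the vector space structure of \<open>complex^'m^'m\<close> is real.\<close>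

definition cscale :: "complex \<Rightarrow> complex^'m^'m \<Rightarrow> complex^'m^'m" where
  "cscale z A = (\<chi> i j. z * A $ i $ j)"

definition unit_matrix :: "'m \<Rightarrow> 'm \<Rightarrow> complex^'m^'m" where
  "unit_matrix i j = axis i (axis j 1)"

lemma unit_matrix_nth: "unit_matrix i j $ k $ l = (if k = i \<and> l = j then 1 else 0)"
  by (simp add: unit_matrix_def axis_def)

lemma inner_matrix: "A \<bullet> (B :: complex^'m^'m) = (\<Sum>i\<in>UNIV. \<Sum>j\<in>UNIV. Re (A $ i $ j * cnj (B $ i $ j)))"
  by (simp add: inner_vec_def inner_complex_def)

lemma sum_Basis_matrix:
  fixes F :: "complex^'m^'m \<Rightarrow> real"
  shows "(\<Sum>e\<in>Basis. F e) = (\<Sum>i\<in>UNIV. \<Sum>j\<in>UNIV. F (unit_matrix i j) + F (cscale \<i> (unit_matrix i j)))"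
proof -
  have ax: "cscale \<i> (unit_matrix i j) = axis i (axis j \<i>)" for i j :: 'm
    by (simp add: vec_eq_iff cscale_def unit_matrix_def axis_def)
  have "(Basis :: (complex^'m^'m) set) = (\<Union>i\<in>UNIV. \<Union>j\<in>UNIV. {unit_matrix i j, cscale \<i> (unit_matrix i j)})"
    unfolding ax unfolding Basis_vec_def Basis_complex_def unit_matrix_def by auto
  also have "sum F \<dots> = (\<Sum>i\<in>UNIV. \<Sum>j\<in>UNIV. sum F {unit_matrix i j, cscale \<i> (unit_matrix i j)})"
  proof -
    have ne: "unit_matrix i j $ i $ j = 1" "cscale \<i> (unit_matrix i j) $ i $ j = \<i>"
      "(k, l) \<noteq> (i, j) \<Longrightarrow> unit_matrix k l $ i $ j = 0" "(k, l) \<noteq> (i, j) \<Longrightarrow> cscale \<i> (unit_matrix k l) $ i $ j = 0"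
      for i j k l :: 'm by (auto simp: unit_matrix_nth cscale_def)
    have disj: "{unit_matrix i j, cscale \<i> (unit_matrix i j)} \<inter> {unit_matrix k l, cscale \<i> (unit_matrix k l)} = {}"
      if neq: "(i, j) \<noteq> (k, l)" for i j k l :: 'm
    proof -
      have "A $ i $ j \<noteq> 0" if "A \<in> {unit_matrix i j, cscale \<i> (unit_matrix i j)}" for A
        using that ne(1,2)[of i j] by auto
      moreover have "A $ i $ j = 0" if "A \<in> {unit_matrix k l, cscale \<i> (unit_matrix k l)}" for A
        using that ne(3,4)[of k l i j] neq by auto
      ultimately show ?thesis by blast
    qed
    have "sum F (\<Union>j\<in>UNIV. {unit_matrix i j, cscale \<i> (unit_matrix i j)}) =
      (\<Sum>j\<in>UNIV. sum F {unit_matrix i j, cscale \<i> (unit_matrix i j)})" for i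
    proof (rule sum.UNION_disjoint)
      show "\<forall>j\<in>UNIV. \<forall>l\<in>UNIV. j \<noteq> l \<longrightarrow>
          {unit_matrix i j, cscale \<i> (unit_matrix i j)} \<inter> {unit_matrix i l, cscale \<i> (unit_matrix i l)} = {}"
        using disj by blast
    qed auto
    moreover have "sum F (\<Union>i\<in>UNIV. \<Union>j\<in>UNIV. {unit_matrix i j, cscale \<i> (unit_matrix i j)}) =
      (\<Sum>i\<in>UNIV. sum F (\<Union>j\<in>UNIV. {unit_matrix i j, cscale \<i> (unit_matrix i j)}))"
    proof -
      have disj': "\<forall>i\<in>(UNIV::'m set). \<forall>k\<in>UNIV. i \<noteq> k \<longrightarrow>
          (\<Union>j\<in>UNIV. {unit_matrix i j, cscale \<i> (unit_matrix i j)}) \<inter> (\<Union>j\<in>UNIV. {unit_matrix k j, cscale \<i> (unit_matrix k j)}) = {}"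
      proof (intro ballI impI)
        fix i k :: 'm assume "i \<noteq> k"
        then have "{unit_matrix i j, cscale \<i> (unit_matrix i j)} \<inter> {unit_matrix k l, cscale \<i> (unit_matrix k l)} = {}" for j l
          by (intro disj) simp
        then show "(\<Union>j\<in>UNIV. {unit_matrix i j, cscale \<i> (unit_matrix i j)}) \<inter> (\<Union>j\<in>UNIV. {unit_matrix k j, cscale \<i> (unit_matrix k j)}) = {}"
          by (simp only: Int_UN_distrib2) simp
      qed
      show ?thesis by (rule sum.UNION_disjoint[OF _ _ disj']) auto
    qed
    ultimately show ?thesis by simp
  qed
  also have "\<dots> = (\<Sum>i\<in>UNIV. \<Sum>j\<in>UNIV. F (unit_matrix i j) + F (cscale \<i> (unit_matrix i j)))"
  proof (intro sum.cong refl)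
    fix i j :: 'm
    have "unit_matrix i j \<noteq> cscale \<i> (unit_matrix i j)"
    proof
      assume "unit_matrix i j = cscale \<i> (unit_matrix i j)"
      then have "unit_matrix i j $ i $ j = cscale \<i> (unit_matrix i j) $ i $ j" by simp
      then show False by (simp add: unit_matrix_nth cscale_def complex_eq_iff)
    qed
    then show "sum F {unit_matrix i j, cscale \<i> (unit_matrix i j)} = F (unit_matrix i j) + F (cscale \<i> (unit_matrix i j))" by simp
  qed
  finally show ?thesis .
qed

lemma inner_unit_matrix: "A \<bullet> unit_matrix i j = Re (A $ i $ j)" "A \<bullet> cscale \<i> (unit_matrix i j) = Im (A $ i $ j)"
proof -
  show "A \<bullet> unit_matrix i j = Re (A $ i $ j)"
    by (simp add: unit_matrix_def inner_axis inner_complex_def)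
  have "cscale \<i> (unit_matrix i j) = axis i (axis j \<i>)"
    by (simp add: vec_eq_iff cscale_def unit_matrix_def axis_def)
  then show "A \<bullet> cscale \<i> (unit_matrix i j) = Im (A $ i $ j)"
    by (simp add: inner_axis inner_complex_def)
qed

definition commutator :: "complex^'m^'m \<Rightarrow> complex^'m^'m \<Rightarrow> complex^'m^'m" where
  "commutator A B = A ** B - B ** A"

text \<open>A compact matrix Lie algebra is a real form of a complex subspace: the skew-Hermitian elements of the
range of a complex linear projection.\<close>

definition skew_hermitian_range :: "(complex^'m^'m \<Rightarrow> complex^'m^'m) \<Rightarrow> (complex^'m^'m) set" where
  "skew_hermitian_range P = {X. P X = X \<and> conj_transpose X = - X}"

locale hermitian_projection =
  fixes P :: "complex^'m^'m \<Rightarrow> complex^'m^'m"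
  assumes linear_P: "linear P"
    and P_cscale: "P (cscale \<i> Z) = cscale \<i> (P Z)"
    and P_idem: "P (P Z) = P Z"
    and P_adjoint: "P (conj_transpose Z) = conj_transpose (P Z)"
    and P_self_adjoint: "P Y \<bullet> Z = Y \<bullet> P Z"
begin

lemma linear_conj_transpose: "linear conj_transpose"
  by (rule linearI) (simp_all add: conj_transpose_def vec_eq_iff)

lemma subspace_range: "subspace (skew_hermitian_range P)"
proof -
  have [simp]: "P 0 = 0" "conj_transpose 0 = 0"
    using linear_0[OF linear_P] linear_0[OF linear_conj_transpose] by auto
  show ?thesis
    unfolding subspace_def skew_hermitian_range_def
    by (auto simp: linear_add[OF linear_P] linear_scale[OF linear_P] linear_add[OF linear_conj_transpose] linear_scale[OF linear_conj_transpose])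
qed

text \<open>The trace of a complex linear map over a real form is its complex trace over the complex subspace,
which can be computed with matrix units instead of an orthonormal basis of the real form.\<close>

lemma sum_orthonormal_basis:
  assumes \<beta>: "finite \<beta>" "\<And>b c. b \<in> \<beta> \<Longrightarrow> c \<in> \<beta> \<Longrightarrow> b \<bullet> c = (if b = c then 1 else 0)"
      "span \<beta> = skew_hermitian_range P"
    and f: "linear f" "\<And>Z. f (cscale \<i> Z) = cscale \<i> (f Z)"
  shows "(\<Sum>b\<in>\<beta>. f b \<bullet> b) = (\<Sum>i\<in>UNIV. \<Sum>j\<in>UNIV. Re (f (P (unit_matrix i j)) $ i $ j))"
proof -
  define \<pi> where "\<pi> Z = (1/2) *\<^sub>R (P Z - conj_transpose (P Z))" for Z
  have ct: "conj_transpose (A - B) = conj_transpose A - conj_transpose B"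
    "conj_transpose (r *\<^sub>R A) = r *\<^sub>R conj_transpose A" "conj_transpose (conj_transpose A) = A"
    for A B :: "complex^'m^'m" and r
    by (simp_all add: conj_transpose_def vec_eq_iff)
  have cti: "conj_transpose A \<bullet> B = A \<bullet> conj_transpose B" for A B :: "complex^'m^'m"
    unfolding inner_matrix conj_transpose_def by (subst sum.swap) (simp add: mult.commute)
  have "(\<Sum>b\<in>\<beta>. f b \<bullet> b) = (\<Sum>e\<in>Basis. f (\<pi> e) \<bullet> e)"
  proof (rule sum_orthonormal_basis_projection[OF \<beta> _ _ _ f(1)])
    show "\<pi> x \<in> skew_hermitian_range P" for x
      by (simp add: skew_hermitian_range_def \<pi>_def linear_scale[OF linear_P] linear_diff[OF linear_P]
          P_idem P_adjoint ct scaleR_minus_right[symmetric] del: scaleR_minus_right)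
    show "\<pi> x = x" if "x \<in> skew_hermitian_range P" for x
      using that by (simp add: skew_hermitian_range_def \<pi>_def scaleR_2[symmetric])
    show "\<pi> x \<bullet> y = x \<bullet> \<pi> y" for x y
      by (simp add: \<pi>_def inner_diff_left inner_diff_right cti P_self_adjoint P_adjoint)
  qed
  also have "\<dots> = (\<Sum>i\<in>UNIV. \<Sum>j\<in>UNIV. Re (f (\<pi> (unit_matrix i j)) $ i $ j) + Im (f (\<pi> (cscale \<i> (unit_matrix i j))) $ i $ j))"
    unfolding sum_Basis_matrix inner_unit_matrix ..
  also have "\<dots> = (\<Sum>i\<in>UNIV. \<Sum>j\<in>UNIV. Re (f (P (unit_matrix i j)) $ i $ j))"
  proof (intro sum.cong refl)
    fix i j :: 'm
    let ?E = "unit_matrix i j"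
    have c: "conj_transpose (cscale \<i> A) = - cscale \<i> (conj_transpose A)" for A :: "complex^'m^'m"
      by (simp add: vec_eq_iff conj_transpose_def cscale_def)
    have "f (\<pi> ?E) = (1/2) *\<^sub>R (f (P ?E) - f (conj_transpose (P ?E)))"
      by (simp add: \<pi>_def linear_scale[OF f(1)] linear_diff[OF f(1)])
    moreover have "f (\<pi> (cscale \<i> ?E)) = (1/2) *\<^sub>R (cscale \<i> (f (P ?E)) + cscale \<i> (f (conj_transpose (P ?E))))"
      by (simp add: \<pi>_def linear_scale[OF f(1)] linear_diff[OF f(1)] linear_add[OF f(1)] P_cscale c f(2))
    ultimately show "Re (f (\<pi> ?E) $ i $ j) + Im (f (\<pi> (cscale \<i> ?E)) $ i $ j) = Re (f (P ?E) $ i $ j)"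
      by (simp add: cscale_def diff_divide_distrib add_divide_distrib)
  qed
  finally show ?thesis .
qed

lemma dim_range: "real (dim (skew_hermitian_range P)) = (\<Sum>i\<in>UNIV. \<Sum>j\<in>UNIV. Re (P (unit_matrix i j) $ i $ j))"
proof -
  obtain \<beta> where \<beta>: "\<beta> \<subseteq> skew_hermitian_range P" "pairwise orthogonal \<beta>" "\<And>x. x \<in> \<beta> \<Longrightarrow> norm x = 1"
     "independent \<beta>" "card \<beta> = dim (skew_hermitian_range P)" "span \<beta> = skew_hermitian_range P"
    using orthonormal_basis_subspace[OF subspace_range] by metis
  have "(\<Sum>b\<in>\<beta>. b \<bullet> b) = (\<Sum>i\<in>UNIV. \<Sum>j\<in>UNIV. Re (P (unit_matrix i j) $ i $ j))"
  proof (rule sum_orthonormal_basis[of \<beta> "\<lambda>x. x"])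
    show "finite \<beta>" using \<beta>(4) independent_imp_finite by blast
    show "b \<bullet> c = (if b = c then 1 else 0)" if "b \<in> \<beta>" "c \<in> \<beta>" for b c
      using \<beta>(2,3) that by (auto simp: pairwise_def orthogonal_def norm_eq_1)
  qed (use \<beta>(6) linear_ident in auto)
  moreover have "(\<Sum>b\<in>\<beta>. b \<bullet> b) = card \<beta>" using \<beta>(3) by (simp add: norm_eq_1)
  ultimately show ?thesis using \<beta>(5) by simp
qed

end

lemma commutator_twice: "commutator X (commutator X Z) = X ** X ** Z - 2 *\<^sub>R (X ** Z ** X) + Z ** X ** X"
proof -
  have "commutator X (commutator X Z) = X ** (X ** Z) - X ** (Z ** X) - (X ** Z ** X - Z ** X ** X)"
    unfolding commutator_def
    by (simp add: vec_eq_iff matrix_matrix_mult_def right_diff_distrib left_diff_distrib sum_subtractf)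
  then show ?thesis by (simp add: matrix_mul_assoc scaleR_2)
qed

lemma inner_skew_hermitian: "conj_transpose X = - X \<Longrightarrow> Re (trace (X ** X)) = - (X \<bullet> X)"
proof -
  assume "conj_transpose X = - X"
  then have "cnj (X $ j $ i) = - X $ i $ j" for i j by (simp add: conj_transpose_def vec_eq_iff)
  then have "Re (X $ i $ j * X $ j $ i) = - Re (X $ i $ j * cnj (X $ i $ j))" for i j
    by (metis complex_cnj_cnj complex_cnj_minus minus_equation_iff mult_minus_right uminus_complex.sel(1))
  then show ?thesis
    by (simp only: trace_def matrix_matrix_mult_def inner_matrix sum_negf vec_lambda_beta Re_sum)
qed

lemma double_commutator_unit:
  fixes X :: "complex^'m^'m"
  shows
  "commutator X (commutator X (unit_matrix k l)) $ i $ j =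
     (if l = j then (X ** X) $ i $ k else 0) - 2 * X $ i $ k * X $ l $ j + (if k = i then (X ** X) $ l $ j else 0)"
proof -
  have 1: "(A ** unit_matrix k l) $ i $ j = (if l = j then A $ i $ k else 0)" for A :: "complex^'m^'m" and i j
    by (simp add: matrix_matrix_mult_def unit_matrix_nth if_distrib[of "\<lambda>x. _ * x"] cong: if_cong)
  have 2: "(unit_matrix k l ** A) $ i $ j = (if k = i then A $ l $ j else 0)" for A :: "complex^'m^'m" and i j
    by (simp add: matrix_matrix_mult_def unit_matrix_nth if_distrib[of "\<lambda>x. x * _"] cong: if_cong)
  have 3: "(X ** unit_matrix k l ** X) $ i $ j = X $ i $ k * X $ l $ j"
    unfolding matrix_mul_assoc[symmetric]
    by (simp add: matrix_matrix_mult_def[of X "unit_matrix k l ** X"] 2 if_distrib[of "\<lambda>x. _ * x"] cong: if_cong)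
  have 4: "(unit_matrix k l ** X ** X) $ i $ j = (if k = i then (X ** X) $ l $ j else 0)"
    unfolding matrix_mul_assoc[symmetric] by (rule 2)
  show ?thesis unfolding commutator_twice by (simp add: 1 3 4 scaleR_conv_of_real[of 2])
qed

lemma linear_commutator: "linear (commutator X)"
  unfolding commutator_def
  by (rule linearI) (simp_all add: vec_eq_iff matrix_matrix_mult_def distrib_left distrib_right sum.distrib scaleR_sum_right[symmetric] scaleR_diff_right)

lemma linear_double_commutator: "linear (\<lambda>Z. commutator X (commutator X Z))"
  using linear_compose[OF linear_commutator linear_commutator, of X X] by (simp add: o_def)

lemma commutator_cscale: "commutator X (cscale z Z) = cscale z (commutator X Z)"
  by (simp add: commutator_def cscale_def vec_eq_iff matrix_matrix_mult_def sum_distrib_left right_diff_distrib mult_ac)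

definition orthonormal_basis :: "'a::euclidean_space set \<Rightarrow> 'a set \<Rightarrow> bool" where
  "orthonormal_basis \<beta> W \<longleftrightarrow> finite \<beta> \<and> (\<forall>b\<in>\<beta>. \<forall>c\<in>\<beta>. b \<bullet> c = (if b = c then 1 else 0)) \<and> span \<beta> = W"

text \<open>The trace form of the adjoint representation of \<open>W\<close> is minus \<open>\<kappa>\<close> times the inner product of matrices.
For a matrix Lie algebra this compares the Killing form with that inner product, and the constants
of an algebra and a subalgebra together determine the block sums.\<close>

definition casimir_constant :: "(complex^'m^'m) set \<Rightarrow> real \<Rightarrow> bool" where
  "casimir_constant W \<kappa> \<longleftrightarrow> (\<forall>X\<in>W. \<forall>\<beta>. orthonormal_basis \<beta> W \<longrightarrow>
      (\<Sum>b\<in>\<beta>. commutator X (commutator X b) \<bullet> b) = - \<kappa> * (X \<bullet> X))"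

lemma matrix_mult_nth: "(A ** B) $ i $ j = (\<Sum>k\<in>UNIV. A $ i $ k * B $ k $ j)"
  by (simp add: matrix_matrix_mult_def)

lemma sum_indicator_pair:
  "(\<Sum>i\<in>UNIV. \<Sum>j\<in>UNIV. if i \<in> S \<and> j \<in> S then F i j else 0) = (\<Sum>i\<in>S. \<Sum>j\<in>S. F i j)"
  for F :: "'m::finite \<Rightarrow> 'm \<Rightarrow> 'b::comm_monoid_add"
proof -
  have "(\<Sum>j\<in>UNIV. if i \<in> S \<and> j \<in> S then F i j else 0) = (if i \<in> S then (\<Sum>j\<in>S. F i j) else 0)" for i
    by (simp add: sum.If_cases)
  then show ?thesis by (simp add: sum.If_cases)
qed

lemma trace_supported:
  assumes "\<And>i j. i \<notin> S \<or> j \<notin> S \<Longrightarrow> X $ i $ j = 0"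
  shows "(\<Sum>i\<in>S. (X ** X) $ i $ i) = trace (X ** X)" "(\<Sum>i\<in>S. X $ i $ i) = trace X"
proof -
  have "(X ** X) $ i $ i = 0" if "i \<notin> S" for i using assms that by (simp add: matrix_mult_nth)
  then show "(\<Sum>i\<in>S. (X ** X) $ i $ i) = trace (X ** X)"
    unfolding trace_def by (intro sum.mono_neutral_left) auto
  show "(\<Sum>i\<in>S. X $ i $ i) = trace X"
    unfolding trace_def by (intro sum.mono_neutral_left) (use assms in auto)
qed

section \<open>The Lie algebra of SU\<close>

text \<open>The index set \<open>S\<close> selects the rows and columns of a corner, so that an algebra and its corner
subalgebras are treated at once.\<close>

definition su_projection :: "'m set \<Rightarrow> complex^'m^'m \<Rightarrow> complex^'m^'m" where
  "su_projection S Z = (\<chi> i j. if i \<in> S \<and> j \<in> S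
     then Z $ i $ j - (if i = j then (\<Sum>k\<in>S. Z $ k $ k) / of_nat (card S) else 0) else 0)"

definition su_algebra :: "'m set \<Rightarrow> (complex^'m^'m) set" where
  "su_algebra S = {X. (\<forall>i j. i \<notin> S \<or> j \<notin> S \<longrightarrow> X $ i $ j = 0) \<and> trace X = 0 \<and> conj_transpose X = - X}"

lemma su_projection_nth: "i \<in> S \<Longrightarrow> j \<in> S \<Longrightarrow>
    su_projection S Z $ i $ j = Z $ i $ j - (if i = j then (\<Sum>k\<in>S. Z $ k $ k) / of_nat (card S) else 0)"
  "i \<notin> S \<or> j \<notin> S \<Longrightarrow> su_projection S Z $ i $ j = 0"
  by (auto simp: su_projection_def)

lemma hermitian_projection_su:
  fixes S :: "'m::finite set"
  assumes S: "S \<noteq> {}" shows "hermitian_projection (su_projection S)"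
proof (rule hermitian_projection.intro)
  let ?n = "of_nat (card S) :: complex"
  have n: "?n \<noteq> 0" using S by (simp add: card_eq_0_iff)
  show "linear (su_projection S)"
    by (rule linearI)
      (auto simp: su_projection_def vec_eq_iff sum.distrib add_divide_distrib right_diff_distrib
        scaleR_conv_of_real[where 'a = complex] sum_distrib_left[symmetric])
  show "su_projection S (cscale \<i> Z) = cscale \<i> (su_projection S Z)" for Z
    by (auto simp: su_projection_def cscale_def vec_eq_iff sum_distrib_left[symmetric] right_diff_distrib)
  show "su_projection S (su_projection S Z) = su_projection S Z" for Z
  proof -
    have "(\<Sum>k\<in>S. su_projection S Z $ k $ k) = 0"
      using n by (simp add: su_projection_nth sum_subtractf)
    then show ?thesis by (subst su_projection_def) (auto simp: vec_eq_iff su_projection_nth)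
  qed
  show "su_projection S (conj_transpose Z) = conj_transpose (su_projection S Z)" for Z
    by (auto simp: su_projection_def conj_transpose_def vec_eq_iff)
  show "su_projection S Y \<bullet> Z = Y \<bullet> su_projection S Z" for Y Z
  proof -
    let ?t = "\<lambda>Z. \<Sum>k\<in>S. Z $ k $ k"
    have L: "A \<bullet> su_projection S B = (\<Sum>i\<in>S. \<Sum>j\<in>S. Re (A $ i $ j * cnj (B $ i $ j))) - Re (?t A * cnj (?t B / ?n))" for A B
    proof -
      have "A \<bullet> su_projection S B = (\<Sum>i\<in>UNIV. \<Sum>j\<in>UNIV. if i \<in> S \<and> j \<in> S then
          Re (A $ i $ j * cnj (B $ i $ j)) - (if i = j then Re (A $ i $ i * cnj (?t B / ?n)) else 0) else 0)"
        unfolding inner_matrix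
      proof (intro sum.cong refl)
        fix i j
        have "A $ i $ j * cnj (B $ i $ j - (if i = j then v else 0)) = A $ i $ j * cnj (B $ i $ j) - (if i = j then A $ i $ i * cnj v else 0)" for v
          by (simp add: right_diff_distrib)
        then have "Re (A $ i $ j * cnj (B $ i $ j - (if i = j then v else 0))) = Re (A $ i $ j * cnj (B $ i $ j)) - (if i = j then Re (A $ i $ i * cnj v) else 0)" for v
          by (simp only: minus_complex.sel if_distrib[of Re] zero_complex.sel)
        then show "Re (A $ i $ j * cnj (su_projection S B $ i $ j)) = (if i \<in> S \<and> j \<in> S then
          Re (A $ i $ j * cnj (B $ i $ j)) - (if i = j then Re (A $ i $ i * cnj (?t B / ?n)) else 0) else 0)"
        proof (cases "i \<in> S \<and> j \<in> S")
          case False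
          then have "su_projection S B $ i $ j = 0" by (intro su_projection_nth(2)) blast
          then show ?thesis using False by auto
        qed (simp_all only: su_projection_nth if_True simp_thms)
      qed
      also have "\<dots> = (\<Sum>i\<in>S. \<Sum>j\<in>S. Re (A $ i $ j * cnj (B $ i $ j))) - (\<Sum>i\<in>S. Re (A $ i $ i * cnj (?t B / ?n)))"
        unfolding sum_indicator_pair sum_subtractf by (simp cong: if_cong)
      also have "(\<Sum>i\<in>S. Re (A $ i $ i * cnj (?t B / ?n))) = Re (?t A * cnj (?t B / ?n))"
        by (simp only: Re_sum[symmetric] sum_distrib_right)
      finally show ?thesis .
    qed
    have "Re (u * cnj (v / ?n)) = Re (v * cnj (u / ?n))" for u v
      by (simp add: algebra_simps)
    then have e1: "Re (?t Y * cnj (?t Z / ?n)) = Re (?t Z * cnj (?t Y / ?n))" .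
    have e2: "(\<Sum>i\<in>S. \<Sum>j\<in>S. Re (Y $ i $ j * cnj (Z $ i $ j))) = (\<Sum>i\<in>S. \<Sum>j\<in>S. Re (Z $ i $ j * cnj (Y $ i $ j)))"
      by (simp add: mult.commute)
    show ?thesis unfolding inner_commute[of _ Z] L by (simp only: e1 e2)
  qed
qed

lemma su_algebra_range:
  fixes S :: "'m::finite set" assumes "S \<noteq> {}"
  shows "skew_hermitian_range (su_projection S) = su_algebra S"
proof -
  have n: "of_nat (card S) \<noteq> (0::complex)" using assms by (simp add: card_eq_0_iff)
  have "su_projection S X = X \<longleftrightarrow> (\<forall>i j. i \<notin> S \<or> j \<notin> S \<longrightarrow> X $ i $ j = 0) \<and> trace X = 0" (is "?l \<longleftrightarrow> ?r") for X
  proof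
    assume P: ?l
    then have z: "X $ i $ j = 0" if "i \<notin> S \<or> j \<notin> S" for i j using su_projection_nth(2)[OF that] by metis
    have "(\<Sum>k\<in>S. su_projection S X $ k $ k) = 0"
      using n by (simp add: su_projection_nth sum_subtractf)
    then have "trace X = 0" using P trace_supported(2)[OF z] by simp
    then show ?r using z by blast
  next
    assume r: ?r
    then have "(\<Sum>k\<in>S. X $ k $ k) = 0" using trace_supported(2)[of S X] by auto
    then show ?l using r by (auto simp: su_projection_def vec_eq_iff)
  qed
  then show ?thesis unfolding skew_hermitian_range_def su_algebra_def by auto
qed

lemma su_projection_unit:
  "su_projection S (unit_matrix i j) $ k $ l =
    (if i \<in> S \<and> j \<in> S then unit_matrix i j $ k $ l - (if i = j then (if k = l \<and> k \<in> S then 1 / of_nat (card S) else 0) else 0) else 0)"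
proof -
  have "(\<Sum>k\<in>S. unit_matrix i j $ k $ k) = (if i = j \<and> i \<in> S then 1 else 0 :: complex)"
  proof -
    have "(\<Sum>k\<in>S. unit_matrix i j $ k $ k) = (\<Sum>k\<in>S. if k = i then (if i = j then 1 else 0) else 0 :: complex)"
      by (intro sum.cong refl) (auto simp: unit_matrix_nth)
    then show ?thesis by simp
  qed
  then show ?thesis by (auto simp: su_projection_def unit_matrix_nth)
qed

lemma dim_su_algebra:
  fixes S :: "'m::finite set" assumes "S \<noteq> {}"
  shows "real (dim (su_algebra S)) = (real (card S))^2 - 1"
proof -
  interpret hermitian_projection "su_projection S" by (rule hermitian_projection_su[OF assms])
  have "real (dim (su_algebra S)) = (\<Sum>i\<in>UNIV. \<Sum>j\<in>UNIV. Re (su_projection S (unit_matrix i j) $ i $ j))"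
    using dim_range su_algebra_range[OF assms] by simp
  also have "\<dots> = (\<Sum>i\<in>UNIV. \<Sum>j\<in>UNIV. if i \<in> S \<and> j \<in> S then 1 - (if i = j then 1 / real (card S) else 0) else 0)"
    by (intro sum.cong refl) (auto simp: su_projection_unit unit_matrix_nth)
  also have "\<dots> = (real (card S))^2 - 1"
  proof -
    have "real (card S) \<noteq> 0" using assms by (simp add: card_eq_0_iff)
    then show ?thesis unfolding sum_indicator_pair by (simp add: sum_subtractf power2_eq_square field_simps cong: if_cong)
  qed
  finally show ?thesis .
qed

lemma casimir_su_algebra:
  fixes S :: "'m::finite set" assumes "S \<noteq> {}"
  shows "casimir_constant (su_algebra S) (2 * real (card S))"
  unfolding casimir_constant_def
proof (intro ballI allI impI)
  fix X \<beta> assume X: "X \<in> su_algebra S" and \<beta>: "orthonormal_basis \<beta> (su_algebra S)"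
  interpret hermitian_projection "su_projection S" by (rule hermitian_projection_su[OF assms])
  let ?D = "\<lambda>Z. commutator X (commutator X Z)"
  define e :: "complex^'m^'m" where "e = (\<chi> k l. if k = l \<and> k \<in> S then 1 else 0)"
  have sup: "X $ i $ j = 0" if "i \<notin> S \<or> j \<notin> S" for i j using X that by (auto simp: su_algebra_def)
  have "X ** e = X"
  proof -
    have "(X ** e) $ i $ j = (\<Sum>k\<in>UNIV. if k = j then X $ i $ j else 0)" for i j
      unfolding matrix_mult_nth using sup by (intro sum.cong refl) (auto simp: e_def)
    then show ?thesis by (simp add: vec_eq_iff)
  qed
  moreover have "e ** X = X"
  proof -
    have "(e ** X) $ i $ j = (\<Sum>k\<in>UNIV. if k = i then X $ i $ j else 0)" for i j
      unfolding matrix_mult_nth using sup by (intro sum.cong refl) (auto simp: e_def)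
    then show ?thesis by (simp add: vec_eq_iff)
  qed
  ultimately have "commutator X e = 0" by (simp add: commutator_def)
  then have De: "?D e = 0" using linear_0[OF linear_commutator] by simp
  have "su_projection S (unit_matrix i j) = (if i \<in> S \<and> j \<in> S then unit_matrix i j - (if i = j then (1 / real (card S)) *\<^sub>R e else 0) else 0)" for i j
    by (auto simp: vec_eq_iff su_projection_unit e_def scaleR_conv_of_real[where 'a = complex])
  then have D: "?D (su_projection S (unit_matrix i j)) = (if i \<in> S \<and> j \<in> S then ?D (unit_matrix i j) else 0)" for i j
    using De by (auto simp: linear_0[OF linear_double_commutator] linear_diff[OF linear_double_commutator] linear_scale[OF linear_double_commutator])
  have "(\<Sum>b\<in>\<beta>. ?D b \<bullet> b) = (\<Sum>i\<in>UNIV. \<Sum>j\<in>UNIV. Re (?D (su_projection S (unit_matrix i j)) $ i $ j))"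
    using \<beta> by (intro sum_orthonormal_basis linear_double_commutator)
      (auto simp: orthonormal_basis_def su_algebra_range[OF assms] commutator_cscale)
  also have "\<dots> = (\<Sum>i\<in>UNIV. \<Sum>j\<in>UNIV. if i \<in> S \<and> j \<in> S then Re ((X ** X) $ i $ i) - 2 * Re (X $ i $ i * X $ j $ j) + Re ((X ** X) $ j $ j) else 0)"
    by (intro sum.cong refl) (simp add: D double_commutator_unit)
  also have "\<dots> = 2 * card S * Re (\<Sum>i\<in>S. (X ** X) $ i $ i) - 2 * Re ((\<Sum>i\<in>S. X $ i $ i) * (\<Sum>i\<in>S. X $ i $ i))"
    unfolding sum_indicator_pair sum_product by (simp add: sum.distrib sum_subtractf sum_distrib_left mult.assoc)
  also have "\<dots> = 2 * card S * Re (trace (X ** X))"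
  proof -
    have "trace X = 0" using X by (simp add: su_algebra_def)
    then show ?thesis by (simp only: trace_supported[OF sup]) simp
  qed
  also have "\<dots> = - (2 * real (card S)) * (X \<bullet> X)"
    using inner_skew_hermitian[of X] X by (simp add: su_algebra_def)
  finally show "(\<Sum>b\<in>\<beta>. ?D b \<bullet> b) = - (2 * real (card S)) * (X \<bullet> X)" .
qed

section \<open>The Lie algebra of Sp\<close>

text \<open>\<open>partner\<close> and \<open>sign_of\<close> describe the symplectic matrix, whose row \<open>i\<close> has the single nonzero entry
\<open>sign_of i\<close> in the column \<open>partner i\<close>.\<close>

fun partner :: "'k + 'k \<Rightarrow> 'k + 'k" where
  "partner (Inl a) = Inr a" | "partner (Inr a) = Inl a"

fun sign_of :: "'k + 'k \<Rightarrow> complex" where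
  "sign_of (Inl a) = 1" | "sign_of (Inr a) = - 1"

lemma partner_partner [simp]: "partner (partner i) = i" by (cases i) auto
lemma partner_eq_iff: "partner i = j \<longleftrightarrow> i = partner j" by (metis partner_partner)
lemma sign_partner [simp]: "sign_of (partner i) = - sign_of i" by (cases i) auto
lemma sign_sign [simp]: "sign_of i * sign_of i = 1" "sign_of i * (sign_of i * z) = z" by (cases i; simp)+
lemma cnj_sign [simp]: "cnj (sign_of i) = sign_of i" by (cases i) auto

definition sp_projection :: "('k + 'k) set \<Rightarrow> complex^('k::finite + 'k)^('k + 'k) \<Rightarrow> complex^('k + 'k)^('k + 'k)" where
  "sp_projection S Z = (\<chi> i j. if i \<in> S \<and> j \<in> S
     then (Z $ i $ j - sign_of i * sign_of j * Z $ partner j $ partner i) / 2 else 0)"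

definition sp_algebra :: "('k + 'k) set \<Rightarrow> (complex^('k::finite + 'k)^('k + 'k)) set" where
  "sp_algebra S = {X. (\<forall>i j. i \<notin> S \<or> j \<notin> S \<longrightarrow> X $ i $ j = 0) \<and>
     (\<forall>i j. X $ i $ j = - sign_of i * sign_of j * X $ partner j $ partner i) \<and> conj_transpose X = - X}"

lemma sp_projection_nth: "sp_projection S Z $ i $ j = (if i \<in> S \<and> j \<in> S
     then (Z $ i $ j - sign_of i * sign_of j * Z $ partner j $ partner i) / 2 else 0)"
  by (simp add: sp_projection_def)

lemma hermitian_projection_sp:
  fixes S :: "('k::finite + 'k) set"
  assumes S: "\<And>i. partner i \<in> S \<longleftrightarrow> i \<in> S" shows "hermitian_projection (sp_projection S)"
proof (rule hermitian_projection.intro)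
  show "linear (sp_projection S)"
    by (rule linearI)
      (auto simp: sp_projection_def vec_eq_iff scaleR_conv_of_real[where 'a = complex] algebra_simps add_divide_distrib diff_divide_distrib)
  show "sp_projection S (cscale \<i> Z) = cscale \<i> (sp_projection S Z)" for Z
    by (auto simp: sp_projection_def cscale_def vec_eq_iff right_diff_distrib)
  show "sp_projection S (sp_projection S Z) = sp_projection S Z" for Z
    by (auto simp: sp_projection_def vec_eq_iff S field_simps)
  show "sp_projection S (conj_transpose Z) = conj_transpose (sp_projection S Z)" for Z
    by (auto simp: sp_projection_def conj_transpose_def vec_eq_iff mult_ac)
  show "sp_projection S Y \<bullet> Z = Y \<bullet> sp_projection S Z" for Y Z
  proof -
    have L: "A \<bullet> sp_projection S B = (\<Sum>i\<in>S. \<Sum>j\<in>S. Re (A $ i $ j * cnj (B $ i $ j))) / 2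
        - (\<Sum>i\<in>S. \<Sum>j\<in>S. Re (sign_of i * sign_of j * (A $ i $ j * cnj (B $ partner j $ partner i)))) / 2" for A B
    proof -
      have "A \<bullet> sp_projection S B = (\<Sum>i\<in>UNIV. \<Sum>j\<in>UNIV. if i \<in> S \<and> j \<in> S then
          Re (A $ i $ j * cnj (B $ i $ j)) / 2 - Re (sign_of i * sign_of j * (A $ i $ j * cnj (B $ partner j $ partner i))) / 2 else 0)"
        unfolding inner_matrix
      proof (intro sum.cong refl)
        fix i j
        have "A $ i $ j * cnj ((B $ i $ j - sign_of i * sign_of j * B $ partner j $ partner i) / 2) =
          (A $ i $ j * cnj (B $ i $ j)) / 2 - (sign_of i * sign_of j * (A $ i $ j * cnj (B $ partner j $ partner i))) / 2"
          by (simp add: field_simps)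
        then show "Re (A $ i $ j * cnj (sp_projection S B $ i $ j)) = (if i \<in> S \<and> j \<in> S then
          Re (A $ i $ j * cnj (B $ i $ j)) / 2 - Re (sign_of i * sign_of j * (A $ i $ j * cnj (B $ partner j $ partner i))) / 2 else 0)"
          by (simp only: sp_projection_def vec_lambda_beta) (simp del: times_complex.sel)
      qed
      then show ?thesis unfolding sum_indicator_pair by (simp only: sum_subtractf sum_divide_distrib)
    qed
    have bij: "bij_betw partner S S"
      by (rule bij_betw_byWitness[where f' = partner]) (auto simp: S)
    have "(\<Sum>i\<in>S. \<Sum>j\<in>S. Re (sign_of i * sign_of j * (Y $ i $ j * cnj (Z $ partner j $ partner i))))
        = (\<Sum>i\<in>S. \<Sum>j\<in>S. Re (sign_of i * sign_of j * (Z $ i $ j * cnj (Y $ partner j $ partner i))))" (is "?l = ?r")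
    proof -
      have "?r = (\<Sum>i\<in>S. \<Sum>j\<in>S. Re (sign_of (partner i) * sign_of (partner j) * (Z $ partner i $ partner j * cnj (Y $ partner (partner j) $ partner (partner i)))))"
        by (subst sum.reindex_bij_betw[OF bij, symmetric], rule sum.cong[OF refl], subst sum.reindex_bij_betw[OF bij, symmetric], rule refl)
      also have "\<dots> = (\<Sum>j\<in>S. \<Sum>i\<in>S. Re (cnj (sign_of i * sign_of j * (Z $ partner i $ partner j * cnj (Y $ j $ i)))))"
        by (subst sum.swap) (simp del: times_complex.sel complex_cnj_mult)
      also have "\<dots> = ?l" by (simp add: mult_ac del: times_complex.sel cnj.sel)
      finally show ?thesis ..
    qed
    moreover have "(\<Sum>i\<in>S. \<Sum>j\<in>S. Re (Y $ i $ j * cnj (Z $ i $ j))) = (\<Sum>i\<in>S. \<Sum>j\<in>S. Re (Z $ i $ j * cnj (Y $ i $ j)))"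
      by (simp add: mult.commute)
    ultimately show ?thesis unfolding inner_commute[of _ Z] L by simp
  qed
qed

lemma sp_algebra_range:
  fixes S :: "('k::finite + 'k) set" assumes S: "\<And>i. partner i \<in> S \<longleftrightarrow> i \<in> S"
  shows "skew_hermitian_range (sp_projection S) = sp_algebra S"
proof -
  have "sp_projection S X = X \<longleftrightarrow> (\<forall>i j. i \<notin> S \<or> j \<notin> S \<longrightarrow> X $ i $ j = 0) \<and>
     (\<forall>i j. X $ i $ j = - sign_of i * sign_of j * X $ partner j $ partner i)" (is "?l \<longleftrightarrow> ?r") for X
  proof
    assume P: ?l
    then have z: "X $ i $ j = 0" if "i \<notin> S \<or> j \<notin> S" for i j
      using that sp_projection_nth[of S X i j] unfolding P by auto
    have "X $ i $ j = - sign_of i * sign_of j * X $ partner j $ partner i" for i j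
    proof (cases "i \<in> S \<and> j \<in> S")
      case True
      then have "X $ i $ j = (X $ i $ j - sign_of i * sign_of j * X $ partner j $ partner i) / 2"
        using sp_projection_nth[of S X i j] unfolding P by simp
      then have "2 * X $ i $ j = X $ i $ j - sign_of i * sign_of j * X $ partner j $ partner i" by simp
      then show ?thesis by (simp add: algebra_simps eq_neg_iff_add_eq_0)
    next
      case False
      then show ?thesis using z[of i j] z[of "partner j" "partner i"] S by auto
    qed
    then show ?r using z by blast
  next
    assume r: ?r
    have "(X $ i $ j - sign_of i * sign_of j * X $ partner j $ partner i) / 2 = X $ i $ j" for i j
    proof -
      have "X $ i $ j = - sign_of i * sign_of j * X $ partner j $ partner i" using r by blast
      then have "sign_of i * sign_of j * X $ partner j $ partner i = - X $ i $ j" by simp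
      then show ?thesis by (simp only:) simp
    qed
    moreover have "X $ i $ j = 0" if "\<not> (i \<in> S \<and> j \<in> S)" for i j using r that by blast
    ultimately have "sp_projection S X $ i $ j = X $ i $ j" for i j
      unfolding sp_projection_nth by (cases "i \<in> S \<and> j \<in> S") (simp_all only: if_True if_False simp_thms)
    then show ?l by (simp add: vec_eq_iff)
  qed
  then show ?thesis unfolding skew_hermitian_range_def sp_algebra_def by auto
qed

lemma sp_projection_unit:
  fixes S :: "('k::finite + 'k) set" assumes S: "\<And>i. partner i \<in> S \<longleftrightarrow> i \<in> S"
  shows "sp_projection S (unit_matrix i j) = (if i \<in> S \<and> j \<in> S
    then (1/2) *\<^sub>R (unit_matrix i j - cscale (sign_of i * sign_of j) (unit_matrix (partner j) (partner i))) else 0)"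
proof -
  have "sp_projection S (unit_matrix i j) $ k $ l = (if i \<in> S \<and> j \<in> S
    then (1/2) *\<^sub>R (unit_matrix i j - cscale (sign_of i * sign_of j) (unit_matrix (partner j) (partner i))) else 0) $ k $ l" for k l
  proof -
    have "sign_of k * sign_of l * (unit_matrix i j $ partner l $ partner k :: complex) =
        sign_of i * sign_of j * unit_matrix (partner j) (partner i) $ k $ l"
      unfolding unit_matrix_nth by (auto simp: partner_eq_iff)
    moreover have "unit_matrix i j $ k $ l = (0::complex)" "unit_matrix (partner j) (partner i) $ k $ l = (0::complex)"
      if "(k \<in> S \<and> l \<in> S) \<noteq> (i \<in> S \<and> j \<in> S)"
      using that S by (auto simp: unit_matrix_nth)
    ultimately show ?thesis
      unfolding sp_projection_nth
      by (cases "k \<in> S \<and> l \<in> S"; cases "i \<in> S \<and> j \<in> S")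
        (auto simp: cscale_def scaleR_conv_of_real[where 'a = complex])
  qed
  then show ?thesis by (simp add: vec_eq_iff)
qed

lemma dim_sp_algebra:
  fixes S :: "('k::finite + 'k) set" assumes S: "\<And>i. partner i \<in> S \<longleftrightarrow> i \<in> S"
  shows "2 * real (dim (sp_algebra S)) = (real (card S))^2 + card S"
proof -
  interpret hermitian_projection "sp_projection S" by (rule hermitian_projection_sp[OF S])
  have "real (dim (sp_algebra S)) = (\<Sum>i\<in>UNIV. \<Sum>j\<in>UNIV. Re (sp_projection S (unit_matrix i j) $ i $ j))"
    using dim_range sp_algebra_range[OF S] by simp
  also have "\<dots> = (\<Sum>i\<in>UNIV. \<Sum>j\<in>UNIV. if i \<in> S \<and> j \<in> S then 1/2 + (if j = partner i then 1/2 else 0) else 0)"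
  proof (intro sum.cong refl)
    fix i j :: "'k + 'k"
    have "sp_projection S (unit_matrix i j) $ i $ j = (if i \<in> S \<and> j \<in> S then 1/2 + (if j = partner i then 1/2 else 0) else 0)"
      by (auto simp: sp_projection_nth unit_matrix_nth)
    then show "Re (sp_projection S (unit_matrix i j) $ i $ j) = (if i \<in> S \<and> j \<in> S then 1/2 + (if j = partner i then 1/2 else 0) else 0)"
      by simp
  qed
  also have "\<dots> = (\<Sum>i\<in>S. real (card S) / 2 + 1/2)"
    unfolding sum_indicator_pair by (intro sum.cong refl) (simp add: sum.distrib S)
  finally show ?thesis by (simp add: power2_eq_square field_simps)
qed

lemma casimir_sp_algebra:
  fixes S :: "('k::finite + 'k) set" assumes S: "\<And>i. partner i \<in> S \<longleftrightarrow> i \<in> S"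
  shows "casimir_constant (sp_algebra S) (real (card S) + 2)"
  unfolding casimir_constant_def
proof (intro ballI allI impI)
  fix X \<beta> assume X: "X \<in> sp_algebra S" and \<beta>: "orthonormal_basis \<beta> (sp_algebra S)"
  interpret hermitian_projection "sp_projection S" by (rule hermitian_projection_sp[OF S])
  let ?D = "\<lambda>Z. commutator X (commutator X Z)"
  have sup: "X $ i $ j = 0" if "i \<notin> S \<or> j \<notin> S" for i j using X that unfolding sp_algebra_def by blast
  have sym: "X $ i $ j = - sign_of i * sign_of j * X $ partner j $ partner i" for i j
    using X unfolding sp_algebra_def by blast
  have bij: "bij_betw partner S S"
    by (rule bij_betw_byWitness[where f' = partner]) (auto simp: S)
  have D: "?D (sp_projection S (unit_matrix i j)) $ i $ j = (if i \<in> S \<and> j \<in> S then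
      (1/2) * (((X ** X) $ i $ i - 2 * (X $ i $ i * X $ j $ j) + (X ** X) $ j $ j) +
        ((if j = partner i then (X ** X) $ i $ i + (X ** X) $ j $ j else 0) + 2 * (X $ i $ partner j * X $ partner j $ i))) else 0)" for i j
  proof -
    have sg: "sign_of i * sign_of j = - 1" if "j = partner i" using that by simp
    have cross: "sign_of i * sign_of j * (X $ i $ partner j * X $ partner i $ j) = X $ i $ partner j * X $ partner j $ i"
    proof -
      have "sign_of i * (sign_of j * (sign_of i * sign_of j)) = 1" by (cases i; cases j) auto
      then show ?thesis using sym[of "partner i" j] by simp
    qed
    have "?D (cscale (sign_of i * sign_of j) (unit_matrix (partner j) (partner i))) $ i $ j =
      - ((if j = partner i then (X ** X) $ i $ i + (X ** X) $ j $ j else 0) + 2 * (X $ i $ partner j * X $ partner j $ i))"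
    proof -
      have "s * (a - 2 * x * y + b) = s * a - 2 * (s * (x * y)) + s * b" for s a b x y :: complex
        by (simp add: algebra_simps)
      then show ?thesis
        unfolding commutator_cscale unfolding cscale_def vec_lambda_beta double_commutator_unit
        using sg by (simp only: cross) (auto simp: partner_eq_iff)
    qed
    then show ?thesis
      by (simp add: sp_projection_unit[OF S] linear_0[OF linear_double_commutator] linear_diff[OF linear_double_commutator]
        linear_scale[OF linear_double_commutator] double_commutator_unit scaleR_conv_of_real[where 'a = complex])
  qed
  have "(\<Sum>b\<in>\<beta>. ?D b \<bullet> b) = (\<Sum>i\<in>UNIV. \<Sum>j\<in>UNIV. Re (?D (sp_projection S (unit_matrix i j)) $ i $ j))"
    using \<beta> by (intro sum_orthonormal_basis linear_double_commutator)
      (auto simp: orthonormal_basis_def sp_algebra_range[OF S] commutator_cscale)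
  also have "\<dots> = Re (\<Sum>i\<in>S. \<Sum>j\<in>S. (1/2) * (((X ** X) $ i $ i - 2 * (X $ i $ i * X $ j $ j) + (X ** X) $ j $ j) +
        ((if j = partner i then (X ** X) $ i $ i + (X ** X) $ j $ j else 0) + 2 * (X $ i $ partner j * X $ partner j $ i))))"
    unfolding D Re_sum[symmetric] sum_indicator_pair ..
  also have "(\<Sum>i\<in>S. \<Sum>j\<in>S. (1/2) * (((X ** X) $ i $ i - 2 * (X $ i $ i * X $ j $ j) + (X ** X) $ j $ j) +
        ((if j = partner i then (X ** X) $ i $ i + (X ** X) $ j $ j else 0) + 2 * (X $ i $ partner j * X $ partner j $ i)))) =
     (1/2) * ((2 * of_nat (card S) * trace (X ** X) - 2 * (trace X * trace X)) + (2 * trace (X ** X) + 2 * trace (X ** X)))"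
  proof -
    have 1: "(\<Sum>i\<in>S. \<Sum>j\<in>S. (X ** X) $ i $ i - 2 * (X $ i $ i * X $ j $ j) + (X ** X) $ j $ j) =
        2 * of_nat (card S) * trace (X ** X) - 2 * (trace X * trace X)"
    proof -
      have "(\<Sum>i\<in>S. \<Sum>j\<in>S. (X ** X) $ i $ i - 2 * (X $ i $ i * X $ j $ j) + (X ** X) $ j $ j) =
          of_nat (card S) * (\<Sum>i\<in>S. (X ** X) $ i $ i) - 2 * ((\<Sum>i\<in>S. X $ i $ i) * (\<Sum>i\<in>S. X $ i $ i))
          + of_nat (card S) * (\<Sum>i\<in>S. (X ** X) $ i $ i)"
      proof -
        have "(\<Sum>i\<in>S. \<Sum>j\<in>S. 2 * (X $ i $ i * X $ j $ j)) = 2 * ((\<Sum>i\<in>S. X $ i $ i) * (\<Sum>i\<in>S. X $ i $ i))"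
          by (subst sum_product) (simp only: sum_distrib_left)
        then show ?thesis by (simp add: sum.distrib sum_subtractf flip: sum_distrib_left)
      qed
      then show ?thesis by (simp only: trace_supported[OF sup]) (simp add: algebra_simps)
    qed
    have 2: "(\<Sum>i\<in>S. \<Sum>j\<in>S. if j = partner i then (X ** X) $ i $ i + (X ** X) $ j $ j else 0) = 2 * trace (X ** X)"
      using sum.reindex_bij_betw[OF bij, of "\<lambda>i. (X ** X) $ i $ i"] trace_supported(1)[OF sup]
      by (simp add: S sum.distrib)
    have 3: "(\<Sum>i\<in>S. \<Sum>j\<in>S. X $ i $ partner j * X $ partner j $ i) = trace (X ** X)"
    proof -
      have "(\<Sum>j\<in>S. X $ i $ partner j * X $ partner j $ i) = (X ** X) $ i $ i" for i
      proof -
        have "(\<Sum>j\<in>S. X $ i $ partner j * X $ partner j $ i) = (\<Sum>j\<in>S. X $ i $ j * X $ j $ i)"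
          by (rule sum.reindex_bij_betw[OF bij])
        also have "\<dots> = (X ** X) $ i $ i"
          unfolding matrix_mult_nth by (intro sum.mono_neutral_left) (use sup in auto)
        finally show ?thesis .
      qed
      then show ?thesis using trace_supported(1)[OF sup] by simp
    qed
    have split: "(\<Sum>i\<in>S. \<Sum>j\<in>S. 1/2 * (F i j + (K i j + 2 * H i j))) =
        1/2 * ((\<Sum>i\<in>S. \<Sum>j\<in>S. F i j) + ((\<Sum>i\<in>S. \<Sum>j\<in>S. K i j) + 2 * (\<Sum>i\<in>S. \<Sum>j\<in>S. H i j)))"
      for F K H :: "'k + 'k \<Rightarrow> 'k + 'k \<Rightarrow> complex"
      by (simp only: sum.distrib flip: sum_distrib_left)
    show ?thesis by (simp only: split 1 2 3)
  qed
  also have "trace X = 0"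
  proof -
    have "trace X = (\<Sum>i\<in>UNIV. X $ partner i $ partner i)"
      unfolding trace_def
      by (rule sum.reindex_bij_witness[of _ partner partner]) auto
    also have "\<dots> = (\<Sum>i\<in>UNIV. - X $ i $ i)"
    proof (rule sum.cong[OF refl])
      fix i show "X $ partner i $ partner i = - X $ i $ i" using sym[of i i] by simp
    qed
    also have "\<dots> = - trace X" by (simp add: trace_def sum_negf)
    finally show ?thesis by simp
  qed
  also have "Re ((1/2) * ((2 * of_nat (card S) * trace (X ** X) - 2 * (0 * 0)) + (2 * trace (X ** X) + 2 * trace (X ** X))))
      = (real (card S) + 2) * Re (trace (X ** X))"
    by (simp add: algebra_simps)
  also have "\<dots> = - (real (card S) + 2) * (X \<bullet> X)"
  proof -
    have "Re (trace (X ** X)) = - (X \<bullet> X)"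
      using inner_skew_hermitian[of X] X by (simp add: sp_algebra_def)
    then show ?thesis by (simp only: mult_minus_left mult_minus_right)
  qed
  finally show "(\<Sum>b\<in>\<beta>. ?D b \<bullet> b) = - (real (card S) + 2) * (X \<bullet> X)" .
qed

section \<open>Lie algebras of matrices\<close>

text \<open>A faithful matrix representation \<open>\<Phi>\<close> of the Lie algebra turns the standard metric into a multiple of
the inner product of matrices (\<open>q_eq\<close>), the factor being the Casimir constant of the image.\<close>

locale matrix_lie_algebra = compact_lie_algebra br for br :: "real^'n \<Rightarrow> real^'n \<Rightarrow> real^'n" +
  fixes \<Phi> :: "real^'n \<Rightarrow> complex^'m^'m" and W :: "(complex^'m^'m) set" and \<kappa> :: real
  assumes linear_\<Phi>: "linear \<Phi>" and inj_\<Phi>: "inj \<Phi>" and \<Phi>_bracket: "\<Phi> (br X Y) = commutator (\<Phi> X) (\<Phi> Y)"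
    and range_\<Phi>: "range \<Phi> = W" and casimir_W: "casimir_constant W \<kappa>" and \<kappa>_pos: "\<kappa> > 0"
begin

lemma dim_W: "dim W = CARD('n)"
proof -
  have "dim (\<Phi> ` UNIV) = dim (UNIV :: (real^'n) set)" by (rule dim_image_eq[OF linear_\<Phi>]) (use inj_\<Phi> in simp)
  then show ?thesis using range_\<Phi> by simp
qed

lemma q_self: "q X X = \<kappa> * (\<Phi> X \<bullet> \<Phi> X)"
proof -
  have "subspace W" using range_\<Phi> linear_subspace_image[OF linear_\<Phi> subspace_UNIV] by simp
  then obtain \<beta> where \<beta>: "\<beta> \<subseteq> W" "pairwise orthogonal \<beta>" "\<And>x. x \<in> \<beta> \<Longrightarrow> norm x = 1"
     "independent \<beta>" "card \<beta> = dim W" "span \<beta> = W"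
    using orthonormal_basis_subspace by metis
  have fin: "finite \<beta>" using \<beta>(4) independent_imp_finite by blast
  have on: "b \<bullet> c = (if b = c then 1 else 0)" if "b \<in> \<beta>" "c \<in> \<beta>" for b c
    using \<beta>(2,3) that by (auto simp: pairwise_def orthogonal_def norm_eq_1)
  have ob: "orthonormal_basis \<beta> W" using fin on \<beta>(6) by (simp add: orthonormal_basis_def)
  have "card \<beta> = CARD('n)" using \<beta>(5) dim_W by simp
  then have "\<exists>h. bij_betw h (UNIV :: 'n set) \<beta>"
    using finite_same_card_bij[OF finite_class.finite_UNIV fin] by metis
  then obtain h :: "'n \<Rightarrow> complex^'m^'m" where h: "bij_betw h UNIV \<beta>" by blast
  have "h i \<in> range \<Phi>" for i unfolding range_\<Phi> using h \<beta>(1) by (auto simp: bij_betw_def)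
  then have "\<exists>x. \<Phi> x = h i" for i by (metis imageE)
  then obtain v where v: "\<And>i. \<Phi> (v i) = h i" by metis
  have lin: "linear (\<lambda>z. br X (br X z))" using linear_compose[OF linear_br linear_br] by (simp add: o_def)
  have "killing_form br X X = (\<Sum>i\<in>UNIV. \<Phi> (br X (br X (v i))) \<bullet> h i)"
    unfolding killing_form_def
  proof (rule trace_dual_basis[where l = "\<lambda>i z. \<Phi> z \<bullet> h i", OF lin])
    show "linear (\<lambda>z. \<Phi> z \<bullet> h i)" for i
      by (rule linearI) (simp_all add: linear_add[OF linear_\<Phi>] linear_scale[OF linear_\<Phi>] inner_add_left)
    show "\<Phi> (v j) \<bullet> h i = (if i = j then 1 else 0)" for i j
    proof -
      have "h i \<in> \<beta>" "h j \<in> \<beta>" "h j = h i \<longleftrightarrow> j = i" using h by (auto simp: bij_betw_def inj_eq)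
      then show ?thesis using on[of "h j" "h i"] by (auto simp: v)
    qed
  qed
  also have "\<dots> = (\<Sum>i\<in>UNIV. commutator (\<Phi> X) (commutator (\<Phi> X) (h i)) \<bullet> h i)"
    by (simp add: \<Phi>_bracket v)
  also have "\<dots> = (\<Sum>b\<in>\<beta>. commutator (\<Phi> X) (commutator (\<Phi> X) b) \<bullet> b)"
    by (rule sum.reindex_bij_betw[OF h])
  also have "\<dots> = - \<kappa> * (\<Phi> X \<bullet> \<Phi> X)"
    using casimir_W ob range_\<Phi> unfolding casimir_constant_def by blast
  finally show ?thesis by (simp add: standard_form)
qed

lemma q_eq: "q X Y = \<kappa> * (\<Phi> X \<bullet> \<Phi> Y)"
proof -
  have "q (X + Y) (X + Y) = q X X + q Y Y + 2 * q X Y" using q_commute[of X Y] by (simp add: metric_form_simps)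
  moreover have "\<Phi> (X + Y) \<bullet> \<Phi> (X + Y) = \<Phi> X \<bullet> \<Phi> X + \<Phi> Y \<bullet> \<Phi> Y + 2 * (\<Phi> X \<bullet> \<Phi> Y)"
    by (simp add: linear_add[OF linear_\<Phi>] inner_add_left inner_add_right inner_commute)
  ultimately show ?thesis unfolding q_self by (simp add: algebra_simps)
qed

text \<open>The frame is adapted to a subalgebra with known Casimir constant; the quotient of the two constants
tells which part of the Killing form comes from the subalgebra.\<close>

lemma subalgebra_frame:
  assumes W': "subspace W'" "W' \<subseteq> W" "\<And>X Y. X \<in> W' \<Longrightarrow> Y \<in> W' \<Longrightarrow> commutator X Y \<in> W'"
    and cas: "casimir_constant W' \<kappa>'"
    and E: "orthonormal_set Q E" "\<And>v e. \<Phi> v \<in> W' \<Longrightarrow> e \<in> E \<Longrightarrow> q v e = 0"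
  obtains f I where "frame Q f" "card I = dim W'" "\<And>i. i \<in> I \<Longrightarrow> \<Phi> (f i) \<in> W'" "E \<subseteq> f ` (- I)"
    "(\<Sum>i\<in>I. \<Sum>j\<in>I. \<Sum>k\<in>UNIV. (struct_const f i j k)^2) = dim W' * (\<kappa>' / \<kappa>)"
    "\<And>i j k. i \<in> I \<Longrightarrow> j \<in> I \<Longrightarrow> k \<notin> I \<Longrightarrow> struct_const f i j k = 0"
proof -
  define V where "V = \<Phi> -` W'"
  have V: "subspace V" using linear_subspace_vimage[OF linear_\<Phi> W'(1)] by (simp add: V_def)
  have imV: "\<Phi> ` V = W'" using W'(2) range_\<Phi> by (auto simp: V_def)
  have dimV: "dim V = dim W'"
    unfolding imV[symmetric] by (rule dim_image_eq[OF linear_\<Phi>, symmetric]) (use inj_\<Phi> in \<open>auto intro: inj_on_subset\<close>)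
  obtain f I where f: "frame Q f" "f ` I \<subseteq> V" "span (f ` I) = V" "card I = dim V"
    and orth: "\<And>i v. i \<notin> I \<Longrightarrow> v \<in> V \<Longrightarrow> q v (f i) = 0" and EI: "E \<subseteq> f ` (- I)"
    by (rule subspace_frame[OF V E(1)]) (use E(2) in \<open>auto simp: V_def\<close>)
  have fW: "\<Phi> (f i) \<in> W'" if "i \<in> I" for i using that f(2) by (auto simp: V_def)
  have closed: "br (f i) (f j) \<in> V" if "i \<in> I" "j \<in> I" for i j
    using W'(3)[OF fW[OF that(1)] fW[OF that(2)]] by (simp add: V_def \<Phi>_bracket)
  have qf: "q (f i) (f j) = (if i = j then 1 else 0)" for i j using f(1) by (simp add: frame_def)
  have injf: "inj f" using f(1) unfolding frame_def inj_def by (metis zero_neq_one)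
  \<comment> \<open>By \<open>q_eq\<close> the factor turns the frame into an orthonormal family of matrices.\<close>
  define h where "h i = sqrt \<kappa> *\<^sub>R \<Phi> (f i)" for i
  have hh: "h i \<bullet> h j = (if i = j then 1 else 0)" for i j
  proof -
    have "h i \<bullet> h j = (sqrt \<kappa> * sqrt \<kappa>) * (\<Phi> (f i) \<bullet> \<Phi> (f j))" by (simp add: h_def mult.assoc)
    also have "\<dots> = q (f i) (f j)" using \<kappa>_pos by (simp add: q_eq)
    finally show ?thesis by (simp only: qf)
  qed
  have injh: "inj h" unfolding inj_def using hh by (metis zero_neq_one)
  have "orthonormal_basis (h ` I) W'"
    unfolding orthonormal_basis_def
  proof (intro conjI ballI)
    show "finite (h ` I)" by simp
    show "b \<bullet> c = (if b = c then 1 else 0)" if "b \<in> h ` I" "c \<in> h ` I" for b c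
      using that hh inj_eq[OF injh] by auto
    show "span (h ` I) = W'"
    proof
      show "span (h ` I) \<subseteq> W'"
        by (rule span_minimal[OF _ W'(1)]) (auto simp: h_def intro!: subspace_scale[OF W'(1)] fW)
      have "\<Phi> (f i) \<in> span (h ` I)" if "i \<in> I" for i
      proof -
        have "\<Phi> (f i) = (1 / sqrt \<kappa>) *\<^sub>R h i" using \<kappa>_pos by (simp add: h_def)
        then show ?thesis using that by (metis imageI span_base span_scale)
      qed
      then have "\<Phi> ` f ` I \<subseteq> span (h ` I)" by auto
      then have "span (\<Phi> ` f ` I) \<subseteq> span (h ` I)" by (rule span_minimal) simp
      then show "W' \<subseteq> span (h ` I)" using linear_span_image[OF linear_\<Phi>, of "f ` I"] f(3) imV by simp
    qed
  qed
  then have cas': "(\<Sum>b\<in>h ` I. commutator X (commutator X b) \<bullet> b) = - \<kappa>' * (X \<bullet> X)" if "X \<in> W'" for X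
    using cas that unfolding casimir_constant_def by blast
  have row: "(\<Sum>j\<in>I. \<Sum>k\<in>UNIV. (struct_const f i j k)^2) = \<kappa>' / \<kappa>" if i: "i \<in> I" for i
  proof -
    have "(\<Sum>k\<in>UNIV. (struct_const f i j k)^2) = - (commutator (\<Phi> (f i)) (commutator (\<Phi> (f i)) (h j)) \<bullet> h j)" for j
    proof -
      have "(\<Sum>k\<in>UNIV. (struct_const f i j k)^2) = q (br (f i) (f j)) (br (f i) (f j))"
        by (simp add: frame_parseval[OF is_metric_standard f(1), of "br (f i) (f j)" "br (f i) (f j)"] struct_const_def power2_eq_square)
      also have "\<dots> = - q (br (f i) (br (f i) (f j))) (f j)" using q_ad_skew[of "f i" "br (f i) (f j)" "f j"] by simp
      also have "\<dots> = - (\<kappa> * (commutator (\<Phi> (f i)) (commutator (\<Phi> (f i)) (\<Phi> (f j))) \<bullet> \<Phi> (f j)))"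
        by (simp add: q_eq \<Phi>_bracket)
      also have "\<kappa> * (commutator (\<Phi> (f i)) (commutator (\<Phi> (f i)) (\<Phi> (f j))) \<bullet> \<Phi> (f j))
          = commutator (\<Phi> (f i)) (commutator (\<Phi> (f i)) (h j)) \<bullet> h j"
        using \<kappa>_pos by (simp add: h_def linear_scale[OF linear_double_commutator] power2_eq_square[symmetric])
      finally show ?thesis .
    qed
    then have "(\<Sum>j\<in>I. \<Sum>k\<in>UNIV. (struct_const f i j k)^2) = - (\<Sum>j\<in>I. commutator (\<Phi> (f i)) (commutator (\<Phi> (f i)) (h j)) \<bullet> h j)"
      by (simp add: sum_negf)
    also have "\<dots> = - (\<Sum>b\<in>h ` I. commutator (\<Phi> (f i)) (commutator (\<Phi> (f i)) b) \<bullet> b)"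
      by (simp add: sum.reindex[OF inj_on_subset[OF injh subset_UNIV]])
    also have "\<dots> = \<kappa>' * (\<Phi> (f i) \<bullet> \<Phi> (f i))" using cas'[OF fW[OF i]] by simp
    also have "\<Phi> (f i) \<bullet> \<Phi> (f i) = 1 / \<kappa>" using qf[of i i] \<kappa>_pos by (simp add: q_eq field_simps)
    finally show ?thesis by simp
  qed
  have "(\<Sum>i\<in>I. \<Sum>j\<in>I. \<Sum>k\<in>UNIV. (struct_const f i j k)^2) = dim W' * (\<kappa>' / \<kappa>)"
    using row f(4) dimV by simp
  moreover have "struct_const f i j k = 0" if "i \<in> I" "j \<in> I" "k \<notin> I" for i j k
    using orth[OF that(3) closed[OF that(1,2)]] by (simp add: struct_const_def)
  ultimately show ?thesis using f(1) f(4)[unfolded dimV] fW EI by (intro that[of f I])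
qed

end

lemma conj_transpose_mult: "conj_transpose (A ** B) = conj_transpose B ** conj_transpose A"
  by (simp add: vec_eq_iff conj_transpose_def matrix_matrix_mult_def mult.commute)

lemma commutator_su:
  assumes "X \<in> su_algebra S" "Y \<in> su_algebra S" shows "commutator X Y \<in> su_algebra S"
proof -
  have z: "(A ** B) $ i $ j = 0" if "A \<in> su_algebra S" "B \<in> su_algebra S" "i \<notin> S \<or> j \<notin> S" for A B i j
    unfolding matrix_mult_nth using that by (intro sum.neutral) (auto simp: su_algebra_def)
  have "trace (commutator X Y) = 0"
    by (simp add: commutator_def trace_sub trace_mul_sym[of X Y])
  moreover have "conj_transpose (commutator X Y) = - commutator X Y"
  proof -
    have "conj_transpose (commutator X Y) = conj_transpose (X ** Y) - conj_transpose (Y ** X)"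
      by (simp add: commutator_def conj_transpose_def vec_eq_iff)
    also have "\<dots> = (- Y) ** (- X) - (- X) ** (- Y)" using assms by (simp add: conj_transpose_mult su_algebra_def)
    also have "\<dots> = - commutator X Y" by (simp add: commutator_def matrix_matrix_mult_def vec_eq_iff)
    finally show ?thesis .
  qed
  moreover have "commutator X Y $ i $ j = 0" if "i \<notin> S \<or> j \<notin> S" for i j
    using z[OF assms that] z[OF assms(2,1) that] by (simp add: commutator_def)
  ultimately show ?thesis by (simp add: su_algebra_def)
qed

lemma su_subspace: "S \<noteq> {} \<Longrightarrow> subspace (su_algebra S)" for S :: "'m::finite set"
  using hermitian_projection.subspace_range[OF hermitian_projection_su] su_algebra_range by metis

text \<open>Removing one index leaves a corner \<open>su(p)\<close>, centralised by the diagonal matrix \<open>Z\<close>.\<close>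

lemma not_local_max_su:
  fixes br :: "real^'n \<Rightarrow> real^'n \<Rightarrow> real^'n" and \<Phi> :: "real^'n \<Rightarrow> complex^'m^'m"
  assumes "compact_lie_algebra br" and \<Phi>: "linear \<Phi>" "inj \<Phi>" "\<And>X Y. \<Phi> (br X Y) = commutator (\<Phi> X) (\<Phi> Y)"
    "range \<Phi> = su_algebra UNIV" and m: "CARD('m) \<ge> 3"
  shows "\<not> local_max_point (scalar_curvature br) (metrics_1 br) (standard_metric br)"
proof -
  interpret compact_lie_algebra br by fact
  define M where "M = real (CARD('m))"
  interpret matrix_lie_algebra br \<Phi> "su_algebra UNIV" "2 * M"
    by (intro matrix_lie_algebra.intro matrix_lie_algebra_axioms.intro assms(1))
      (use \<Phi> casimir_su_algebra[of "UNIV :: 'm set"] m in \<open>simp_all add: M_def\<close>)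
  fix a :: 'm
  define p where "p = CARD('m) - 1"
  define S where "S = - {a}"
  have p: "p \<ge> 2" "M = real p + 1" using m by (simp_all add: p_def M_def of_nat_diff)
  have cS: "card S = p" by (simp add: S_def p_def Compl_eq_Diff_UNIV card_Diff_subset)
  then have S: "S \<noteq> {}" using p by auto
  have dS: "dim (su_algebra S) = p^2 - 1"
  proof -
    have "real (dim (su_algebra S)) = (real p)^2 - 1" using dim_su_algebra[OF S] cS by simp
    also have "\<dots> = real (p^2 - 1)" using p by (simp add: of_nat_diff)
    finally show ?thesis by simp
  qed
  have n: "CARD('n) = p^2 + 2 * p"
  proof -
    have "real (CARD('n)) = M^2 - 1" using dim_su_algebra[of "UNIV :: 'm set"] dim_W by (simp add: M_def)
    also have "\<dots> = real (p^2 + 2 * p)" by (simp add: p(2) power2_eq_square algebra_simps)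
    finally show ?thesis by linarith
  qed
  define Z :: "complex^'m^'m" where "Z = (\<chi> i j. if i = j then (if i = a then - \<i> * of_nat p else \<i>) else 0)"
  have Zcomm: "X ** Z = Z ** X" if "X \<in> su_algebra S" for X
  proof -
    have X0: "X $ i $ j = 0" if "i = a \<or> j = a" for i j using \<open>X \<in> su_algebra S\<close> that by (auto simp: su_algebra_def S_def)
    have "(X ** Z) $ i $ j = X $ i $ j * Z $ j $ j" for i j
      unfolding matrix_mult_nth by (subst sum.remove[of _ j]) (auto simp: Z_def intro!: sum.neutral)
    moreover have "(Z ** X) $ i $ j = Z $ i $ i * X $ i $ j" for i j
      unfolding matrix_mult_nth by (subst sum.remove[of _ i]) (auto simp: Z_def intro!: sum.neutral)
    ultimately show ?thesis using X0 by (auto simp: vec_eq_iff Z_def)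
  qed
  have "Z \<in> su_algebra UNIV"
  proof -
    have "trace Z = (\<Sum>i\<in>UNIV. if i = a then - \<i> * of_nat p else \<i>)" by (simp add: trace_def Z_def)
    also have "\<dots> = - \<i> * of_nat p + (\<Sum>i\<in>UNIV - {a}. \<i>)" by (subst sum.remove[of _ a]) (auto intro!: sum.cong)
    also have "\<dots> = 0" by (simp add: p_def)
    finally have "trace Z = 0" .
    moreover have "conj_transpose Z = - Z" by (auto simp: conj_transpose_def vec_eq_iff Z_def)
    ultimately show ?thesis by (simp add: su_algebra_def)
  qed
  then obtain z0 where z0: "\<Phi> z0 = Z" using range_\<Phi> by (metis imageE)
  have orthZ: "q v z0 = 0" if "\<Phi> v \<in> su_algebra S" for v
  proof -
    have "\<Phi> v \<bullet> Z = Re (\<Sum>i\<in>UNIV. \<Phi> v $ i $ i * cnj (Z $ i $ i))"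
    proof -
      have "(\<Sum>j\<in>UNIV. Re (\<Phi> v $ i $ j * cnj (Z $ i $ j))) = Re (\<Phi> v $ i $ i * cnj (Z $ i $ i))" for i
      proof -
        have "(\<Sum>j\<in>UNIV. Re (\<Phi> v $ i $ j * cnj (Z $ i $ j)))
            = (\<Sum>j\<in>UNIV. if j = i then Re (\<Phi> v $ i $ i * cnj (Z $ i $ i)) else 0)"
          by (intro sum.cong refl) (simp add: Z_def)
        then show ?thesis by simp
      qed
      then show ?thesis by (simp only: inner_matrix Re_sum)
    qed
    also have "(\<Sum>i\<in>UNIV. \<Phi> v $ i $ i * cnj (Z $ i $ i)) = (\<Sum>i\<in>UNIV. \<Phi> v $ i $ i * (- \<i>))"
      using that by (intro sum.cong refl) (auto simp: Z_def su_algebra_def S_def)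
    also have "\<dots> = trace (\<Phi> v) * (- \<i>)" by (simp only: trace_def sum_distrib_right)
    also have "\<dots> = 0" using that by (simp add: su_algebra_def)
    finally show ?thesis by (simp add: q_eq z0)
  qed
  have "z0 \<noteq> 0"
  proof
    assume "z0 = 0"
    then have "Z $ a $ a = 0" using z0 linear_0[OF linear_\<Phi>] by simp
    then show False using p by (simp add: Z_def)
  qed
  then have qz: "q z0 z0 > 0" using is_metric_standard by (simp add: is_metric_def)
  define z where "z = (1 / sqrt (q z0 z0)) *\<^sub>R z0"
  have "q z z = 1" using qz by (simp add: z_def metric_form_simps)
  then have E: "orthonormal_set Q {z}" by (simp add: orthonormal_set_def)
  have Ez: "q v e = 0" if "\<Phi> v \<in> su_algebra S" "e \<in> {z}" for v e
    using that orthZ by (simp add: z_def metric_form_simps)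
  have sub: "su_algebra S \<subseteq> su_algebra UNIV" by (auto simp: su_algebra_def)
  obtain f I where f: "frame Q f" "card I = dim (su_algebra S)" "\<And>i. i \<in> I \<Longrightarrow> \<Phi> (f i) \<in> su_algebra S" "{z} \<subseteq> f ` (- I)"
    "(\<Sum>i\<in>I. \<Sum>j\<in>I. \<Sum>k\<in>UNIV. (struct_const f i j k)^2) = dim (su_algebra S) * (2 * real (card S) / (2 * M))"
    "\<And>i j k. i \<in> I \<Longrightarrow> j \<in> I \<Longrightarrow> k \<notin> I \<Longrightarrow> struct_const f i j k = 0"
    by (rule subalgebra_frame[OF su_subspace[OF S] sub commutator_su casimir_su_algebra[OF S] E Ez])
      (assumption | rule that)+
  obtain i0 where i0: "f i0 = z" "i0 \<notin> I" using f(4) by auto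
  have K: "(\<Sum>i\<in>I. \<Sum>j\<in>I. \<Sum>k\<in>UNIV. (struct_const f i j k)^2) = p * (real p - 1)"
  proof -
    have "real (dim (su_algebra S)) * (2 * real (card S) / (2 * M)) = ((real p)^2 - 1) * (real p / (real p + 1))"
    proof -
      have "2 * real (card S) / (2 * M) = real p / (real p + 1)"
        unfolding cS p(2) by (rule mult_divide_mult_cancel_left) simp
      then show ?thesis using dim_su_algebra[OF S] by (simp add: cS)
    qed
    also have "\<dots> = p * (real p - 1)" by (simp add: field_simps power2_eq_square)
    finally show ?thesis using f(5) by simp
  qed
  have zero: "struct_const f i i0 k = 0" if "i \<in> I" for i k
  proof -
    have "\<Phi> (br (f i) z0) = 0" using Zcomm[OF f(3)[OF that]] by (simp add: \<Phi>_bracket z0 commutator_def)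
    then have "br (f i) z0 = 0" using inj_\<Phi> linear_0[OF linear_\<Phi>] by (metis injD)
    then show ?thesis by (simp add: struct_const_def i0 z_def br_simps metric_form_simps)
  qed
  show ?thesis
    by (rule not_local_max_of_special_unitary_block[OF f(1) p(1) f(2)[unfolded dS] n K f(6) i0(2) zero])
qed

lemma commutator_sp:
  assumes "X \<in> sp_algebra S" "Y \<in> sp_algebra S" shows "commutator X Y \<in> sp_algebra S"
proof -
  have z: "(A ** B) $ i $ j = 0" if "A \<in> sp_algebra S" "B \<in> sp_algebra S" "i \<notin> S \<or> j \<notin> S" for A B i j
    unfolding matrix_mult_nth
  proof (intro sum.neutral ballI)
    fix k show "A $ i $ k * B $ k $ j = 0"
      using that unfolding sp_algebra_def mem_Collect_eq mult_eq_0_iff by blast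
  qed
  have "conj_transpose (commutator X Y) = - commutator X Y"
  proof -
    have "conj_transpose (commutator X Y) = conj_transpose (X ** Y) - conj_transpose (Y ** X)"
      by (simp add: commutator_def conj_transpose_def vec_eq_iff)
    also have "\<dots> = (- Y) ** (- X) - (- X) ** (- Y)"
      using assms unfolding conj_transpose_mult by (simp only: sp_algebra_def mem_Collect_eq)
    also have "\<dots> = - commutator X Y" by (simp add: commutator_def matrix_matrix_mult_def vec_eq_iff)
    finally show ?thesis .
  qed
  moreover have "commutator X Y $ i $ j = - sign_of i * sign_of j * commutator X Y $ partner j $ partner i" for i j
  proof -
    have prod: "(A ** B) $ i $ j = sign_of i * sign_of j * (B ** A) $ partner j $ partner i"
      if A: "A \<in> sp_algebra S" and B: "B \<in> sp_algebra S" for A B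
    proof -
      have "(A ** B) $ i $ j = (\<Sum>k\<in>UNIV. sign_of i * sign_of j * (B $ partner j $ partner k * A $ partner k $ partner i))"
        unfolding matrix_mult_nth
      proof (rule sum.cong[OF refl])
        fix k
        have a: "A $ i $ k = - sign_of i * sign_of k * A $ partner k $ partner i"
          and b: "B $ k $ j = - sign_of k * sign_of j * B $ partner j $ partner k"
          using A B unfolding sp_algebra_def by blast+
        show "A $ i $ k * B $ k $ j = sign_of i * sign_of j * (B $ partner j $ partner k * A $ partner k $ partner i)"
          unfolding a b by (cases k) (simp_all add: mult_ac)
      qed
      also have "\<dots> = sign_of i * sign_of j * (\<Sum>k\<in>UNIV. B $ partner j $ partner k * A $ partner k $ partner i)"
        by (simp only: sum_distrib_left)
      also have "(\<Sum>k\<in>UNIV. B $ partner j $ partner k * A $ partner k $ partner i) = (B ** A) $ partner j $ partner i"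
        unfolding matrix_mult_nth
        by (rule sum.reindex_bij_betw[of partner UNIV UNIV "\<lambda>k. B $ partner j $ k * A $ k $ partner i"])
          (rule bij_betw_byWitness[where f' = partner], simp_all)
      finally show ?thesis .
    qed
    show ?thesis
      using prod[OF assms] prod[OF assms(2,1)] by (simp add: commutator_def right_diff_distrib)
  qed
  moreover have "commutator X Y $ i $ j = 0" if "i \<notin> S \<or> j \<notin> S" for i j
    using z[OF assms that] z[OF assms(2,1) that] by (simp add: commutator_def)
  ultimately show ?thesis unfolding sp_algebra_def by blast
qed

lemma sp_subspace:
  fixes S :: "('k::finite + 'k) set" assumes "\<And>i. partner i \<in> S \<longleftrightarrow> i \<in> S"
  shows "subspace (sp_algebra S)"
  using hermitian_projection.subspace_range[OF hermitian_projection_sp[OF assms]] sp_algebra_range[OF assms] by simp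

text \<open>Removing an index and its partner leaves a corner \<open>sp(n - 1)\<close>. With \<open>P = n - 1\<close> and \<open>D\<close> its dimension, the
block test succeeds with the margin \<open>D * P / (2 * (P + 2))\<close>.\<close>

lemma not_local_max_sp:
  fixes br :: "real^'n \<Rightarrow> real^'n \<Rightarrow> real^'n" and \<Phi> :: "real^'n \<Rightarrow> complex^('k::finite + 'k)^('k + 'k)"
  assumes "compact_lie_algebra br" and \<Phi>: "linear \<Phi>" "inj \<Phi>" "\<And>X Y. \<Phi> (br X Y) = commutator (\<Phi> X) (\<Phi> Y)"
    "range \<Phi> = sp_algebra UNIV" and k: "CARD('k) \<ge> 2"
  shows "\<not> local_max_point (scalar_curvature br) (metrics_1 br) (standard_metric br)"
proof -
  interpret compact_lie_algebra br by fact
  define N where "N = real (CARD('k))"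
  have cU: "card (UNIV :: ('k + 'k) set) = 2 * CARD('k)" by (simp add: card_UNIV_sum)
  interpret matrix_lie_algebra br \<Phi> "sp_algebra UNIV" "2 * N + 2"
    by (intro matrix_lie_algebra.intro matrix_lie_algebra_axioms.intro assms(1))
      (use \<Phi> casimir_sp_algebra[of "UNIV :: ('k + 'k) set"] in \<open>simp_all add: N_def cU\<close>)
  fix a :: 'k
  define S :: "('k + 'k) set" where "S = - {Inl a, Inr a}"
  define P where "P = N - 1"
  have P: "P \<ge> 1" using k by (simp add: P_def N_def)
  have partner_S: "partner i \<in> S \<longleftrightarrow> i \<in> S" for i by (cases i) (auto simp: S_def)
  have cS: "real (card S) = 2 * P"
  proof -
    have "card S = card (UNIV :: ('k + 'k) set) - card {Inl a, Inr a :: 'k + 'k}"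
      unfolding S_def Compl_eq_Diff_UNIV by (rule card_Diff_subset) simp_all
    then have "card S = 2 * CARD('k) - 2" using cU by simp
    then show ?thesis using k by (simp add: P_def N_def of_nat_diff)
  qed
  have d: "real (dim (sp_algebra S)) = 2 * P^2 + P"
    using dim_sp_algebra[OF partner_S] by (simp add: cS power2_eq_square)
  have n: "real (CARD('n)) = 2 * N^2 + N"
    using dim_sp_algebra[of "UNIV :: ('k + 'k) set"] dim_W by (simp add: cU N_def power2_eq_square)
  have E: "orthonormal_set Q {}" by (simp add: orthonormal_set_def)
  have sub: "sp_algebra S \<subseteq> sp_algebra UNIV" unfolding sp_algebra_def by blast
  obtain f I where f: "frame Q f" "card I = dim (sp_algebra S)"
    "(\<Sum>i\<in>I. \<Sum>j\<in>I. \<Sum>k\<in>UNIV. (struct_const f i j k)^2) = dim (sp_algebra S) * ((real (card S) + 2) / (2 * N + 2))"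
    by (rule subalgebra_frame[OF sp_subspace[OF partner_S] sub commutator_sp casimir_sp_algebra[OF partner_S] E])
      (use that in simp_all)
  define D where "D = 2 * P^2 + P"
  define K where "K = D * ((2 * P + 2) / (2 * P + 4))"
  have K: "K = (\<Sum>i\<in>I. \<Sum>j\<in>I. \<Sum>k\<in>UNIV. (struct_const f i j k)^2)"
    unfolding f(3) d cS K_def D_def by (simp add: P_def)
  have "real (CARD('n)) * K > D^2 + D * (real (CARD('n)) - D) / 2"
  proof -
    have n': "real (CARD('n)) = D + 4 * P + 3" unfolding n by (simp add: D_def P_def power2_eq_square algebra_simps)
    have "real (CARD('n)) * K - (D^2 + D * (real (CARD('n)) - D) / 2) = D * P / (2 * (P + 2))"
      unfolding n' K_def D_def using P by (simp add: field_simps power2_eq_square)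
    moreover have "D * P / (2 * (P + 2)) > 0" using P by (simp add: D_def add_nonneg_pos)
    ultimately show ?thesis by argo
  qed
  then show ?thesis using not_local_max_of_block[OF f(1) K] f(2) d by (simp add: D_def)
qed

section \<open>Tangent spaces of the classical groups\<close>

text \<open>Differentiability at the single parameter \<open>0\<close> suffices, which makes it easy to exhibit tangent vectors.\<close>

definition tangent_at_one :: "(complex^'m^'m) set \<Rightarrow> (complex^'m^'m) set" where
  "tangent_at_one H = {X. \<exists>\<gamma> :: real \<Rightarrow> complex^'m^'m.
     (\<forall>\<^sub>F t in nhds 0. \<gamma> t \<in> H) \<and> \<gamma> 0 = mat 1 \<and> (\<gamma> has_vector_derivative X) (at 0)}"

lemma bounded_bilinear_matrix_mult: "bounded_bilinear ((**) :: complex^'m^'m \<Rightarrow> complex^'m^'m \<Rightarrow> complex^'m^'m)"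
proof -
  have "bilinear ((**) :: complex^'m^'m \<Rightarrow> complex^'m^'m \<Rightarrow> complex^'m^'m)"
    unfolding bilinear_def
    by (intro conjI allI linearI)
      (simp_all add: vec_eq_iff matrix_matrix_mult_def distrib_left distrib_right sum.distrib scaleR_sum_right)
  then show ?thesis by (simp add: bilinear_conv_bounded_bilinear)
qed

lemma bounded_linear_conj_transpose: "bounded_linear (conj_transpose :: complex^'m^'m \<Rightarrow> complex^'m^'m)"
proof -
  have "linear (conj_transpose :: complex^'m^'m \<Rightarrow> complex^'m^'m)"
    by (rule linearI) (simp_all add: conj_transpose_def vec_eq_iff complex_eq_iff)
  then show ?thesis by (simp add: linear_conv_bounded_linear)
qed

lemma bounded_linear_transpose: "bounded_linear (transpose :: complex^'m^'m \<Rightarrow> complex^'m^'m)"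
proof -
  have "linear (transpose :: complex^'m^'m \<Rightarrow> complex^'m^'m)"
    by (rule linearI) (simp_all add: transpose_def vec_eq_iff)
  then show ?thesis by (simp add: linear_conv_bounded_linear)
qed

lemma conj_transpose_mat: "conj_transpose (mat 1) = mat 1"
  by (simp add: vec_eq_iff conj_transpose_def mat_def)

lemma conj_transpose_idem: "conj_transpose (conj_transpose A) = A"
  by (simp add: vec_eq_iff conj_transpose_def)

lemma det_conj_transpose: "det (conj_transpose A) = cnj (det A)"
proof -
  have "det (conj_transpose A) = det (\<chi> i j. cnj (A $ i $ j))"
    using det_transpose[of "\<chi> i j. cnj (A $ i $ j)"] by (simp add: conj_transpose_def transpose_def)
  then show ?thesis by (simp add: det_def)
qed

lemma has_vector_derivative_matrix_mult:
  fixes f g :: "real \<Rightarrow> complex^'m^'m"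
  assumes "(f has_vector_derivative f') (at t)" "(g has_vector_derivative g') (at t)"
  shows "((\<lambda>s. f s ** g s) has_vector_derivative (f t ** g' + f' ** g t)) (at t)"
  using bounded_bilinear.has_vector_derivative[OF bounded_bilinear_matrix_mult assms] .

lemma has_vector_derivative_cong_nhds:
  fixes f g :: "real \<Rightarrow> 'a::real_normed_vector"
  assumes "\<forall>\<^sub>F s in nhds t. f s = g s" "(f has_vector_derivative D) (at t)"
  shows "(g has_vector_derivative D) (at t)"
proof -
  obtain U where "open U" "t \<in> U" "\<And>x. x \<in> U \<Longrightarrow> f x = g x" using assms(1) unfolding eventually_nhds by blast
  then show ?thesis
    using has_vector_derivative_transform_within_open[OF assms(2)] by blast
qed

lemma has_vector_derivative_const_nhds:
  fixes f :: "real \<Rightarrow> 'a::real_normed_vector"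
  assumes "\<forall>\<^sub>F s in nhds t. f s = c" "(f has_vector_derivative D) (at t)" shows "D = 0"
  using has_vector_derivative_cong_nhds[OF assms] has_vector_derivative_const vector_derivative_unique_at by blast

text \<open>Jacobi's formula at the identity: a permutation other than the identity moves at least two indices,
so its product of entries vanishes to second order.\<close>

lemma has_vector_derivative_det:
  fixes \<gamma> :: "real \<Rightarrow> complex^'m^'m"
  assumes \<gamma>: "(\<gamma> has_vector_derivative X) (at 0)" "\<gamma> 0 = mat 1"
  shows "((\<lambda>t. det (\<gamma> t)) has_vector_derivative trace X) (at 0)"
proof -
  have entry: "((\<lambda>t. \<gamma> t $ i $ j) has_derivative (\<lambda>h. h *\<^sub>R X $ i $ j)) (at 0)" for i j
  proof -
    have "bounded_linear (\<lambda>A :: complex^'m^'m. A $ i $ j)"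
      using bounded_linear_compose[OF bounded_linear_vec_nth bounded_linear_vec_nth] .
    from bounded_linear.has_vector_derivative[OF this \<gamma>(1)] show ?thesis
      by (simp add: has_vector_derivative_def)
  qed
  have id1: "(\<Prod>j\<in>UNIV - {i}. \<gamma> 0 $ j $ \<pi> j) = (if \<pi> = id then 1 else 0)" if \<pi>: "\<pi> permutes UNIV" for \<pi> :: "'m \<Rightarrow> 'm" and i
  proof (cases "\<pi> = id")
    case True then show ?thesis by (simp add: \<gamma>(2) mat_def)
  next
    case False
    have "\<exists>j. j \<noteq> i \<and> \<pi> j \<noteq> j"
    proof (rule ccontr)
      assume *: "\<not> ?thesis"
      have "\<pi> i = i"
      proof (rule ccontr)
        assume "\<pi> i \<noteq> i"
        then have "\<pi> (\<pi> i) = \<pi> i" using * by blast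
        then show False using permutes_inj[OF \<pi>] \<open>\<pi> i \<noteq> i\<close> by (meson injD)
      qed
      then have "\<pi> = id" using * by (metis eq_id_iff)
      then show False using False by simp
    qed
    then obtain j where "j \<noteq> i" "\<pi> j \<noteq> j" by blast
    then have "(\<Prod>j\<in>UNIV - {i}. \<gamma> 0 $ j $ \<pi> j) = 0" by (intro prod_zero bexI[of _ j]) (auto simp: \<gamma>(2) mat_def)
    then show ?thesis using False by simp
  qed
  have "((\<lambda>t. det (\<gamma> t)) has_derivative (\<lambda>h. \<Sum>\<pi>\<in>{\<pi>. \<pi> permutes UNIV}. of_int (sign \<pi>) *
      (\<Sum>i\<in>UNIV. h *\<^sub>R X $ i $ \<pi> i * (\<Prod>j\<in>UNIV - {i}. \<gamma> 0 $ j $ \<pi> j)))) (at 0)"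
    unfolding det_def by (intro has_derivative_sum has_derivative_mult_right has_derivative_prod entry)
  moreover have "(\<Sum>\<pi>\<in>{\<pi>. \<pi> permutes UNIV}. of_int (sign \<pi>) *
      (\<Sum>i\<in>UNIV. h *\<^sub>R X $ i $ \<pi> i * (\<Prod>j\<in>UNIV - {i}. \<gamma> 0 $ j $ \<pi> j))) = h *\<^sub>R trace X" for h
  proof -
    have "(\<Sum>\<pi>\<in>{\<pi>. \<pi> permutes UNIV}. of_int (sign \<pi>) *
        (\<Sum>i\<in>UNIV. h *\<^sub>R X $ i $ \<pi> i * (\<Prod>j\<in>UNIV - {i}. \<gamma> 0 $ j $ \<pi> j))) =
      (\<Sum>\<pi>\<in>{\<pi>. \<pi> permutes (UNIV :: 'm set)}. if \<pi> = id then h *\<^sub>R trace X else 0)"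
      by (intro sum.cong refl) (auto simp: id1 trace_def scaleR_sum_right sign_id)
    also have "\<dots> = h *\<^sub>R trace X" by (simp add: permutes_id)
    finally show ?thesis .
  qed
  ultimately show ?thesis by (simp add: has_vector_derivative_def)
qed

lemma tangent_unitary:
  fixes \<gamma> :: "real \<Rightarrow> complex^'m^'m"
  assumes "\<forall>\<^sub>F t in nhds 0. \<gamma> t ** conj_transpose (\<gamma> t) = mat 1" "\<gamma> 0 = mat 1" "(\<gamma> has_vector_derivative X) (at 0)"
  shows "conj_transpose X = - X"
proof -
  have "((\<lambda>t. \<gamma> t ** conj_transpose (\<gamma> t)) has_vector_derivative
      (\<gamma> 0 ** conj_transpose X + X ** conj_transpose (\<gamma> 0))) (at 0)"
    by (intro has_vector_derivative_matrix_mult assms(3) bounded_linear.has_vector_derivative[OF bounded_linear_conj_transpose])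
  from has_vector_derivative_const_nhds[OF assms(1) this] show ?thesis
    by (simp add: assms(2) conj_transpose_mat add_eq_0_iff2)
qed

text \<open>The Cayley transform, an algebraic substitute for the exponential map with the same tangent vector.\<close>

definition cayley :: "complex^'m^'m \<Rightarrow> real \<Rightarrow> complex^'m^'m" where
  "cayley X t = matrix_inv (mat 1 - (t / 2) *\<^sub>R X) ** (mat 1 + (t / 2) *\<^sub>R X)"

lemma matrix_inv_inverse:
  assumes "invertible (B :: complex^'m^'m)" shows "B ** matrix_inv B = mat 1" "matrix_inv B ** B = mat 1"
proof -
  have "\<exists>C. B ** C = mat 1 \<and> C ** B = mat 1" using assms by (simp add: invertible_def)
  then have "B ** matrix_inv B = mat 1 \<and> matrix_inv B ** B = mat 1"
    unfolding matrix_inv_def by (rule someI_ex)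
  then show "B ** matrix_inv B = mat 1" "matrix_inv B ** B = mat 1" by auto
qed

text \<open>The derivative comes from the equation \<open>(1 - tX/2) U = 1 + tX/2\<close> and the boundedness of unitary
matrices, without differentiating matrix inversion.\<close>

lemma cayley:
  fixes X :: "complex^'m^'m"
  assumes X: "conj_transpose X = - X"
  shows "cayley X 0 = mat 1"
    and "\<forall>\<^sub>F t in nhds 0. invertible (mat 1 - (t / 2) *\<^sub>R X)"
    and "invertible (mat 1 - (t / 2) *\<^sub>R X) \<Longrightarrow> cayley X t ** conj_transpose (cayley X t) = mat 1"
    and "(cayley X has_vector_derivative X) (at 0)"
proof -
  interpret mult: bounded_bilinear "(**) :: complex^'m^'m \<Rightarrow> complex^'m^'m \<Rightarrow> complex^'m^'m"
    by (rule bounded_bilinear_matrix_mult)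
  define B C where "B t = mat 1 - (t / 2) *\<^sub>R X" and "C t = mat 1 + (t / 2) *\<^sub>R X" for t
  have BC: "B t ** C t = C t ** B t" for t
    unfolding B_def C_def mult.add_left mult.add_right mult.diff_left mult.diff_right mult.scaleR_left mult.scaleR_right
    by (simp only: matrix_mul_lid matrix_mul_rid) (simp only: algebra_simps)
  have cay: "cayley X t = matrix_inv (B t) ** C t" for t by (simp add: cayley_def B_def C_def)
  have CB: "conj_transpose (B t) = C t" "conj_transpose (C t) = B t" for t
  proof -
    show 1: "conj_transpose (B t) = C t"
      using X by (simp add: B_def C_def vec_eq_iff conj_transpose_def mat_def)
    show "conj_transpose (C t) = B t" unfolding 1[symmetric] by (rule conj_transpose_idem)
  qed
  have B0: "invertible (B 0)" by (simp add: B_def invertible_det_nz)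
  show c0: "cayley X 0 = mat 1"
    using matrix_inv_inverse(2)[OF B0] by (simp add: cay B_def C_def)
  have dB: "(B has_vector_derivative ((- 1 / 2) *\<^sub>R X)) (at t)" for t
    unfolding B_def by (auto intro!: derivative_eq_intros)
  have inv: "\<forall>\<^sub>F t in nhds 0. invertible (B t)"
  proof -
    have "((\<lambda>t. det (B t)) has_vector_derivative trace ((- 1 / 2) *\<^sub>R X)) (at 0)"
      by (rule has_vector_derivative_det[OF dB]) (simp add: B_def)
    then have "isCont (\<lambda>t. det (B t)) 0" by (rule has_vector_derivative_continuous)
    moreover have "det (B 0) \<noteq> 0" by (simp add: B_def)
    then have "\<forall>\<^sub>F y in nhds (det (B 0)). y \<noteq> 0"
      unfolding eventually_nhds by (intro exI[of _ "- {0}"]) (auto intro: open_Compl)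
    ultimately have "\<forall>\<^sub>F t in nhds 0. det (B t) \<noteq> 0"
      by (rule isCont_eventually_nhds)
    then show ?thesis by (simp add: invertible_det_nz)
  qed
  then show "\<forall>\<^sub>F t in nhds 0. invertible (mat 1 - (t / 2) *\<^sub>R X)" by (simp add: B_def)
  have inv': "\<forall>\<^sub>F t in at 0. invertible (B t)" using inv by (simp add: eventually_nhds_conv_at)
  have uni: "cayley X t ** conj_transpose (cayley X t) = mat 1" if "invertible (B t)" for t
  proof -
    note i = matrix_inv_inverse[OF that]
    have "cayley X t ** conj_transpose (cayley X t) = matrix_inv (B t) ** (C t ** B t) ** conj_transpose (matrix_inv (B t))"
      by (simp add: cay conj_transpose_mult CB matrix_mul_assoc)
    also have "\<dots> = (matrix_inv (B t) ** B t) ** C t ** conj_transpose (matrix_inv (B t))"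
      unfolding BC[symmetric] by (simp add: matrix_mul_assoc)
    also have "\<dots> = conj_transpose (B t) ** conj_transpose (matrix_inv (B t))" by (simp add: i CB)
    also have "\<dots> = mat 1" by (simp add: i conj_transpose_mat flip: conj_transpose_mult)
    finally show ?thesis .
  qed
  then show "invertible (mat 1 - (t / 2) *\<^sub>R X) \<Longrightarrow> cayley X t ** conj_transpose (cayley X t) = mat 1"
    by (simp add: B_def)
  define R where "R t = (1/2) *\<^sub>R (X ** (cayley X t + mat 1))" for t
  \<comment> \<open>The equation \<open>(1 - tX/2) U = 1 + tX/2\<close> says \<open>U - 1 = t R\<close>.\<close>
  have step: "cayley X t - mat 1 = t *\<^sub>R R t" if "invertible (B t)" for t
  proof -
    have "B t ** cayley X t = C t"
      unfolding cay using matrix_inv_inverse[OF that] by (simp add: matrix_mul_assoc)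
    then have "cayley X t - (t / 2) *\<^sub>R (X ** cayley X t) = mat 1 + (t / 2) *\<^sub>R X"
      by (simp add: B_def C_def mult.diff_left mult.scaleR_left)
    then show ?thesis by (simp add: R_def mult.add_right scaleR_add_right algebra_simps)
  qed
  have norm_uni: "norm U = sqrt CARD('m)" if "U ** conj_transpose U = mat 1" for U :: "complex^'m^'m"
  proof -
    have "norm U ^ 2 = Re (trace (U ** conj_transpose U))"
      by (simp add: power2_norm_eq_inner inner_matrix trace_def matrix_mult_nth conj_transpose_def)
    then have "norm U ^ 2 = CARD('m)" using that by (simp add: trace_def mat_def)
    then show ?thesis by (metis norm_ge_zero real_sqrt_unique)
  qed
  obtain K where K: "K > 0" "\<forall>(A :: complex^'m^'m) (D :: complex^'m^'m). norm (A ** D) \<le> norm A * norm D * K"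
    using mult.pos_bounded by (elim exE conjE) (rule that)
  define M where "M = norm X * (2 * sqrt CARD('m)) * K"
  have RM: "norm (R t) \<le> M" if "invertible (B t)" for t
  proof -
    have n: "norm (cayley X t) = sqrt CARD('m)" "norm (mat 1 :: complex^'m^'m) = sqrt CARD('m)"
      using norm_uni[OF uni[OF that]] norm_uni[of "mat 1"] by (simp_all add: conj_transpose_mat)
    have "norm (cayley X t + mat 1) \<le> 2 * sqrt CARD('m)"
      using norm_triangle_ineq[of "cayley X t" "mat 1"] n by simp
    then have "norm X * norm (cayley X t + mat 1) * K \<le> M"
      unfolding M_def using K(1) by (intro mult_right_mono mult_left_mono) auto
    then have le: "norm (X ** (cayley X t + mat 1)) \<le> M" using K(2)[rule_format, of X "cayley X t + mat 1"] by simp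
    also have "M \<le> 2 * M" using order_trans[OF norm_ge_zero le] by simp
    finally show ?thesis by (simp add: R_def)
  qed
  have "(cayley X \<longlongrightarrow> mat 1) (at 0)"
  proof -
    have "((\<lambda>t. cayley X t - mat 1) \<longlongrightarrow> 0) (at 0)"
    proof (rule Lim_null_comparison)
      show "\<forall>\<^sub>F t in at 0. norm (cayley X t - mat 1) \<le> \<bar>t\<bar> * M"
        using inv'
      proof eventually_elim
        case (elim t) then show ?case using step[OF elim] RM[OF elim] by (simp add: mult_left_mono)
      qed
      show "((\<lambda>t. \<bar>t\<bar> * M) \<longlongrightarrow> 0) (at 0)"
        by (rule tendsto_mult_left_zero) (simp add: tendsto_rabs_zero)
    qed
    then show ?thesis by (simp add: LIM_zero_iff)
  qed
  then have lim: "((\<lambda>t. (1/2) *\<^sub>R (X ** (cayley X t + mat 1))) \<longlongrightarrow> (1/2) *\<^sub>R (X ** (mat 1 + mat 1))) (at 0)"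
    by (intro tendsto_intros mult.tendsto)
  have "((\<lambda>t. R t) \<longlongrightarrow> X) (at 0)"
  proof -
    have "(1/2) *\<^sub>R (X ** (mat 1 + mat 1)) = X"
      unfolding mult.add_right matrix_mul_rid by (rule scaleR_half_double)
    then show ?thesis using lim unfolding R_def by (simp only:)
  qed
  then have "((\<lambda>t. norm (R t - X)) \<longlongrightarrow> 0) (at 0)"
    by (intro tendsto_norm_zero) (simp add: LIM_zero_iff)
  then have "((\<lambda>t. norm (cayley X (0 + t) - cayley X 0 - t *\<^sub>R X) / norm t) \<longlongrightarrow> 0) (at 0)"
  proof (rule Lim_transform_eventually)
    have "\<forall>\<^sub>F t :: real in at 0. t \<noteq> 0" by (simp add: eventually_at_filter)
    with inv'
    show "\<forall>\<^sub>F t in at 0. norm (R t - X) = norm (cayley X (0 + t) - cayley X 0 - t *\<^sub>R X) / norm t"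
      by eventually_elim (simp add: c0 step flip: scaleR_diff_right)
  qed
  then show "(cayley X has_vector_derivative X) (at 0)"
    unfolding has_vector_derivative_def has_derivative_at
    by (intro conjI bounded_linear_scaleR_left)
qed

text \<open>The Cayley transform of a traceless skew-Hermitian matrix is unitary but its determinant is only
\<open>1\<close> to first order; multiplying one column by the conjugate of the determinant repairs this and does
not change the tangent vector.\<close>

theorem tangent_SU: "tangent_at_one (SU :: (complex^'m^'m) set) = su_algebra UNIV"
proof (intro equalityI subsetI)
  fix X :: "complex^'m^'m" assume "X \<in> tangent_at_one SU"
  then obtain \<gamma> :: "real \<Rightarrow> complex^'m^'m" where \<gamma>: "\<forall>\<^sub>F t in nhds 0. \<gamma> t \<in> SU" "\<gamma> 0 = mat 1" "(\<gamma> has_vector_derivative X) (at 0)"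
    unfolding tangent_at_one_def by blast
  have "\<forall>\<^sub>F t in nhds 0. \<gamma> t ** conj_transpose (\<gamma> t) = mat 1" "\<forall>\<^sub>F t in nhds 0. det (\<gamma> t) = 1"
    using \<gamma>(1) by (auto elim!: eventually_mono simp: SU_def)
  then have "conj_transpose X = - X" "trace X = 0"
    using tangent_unitary[OF _ \<gamma>(2,3)] has_vector_derivative_const_nhds[OF _ has_vector_derivative_det[OF \<gamma>(3,2)]] by auto
  then show "X \<in> su_algebra UNIV" by (simp add: su_algebra_def)
next
  fix X :: "complex^'m^'m" assume "X \<in> su_algebra UNIV"
  then have X: "conj_transpose X = - X" "trace X = 0" by (auto simp: su_algebra_def)
  fix a :: 'm
  define \<delta> where "\<delta> t = det (cayley X t)" for t
  define D where "D t = mat 1 + cscale (cnj (\<delta> t) - 1) (unit_matrix a a)" for t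
  have D_nth: "D t $ i $ j = (if i = j then (if i = a then cnj (\<delta> t) else 1) else 0)" for t i j
    by (simp add: D_def mat_def cscale_def unit_matrix_nth)
  have \<delta>: "(\<delta> has_vector_derivative 0) (at 0)"
    unfolding \<delta>_def[abs_def] using has_vector_derivative_det[OF cayley(4,1)[OF X(1)]] X(2) by simp
  have "((\<lambda>t. cnj (\<delta> t) - 1) has_vector_derivative 0) (at 0)"
    using has_vector_derivative_diff[OF bounded_linear.has_vector_derivative[OF bounded_linear_cnj \<delta>] has_vector_derivative_const[of 1]]
    by simp
  moreover have "bounded_linear (\<lambda>z. cscale z (unit_matrix a a))"
  proof -
    have "linear (\<lambda>z. cscale z (unit_matrix a a))"
      by (rule linearI) (simp_all add: cscale_def vec_eq_iff distrib_right)
    then show ?thesis by (simp add: linear_conv_bounded_linear)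
  qed
  ultimately have "((\<lambda>t. cscale (cnj (\<delta> t) - 1) (unit_matrix a a)) has_vector_derivative cscale 0 (unit_matrix a a)) (at 0)"
    using bounded_linear.has_vector_derivative by blast
  then have D': "(D has_vector_derivative 0) (at 0)"
    unfolding D_def[abs_def] by (auto intro!: derivative_eq_intros simp: cscale_def vec_eq_iff)
  have "\<delta> 0 = 1" by (simp add: \<delta>_def cayley(1)[OF X(1)])
  then have D0: "D 0 = mat 1" by (simp add: vec_eq_iff D_nth mat_def)
  have "((\<lambda>t. cayley X t ** D t) has_vector_derivative (cayley X 0 ** 0 + X ** D 0)) (at 0)"
    by (intro has_vector_derivative_matrix_mult cayley(4) X(1) D')
  moreover have "cayley X 0 ** 0 + X ** D 0 = X"
    by (simp add: D0 matrix_matrix_mult_def[of _ 0] zero_vec_def[symmetric])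
  ultimately have "((\<lambda>t. cayley X t ** D t) has_vector_derivative X) (at 0)" by simp
  moreover have "\<forall>\<^sub>F t in nhds 0. cayley X t ** D t \<in> SU"
    using cayley(2)[OF X(1)]
  proof eventually_elim
    case (elim t)
    note u = cayley(3)[OF X(1) elim]
    have "\<delta> t * cnj (\<delta> t) = det (cayley X t ** conj_transpose (cayley X t))"
      by (simp add: \<delta>_def det_mul det_conj_transpose)
    then have \<delta>1: "\<delta> t * cnj (\<delta> t) = 1" by (simp add: u)
    have DD: "D t ** conj_transpose (D t) = mat 1"
    proof -
      have "(D t ** conj_transpose (D t)) $ i $ j = (if i = j then 1 else 0)" for i j
      proof -
        have "(D t ** conj_transpose (D t)) $ i $ j = D t $ i $ i * cnj (D t $ j $ i)"
          unfolding matrix_mult_nth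
          by (subst sum.remove[of _ i]) (auto simp: conj_transpose_def D_nth intro!: sum.neutral)
        then show ?thesis using \<delta>1 by (simp add: D_nth mult.commute)
      qed
      then show ?thesis by (simp add: vec_eq_iff mat_def)
    qed
    have "det (D t) = (\<Prod>i\<in>UNIV. if i = a then cnj (\<delta> t) else 1)"
      by (subst det_diagonal) (simp_all add: D_nth)
    then have "det (D t) = cnj (\<delta> t)" by simp
    then have "det (cayley X t ** D t) = 1" using \<delta>1 by (simp add: det_mul flip: \<delta>_def)
    moreover have "(cayley X t ** D t) ** conj_transpose (cayley X t ** D t)
        = cayley X t ** (D t ** conj_transpose (D t)) ** conj_transpose (cayley X t)"
      by (simp add: conj_transpose_mult matrix_mul_assoc)
    ultimately show ?case by (simp add: SU_def DD u)
  qed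
  moreover have "cayley X 0 ** D 0 = mat 1" by (simp add: D0 cayley(1)[OF X(1)])
  ultimately show "X \<in> tangent_at_one SU"
    unfolding tangent_at_one_def by (intro CollectI exI[of _ "\<lambda>t. cayley X t ** D t"] conjI)
qed

lemma symplectic_matrix_nth: "symplectic_matrix $ i $ j = (if j = partner i then sign_of i else 0)"
  by (cases i; cases j) (auto simp: symplectic_matrix_def)

lemma symplectic_condition:
  "transpose X ** symplectic_matrix + symplectic_matrix ** X = 0 \<longleftrightarrow>
     (\<forall>i j. X $ i $ j = - sign_of i * sign_of j * X $ partner j $ partner i)"
proof -
  have "(transpose X ** symplectic_matrix) $ i $ j = - sign_of j * X $ partner j $ i" for i j
  proof -
    have "(transpose X ** symplectic_matrix) $ i $ j = (\<Sum>k\<in>UNIV. if k = partner j then - sign_of j * X $ partner j $ i else 0)"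
      unfolding matrix_mult_nth by (intro sum.cong refl) (auto simp: symplectic_matrix_nth transpose_def)
    then show ?thesis by simp
  qed
  moreover have "(symplectic_matrix ** X) $ i $ j = sign_of i * X $ partner i $ j" for i j
  proof -
    have "(symplectic_matrix ** X) $ i $ j = (\<Sum>k\<in>UNIV. if k = partner i then sign_of i * X $ partner i $ j else 0)"
      unfolding matrix_mult_nth by (intro sum.cong refl) (auto simp: symplectic_matrix_nth)
    then show ?thesis by simp
  qed
  ultimately have "transpose X ** symplectic_matrix + symplectic_matrix ** X = 0 \<longleftrightarrow>
      (\<forall>i j. sign_of j * X $ partner j $ i = sign_of i * X $ partner i $ j)"
    by (simp add: vec_eq_iff) metis
  also have "\<dots> \<longleftrightarrow> (\<forall>i j. X $ i $ j = - sign_of i * sign_of j * X $ partner j $ partner i)"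
  proof (intro iffI allI)
    fix i j assume "\<forall>i j. sign_of j * X $ partner j $ i = sign_of i * X $ partner i $ j"
    then have "sign_of j * X $ partner j $ partner i = - sign_of i * X $ i $ j" by (metis partner_partner sign_partner)
    then have "- sign_of i * (sign_of j * X $ partner j $ partner i) = sign_of i * (sign_of i * X $ i $ j)" by simp
    then show "X $ i $ j = - sign_of i * sign_of j * X $ partner j $ partner i" by (simp add: mult.assoc)
  next
    fix i j assume "\<forall>i j. X $ i $ j = - sign_of i * sign_of j * X $ partner j $ partner i"
    then have "X $ partner j $ i = - sign_of (partner j) * sign_of i * X $ partner i $ partner (partner j)" by blast
    then show "sign_of j * X $ partner j $ i = sign_of i * X $ partner i $ j" by (simp add: mult.assoc)
  qed
  finally show ?thesis .
qed

text \<open>The Cayley transform of \<open>X\<close> preserves every bilinear form for which \<open>X\<close> is skew.\<close>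

theorem tangent_Sp: "tangent_at_one (Sp :: (complex^('k::finite + 'k)^('k + 'k)) set) = sp_algebra UNIV"
proof (intro equalityI subsetI)
  fix X :: "complex^('k + 'k)^('k + 'k)" assume "X \<in> tangent_at_one Sp"
  then obtain \<gamma> :: "real \<Rightarrow> complex^('k + 'k)^('k + 'k)" where \<gamma>: "\<forall>\<^sub>F t in nhds 0. \<gamma> t \<in> Sp" "\<gamma> 0 = mat 1" "(\<gamma> has_vector_derivative X) (at 0)"
    unfolding tangent_at_one_def by blast
  have ev: "\<forall>\<^sub>F t in nhds 0. \<gamma> t ** conj_transpose (\<gamma> t) = mat 1"
    "\<forall>\<^sub>F t in nhds 0. transpose (\<gamma> t) ** symplectic_matrix ** \<gamma> t = symplectic_matrix"
    using \<gamma>(1) by (auto elim!: eventually_mono simp: Sp_def)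
  have zero: "0 ** A = 0" "A ** 0 = 0" for A :: "complex^('k + 'k)^('k + 'k)"
    by (simp_all add: matrix_matrix_mult_def vec_eq_iff)
  have "((\<lambda>t. transpose (\<gamma> t) ** symplectic_matrix ** \<gamma> t) has_vector_derivative
      ((transpose (\<gamma> 0) ** symplectic_matrix) ** X + (transpose (\<gamma> 0) ** 0 + transpose X ** symplectic_matrix) ** \<gamma> 0)) (at 0)"
    by (intro has_vector_derivative_matrix_mult has_vector_derivative_const \<gamma>(3) bounded_linear.has_vector_derivative[OF bounded_linear_transpose])
  from has_vector_derivative_const_nhds[OF ev(2) this]
  have "transpose X ** symplectic_matrix + symplectic_matrix ** X = 0"
    by (simp add: \<gamma>(2) zero transpose_mat add.commute)
  then show "X \<in> sp_algebra UNIV"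
    using tangent_unitary[OF ev(1) \<gamma>(2,3)] unfolding symplectic_condition sp_algebra_def by blast
next
  fix X :: "complex^('k + 'k)^('k + 'k)" assume "X \<in> sp_algebra UNIV"
  then have X: "conj_transpose X = - X" and "transpose X ** symplectic_matrix + symplectic_matrix ** X = 0"
    unfolding symplectic_condition sp_algebra_def by blast+
  then have XJ: "transpose X ** symplectic_matrix = - (symplectic_matrix ** X)" by (simp add: eq_neg_iff_add_eq_0)
  let ?J = "symplectic_matrix :: complex^('k + 'k)^('k + 'k)"
  interpret mult: bounded_bilinear "(**) :: complex^('k + 'k)^('k + 'k) \<Rightarrow> complex^('k + 'k)^('k + 'k) \<Rightarrow> complex^('k + 'k)^('k + 'k)"
    by (rule bounded_bilinear_matrix_mult)
  have "\<forall>\<^sub>F t in nhds 0. cayley X t \<in> Sp"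
    using cayley(2)[OF X]
  proof eventually_elim
    case (elim t)
    define B C where "B = mat 1 - (t / 2) *\<^sub>R X" and "C = mat 1 + (t / 2) *\<^sub>R X"
    have cay: "cayley X t = matrix_inv B ** C" by (simp add: cayley_def B_def C_def)
    note i = matrix_inv_inverse[OF elim[folded B_def]]
    have BC: "B ** C = C ** B"
      unfolding B_def C_def mult.add_left mult.add_right mult.diff_left mult.diff_right mult.scaleR_left mult.scaleR_right
      by (simp only: matrix_mul_lid matrix_mul_rid) (simp only: algebra_simps)
    have cay': "cayley X t = C ** matrix_inv B"
    proof -
      have "matrix_inv B ** C = matrix_inv B ** (C ** B) ** matrix_inv B" by (simp add: i flip: matrix_mul_assoc)
      also have "\<dots> = (matrix_inv B ** B) ** C ** matrix_inv B" unfolding BC[symmetric] by (simp add: matrix_mul_assoc)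
      finally show ?thesis by (simp add: cay i)
    qed
    have tr: "transpose (mat 1 + s *\<^sub>R X) = mat 1 + s *\<^sub>R transpose X" for s
      by (simp add: transpose_def vec_eq_iff mat_def)
    have flip: "transpose (mat 1 + s *\<^sub>R X) ** ?J = ?J ** (mat 1 - s *\<^sub>R X)" for s
      unfolding tr by (simp add: mult.add_left mult.diff_right mult.scaleR_left mult.scaleR_right XJ)
    have BJ: "transpose B ** ?J = ?J ** C" using flip[of "- (t / 2)"] by (simp add: B_def C_def)
    have CJ: "transpose C ** ?J = ?J ** B" using flip[of "t / 2"] by (simp add: B_def C_def)
    have "transpose (cayley X t) ** ?J ** cayley X t = transpose (matrix_inv B) ** (transpose C ** ?J) ** (matrix_inv B ** C)"
    proof -
      have "transpose (cayley X t) = transpose (matrix_inv B) ** transpose C" by (simp add: cay' matrix_transpose_mul)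
      then show ?thesis by (simp only: cay matrix_mul_assoc)
    qed
    also have "\<dots> = transpose (matrix_inv B) ** ?J ** (B ** matrix_inv B) ** C"
      unfolding CJ by (simp add: matrix_mul_assoc)
    also have "\<dots> = transpose (matrix_inv B) ** (?J ** C)" by (simp add: i matrix_mul_assoc)
    also have "\<dots> = transpose (B ** matrix_inv B) ** ?J"
      unfolding BJ[symmetric] by (simp add: matrix_transpose_mul matrix_mul_assoc)
    finally have "transpose (cayley X t) ** ?J ** cayley X t = ?J" by (simp add: i transpose_mat)
    then show ?case using cayley(3)[OF X elim] by (simp add: Sp_def)
  qed
  then show "X \<in> tangent_at_one Sp"
    unfolding tangent_at_one_def using cayley(1,4)[OF X] by blast
qed

section \<open>Local isomorphisms with matrix groups\<close>

lemma smooth_near_matrix_mult: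
  "smooth_near (\<lambda>p :: (complex^'m^'m) \<times> (complex^'m^'m). fst p ** snd p) q"
  by (rule smooth_near_bilinear[OF bounded_bilinear_matrix_mult smooth_near_linear[OF bounded_linear_fst] smooth_near_linear[OF bounded_linear_snd]])

lemma local_bracket_matrix_mult:
  "local_bracket (\<lambda>p. fst p ** snd p) e X Y = commutator X (Y :: complex^'m^'m)"
proof -
  have "deriv_right (\<lambda>p. fst p ** snd p) e A B = A ** B" for A B :: "complex^'m^'m"
    unfolding deriv_right_def
    using frechet_derivative_at[OF bounded_linear_imp_has_derivative[OF bounded_bilinear.bounded_linear_right[OF bounded_bilinear_matrix_mult]], of A e]
    by simp
  moreover have "frechet_derivative (\<lambda>A. A ** B) (at e) D = D ** B" for B D :: "complex^'m^'m"
    using frechet_derivative_at[OF bounded_linear_imp_has_derivative[OF bounded_bilinear.bounded_linear_left[OF bounded_bilinear_matrix_mult]], of B e]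
    by metis
  ultimately show ?thesis by (simp add: local_bracket_def commutator_def)
qed

context lie_group_chart
begin

text \<open>In the chart \<open>c\<close>, the local isomorphism is a smooth map into the space of matrices that carries the
group multiplication to the product of matrices, whose bracket is the commutator. The inverse
extends to a smooth map \<open>K\<close> on a neighbourhood of the identity in the space of matrices; the chain rule for
both composites shows that the differential is injective and onto the tangent space of \<open>H\<close>.\<close>

theorem local_isomorphism_differential:
  fixes H :: "(complex^'m^'m) set"
  assumes iso: "locally_isomorphic_to_matrix_group G T A H"
    and unitary: "\<And>M. M \<in> H \<Longrightarrow> M ** conj_transpose M = mat 1"
  obtains \<Phi> :: "'v \<Rightarrow> complex^'m^'m" where "linear \<Phi>" "inj \<Phi>"
    "\<And>X Y. \<Phi> (lie_bracket G c X Y) = commutator (\<Phi> X) (\<Phi> Y)" "range \<Phi> = tangent_at_one H"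
proof -
  let ?A' = "submanifold_atlas H :: (complex^'m^'m, 'v) chart set"
  let ?M = "matrix_group H"
  obtain U V f h where iso':
    "openin T U" "\<one>\<^bsub>G\<^esub> \<in> U" "openin (top_of_set H) V" "\<one>\<^bsub>?M\<^esub> \<in> V" "f ` U = V" "h ` V = U"
    "\<forall>x\<in>U. h (f x) = x" "\<forall>y\<in>V. f (h y) = y" "smooth_map_on T A ?A' U f" "smooth_map_on (top_of_set H) ?A' A V h"
    "\<forall>x\<in>U. \<forall>y\<in>U. x \<otimes>\<^bsub>G\<^esub> y \<in> U \<longrightarrow> f (x \<otimes>\<^bsub>G\<^esub> y) = f x \<otimes>\<^bsub>?M\<^esub> f y"
    using iso unfolding locally_isomorphic_to_matrix_group_def locally_isomorphic_def
    by (elim exE conjE) (rule that)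
  note U = iso'(1,2) and f_smooth = iso'(9) and h_smooth = iso'(10)
  have V: "openin (top_of_set H) V" "mat 1 \<in> V" and fh: "f ` U = V" "h ` V = U"
    "\<And>x. x \<in> U \<Longrightarrow> h (f x) = x" "\<And>y. y \<in> V \<Longrightarrow> f (h y) = y"
    and f_hom: "\<And>x y. x \<in> U \<Longrightarrow> y \<in> U \<Longrightarrow> x \<otimes>\<^bsub>G\<^esub> y \<in> U \<Longrightarrow> f (x \<otimes>\<^bsub>G\<^esub> y) = f x ** f y"
    using iso'(3-8,11) by (simp_all add: matrix_group_def)
  have VH: "V \<subseteq> H" using openin_subset[OF V(1)] by simp
  \<comment> \<open>An invertible idempotent is the identity.\<close>
  have f1: "f \<one>\<^bsub>G\<^esub> = mat 1"
  proof -
    have "f \<one>\<^bsub>G\<^esub> \<in> H" using fh(1) U(2) VH by blast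
    then have u: "f \<one>\<^bsub>G\<^esub> ** conj_transpose (f \<one>\<^bsub>G\<^esub>) = mat 1" by (rule unitary)
    have "f \<one>\<^bsub>G\<^esub> = f \<one>\<^bsub>G\<^esub> ** f \<one>\<^bsub>G\<^esub>" using f_hom[OF U(2) U(2)] U(2) by simp
    then have "f \<one>\<^bsub>G\<^esub> ** conj_transpose (f \<one>\<^bsub>G\<^esub>) = f \<one>\<^bsub>G\<^esub> ** (f \<one>\<^bsub>G\<^esub> ** conj_transpose (f \<one>\<^bsub>G\<^esub>))"
      by (metis matrix_mul_assoc)
    then show ?thesis by (simp add: u)
  qed
  have h1: "h (mat 1) = \<one>\<^bsub>G\<^esub>" using fh(3)[OF U(2)] by (simp add: f1)
  define F where "F u = f (chart_inv c u)" for u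
  have F0: "F e0 = mat 1" by (simp add: F_def inv_map one_in f1)
  have F_smooth: "smooth_near F e0"
  proof -
    obtain c1 d N where c1: "c1 \<in> A" and d: "d \<in> ?A'" and N: "openin T N" "\<one>\<^bsub>G\<^esub> \<in> N" "N \<subseteq> chart_dom c1" "f ` N \<subseteq> chart_dom d"
      and s: "smooth_near (\<lambda>u. chart_map d (f (chart_inv c1 u))) (chart_map c1 \<one>\<^bsub>G\<^esub>)"
      using smooth_map_onE[OF f_smooth U(2)] by metis
    have one1: "\<one>\<^bsub>G\<^esub> \<in> chart_dom c1" using N by blast
    have d_inj: "chart_inv d (chart_map d y) = y" if "y \<in> chart_dom d" for y
      using d that by (simp add: submanifold_atlas_def)
    have c1_inv: "chart_inv c1 (chart_map c1 x) = x" if "x \<in> chart_dom c1" for x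
      using chart_inv_map[OF chart_like_A[OF c1] that] .
    have "smooth_on (chart_inv d) (chart_map d ` chart_dom d)" using d by (simp add: submanifold_atlas_def)
    moreover have "chart_map d (f \<one>\<^bsub>G\<^esub>) \<in> chart_map d ` chart_dom d" using N by blast
    ultimately have "smooth_near (chart_inv d) (chart_map d (f \<one>\<^bsub>G\<^esub>))" unfolding smooth_near_def by blast
    then have "smooth_near (\<lambda>u. chart_inv d (chart_map d (f (chart_inv c1 u)))) (chart_map c1 \<one>\<^bsub>G\<^esub>)"
      by (intro smooth_near_comp[OF s]) (simp add: c1_inv[OF one1])
    then have "smooth_near (\<lambda>u. chart_inv d (chart_map d (f (chart_inv c1 (chart_map c1 (chart_inv c u)))))) e0"
      by (intro smooth_near_comp[OF transition_smooth[OF cA c1 one_in one1]]) (simp add: inv_map one_in)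
    then show ?thesis
    proof (rule smooth_near_cong)
      show "\<forall>\<^sub>F u in nhds e0. chart_inv d (chart_map d (f (chart_inv c1 (chart_map c1 (chart_inv c u))))) = F u"
        using eventually_near_one[OF N(1,2)]
      proof eventually_elim
        case (elim u)
        then have "chart_inv c u \<in> chart_dom c1" "f (chart_inv c u) \<in> chart_dom d" using N(3,4) by auto
        then show ?case by (simp add: c1_inv d_inj F_def)
      qed
    qed
  qed
  \<comment> \<open>A smooth extension of the coordinate expression of \<open>h\<close> to a neighbourhood of the identity
    in the space of all matrices\<close>
  obtain K where K_smooth: "smooth_near K (mat 1)" and K1: "K (mat 1) = e0"
    and K: "\<forall>\<^sub>F y in nhds (mat 1). y \<in> H \<longrightarrow> y \<in> V \<and> h y \<in> chart_dom c \<and> K y = chart_map c (h y)"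
  proof -
    obtain c1 d N where c1: "c1 \<in> ?A'" and d: "d \<in> A" and N: "openin (top_of_set H) N" "mat 1 \<in> N" "N \<subseteq> V" "N \<subseteq> chart_dom c1" "h ` N \<subseteq> chart_dom d"
      and s: "smooth_near (\<lambda>u. chart_map d (h (chart_inv c1 u))) (chart_map c1 (mat 1))"
      using smooth_map_onE[OF h_smooth V(2)] by metis
    have one1: "mat 1 \<in> chart_dom c1" and one_d: "\<one>\<^bsub>G\<^esub> \<in> chart_dom d" using N h1 by auto
    have c1_inv: "chart_inv c1 (chart_map c1 y) = y" if "y \<in> chart_dom c1" for y
      using c1 that by (simp add: submanifold_atlas_def)
    have d_inv: "chart_inv d (chart_map d x) = x" if "x \<in> chart_dom d" for x
      using chart_inv_map[OF chart_like_A[OF d] that] .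
    obtain W E where W: "mat 1 \<in> W" "smooth_on E W" "\<forall>y\<in>chart_dom c1 \<inter> W. E y = chart_map c1 y"
      using c1 one1 unfolding submanifold_atlas_def smooth_on_subset_def by blast
    obtain Z where Z: "open Z" "N = H \<inter> Z" using N(1) unfolding openin_open by blast
    define K0 where "K0 y = chart_map d (h (chart_inv c1 (E y)))" for y
    define K where "K y = chart_map c (chart_inv d (K0 y))" for y
    have E1: "E (mat 1) = chart_map c1 (mat 1)" using W one1 by blast
    have "smooth_near E (mat 1)" using W unfolding smooth_near_def by blast
    then have sK0: "smooth_near K0 (mat 1)" unfolding K0_def by (rule smooth_near_comp) (use s E1 in simp)
    have K01: "K0 (mat 1) = chart_map d \<one>\<^bsub>G\<^esub>" by (simp add: K0_def E1 c1_inv one1 h1)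
    have "smooth_near K (mat 1)" unfolding K_def
      by (rule smooth_near_comp[OF sK0]) (use transition_smooth[OF d cA one_d one_in] K01 in simp)
    moreover have "K (mat 1) = e0" by (simp add: K_def K01 d_inv one_d)
    moreover have "\<forall>\<^sub>F y in nhds (mat 1). y \<in> H \<longrightarrow> y \<in> V \<and> h y \<in> chart_dom c \<and> K y = chart_map c (h y)"
    proof -
      have "\<forall>\<^sub>F w in nhds (K0 (mat 1)). chart_inv d w \<in> chart_dom c"
        unfolding K01 by (rule eventually_mono[OF eventually_chart[OF chart_like_A[OF d] open_dom one_in one_d]]) simp
      then have 1: "\<forall>\<^sub>F y in nhds (mat 1). chart_inv d (K0 y) \<in> chart_dom c"
        by (rule isCont_eventually_nhds[OF smooth_near_isCont[OF sK0]])
      have "open W" using W(2) by (simp add: smooth_on_def)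
      then have 2: "\<forall>\<^sub>F y in nhds (mat 1). y \<in> W" using W(1) by (rule eventually_nhds_in_open)
      have "mat 1 \<in> Z" using N(2) Z(2) by blast
      then have 3: "\<forall>\<^sub>F y in nhds (mat 1). y \<in> Z" by (rule eventually_nhds_in_open[OF Z(1)])
      show ?thesis
        using 1 2 3
      proof (eventually_elim, intro impI)
        case (elim y)
        assume "y \<in> H"
        then have y: "y \<in> N" using elim Z(2) by blast
        then have "K0 y = chart_map d (h y)" "h y \<in> chart_dom d"
          using elim W(3) N(4,5) c1_inv by (auto simp: K0_def)
        then have "chart_inv d (K0 y) = h y" by (simp add: d_inv)
        then show "y \<in> V \<and> h y \<in> chart_dom c \<and> K y = chart_map c (h y)"
          using elim y N(3) by (auto simp: K_def)
      qed
    qed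
    ultimately show thesis by (rule that)
  qed
  have F_near: "\<forall>\<^sub>F u in nhds e0. F u \<in> H"
    using eventually_near_one[OF U] by eventually_elim (use fh(1) VH in \<open>auto simp: F_def\<close>)
  have KF: "\<forall>\<^sub>F u in nhds e0. K (F u) = u"
  proof -
    have "\<forall>\<^sub>F y in nhds (F e0). y \<in> H \<longrightarrow> y \<in> V \<and> h y \<in> chart_dom c \<and> K y = chart_map c (h y)"
      unfolding F0 by (rule K)
    then have "\<forall>\<^sub>F u in nhds e0. F u \<in> H \<longrightarrow> F u \<in> V \<and> h (F u) \<in> chart_dom c \<and> K (F u) = chart_map c (h (F u))"
      by (rule isCont_eventually_nhds[OF smooth_near_isCont[OF F_smooth]])
    with F_near eventually_near_one[OF U] show ?thesis
      by eventually_elim (simp add: F_def fh(3))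
  qed
  have FK: "\<forall>\<^sub>F y in nhds (mat 1). y \<in> H \<longrightarrow> F (K y) = y"
    using K by eventually_elim (auto simp: F_def inv_map fh(4))
  define \<Phi> where "\<Phi> = frechet_derivative F (at e0)"
  have F_deriv: "(F has_derivative \<Phi>) (at e0)" unfolding \<Phi>_def by (rule smooth_near_has_derivative[OF F_smooth])
  obtain \<Psi> where K_deriv: "(K has_derivative \<Psi>) (at (mat 1))" using smooth_near_has_derivative[OF K_smooth] by blast
  have linear: "linear \<Phi>" using F_deriv has_derivative_linear by blast
  have inv: "\<Psi> (\<Phi> X) = X" for X
  proof -
    have "((\<lambda>u. K (F u)) has_derivative (\<lambda>X. \<Psi> (\<Phi> X))) (at e0)"
      by (rule has_derivative_compose[OF F_deriv]) (use K_deriv F0 in simp)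
    from has_derivative_cong_nhds[OF KF this] have "((\<lambda>u. u) has_derivative (\<lambda>X. \<Psi> (\<Phi> X))) (at e0)" .
    from has_derivative_unique[OF this has_derivative_ident] show ?thesis by (rule fun_cong)
  qed
  have bracket: "\<Phi> (lie_bracket G c X Y) = commutator (\<Phi> X) (\<Phi> Y)" for X Y
  proof -
    have "\<forall>\<^sub>F p in nhds (e0, e0). F (loc_mult p) = F (fst p) ** F (snd p)"
      using eventually_near_one_pair[OF eventually_near_one[OF U] eventually_near_one[OF U]] eventually_mult[OF U] eventually_mult[OF open_dom one_in]
      by eventually_elim (simp add: F_def loc_mult_def inv_map f_hom)
    then have "frechet_derivative F (at e0) (local_bracket loc_mult e0 X Y) =
        local_bracket (\<lambda>p. fst p ** snd p) (F e0) (frechet_derivative F (at e0) X) (frechet_derivative F (at e0) Y)"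
      by (intro local_homomorphism_bracket loc_mult_smooth loc_mult_units F_smooth smooth_near_matrix_mult) simp
    then show ?thesis by (simp add: lie_bracket_eq local_bracket_matrix_mult \<Phi>_def)
  qed
  have range: "range \<Phi> = tangent_at_one H"
  proof (intro equalityI subsetI)
    fix X assume "X \<in> range \<Phi>"
    then obtain v where X: "X = \<Phi> v" by blast
    define line where "line t = e0 + t *\<^sub>R v" for t
    have line0: "line 0 = e0" by (simp add: line_def)
    have dline: "(line has_vector_derivative v) (at 0)"
      unfolding line_def[abs_def] by (auto intro!: derivative_eq_intros)
    then have "isCont line 0" by (rule has_vector_derivative_continuous)
    moreover have "\<forall>\<^sub>F u in nhds (line 0). F u \<in> H" using F_near by (simp add: line0)
    ultimately have "\<forall>\<^sub>F t in nhds 0. F (line t) \<in> H" by (rule isCont_eventually_nhds)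
    moreover have "((\<lambda>t. F (line t)) has_vector_derivative X) (at 0)"
      using vector_derivative_diff_chain_within[of line v 0 UNIV F \<Phi>] dline F_deriv
      by (simp add: line0 o_def X has_derivative_at_withinI)
    moreover have "F (line 0) = mat 1" by (simp add: line0 F0)
    ultimately show "X \<in> tangent_at_one H"
      unfolding tangent_at_one_def by (intro CollectI exI[of _ "\<lambda>t. F (line t)"] conjI)
  next
    fix X assume "X \<in> tangent_at_one H"
    then obtain \<gamma> :: "real \<Rightarrow> complex^'m^'m" where \<gamma>: "\<forall>\<^sub>F t in nhds 0. \<gamma> t \<in> H" "\<gamma> 0 = mat 1" "(\<gamma> has_vector_derivative X) (at 0)"
      unfolding tangent_at_one_def by blast
    have "((\<lambda>t. K (\<gamma> t)) has_vector_derivative \<Psi> X) (at 0)"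
      using vector_derivative_diff_chain_within[of \<gamma> X 0 UNIV K \<Psi>] \<gamma>(3) K_deriv
      by (simp add: \<gamma>(2) o_def has_derivative_at_withinI)
    then have 1: "((\<lambda>t. F (K (\<gamma> t))) has_vector_derivative \<Phi> (\<Psi> X)) (at 0)"
      using vector_derivative_diff_chain_within[of "\<lambda>t. K (\<gamma> t)" "\<Psi> X" 0 UNIV F \<Phi>] F_deriv
      by (simp add: \<gamma>(2) K1 o_def has_derivative_at_withinI)
    have "\<forall>\<^sub>F t in nhds 0. F (K (\<gamma> t)) = \<gamma> t"
    proof -
      have "\<forall>\<^sub>F y in nhds (\<gamma> 0). y \<in> H \<longrightarrow> F (K y) = y" unfolding \<gamma>(2) by (rule FK)
      then have "\<forall>\<^sub>F t in nhds 0. \<gamma> t \<in> H \<longrightarrow> F (K (\<gamma> t)) = \<gamma> t"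
        by (rule isCont_eventually_nhds[OF has_vector_derivative_continuous[OF \<gamma>(3)]])
      with \<gamma>(1) show ?thesis by eventually_elim simp
    qed
    from has_vector_derivative_cong_nhds[OF this 1] have "\<Phi> (\<Psi> X) = X"
      using \<gamma>(3) vector_derivative_unique_at by blast
    then show "X \<in> range \<Phi>" by (metis rangeI)
  qed
  show thesis
    by (rule that[OF linear _ bracket range]) (metis inv injI)
qed

end

section \<open>Maxima and saddle points\<close>

theorem theorem3:
  fixes G :: "('a, 'r) monoid_scheme" and T :: "'a topology"
    and A :: "('a, real^'n) chart set" and c :: "('a, real^'n) chart"
    and br :: "real^'n \<Rightarrow> real^'n \<Rightarrow> real^'n"
  assumes "lie_group G T A" "connected_space T" "compact_space T"
    and "c \<in> A" "\<one>\<^bsub>G\<^esub> \<in> chart_dom c"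
    and br: "br = lie_bracket G c"
    and "semisimple_lie_algebra br"
  shows
    "(locally_isomorphic_to_matrix_group G T A (SU :: (complex^2^2) set) \<longrightarrow>
        local_max_point (scalar_curvature br) (metrics_1 br) (standard_metric br)) \<and>
     \<not> local_min_point (scalar_curvature br) (metrics_1 br) (standard_metric br) \<and>
     (\<not> simple_lie_algebra br \<longrightarrow>
        saddle_point (scalar_curvature br) (metrics_1 br) (standard_metric br)) \<and>
     ((CARD('k::finite) \<ge> 2 \<and>
         locally_isomorphic_to_matrix_group G T A (Sp :: (complex^('k + 'k)^('k + 'k)) set)) \<or>
      (CARD('m::finite) \<ge> 3 \<and>
         locally_isomorphic_to_matrix_group G T A (SU :: (complex^'m^'m) set)) \<longrightarrow>
        saddle_point (scalar_curvature br) (metrics_1 br) (standard_metric br))"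
proof -
  interpret lie_group_chart G T A c by unfold_locales fact+
  have comp: "compact_lie_algebra br"
    unfolding br by (rule compact_lie_algebra_of_compact_group) (use assms in simp_all)
  interpret compact_lie_algebra br by (rule comp)
  have saddle: "saddle_point (scalar_curvature br) (metrics_1 br) (standard_metric br)"
    if "\<not> local_max_point (scalar_curvature br) (metrics_1 br) (standard_metric br)"
    using that standard_critical standard_not_local_min by (simp add: saddle_point_def)
  have "local_max_point (scalar_curvature br) (metrics_1 br) (standard_metric br)"
    if iso: "locally_isomorphic_to_matrix_group G T A (SU :: (complex^2^2) set)"
  proof -
    have "\<And>M. M \<in> (SU :: (complex^2^2) set) \<Longrightarrow> M ** conj_transpose M = mat 1" by (simp add: SU_def)
    from local_isomorphism_differential[OF iso this]
    obtain \<Phi> :: "real^'n \<Rightarrow> complex^2^2" where \<Phi>: "linear \<Phi>" "inj \<Phi>" "range \<Phi> = tangent_at_one SU"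
      by metis
    have "dim (range \<Phi>) = CARD('n)"
      using dim_image_eq[OF \<Phi>(1), of UNIV] \<Phi>(2) by simp
    moreover have "dim (range \<Phi>) = 3"
      using dim_su_algebra[of "UNIV :: 2 set"] by (simp add: \<Phi>(3) tangent_SU)
    ultimately show ?thesis by (intro local_max_of_dim_3) simp
  qed
  moreover have "\<not> local_max_point (scalar_curvature br) (metrics_1 br) (standard_metric br)"
    if k: "CARD('k) \<ge> 2" and iso: "locally_isomorphic_to_matrix_group G T A (Sp :: (complex^('k + 'k)^('k + 'k)) set)"
  proof -
    have "\<And>M. M \<in> (Sp :: (complex^('k + 'k)^('k + 'k)) set) \<Longrightarrow> M ** conj_transpose M = mat 1" by (simp add: Sp_def)
    from local_isomorphism_differential[OF iso this]
    obtain \<Phi> :: "real^'n \<Rightarrow> complex^('k + 'k)^('k + 'k)" where \<Phi>: "linear \<Phi>" "inj \<Phi>"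
      "\<And>X Y. \<Phi> (br X Y) = commutator (\<Phi> X) (\<Phi> Y)" "range \<Phi> = sp_algebra UNIV"
      unfolding br tangent_Sp by metis
    show ?thesis by (rule not_local_max_sp[OF comp \<Phi> k])
  qed
  moreover have "\<not> local_max_point (scalar_curvature br) (metrics_1 br) (standard_metric br)"
    if m: "CARD('m) \<ge> 3" and iso: "locally_isomorphic_to_matrix_group G T A (SU :: (complex^'m^'m) set)"
  proof -
    have "\<And>M. M \<in> (SU :: (complex^'m^'m) set) \<Longrightarrow> M ** conj_transpose M = mat 1" by (simp add: SU_def)
    from local_isomorphism_differential[OF iso this]
    obtain \<Phi> :: "real^'n \<Rightarrow> complex^'m^'m" where \<Phi>: "linear \<Phi>" "inj \<Phi>"
      "\<And>X Y. \<Phi> (br X Y) = commutator (\<Phi> X) (\<Phi> Y)" "range \<Phi> = su_algebra UNIV"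
      unfolding br tangent_SU by metis
    show ?thesis by (rule not_local_max_su[OF comp \<Phi> m])
  qed
  ultimately show ?thesis
    using saddle standard_not_local_min not_local_max_of_not_simple by blast
qed

end
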